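(* Let $m>0$. The following statements hold: (i) the quasi-local C*-algebras $\mathfrak W^{(m)}_r$ and $\mathcal A^{(m)}_\phi$ are not simple; (ii) $\mathcal A^{(m)}_\phi$ is a proper subalgebra of $\mathcal A^{(m)}$.
   Context: **Weyl algebra and net.** $\mathcal D(\mathbb R)$ is the space of complex-valued compactly supported smooth functions on $\mathbb R$ (as a real vector space); $\hat f(p)=(2\pi)^{-1/2}\int_{\mathbb R}e^{-ipx}f(x)\,dx$. $\mathfrak W$ is the Weyl C*-algebra generated by unitaries $W(f)$, $f\in\mathcal D(\mathbb R)$, with $W(f)W(g)=e^{-\frac i2\sigma(f,g)}W(f+g)$, $\sigma(f,g)=\mathrm{Im}\int_{\mathbb R}\overline fg$. For $m\ge0$ put $\omega_m(p)=\sqrt{p^2+m^2}$. The proper orthochronous Poincaré group of $\mathbb R^2$ acts on $\mathcal D(\mathbb R)$ by real-linear maps $\tau^{(m)}_{(\Lambda,x)}$ determined by: with $\tilde f(p)=\widehat{\mathrm{Re}f}(p)+i\omega_m(p)\widehat{\mathrm{Im}f}(p)$ and $x=(t,\boldsymbol x)$, $(\tau^{(m)}_{(\Lambda,x)}f)^{\sim}(p)=e^{i(t\omega_m(p)-\boldsymbol xp)}\tilde f(\Lambda^{-1}p)$, where $\Lambda^{-1}p$ is the spatial component of $\Lambda^{-1}(\omega_m(p),p)$. So space translations act by $f\mapsto f(\cdot-\boldsymbol x)$ and time translations by $(\tau^{(m)}_tf)\hat{\ }=[\cos(t\omega_m)+i\omega_m^{-1}\sin(t\omega_m)]\widehat{\mathrm{Re}f}+i[\cos(t\omega_m)+i\omega_m\sin(t\omega_m)]\widehat{\mathrm{Im}f}$.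 $\alpha^{(m)}_{(\Lambda,x)}(W(f))=W(\tau^{(m)}_{(\Lambda,x)}f)$; $\alpha^{(m)}_x$ denotes translations. For $m>0$ the vacuum state is $\omega^{(m)}(W(f))=e^{-\frac12\|f\|_m^2}$, $\|f\|_m^2=\frac12\int_{\mathbb R}dp\,|\omega_m^{-1/2}\widehat{\mathrm{Re}f}+i\omega_m^{1/2}\widehat{\mathrm{Im}f}|^2$, with GNS triple $(\pi^{(m)},\mathcal H^{(m)},\Omega^{(m)})$; $\pi^{(m)}$ is omitted in the notation. $O_I$ is the open double cone with base the bounded open interval $I$ of the time-zero line, and $\mathcal A^{(m)}(\Lambda O_I+x)=\{\pi^{(m)}(\alpha^{(m)}_{(\Lambda,x)}(W(f))):\mathrm{supp}f\subset I\}''$; $\mathcal A^{(m)}$ also denotes the norm closure of $\bigcup_O\mathcal A^{(m)}(O)$. $\alpha^{(m)}$ extends to $\mathcal A^{(m)}$. Dilations: $(\delta_\lambda f)(x)=\lambda^{-1}\mathrm{Re}f(\lambda^{-1}x)+i\,\mathrm{Im}f(\lambda^{-1}x)$; $\phi_\lambda$, $\lambda>0$, is the automorphism of $\mathcal A^{(m)}$, normal on local algebras, with $\phi_\lambda(W(f))=W(\delta_\lambda f)$, and $\boldsymbol\phi^\bullet(A)=(\lambda\mapsto\phi_\lambda(A))$. **Scaling algebras.** Let $\mathcal G$ be a subgroup of the connected component of the Poincaré group containing the translations. $\underline{\mathcal A}^{(m)}(O)$ is the C*-algebra (pointwise operations, sup norm) of bounded functions $\lambda\in(0,\infty)\mapsto\underline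 A_\lambda\in\mathcal A^{(m)}(\lambda O)$ with $\sup_{\lambda>0}\|\alpha^{(m)}_{(\Lambda,\lambda x)}(\underline A_\lambda)-\underline A_\lambda\|\to0$ as $(\Lambda,x)\to(\mathbf 1,0)$ in $\mathcal G$. A scaling limit state $\underline\omega_{0,\iota}=\lim_\kappa\underline\omega_{\lambda_\kappa}$ is fixed, i.e. a weak* limit point as $\lambda\to0$, along a fixed net $\lambda_\kappa\to0$, of the states $\underline\omega_\lambda(\underline A)=\omega^{(m)}(\underline A_\lambda)$. $\underline{\mathcal A}^{(m)\bullet}(O)$ is the C*-algebra of bounded functions $\lambda\mapsto A_\lambda\in\mathcal A^{(m)}(\lambda O)$ such that for all double cones $\hat O\supset\overline O$ and $\varepsilon>0$ there are $\underline A,\underline A'\in\underline{\mathcal A}^{(m)}(\hat O)$ with $\limsup_\kappa\|(A_{\lambda_\kappa}-\underline A_{\lambda_\kappa})\Omega^{(m)}\|+\|(A^*_{\lambda_\kappa}-\underline A'_{\lambda_\kappa})\Omega^{(m)}\|<\varepsilon$. **Subalgebras.** $\mathfrak W^{(m)}_r(O)$ is the C*-algebra generated by the elements of $\mathcal A^{(m)}(O)$ of the form $\int_{\mathbb R^2}dy\,g(y)\alpha^{(m)}_y(W(f))$, $g\in C_c(\mathbb R^2)$, $f\in\mathcal D(\mathbb R)$ (strong integrals). $\mathcal A^{(m)}_\phi(O)\subset\mathcal A^{(m)}(O)$ is the C*-subalgebra of all $A\in\mathcal A^{(m)}(O)$ with $\boldsymbol\phi^\bullet(A)\in\underline{\mathcal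 A}^{(m)\bullet}(O)$. $\mathfrak W^{(m)}_r$, $\mathcal A^{(m)}_\phi$ denote the norm closures of the unions over all double cones $O$ of these local algebras. *)

theory Defs
  imports "HOL-Analysis.Analysis" "HOL-Algebra.Group"
begin

section \<open>Complex Hilbert spaces, C*-algebras, algebras of operators\<close>

class scaleC =
  fixes scaleC :: "complex \<Rightarrow> 'a \<Rightarrow> 'a" (infixr \<open>*\<^sub>C\<close> 75)

class complex_normed_vector = real_normed_vector + scaleC +
  assumes scaleC_add_right: "c *\<^sub>C (x + y) = c *\<^sub>C x + c *\<^sub>C y"
    and scaleC_add_left: "(c + d) *\<^sub>C x = c *\<^sub>C x + d *\<^sub>C x"
    and scaleC_scaleC: "c *\<^sub>C d *\<^sub>C x = (c * d) *\<^sub>C x"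
    and scaleC_of_real: "complex_of_real r *\<^sub>C x = r *\<^sub>R x"
    and norm_scaleC: "norm (c *\<^sub>C x) = cmod c * norm x"

text \<open>The scalar product is linear in the second argument; its real part is the real inner
  product, so that norm and positive definiteness are those of \<^class>\<open>real_inner\<close>.\<close>

class complex_hilbert = complex_normed_vector + real_inner + complete_space +
  fixes cinner :: "'a \<Rightarrow> 'a \<Rightarrow> complex"
  assumes cinner_commute: "cinner x y = cnj (cinner y x)"
    and cinner_add_right: "cinner x (y + z) = cinner x y + cinner x z"
    and cinner_scaleC_right: "cinner x (c *\<^sub>C y) = c * cinner x y"
    and Re_cinner: "Re (cinner x y) = inner x y"

class cstar_algebra = complex_normed_vector + real_normed_algebra_1 + complete_space +
  fixes star :: "'a \<Rightarrow> 'a"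
  assumes scaleC_mult_left: "(c *\<^sub>C a) * b = c *\<^sub>C (a * b)"
    and scaleC_mult_right: "a * (c *\<^sub>C b) = c *\<^sub>C (a * b)"
    and star_star: "star (star a) = a"
    and star_add: "star (a + b) = star a + star b"
    and star_scaleC: "star (c *\<^sub>C a) = cnj c *\<^sub>C star a"
    and star_mult: "star (a * b) = star b * star a"
    and cstar_identity: "norm (star a * a) = (norm a)\<^sup>2"

instantiation blinfun :: (real_normed_vector, complex_normed_vector) complex_normed_vector
begin

lift_definition scaleC_blinfun :: "complex \<Rightarrow> ('a, 'b) blinfun \<Rightarrow> ('a, 'b) blinfun"
  is "\<lambda>c f x. c *\<^sub>C f x"
proof -
  fix c :: complex and f :: "'a \<Rightarrow> 'b"
  assume f: "bounded_linear f"
  have R: "c *\<^sub>C (r *\<^sub>R y) = r *\<^sub>R (c *\<^sub>C y)" for r and y :: 'b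
    by (metis mult.commute scaleC_of_real scaleC_scaleC)
  obtain K where K: "\<And>x. norm (f x) \<le> norm x * K"
    using bounded_linear.bounded[OF f] by blast
  show "bounded_linear (\<lambda>x. c *\<^sub>C f x)"
  proof (rule bounded_linear_intro[where K = "cmod c * K"])
    fix x
    show "norm (c *\<^sub>C f x) \<le> norm x * (cmod c * K)"
      using mult_left_mono[OF K[of x] norm_ge_zero[of c]] by (simp add: norm_scaleC mult.left_commute)
  qed (simp_all add: linear_simps[OF f] bounded_linear.linear[OF f] linear_cmul scaleC_add_right R)
qed

instance
proof
  fix c d :: complex and f g :: "('a, 'b) blinfun" and r :: real
  show "c *\<^sub>C (f + g) = c *\<^sub>C f + c *\<^sub>C g"
    by transfer (simp add: scaleC_add_right)
  show "(c + d) *\<^sub>C f = c *\<^sub>C f + d *\<^sub>C f"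
    by transfer (simp add: scaleC_add_left)
  show "c *\<^sub>C d *\<^sub>C f = (c * d) *\<^sub>C f"
    by transfer (simp add: scaleC_scaleC)
  show "complex_of_real r *\<^sub>C f = r *\<^sub>R f"
    by transfer (simp add: scaleC_of_real)
  have le: "norm (c *\<^sub>C f) \<le> cmod c * norm f" for c and f :: "('a, 'b) blinfun"
  proof (rule norm_blinfun_bound)
    fix x
    have "norm (blinfun_apply (c *\<^sub>C f) x) = cmod c * norm (blinfun_apply f x)"
      by transfer (simp add: norm_scaleC)
    also have "\<dots> \<le> cmod c * (norm f * norm x)"
      by (intro mult_left_mono norm_blinfun) simp
    finally show "norm (blinfun_apply (c *\<^sub>C f) x) \<le> cmod c * norm f * norm x"
      by (simp add: mult.assoc)
  qed simp
  show "norm (c *\<^sub>C f) = cmod c * norm f"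
  proof (cases "c = 0")
    case True
    then show ?thesis using le[of c f] by simp
  next
    case False
    have "f = inverse c *\<^sub>C c *\<^sub>C f"
      using False by transfer (simp add: scaleC_scaleC scaleC_of_real[of 1, simplified])
    then have "norm f \<le> cmod (inverse c) * norm (c *\<^sub>C f)"
      using le[of "inverse c" "c *\<^sub>C f"] by simp
    then have "norm f \<le> norm (c *\<^sub>C f) / cmod c"
      by (simp add: norm_inverse divide_inverse mult.commute)
    then have "cmod c * norm f \<le> norm (c *\<^sub>C f)"
      using False by (simp add: pos_le_divide_eq mult.commute)
    then show ?thesis using le[of c f] by simp
  qed
qed

end

type_synonym 'h op = "'h \<Rightarrow>\<^sub>L 'h"

text \<open>The library's \<^typ>\<open>'h \<Rightarrow>\<^sub>L 'h\<close> consists of the bounded real-linear maps;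
  the bounded operators of the Hilbert space are the complex-linear ones among them.\<close>

definition bounded_ops :: "('h::complex_hilbert) op set" where
  "bounded_ops = {A. \<forall>c x. blinfun_apply A (c *\<^sub>C x) = c *\<^sub>C blinfun_apply A x}"

definition adj :: "('h::complex_hilbert) op \<Rightarrow> 'h op" where
  "adj A = (THE B. \<forall>x y. cinner (blinfun_apply A x) y = cinner x (blinfun_apply B y))"

definition commutant :: "('h::complex_hilbert) op set \<Rightarrow> 'h op set" where
  "commutant M = {B \<in> bounded_ops. \<forall>A\<in>M. A o\<^sub>L B = B o\<^sub>L A}"

text \<open>Product and involution are arguments, so that the notion applies both to elements of
  a \<^class>\<open>cstar_algebra\<close> and to operators.\<close>

definition cstar_subalgebra ::
    "('a \<Rightarrow> 'a \<Rightarrow> 'a) \<Rightarrow> ('a \<Rightarrow> 'a) \<Rightarrow> 'a::complex_normed_vector set \<Rightarrow> bool" where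
  "cstar_subalgebra mul st S \<longleftrightarrow>
     closed S \<and> 0 \<in> S \<and>
     (\<forall>a\<in>S. \<forall>b\<in>S. a + b \<in> S \<and> mul a b \<in> S) \<and>
     (\<forall>a\<in>S. st a \<in> S \<and> (\<forall>c. c *\<^sub>C a \<in> S))"

definition cstar_generated ::
    "('a \<Rightarrow> 'a \<Rightarrow> 'a) \<Rightarrow> ('a \<Rightarrow> 'a) \<Rightarrow> 'a::complex_normed_vector set \<Rightarrow> 'a set" where
  "cstar_generated mul st X = \<Inter>{S. cstar_subalgebra mul st S \<and> X \<subseteq> S}"

abbreviation op_cstar_subalgebra :: "('h::complex_hilbert) op set \<Rightarrow> bool" where
  "op_cstar_subalgebra \<equiv> cstar_subalgebra (o\<^sub>L) adj"

definition closed_ideal :: "('h::complex_hilbert) op set \<Rightarrow> 'h op set \<Rightarrow> bool" where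
  "closed_ideal J S \<longleftrightarrow>
     J \<subseteq> S \<and> closed J \<and> 0 \<in> J \<and>
     (\<forall>A\<in>J. \<forall>B\<in>J. A + B \<in> J) \<and> (\<forall>A\<in>J. \<forall>c. c *\<^sub>C A \<in> J) \<and>
     (\<forall>A\<in>S. \<forall>B\<in>J. A o\<^sub>L B \<in> J \<and> B o\<^sub>L A \<in> J)"

definition simple_algebra :: "('h::complex_hilbert) op set \<Rightarrow> bool" where
  "simple_algebra S \<longleftrightarrow> (\<forall>J. closed_ideal J S \<longrightarrow> J = {0} \<or> J = S)"

definition star_automorphism :: "('h::complex_hilbert) op set \<Rightarrow> ('h op \<Rightarrow> 'h op) \<Rightarrow> bool" where
  "star_automorphism S \<Theta> \<longleftrightarrow>
     bij_betw \<Theta> S S \<and>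
     (\<forall>A\<in>S. \<forall>B\<in>S. \<Theta> (A + B) = \<Theta> A + \<Theta> B \<and> \<Theta> (A o\<^sub>L B) = \<Theta> A o\<^sub>L \<Theta> B) \<and>
     (\<forall>A\<in>S. \<Theta> (adj A) = adj (\<Theta> A) \<and> (\<forall>c. \<Theta> (c *\<^sub>C A) = c *\<^sub>C \<Theta> A))"

text \<open>The normal (i.e. sigma-weakly continuous) functionals on operators are
  \<open>A \<mapsto> \<Sum>n. \<langle>x n, A (y n)\<rangle>\<close> with square-summable \<open>x\<close>, \<open>y\<close>; a map is normal
  if it pulls these functionals back to functionals of the same form.\<close>

definition normal_functional ::
    "(nat \<Rightarrow> 'h) \<Rightarrow> (nat \<Rightarrow> 'h) \<Rightarrow> ('h::complex_hilbert) op \<Rightarrow> complex" where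
  "normal_functional x y A = (\<Sum>n. cinner (x n) (blinfun_apply A (y n)))"

definition square_summable :: "(nat \<Rightarrow> 'h::complex_hilbert) \<Rightarrow> bool" where
  "square_summable x \<longleftrightarrow> summable (\<lambda>n. (norm (x n))\<^sup>2)"

definition normal_on :: "('h::complex_hilbert) op set \<Rightarrow> ('h op \<Rightarrow> 'h op) \<Rightarrow> bool" where
  "normal_on M \<Theta> \<longleftrightarrow>
     (\<forall>x y. square_summable x \<and> square_summable y \<longrightarrow>
        (\<exists>x' y'. square_summable x' \<and> square_summable y' \<and>
           (\<forall>A\<in>M. normal_functional x y (\<Theta> A) = normal_functional x' y' A)))"


section \<open>Test functions and the Weyl algebra\<close>

definition supp :: "(real \<Rightarrow> complex) \<Rightarrow> real set" where
  "supp f = closure {x. f x \<noteq> 0}"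

definition test_functions :: "(real \<Rightarrow> complex) set" where
  "test_functions =
     {f. compact (supp f) \<and>
         (\<forall>n x. ((\<lambda>g t. vector_derivative g (at t)) ^^ n) f differentiable (at x))}"

definition fourier :: "(real \<Rightarrow> complex) \<Rightarrow> real \<Rightarrow> complex" where
  "fourier f p =
     complex_of_real (1 / sqrt (2 * pi)) *
     (LINT x|lborel. exp (- (\<i> * complex_of_real (p * x))) * f x)"

definition Re_fourier :: "(real \<Rightarrow> complex) \<Rightarrow> real \<Rightarrow> complex" where
  "Re_fourier f = fourier (\<lambda>x. complex_of_real (Re (f x)))"

definition Im_fourier :: "(real \<Rightarrow> complex) \<Rightarrow> real \<Rightarrow> complex" where
  "Im_fourier f = fourier (\<lambda>x. complex_of_real (Im (f x)))"

definition sympl :: "(real \<Rightarrow> complex) \<Rightarrow> (real \<Rightarrow> complex) \<Rightarrow> real" where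
  "sympl f g = Im (LINT x|lborel. cnj (f x) * g x)"

definition weyl_algebra :: "((real \<Rightarrow> complex) \<Rightarrow> 'w::cstar_algebra) \<Rightarrow> bool" where
  "weyl_algebra W \<longleftrightarrow>
     (\<forall>f\<in>test_functions. star (W f) * W f = 1 \<and> W f * star (W f) = 1) \<and>
     (\<forall>f\<in>test_functions. \<forall>g\<in>test_functions.
        W f * W g = exp (- (\<i> / 2) * complex_of_real (sympl f g)) *\<^sub>C W (\<lambda>x. f x + g x)) \<and>
     cstar_generated (*) star (W ` test_functions) = UNIV"

definition disp :: "real \<Rightarrow> real \<Rightarrow> real" where
  "disp m p = sqrt (p\<^sup>2 + m\<^sup>2)"

definition mass_norm_sq :: "real \<Rightarrow> (real \<Rightarrow> complex) \<Rightarrow> real" where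
  "mass_norm_sq m f =
     1 / 2 * (LINT p|lborel.
       (cmod (complex_of_real (disp m p powr (- 1 / 2)) * Re_fourier f p +
              \<i> * complex_of_real (disp m p powr (1 / 2)) * Im_fourier f p))\<^sup>2)"

definition state :: "('w::cstar_algebra \<Rightarrow> complex) \<Rightarrow> bool" where
  "state \<omega> \<longleftrightarrow>
     (\<forall>a b. \<omega> (a + b) = \<omega> a + \<omega> b) \<and> (\<forall>c a. \<omega> (c *\<^sub>C a) = c * \<omega> a) \<and>
     (\<forall>a. \<omega> (star a * a) \<in> \<real>\<^sub>\<ge>\<^sub>0) \<and> \<omega> 1 = 1"

definition vacuum_state ::
    "real \<Rightarrow> ((real \<Rightarrow> complex) \<Rightarrow> 'w::cstar_algebra) \<Rightarrow> ('w \<Rightarrow> complex) \<Rightarrow> bool" where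
  "vacuum_state m W \<omega> \<longleftrightarrow>
     state \<omega> \<and> (\<forall>f\<in>test_functions. \<omega> (W f) = complex_of_real (exp (- (1 / 2) * mass_norm_sq m f)))"

definition gns_triple ::
    "('w::cstar_algebra \<Rightarrow> complex) \<Rightarrow> ('w \<Rightarrow> ('h::complex_hilbert) op) \<Rightarrow> 'h \<Rightarrow> bool" where
  "gns_triple \<omega> rep \<Omega> \<longleftrightarrow>
     range rep \<subseteq> bounded_ops \<and>
     (\<forall>a b. rep (a + b) = rep a + rep b) \<and> (\<forall>c a. rep (c *\<^sub>C a) = c *\<^sub>C rep a) \<and>
     (\<forall>a b. rep (a * b) = rep a o\<^sub>L rep b) \<and> (\<forall>a. rep (star a) = adj (rep a)) \<and>
     rep 1 = id_blinfun \<and>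
     (\<forall>a. cinner \<Omega> (blinfun_apply (rep a) \<Omega>) = \<omega> a) \<and>
     closure (range (\<lambda>a. blinfun_apply (rep a) \<Omega>)) = UNIV"


section \<open>Poincare group and dilations\<close>

text \<open>A point of two-dimensional Minkowski space is \<open>x :: real^2\<close> with time \<open>x $ 1\<close> and
  space \<open>x $ 2\<close>.\<close>

definition minkowski_metric :: "real^2^2" where
  "minkowski_metric = vector [vector [1, 0], vector [0, - 1]]"

type_synonym poincare_elem = "(real^2^2) \<times> (real^2)"

definition lorentz :: "(real^2^2) set" where
  "lorentz = {L. transpose L ** minkowski_metric ** L = minkowski_metric \<and> det L = 1 \<and> L $ 1 $ 1 > 0}"

definition poincare :: "poincare_elem monoid" where
  "poincare =
     \<lparr>carrier = lorentz \<times> UNIV,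
      mult = (\<lambda>(L, x) (L', x'). (L ** L', L *v x' + x)),
      one = (mat 1, 0)\<rparr>"

definition spacetime_shifts :: "poincare_elem set" where
  "spacetime_shifts = {mat 1} \<times> UNIV"

text \<open>For \<open>m > 0\<close> the function \<open>Re_fourier f + \<i> \<omega> Im_fourier f\<close> determines \<open>f\<close>, since
  Fourier transforms of real functions satisfy \<open>u (- p) = cnj (u p)\<close>.\<close>

definition field_transform :: "real \<Rightarrow> (real \<Rightarrow> complex) \<Rightarrow> real \<Rightarrow> complex" where
  "field_transform m f p = Re_fourier f p + \<i> * complex_of_real (disp m p) * Im_fourier f p"

definition poincare_action ::
    "real \<Rightarrow> poincare_elem \<Rightarrow> (real \<Rightarrow> complex) \<Rightarrow> (real \<Rightarrow> complex)" where
  "poincare_action m = (\<lambda>(L, x) f. THE h. h \<in> test_functions \<and>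
     (\<forall>p. field_transform m h p =
        exp (\<i> * complex_of_real (x $ 1 * disp m p - x $ 2 * p)) *
        field_transform m f ((matrix_inv L *v vector [disp m p, p]) $ 2)))"

definition dilation :: "real \<Rightarrow> (real \<Rightarrow> complex) \<Rightarrow> (real \<Rightarrow> complex)" where
  "dilation l f = (\<lambda>x. complex_of_real (Re (f (x / l)) / l) + \<i> * complex_of_real (Im (f (x / l))))"


section \<open>The local net in the vacuum representation\<close>

definition cone_over :: "real \<Rightarrow> real \<Rightarrow> (real^2) set" where
  "cone_over a b = {x. a + \<bar>x $ 1\<bar> < x $ 2 \<and> x $ 2 < b - \<bar>x $ 1\<bar>}"

definition transformed_cone :: "poincare_elem \<Rightarrow> real \<Rightarrow> real \<Rightarrow> (real^2) set" where
  "transformed_cone = (\<lambda>(L, x) a b. (\<lambda>y. L *v y + x) ` cone_over a b)"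

definition double_cones :: "(real^2) set set" where
  "double_cones = {transformed_cone g a b | g a b. g \<in> carrier poincare \<and> a < b}"

text \<open>Below \<open>V f\<close> is the Weyl operator \<open>W f\<close> in the vacuum representation, so that
  \<open>V (poincare_action m g f)\<close> represents the Poincare transform of \<open>W f\<close>.
  A double cone can be written as \<open>transformed_cone g a b\<close> in several ways (they differ by
  a spatial translation of the interval) and all of them are admitted; they yield the same operators.\<close>

definition local_algebra ::
    "real \<Rightarrow> ((real \<Rightarrow> complex) \<Rightarrow> ('h::complex_hilbert) op) \<Rightarrow> (real^2) set \<Rightarrow> 'h op set" where
  "local_algebra m V R = commutant (commutant
     {V (poincare_action m g f) | g a b f.
        g \<in> carrier poincare \<and> a < b \<and> R = transformed_cone g a b \<and>
        f \<in> test_functions \<and> supp f \<subseteq> {a<..<b}})"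

definition quasi_local :: "((real^2) set \<Rightarrow> ('h::complex_hilbert) op set) \<Rightarrow> 'h op set" where
  "quasi_local N = closure (\<Union>R\<in>double_cones. N R)"

text \<open>\<open>\<Theta>\<close> is the automorphism of the quasi-local algebra, normal on local algebras, which is
  induced by the map \<open>T\<close> of test functions. By normality it is unique.\<close>

definition weyl_automorphism ::
    "real \<Rightarrow> ((real \<Rightarrow> complex) \<Rightarrow> ('h::complex_hilbert) op) \<Rightarrow>
     ((real \<Rightarrow> complex) \<Rightarrow> (real \<Rightarrow> complex)) \<Rightarrow> ('h op \<Rightarrow> 'h op) \<Rightarrow> bool" where
  "weyl_automorphism m V T \<Theta> \<longleftrightarrow>
     star_automorphism (quasi_local (local_algebra m V)) \<Theta> \<and>
     (\<forall>R\<in>double_cones. normal_on (local_algebra m V R) \<Theta>) \<and>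
     (\<forall>f\<in>test_functions. \<Theta> (V f) = V (T f))"


section \<open>Scaling algebras\<close>

text \<open>In this section \<open>N\<close> is the local net, \<open>\<alpha>\<close> the action of the Poincare group and \<open>G\<close> a
  subgroup of the latter. Functions of the scaling parameter are only considered on
  \<open>{0<..}\<close>; uniform convergence there is convergence of the supremum norm.\<close>

definition scaling_algebra ::
    "((real^2) set \<Rightarrow> ('h::complex_hilbert) op set) \<Rightarrow> (poincare_elem \<Rightarrow> 'h op \<Rightarrow> 'h op) \<Rightarrow>
     poincare_elem set \<Rightarrow> (real^2) set \<Rightarrow> (real \<Rightarrow> 'h op) set" where
  "scaling_algebra N \<alpha> G R =
     {A. bounded (A ` {0<..}) \<and> (\<forall>l>0. A l \<in> N ((\<lambda>x. l *\<^sub>R x) ` R)) \<and>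
         uniform_limit {0<..} (\<lambda>g l. \<alpha> (fst g, l *\<^sub>R snd g) (A l)) A (at (mat 1, 0) within G)}"

definition quasi_local_scaling_algebra ::
    "((real^2) set \<Rightarrow> ('h::complex_hilbert) op set) \<Rightarrow> (poincare_elem \<Rightarrow> 'h op \<Rightarrow> 'h op) \<Rightarrow>
     poincare_elem set \<Rightarrow> (real \<Rightarrow> 'h op) set" where
  "quasi_local_scaling_algebra N \<alpha> G =
     {A. \<forall>\<epsilon>>0. \<exists>R\<in>double_cones. \<exists>B\<in>scaling_algebra N \<alpha> G R. \<forall>l>0. norm (A l - B l) \<le> \<epsilon>}"

text \<open>A net of scales is a function \<open>scl\<close> on an index type together with the filter \<open>K\<close> of
  tails of the directed index set. The net \<open>scl\<close> tends to 0 from above, and the vacuum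
  states at scale \<open>scl k\<close> converge to \<open>\<omega>\<^sub>0\<close> in the weak* topology.\<close>

definition scaling_limit_state ::
    "((real^2) set \<Rightarrow> ('h::complex_hilbert) op set) \<Rightarrow> (poincare_elem \<Rightarrow> 'h op \<Rightarrow> 'h op) \<Rightarrow>
     poincare_elem set \<Rightarrow> 'h \<Rightarrow> 'k filter \<Rightarrow> ('k \<Rightarrow> real) \<Rightarrow>
     ((real \<Rightarrow> 'h op) \<Rightarrow> complex) \<Rightarrow> bool" where
  "scaling_limit_state N \<alpha> G \<Omega> K scl \<omega>\<^sub>0 \<longleftrightarrow>
     K \<noteq> bot \<and> filterlim scl (at_right 0) K \<and>
     (\<forall>A\<in>quasi_local_scaling_algebra N \<alpha> G.
        ((\<lambda>k. cinner \<Omega> (blinfun_apply (A (scl k)) \<Omega>)) \<longlongrightarrow> \<omega>\<^sub>0 A) K)"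

definition bullet_scaling_algebra ::
    "((real^2) set \<Rightarrow> ('h::complex_hilbert) op set) \<Rightarrow> (poincare_elem \<Rightarrow> 'h op \<Rightarrow> 'h op) \<Rightarrow>
     poincare_elem set \<Rightarrow> 'h \<Rightarrow> 'k filter \<Rightarrow> ('k \<Rightarrow> real) \<Rightarrow>
     (real^2) set \<Rightarrow> (real \<Rightarrow> 'h op) set" where
  "bullet_scaling_algebra N \<alpha> G \<Omega> K scl R =
     {A. bounded (A ` {0<..}) \<and> (\<forall>l>0. A l \<in> N ((\<lambda>x. l *\<^sub>R x) ` R)) \<and>
         (\<forall>R'\<in>double_cones. closure R \<subseteq> R' \<longrightarrow> (\<forall>\<epsilon>>0.
            \<exists>B\<in>scaling_algebra N \<alpha> G R'. \<exists>B'\<in>scaling_algebra N \<alpha> G R'.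
              Limsup K (\<lambda>k. ereal (
                norm (blinfun_apply (A (scl k) - B (scl k)) \<Omega>) +
                norm (blinfun_apply (adj (A (scl k)) - B' (scl k)) \<Omega>))) < ereal \<epsilon>))}"


section \<open>The two subnets\<close>

text \<open>The integral is in the strong sense, i.e. \<open>A \<psi>\<close> is the (Riemann) integral of a continuous
  compactly supported vector-valued function.\<close>

definition regularized_weyl ::
    "((real \<Rightarrow> complex) \<Rightarrow> ('h::complex_hilbert) op) \<Rightarrow> (poincare_elem \<Rightarrow> 'h op \<Rightarrow> 'h op) \<Rightarrow>
     'h op set" where
  "regularized_weyl V \<alpha> =
     {A. \<exists>g f. continuous_on UNIV g \<and> compact (closure {y. g y \<noteq> 0}) \<and> f \<in> test_functions \<and>
        (\<forall>\<psi>. ((\<lambda>y. (g y :: complex) *\<^sub>C blinfun_apply (\<alpha> (mat 1, y) (V f)) \<psi>)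
                has_integral blinfun_apply A \<psi>) UNIV)}"

definition weyl_reg_algebra ::
    "real \<Rightarrow> ((real \<Rightarrow> complex) \<Rightarrow> ('h::complex_hilbert) op) \<Rightarrow>
     (poincare_elem \<Rightarrow> 'h op \<Rightarrow> 'h op) \<Rightarrow> (real^2) set \<Rightarrow> 'h op set" where
  "weyl_reg_algebra m V \<alpha> R =
     cstar_generated (o\<^sub>L) adj (local_algebra m V R \<inter> regularized_weyl V \<alpha>)"

definition phi_algebra ::
    "((real^2) set \<Rightarrow> ('h::complex_hilbert) op set) \<Rightarrow> (poincare_elem \<Rightarrow> 'h op \<Rightarrow> 'h op) \<Rightarrow>
     (real \<Rightarrow> 'h op \<Rightarrow> 'h op) \<Rightarrow>
     poincare_elem set \<Rightarrow> 'h \<Rightarrow> 'k filter \<Rightarrow> ('k \<Rightarrow> real) \<Rightarrow>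
     (real^2) set \<Rightarrow> 'h op set" where
  "phi_algebra N \<alpha> \<phi> G \<Omega> K scl R =
     {A \<in> N R. (\<lambda>l. \<phi> l A) \<in> bullet_scaling_algebra N \<alpha> G \<Omega> K scl R}"

end

theory Submission
  imports Defs "HOL-Complex_Analysis.Conformal_Mappings" "HOL-Probability.Characteristic_Functions"
    "HOL-Probability.Sinc_Integral" "HOL-Real_Asymp.Real_Asymp"
begin

text \<open>
  Let \<open>V f\<close> be the Weyl operators in the vacuum representation. The scalar products of the
  coherent vectors \<open>V f \<Omega>\<close> are Gaussian in the one-particle norm (\<open>V_coherent\<close>).
  A dilation by \<open>l\<close> amounts to replacing the mass \<open>m\<close> in this norm by \<open>l m\<close>. For \<open>l \<rightarrow> 0\<close> the norm diverges, logarithmically,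
  unless the mean \<open>\<integral> Re f\<close> vanishes (\<open>mnsq_diverges\<close>). Hence the dilates of Weyl operators with different means map
  dilated coherent vectors to vectors which become orthogonal in the scaling limit.

  Both ideals come from this decoherence. For a suitable \<open>f\<close> the operator \<open>A = \<integral> g(y) \<alpha>\<^sub>y(V f) dy\<close> is an integral of Weyl
  operators with pairwise different means, because the mean of \<open>f\<close> oscillates in time like \<open>cos (m t)\<close>. Its dilates \<open>\<phi>\<^sub>l(A)\<close> tend
  to 0 on all dilated coherent vectors, although \<open>A \<noteq> 0\<close> (\<open>decoherent_operator\<close>). In the algebra of regularized Weyl
  operators the elements with this property form a proper closed two-sided ideal, since the generators transform dilated coherent
  vectors into integrals of such vectors (\<open>weyl_reg_not_simple\<close>). In \<open>\<A>\<^sub>\<phi>\<close> the ideal consists of the \<open>A\<close> such that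
  \<open>\<phi>\<^sub>l(A B) \<Omega> \<rightarrow> 0\<close> for all \<open>B\<close> (\<open>PA_not_simple\<close>). That the above operator belongs to it follows from a Reeh-Schlieder argument:
  \<open>\<phi>\<^sub>l(B) \<Omega>\<close> is approximated by \<open>X\<^sub>l \<Omega>\<close> with a scaling function \<open>X\<close>, and \<open>X\<^sub>l \<Omega>\<close> by linear combinations
  \<open>\<Sum>\<^sub>j c\<^sub>j \<alpha>\<^sub>l\<^sub>y(X\<^sub>l) \<Omega>\<close>, \<open>y = y\<^sub>j\<close>, of far translates, which commute with \<open>\<phi>\<^sub>l(A)\<close>. Here \<open>c\<^sub>j\<close> and \<open>y\<^sub>j\<close> do not depend on \<open>l\<close>;
  they are obtained from the positivity of the energy: matrix elements of translates on the vacuum are annihilated by the kernels which are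
  holomorphic in a half-plane, so that a Poisson kernel may be multiplied by a holomorphic function which is concentrated
  on a given interval (\<open>annihilated_approx\<close>, \<open>shifts_approx\<close>). The same approximation shows that products of
  elements of \<open>\<A>\<^sub>\<phi>(O)\<close> belong to \<open>\<A>\<^sub>\<phi>(O)\<close> (\<open>ap_compose\<close>), so that \<open>\<A>\<^sub>\<phi>\<close> is a C*-algebra.

  An element outside \<open>\<A>\<^sub>\<phi>\<close> is, up to a phase, \<open>B = exp (- \<i> \<Phi>\<^sup>2 / 2)\<close>, where \<open>V (s f) = exp (\<i> s \<Phi>)\<close> for a real \<open>f\<close> with non-zero
  mean. It is a weak
  limit of Fresnel integrals of Weyl operators, hence local, and isometric. For every \<open>b > 0\<close> the correlations between \<open>\<phi>\<^sub>l(B) \<Omega>\<close> and its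
  translate by \<open>l b\<close> are Gaussian integrals which vanish in the limit (\<open>fresnel_correlation\<close>). This is incompatible with an
  approximation by scaling functions, which are uniformly continuous under the rescaled translations (\<open>PA_proper\<close>).

  The structure of the local net rests on finite propagation speed (\<open>finite_propagation\<close>) and on the determination of
  normal functionals by their values on generators (\<open>normal_form_zero_bicommutant\<close>).
\<close>

text \<open>Abbreviations; \<open>LI x. f x\<close> is the integral with respect to the Lebesgue-Borel measure.\<close>

notation scaleC (infixr "*C" 75) and scaleR (infixr "*R" 75) and blinfun_compose (infixl "oL" 55)
notation tendsto (infixr "--->" 55) and LIMSEQ ("((_)/ ----> (_))" [60, 60] 60)

abbreviation "cor \<equiv> complex_of_real"
abbreviation "ftr \<equiv> field_transform"
abbreviation "mnsq \<equiv> mass_norm_sq"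
abbreviation "tcone \<equiv> transformed_cone"
abbreviation "\<D> \<equiv> test_functions"
abbreviation "\<K> \<equiv> double_cones"
abbreviation "\<B> \<equiv> bounded_ops"
abbreviation "PG \<equiv> carrier poincare"
abbreviation poincare_mult (infixl "\<cdot>" 70) where "g \<cdot> h \<equiv> g \<otimes>\<^bsub>poincare\<^esub> h"
abbreviation lborel_integral :: "('a::euclidean_space \<Rightarrow> 'b::{banach, second_countable_topology}) \<Rightarrow> 'b" (binder "LI " [60] 60)
  where "lborel_integral f \<equiv> integral\<^sup>L lborel f"

lemmas ftr_def = field_transform_def
lemmas mnsq_def = mass_norm_sq_def
lemmas tcone_def = transformed_cone_def
lemmas tf_def = test_functions_def
lemmas \<K>_def = double_cones_def
lemmas \<B>_def = bounded_ops_def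
lemmas BI_bound = Bochner_Integration.integrable_bound
lemmas BI_cnj = Bochner_Integration.integral_cnj
lemmas BI_cong = Bochner_Integration.integral_cong
lemmas BI_norm_bound = Bochner_Integration.integral_norm_bound_integral
lemmas borel_cont = borel_measurable_continuous_onI
lemmas scaleC_app = scaleC_blinfun.rep_eq
lemmas oL_app = blinfun_apply_blinfun_compose

section \<open>Hilbert spaces\<close>

subclass (in complex_hilbert) banach ..

subsection \<open>Projections and the representation of functionals\<close>

lemma closed_subspace_projection:
 fixes S :: "'a::{real_inner, complete_space} set"
 assumes S: "subspace S" and cl: "closed S"
 shows "\<exists>p\<in>S. \<forall>s\<in>S. inner (x - p) s = 0"
proof -
 let ?q = "%s. (norm (x - s))^2"
 define d where "d = Inf (?q ` S)"
 have d_le: "d <= ?q s" if "s : S" for s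
  unfolding d_def by (intro cInf_lower imageI that bdd_belowI[of _ 0]) auto
 have "\<exists>s\<in>S. ?q s < d + 1/real (Suc n)" for n
  using cInf_lessD[of "?q ` S" "d + 1/real (Suc n)"] subspace_0[OF S] by (auto simp: d_def)
 then obtain s where s: "!!n. s n : S" "!!n. ?q (s n) < d + 1/real (Suc n)" by metis
 have bnd: "(norm (a - b))^2 <= 2*?q a + 2*?q b - 4*d" if "a : S" "b : S" for a b
 proof -
  have "(1/2) *R (a + b) : S" using S that by (simp add: subspace_add subspace_scale)
  from d_le[OF this] show ?thesis unfolding power2_norm_eq_inner by (simp add: inner_simps field_simps inner_commute)
 qed
 have "Cauchy s"
 proof (rule metric_CauchyI)
  fix e :: real assume e: "e > 0"
  then obtain N where N: "1/real (Suc N) < e^2/4" using nat_approx_posE[of "e^2/4"] by auto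
  have "dist (s i) (s j) < e" if "i >= N" "j >= N" for i j
  proof -
   have "1/real (Suc i) <= 1/real (Suc N)" "1/real (Suc j) <= 1/real (Suc N)" using that by (auto simp: frac_le)
   hence "(norm (s i - s j))^2 < e^2" using bnd[OF s(1) s(1), of i j] s(2)[of i] s(2)[of j] N by linarith
   thus ?thesis using e by (simp add: dist_norm power_less_imp_less_base)
  qed
  thus "\<exists>M. \<forall>m\<ge>M. \<forall>n\<ge>M. dist (s m) (s n) < e" by blast
 qed
 then obtain p where p: "s ----> p" using Cauchy_convergent convergent_def by blast
 have pS: "p : S" using closed_sequentially[OF cl] s(1) p by blast
 have "(%n. ?q (s n)) ----> ?q p" "(%n. d + 1/real (Suc n)) ----> d + 0" by (intro tendsto_intros p LIMSEQ_Suc)+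
 hence pd: "?q p <= d + 0" by (rule LIMSEQ_le) (use s(2) less_imp_le in blast)
 have "inner (x - p) t = 0" if t: "t : S" for t
 proof (rule ccontr)
  assume ne0: "inner (x - p) t ~= 0"
  hence tt: "inner t t > 0" by auto
  define c where "c = inner (x - p) t/inner t t"
  have "p + c *R t : S" using S pS t by (simp add: subspace_add subspace_scale)
  from d_le[OF this] have "?q p <= (norm ((x - p) - c *R t))^2" using pd unfolding diff_diff_eq by linarith
  also have "... = ?q p - (inner (x - p) t)\<^sup>2/inner t t"
   unfolding power2_norm_eq_inner inner_diff_left[of "x - p" "c *R t"] inner_diff_right[of _ "x - p" "c *R t"]
   using tt by (simp add: c_def inner_commute power2_eq_square)
  finally have "(inner (x - p) t)^2/inner t t <= 0" by simp
  thus False using tt ne0 by (simp add: divide_le_0_iff)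
 qed
 thus ?thesis using pS by blast
qed

lemma riesz_real:
 fixes f :: "'a::{real_inner, complete_space} => real"
 assumes f: "bounded_linear f"
 shows "\<exists>y. \<forall>x. f x = inner x y"
proof (cases "\<forall>x. f x = 0")
 case True thus ?thesis by (intro exI[of _ 0]) simp
next
 case False
 then obtain x0 where x0: "f x0 ~= 0" by blast
 note lin = bounded_linear.linear[OF f]
 note add = linear_add[OF lin] and diff = linear_diff[OF lin] and scaleR = linear_scale[OF lin] and zero = linear_0[OF lin]
 have S: "subspace {x. f x = 0}" by (auto simp: subspace_def add scaleR zero)
 have "closed {x. f x = 0}" by (intro closed_Collect_eq linear_continuous_on f continuous_on_const)
 from closed_subspace_projection[OF S this, of x0] obtain p where
  p: "f p = 0" "!!s. f s = 0 ==> inner (x0 - p) s = 0" by auto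
 define w where "w = x0 - p"
 have fw: "f w = f x0" by (simp add: w_def diff p)
 have w0: "inner w w ~= 0" using fw x0 zero by auto
 have "f x = inner x ((f w/inner w w) *R w)" for x
 proof -
  have "f (f w *R x - f x *R w) = 0" by (simp add: diff scaleR)
  from p(2)[OF this] have "inner w (f w *R x - f x *R w) = 0" by (simp add: w_def)
  hence "f w*inner w x = f x*inner w w" by (simp add: inner_diff_right)
  thus ?thesis using w0 by (simp add: inner_commute)
 qed
 thus ?thesis by blast
qed

subsection \<open>The complex scalar product\<close>

lemma scaleC_one [simp]: "1 *C x = (x::'a::complex_normed_vector)"
 using scaleC_of_real[of 1 x] by simp

lemma scaleC_zero_left [simp]: "0 *C x = (0::'a::complex_normed_vector)"
 using scaleC_of_real[of 0 x] by simp

lemma scaleC_zero_right [simp]: "c *C 0 = (0::'a::complex_normed_vector)"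
 using norm_scaleC[of c "0::'a"] by simp

lemma scaleC_minus_one: "(-1) *C x = - (x::'a::complex_normed_vector)"
 using scaleC_of_real[of "-1" x] by simp

lemma scaleC_minus_right: "c *C (- x) = - (c *C (x::'a::complex_normed_vector))"
 by (metis add_eq_0_iff scaleC_add_right scaleC_zero_right)

lemma scaleC_diff_right: "c *C (x - y) = c *C x - c *C (y::'a::complex_normed_vector)"
 by (simp add: diff_conv_add_uminus scaleC_add_right scaleC_minus_right del: add_uminus_conv_diff)

lemma scaleC_scaleR: "c *C (r *R x) = r *R (c *C (x::'a::complex_normed_vector))"
 by (metis mult.commute scaleC_of_real scaleC_scaleC)

lemma bounded_linear_scaleC: "bounded_linear (%x::'a::complex_normed_vector. c *C x)"
 by (rule bounded_linear_intro[where K = "cmod c"])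
   (auto simp: scaleC_add_right scaleC_scaleR norm_scaleC)

lemma cinner_add_left: "cinner (x + y) z = cinner x z + cinner y (z::'h::complex_hilbert)"
 by (metis cinner_add_right cinner_commute complex_cnj_add)

lemma cinner_scaleC_left: "cinner (c *C x) y = cnj c*cinner x (y::'h::complex_hilbert)"
 by (metis cinner_commute cinner_scaleC_right complex_cnj_mult)

lemma cinner_scaleR_right: "cinner x (r *R y) = of_real r*cinner x (y::'h::complex_hilbert)"
 by (metis cinner_scaleC_right scaleC_of_real)

lemma cinner_scaleR_left: "cinner (r *R x) y = of_real r*cinner x (y::'h::complex_hilbert)"
 by (metis cinner_commute cinner_scaleR_right complex_cnj_complex_of_real complex_cnj_mult)

lemma cinner_simps [simp]:
 "cinner (0::'h::complex_hilbert) y = 0" "cinner y (0::'h) = 0"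
 "cinner y (- x) = - cinner y (x::'h)" "cinner (- x) y = - cinner x (y::'h)"
 using cinner_scaleR_left[of 0 0 y] cinner_scaleR_right[of y 0 0]
  cinner_scaleR_right[of y "-1" x] cinner_scaleR_left[of "-1" x y] by simp_all

lemma cinner_diff_right: "cinner x (y - z) = cinner x y - cinner x (z::'h::complex_hilbert)"
 using cinner_add_right[of x y "- z"] by simp

lemma cinner_diff_left: "cinner (x - y) z = cinner x z - cinner y (z::'h::complex_hilbert)"
 using cinner_add_left[of x "- y" z] by simp

lemma cinner_sum_right: "cinner x (\<Sum>i\<in>I. f i) = (\<Sum>i\<in>I. cinner x (f i::'h::complex_hilbert))"
 by (induction I rule: infinite_finite_induct) (auto simp: cinner_add_right)

lemma cinner_self: "cinner x x = of_real ((norm (x::'h::complex_hilbert))^2)"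
 using cinner_commute[of x x] by (auto simp: complex_eq_iff Re_cinner power2_norm_eq_inner)

lemma cinner_norm_le: "cmod (cinner x y) <= norm x*norm (y::'h::complex_hilbert)"
proof -
 define c where "c = cnj (sgn (cinner x y))"
 have c1: "cmod c <= 1" by (simp add: c_def norm_sgn)
 have "of_real (cmod (cinner x y)) = c*cinner x y"
  by (cases "cinner x y = 0") (simp_all add: c_def sgn_eq field_simps complex_norm_square[symmetric] power2_eq_square)
 also have "... = cinner x (c *C y)" by (simp add: cinner_scaleC_right)
 finally have "cmod (cinner x y) = inner x (c *C y)" by (metis Re_cinner Re_complex_of_real)
 also have "... <= norm x*norm (c *C y)" by (rule norm_cauchy_schwarz)
 also have "... <= norm x*(1*norm y)" using c1 by (simp only: norm_scaleC) (intro mult_left_mono mult_right_mono norm_ge_zero)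
 finally show ?thesis by simp
qed

lemma bounded_linear_cinner: "bounded_linear (cinner (x::'h::complex_hilbert))"
proof (rule bounded_linear_intro[where K = "norm x"])
 show "norm (cinner x y) <= norm y*norm x" for y
  using cinner_norm_le[of x y] by (simp add: mult.commute)
qed (auto simp: cinner_add_right cinner_scaleR_right scaleR_conv_of_real)

lemma cinner_tendsto:
 fixes x y :: "'h::complex_hilbert"
 assumes "(f ---> x) F" "(g ---> y) F"
 shows "((%t. cinner (f t) (g t)) ---> cinner x y) F"
proof -
 have e: "cinner x y = Complex (inner x y) (inner x ((- \<i>) *C y))" for x y :: 'h
  by (simp add: Re_cinner[symmetric] cinner_scaleC_right)
 show ?thesis unfolding e by (intro tendsto_intros bounded_linear.tendsto[OF bounded_linear_scaleC] assms)
qed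

lemmas tendsto_cinner_right = bounded_linear.tendsto[OF bounded_linear_cinner]
lemmas continuous_on_cinner_right = bounded_linear.continuous_on[OF bounded_linear_cinner]

lemma cinner_i_left: "Re (cinner (\<i> *C x) y) = Im (cinner x (y::'h::complex_hilbert))"
 by (simp add: cinner_scaleC_left)

lemma cinner_extR: "(!!x. cinner x y = cinner x z) ==> y = (z::'h::complex_hilbert)"
proof -
 assume "!!x. cinner x y = cinner x z"
 hence "cinner (y - z) (y - z) = 0" by (simp add: cinner_diff_right)
 thus ?thesis by (simp add: cinner_self)
qed

text \<open>A vector is bounded by its scalar products with vectors of norm at most one.\<close>

lemma norm_le_if_cinner_le:
 fixes y :: "'h::complex_hilbert"
 assumes "!!x. norm x <= 1 ==> cmod (cinner x y) <= C" "C >= 0"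
 shows "norm y <= C"
proof (cases "y = 0")
 case False
 have "cinner ((1/norm y) *R y) y = of_real (norm y)"
  by (simp add: cinner_scaleR_left cinner_self power2_eq_square)
 moreover have "norm ((1/norm y) *R y) <= 1" by simp
 ultimately show ?thesis using assms(1) by (metis norm_of_real abs_norm_cancel)
qed (use assms in simp)

lemma norm_diff_sq_cinner:
 fixes x y :: "'h::complex_hilbert"
 shows "(norm (x - y))^2 = (norm x)^2 + (norm y)^2 - 2 * Re (cinner x y)"
 by (simp add: power2_norm_eq_inner inner_diff_right Re_cinner inner_commute)

subsection \<open>Adjoints\<close>

lemma \<B>_scaleC: "A : \<B> ==> A (c *C x) = c *C A x"
 by (simp add: \<B>_def)

lemma adj_exists:
 fixes A :: "('h::complex_hilbert) op"
 assumes A: "A : \<B>"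
 shows "\<exists>!B. \<forall>x y. cinner (blinfun_apply A x) y = cinner x (blinfun_apply B y)"
proof -
 have "\<exists>z. \<forall>x. cinner (A x) y = cinner x z" for y
 proof -
  have "bounded_linear (%x. inner (A x) y)"
   by (intro bounded_linear_inner_left_comp blinfun.bounded_linear_right)
  from riesz_real[OF this] obtain z where z: "!!x. inner (A x) y = inner x z" by blast
  have re: "Re (cinner (A x) y) = Re (cinner x z)" for x by (simp add: z Re_cinner)
  have "Im (cinner (A x) y) = Im (cinner x z)" for x
   using re[of "\<i> *C x"] by (simp only: \<B>_scaleC[OF A] cinner_i_left)
  with re show ?thesis by (metis complex_eqI)
 qed
 then obtain B where B: "!!x y. cinner (A x) y = cinner x (B y)" by metis
 have "bounded_linear B"
 proof (rule bounded_linear_intro[where K = "norm A"])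
  show "B (x + y) = B x + B y" for x y
   by (rule cinner_extR) (simp add: B[symmetric] cinner_add_right)
  show "B (r *R x) = r *R B x" for r x
   by (rule cinner_extR) (simp add: B[symmetric] cinner_scaleR_right)
  show "norm (B y) <= norm y*norm A" for y
  proof (rule norm_le_if_cinner_le)
   fix x :: 'h assume x: "norm x <= 1"
   have "cmod (cinner x (B y)) <= norm (A x)*norm y" by (simp add: B[symmetric] cinner_norm_le)
   also have "... <= (norm A*1)*norm y"
    using x by (intro mult_right_mono order_trans[OF norm_blinfun] mult_left_mono) auto
   finally show "cmod (cinner x (B y)) <= norm y*norm A" by (simp add: mult.commute)
  qed simp
 qed
 hence B': "\<forall>x y. cinner (A x) y = cinner x (Blinfun B y)" by (simp add: bounded_linear_Blinfun_apply B)
 show ?thesis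
 proof (rule ex1I[of _ "Blinfun B"], fact B')
  fix C assume "\<forall>x y. cinner (blinfun_apply A x) y = cinner x (blinfun_apply C y)"
  hence "cinner x (C y) = cinner x (Blinfun B y)" for x y using B' by metis
  thus "C = Blinfun B" by (intro blinfun_eqI cinner_extR)
 qed
qed

lemma cinner_adj_right:
 assumes "A : \<B>"
 shows "cinner x (blinfun_apply (adj A) y) = cinner (blinfun_apply A x) y"
proof -
 have "\<forall>x y. cinner (blinfun_apply A x) y = cinner x (blinfun_apply (adj A) y)"
  unfolding adj_def by (rule theI'[OF adj_exists[OF assms]])
 thus ?thesis by metis
qed

lemma cinner_adj_left:
 assumes "A : \<B>"
 shows "cinner (blinfun_apply (adj A) x) y = cinner x (blinfun_apply A y)"
 by (metis assms cinner_adj_right cinner_commute)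

lemma adj_eqI:
 assumes "A : \<B>" "!!x y. cinner (blinfun_apply A x) y = cinner x (blinfun_apply B y)"
 shows "adj A = B"
 unfolding adj_def by (rule the1_equality[OF adj_exists[OF assms(1)]]) (use assms(2) in blast)

lemma adj_in_\<B> [intro]:
 assumes "A : \<B>" shows "adj A : \<B>"
proof -
 have "adj A (c *C x) = c *C adj A x" for c x
  by (rule cinner_extR) (simp add: cinner_adj_right[OF assms] cinner_scaleC_right)
 thus ?thesis by (simp add: \<B>_def)
qed

lemma adj_adj [simp]: "A : \<B> ==> adj (adj A) = A"
 by (rule adj_eqI) (auto simp: cinner_adj_left)

lemma \<B>_intros [intro]:
 "0 : \<B>" "id_blinfun : \<B>"
 "A : \<B> ==> B : \<B> ==> A + B : \<B>"
 "A : \<B> ==> B : \<B> ==> A - B : \<B>"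
 "A : \<B> ==> B : \<B> ==> A oL B : \<B>"
 "A : \<B> ==> c *C A : \<B>"
 by (auto simp: \<B>_def blinfun.add_left blinfun.diff_left scaleC_add_right scaleC_diff_right
   scaleC_app scaleC_scaleC mult.commute)

lemma adj_add: "A : \<B> ==> B : \<B> ==> adj (A + B) = adj A + adj B"
 by (rule adj_eqI) (auto simp: blinfun.add_left cinner_add_left cinner_add_right cinner_adj_right)

lemma adj_diff: "A : \<B> ==> B : \<B> ==> adj (A - B) = adj A - adj B"
 by (rule adj_eqI) (auto simp: blinfun.diff_left cinner_diff_left cinner_diff_right cinner_adj_right)

lemma adj_scaleC: "A : \<B> ==> adj (c *C A) = cnj c *C adj A"
 by (rule adj_eqI) (auto simp: scaleC_app cinner_scaleC_left cinner_scaleC_right cinner_adj_right)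

lemma adj_compose: "A : \<B> ==> B : \<B> ==> adj (A oL B) = adj B oL adj A"
 by (rule adj_eqI) (auto simp: cinner_adj_right)

lemma adj_id [simp]: "adj id_blinfun = (id_blinfun :: ('h::complex_hilbert) op)"
 by (rule adj_eqI) auto

lemma adj_zero [simp]: "adj 0 = (0 :: ('h::complex_hilbert) op)"
 by (rule adj_eqI) auto

lemma norm_op_le_if_cinner:
 fixes A :: "('h::complex_hilbert) op"
 assumes "!!x y. norm x <= 1 ==> cmod (cinner x (A y)) <= C*norm y" "C >= 0"
 shows "norm A <= C"
 by (rule norm_blinfun_bound[OF assms(2)]) (rule norm_le_if_cinner_le, use assms in auto)

lemma norm_adj_le: "A : \<B> ==> norm (adj A) <= norm A"
proof (rule norm_op_le_if_cinner)
 fix x y :: 'a assume A: "A : \<B>" and x: "norm x <= 1"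
 have "cmod (cinner x (adj A y)) <= norm (A x)*norm y" by (simp add: cinner_adj_right[OF A] cinner_norm_le)
 also have "... <= (norm A*1)*norm y"
  using x by (intro mult_right_mono order_trans[OF norm_blinfun] mult_left_mono) auto
 finally show "cmod (cinner x (adj A y)) <= norm A*norm y" by simp
qed simp

lemma norm_adj [simp]: "A : \<B> ==> norm (adj A) = norm A"
 by (metis adj_adj adj_in_\<B> antisym norm_adj_le)

lemma closed_\<B>: "closed (\<B> :: ('h::complex_hilbert) op set)"
proof -
 have eq: "(\<B> :: 'h op set) = (\<Inter>c x. {A. blinfun_apply A (c *C x) = c *C blinfun_apply A x})"
  by (auto simp: \<B>_def)
 have "closed {A::'h op. blinfun_apply A (c *C x) = c *C blinfun_apply A x}" for c x
  by (intro closed_Collect_eq blinfun.continuous_on continuous_on_const continuous_on_id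
    bounded_linear.continuous_on[OF bounded_linear_scaleC])
 thus ?thesis unfolding eq by (intro closed_INT ballI)
qed

lemma blinfun_compose_add_left: "(A + B) oL C = (A oL C) + (B oL C)"
 by (rule blinfun_eqI) (simp add: blinfun.add_left)
lemma blinfun_compose_add_right: "C oL (A + B) = (C oL A) + (C oL B)"
 by (rule blinfun_eqI) (simp add: blinfun.add_left blinfun.add_right)
lemma blinfun_compose_diff_left: "(A - B) oL C = (A oL C) - (B oL C)"
 by (rule blinfun_eqI) (simp add: blinfun.diff_left)
lemma blinfun_compose_diff_right: "C oL (A - B) = (C oL A) - (C oL B)"
 by (rule blinfun_eqI) (simp add: blinfun.diff_left blinfun.diff_right)
lemma scaleC_compose_left: "(c *C A) oL B = c *C (A oL B)"
 by (rule blinfun_eqI) (simp add: scaleC_app)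
lemma scaleC_compose_right: "A : \<B> ==> A oL (c *C B) = c *C (A oL B)"
 by (rule blinfun_eqI) (simp add: scaleC_app \<B>_scaleC)

section \<open>Normal functionals and the double commutant\<close>

subsection \<open>Square-summable sequences of vectors\<close>

text \<open>The Hilbert space of square-summable sequences in a Hilbert space: the amplification on which
 a normal functional becomes a vector functional.\<close>

typedef (overloaded) 'a ell2 = "{x::nat => 'a::real_inner. summable (%n. (norm (x n))^2)}"
 morphisms ell2_nth Abs_ell2
 by (rule exI[of _ "%_. 0"]) simp

setup_lifting type_definition_ell2

lemma summable_norm_ell2: "summable (%n. (norm (ell2_nth x n))^2)"
 using ell2_nth[of x] by simp

lemma summable_norm_sq_add:
 fixes x y :: "nat => 'a::real_inner"
 assumes "summable (%n. (norm (x n))^2)" "summable (%n. (norm (y n))^2)"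
 shows "summable (%n. (norm (x n + y n))^2)"
proof (rule summable_comparison_test')
 show "summable (%n. 2*(norm (x n))^2 + 2*(norm (y n))^2)"
  by (intro summable_add summable_mult assms)
 show "norm ((norm (x n + y n))^2) <= 2*(norm (x n))^2 + 2*(norm (y n))^2" for n
 proof -
  have "(norm (x n + y n))^2 <= (norm (x n) + norm (y n))^2" by (intro power_mono norm_triangle_ineq) simp
  also have "... <= 2*(norm (x n))^2 + 2*(norm (y n))^2"
   using sum_squares_ge_zero[of "norm (x n) - norm (y n)" 0] by (simp add: power2_eq_square algebra_simps)
  finally show ?thesis by simp
 qed
qed

lemma summable_inner_sq:
 fixes x y :: "nat => 'a::real_inner"
 assumes "summable (%n. (norm (x n))^2)" "summable (%n. (norm (y n))^2)"
 shows "summable (%n. norm (x n)*norm (y n))"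
proof (rule summable_comparison_test')
 show "summable (%n. (norm (x n))^2 + (norm (y n))^2)"
  by (intro summable_add assms)
 show "norm (norm (x n)*norm (y n)) <= (norm (x n))^2 + (norm (y n))^2" for n
 proof -
  have "0 <= norm (x n)*norm (y n)" by simp
  moreover have "norm (norm (x n)*norm (y n)) = norm (x n)*norm (y n)" by simp
  ultimately show ?thesis using sum_squares_bound[of "norm (x n)" "norm (y n)"] by linarith
 qed
qed

instantiation ell2 :: (real_inner) real_inner
begin

lift_definition zero_ell2 :: "'a ell2" is "%_. 0" by simp
lift_definition plus_ell2 :: "'a ell2 => 'a ell2 => 'a ell2" is "%x y n. x n + y n"
 by (rule summable_norm_sq_add)
lift_definition scaleR_ell2 :: "real => 'a ell2 => 'a ell2" is "%r x n. r *R x n"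
 by (simp add: power_mult_distrib)
lift_definition uminus_ell2 :: "'a ell2 => 'a ell2" is "%x n. - x n" by simp
lift_definition minus_ell2 :: "'a ell2 => 'a ell2 => 'a ell2" is "%x y n. x n - y n"
proof -
 fix x y :: "nat => 'a"
 assume "summable (%n. (norm (x n))^2)" "summable (%n. (norm (y n))^2)"
 thus "summable (%n. (norm (x n - y n))^2)"
  using summable_norm_sq_add[of x "%n. - y n"] by simp
qed
lift_definition inner_ell2 :: "'a ell2 => 'a ell2 => real" is "%x y. \<Sum>n. inner (x n) (y n)" .
definition "norm_ell2 (x::'a ell2) = sqrt (inner x x)"
definition "dist_ell2 (x::'a ell2) y = norm (x - y)"
definition "sgn_ell2 (x::'a ell2) = scaleR (inverse (norm x)) x"
definition [code del]: "(uniformity :: ('a ell2 \<times> 'a ell2) filter) = (INF e\<in>{0<..}. principal {(x, y). dist x y < e})"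
definition [code del]: "open (U :: 'a ell2 set) \<longleftrightarrow> (\<forall>x\<in>U. eventually (%(x', y). x' = x --> y : U) uniformity)"

lemma summable_inner_ell2: "summable (%n. inner (ell2_nth x n) (ell2_nth y n :: 'a))"
 by (rule summable_comparison_test'[OF summable_inner_sq[OF summable_norm_ell2[of x] summable_norm_ell2[of y]]])
   (use Cauchy_Schwarz_ineq2 in auto)

instance
proof
 fix x y z :: "'a ell2" and r s :: real
 show "x + y + z = x + (y + z)" by transfer (simp add: add.assoc)
 show "x + y = y + x" by transfer (simp add: add.commute)
 show "0 + x = x" by transfer simp
 show "- x + x = 0" by transfer simp
 show "x - y = x + - y" by transfer simp
 show "r *R (x + y) = r *R x + r *R y" by transfer (simp add: scaleR_add_right)
 show "(r + s) *R x = r *R x + s *R x" by transfer (simp add: scaleR_add_left)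
 show "r *R s *R x = (r * s) *R x" by transfer simp
 show "1 *R x = x" by transfer simp
 show "dist x y = norm (x - y)" by (rule dist_ell2_def)
 show "sgn x = inverse (norm x) *R x" by (rule sgn_ell2_def)
 show "uniformity = (INF e\<in>{0<..}. principal {(x, y :: 'a ell2). dist x y < e})" by (rule uniformity_ell2_def)
 show "open U \<longleftrightarrow> (\<forall>x\<in>U. eventually (%(x', y). x' = x --> y : U) uniformity)" for U :: "'a ell2 set"
  by (rule open_ell2_def)
 show "inner x y = inner y x" by transfer (simp add: inner_commute)
 show "inner (x + y) z = inner x z + inner y z"
  using suminf_add[OF summable_inner_ell2[of x z] summable_inner_ell2[of y z]]
  by (simp add: inner_ell2.rep_eq plus_ell2.rep_eq inner_add_left)
 show "inner (r *R x) y = r*inner x y"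
  using suminf_mult[OF summable_inner_ell2[of x y], of r]
  by (simp add: inner_ell2.rep_eq scaleR_ell2.rep_eq)
 show "0 <= inner x x"
  unfolding inner_ell2.rep_eq by (intro suminf_nonneg summable_inner_ell2) simp
 have "inner x x = 0 \<longleftrightarrow> (\<forall>n. inner (ell2_nth x n) (ell2_nth x n) = 0)"
  unfolding inner_ell2.rep_eq by (intro suminf_eq_zero_iff summable_inner_ell2) simp
 also have "... \<longleftrightarrow> x = 0" by transfer auto
 finally show "inner x x = 0 \<longleftrightarrow> x = 0" .
 show "norm x = sqrt (inner x x)" by (rule norm_ell2_def)
qed

end

lemma norm_ell2_sums: "(%n. (norm (ell2_nth x n))^2) sums (norm x)^2"
 using summable_sums[OF summable_norm_ell2[of x]]
 by (simp add: power2_norm_eq_inner inner_ell2.rep_eq)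

lemma ell2_sum_le: "finite I ==> (\<Sum>n\<in>I. (norm (ell2_nth x n))^2) <= (norm x)^2"
 using sum_le_suminf[OF summable_norm_ell2[of x], of I] sums_unique[OF norm_ell2_sums[of x]] by simp

lemma norm_ell2_nth_le: "norm (ell2_nth x n) <= norm x"
 using ell2_sum_le[of "{n}" x] by simp

lemma bounded_linear_ell2_nth: "bounded_linear (%x. ell2_nth x n)"
 by (rule bounded_linear_intro[where K = 1])
   (simp_all add: plus_ell2.rep_eq scaleR_ell2.rep_eq norm_ell2_nth_le)

lemma ell2_eqI: "(!!n. ell2_nth x n = ell2_nth y n) ==> x = y"
 by (metis ell2_nth_inject ext)

lemma norm_ell2_leI:
 assumes "!!k. (\<Sum>n<k. (norm (ell2_nth x n))^2) <= C^2" "C >= 0"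
 shows "norm x <= C"
proof -
 have "(norm x)^2 <= C^2"
  using norm_ell2_sums[of x] assms(1) unfolding sums_def by (intro LIMSEQ_le_const2) auto
 thus ?thesis using assms(2) by (rule power2_le_imp_le)
qed

instance ell2 :: ("{real_inner, complete_space}") complete_space
proof
 fix X :: "nat => 'a ell2" assume X: "Cauchy X"
 have "Cauchy (%i. ell2_nth (X i) n)" for n
  using bounded_linear.Cauchy[OF bounded_linear_ell2_nth X] .
 then obtain y where y: "!!n. (%i. ell2_nth (X i) n) ----> y n"
  using choice[of "%n l. (%i. ell2_nth (X i) n) ----> l"] Cauchy_convergent[unfolded convergent_def] by blast
 have *: "\<exists>N. \<forall>i\<ge>N. \<forall>k. (\<Sum>n<k. (norm (ell2_nth (X i) n - y n))^2) <= e^2" if e: "e > 0" for e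
 proof -
  from metric_CauchyD[OF X e] obtain N where N: "!!i j. i >= N ==> j >= N ==> dist (X i) (X j) < e" by blast
  have "(\<Sum>n<k. (norm (ell2_nth (X i) n - y n))^2) <= e^2" if i: "i >= N" for i k
  proof (rule LIMSEQ_le_const2)
   show "(%j. \<Sum>n<k. (norm (ell2_nth (X i) n - ell2_nth (X j) n))^2) ----> (\<Sum>n<k. (norm (ell2_nth (X i) n - y n))^2)"
    by (intro tendsto_intros y)
   have "(\<Sum>n<k. (norm (ell2_nth (X i) n - ell2_nth (X j) n))^2) <= e^2" if "j >= N" for j
   proof -
    have "(\<Sum>n<k. (norm (ell2_nth (X i - X j) n))^2) <= (norm (X i - X j))^2" by (rule ell2_sum_le) simp
    also have "... <= e^2" using N[OF i that] by (intro power_mono) (auto simp: dist_norm)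
    finally show ?thesis by (simp add: minus_ell2.rep_eq)
   qed
   thus "\<exists>M. \<forall>j\<ge>M. (\<Sum>n<k. (norm (ell2_nth (X i) n - ell2_nth (X j) n))^2) <= e^2" by blast
  qed
  thus ?thesis by blast
 qed
 from *[of 1] obtain N where N: "!!k. (\<Sum>n<k. (norm (ell2_nth (X N) n - y n))^2) <= 1" by auto
 have "summable (%n. (norm (ell2_nth (X N) n - y n))^2)"
  by (rule summableI_nonneg_bounded) (use N in auto)
 hence "summable (%n. (norm (y n - ell2_nth (X N) n))^2)" by (simp add: norm_minus_commute)
 from summable_norm_sq_add[OF this summable_norm_ell2[of "X N"]]
 have sy: "summable (%n. (norm (y n))^2)" by simp
 define Y where "Y = Abs_ell2 y"
 have Y: "ell2_nth Y = y" using sy by (simp add: Y_def Abs_ell2_inverse)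
 have "X ----> Y"
 proof (rule metric_LIMSEQ_I)
  fix e :: real assume "e > 0"
  hence e2: "e/2 > 0" by simp
  from *[OF this] obtain N where N: "!!i k. i >= N ==> (\<Sum>n<k. (norm (ell2_nth (X i) n - y n))^2) <= (e/2)^2" by blast
  have "norm (X i - Y) <= e/2" if "i >= N" for i
   by (rule norm_ell2_leI) (use N[OF that] e2 in "auto simp: minus_ell2.rep_eq Y")
  thus "\<exists>N. \<forall>i\<ge>N. dist (X i) Y < e" using `e > 0` unfolding dist_norm
   by (intro exI[of _ N]) (smt (verit, best) field_sum_of_halves)
 qed
 thus "convergent X" by (auto simp: convergent_def)
qed

lift_definition ell2_single :: "nat => 'a::real_inner => 'a ell2" is "%j x n. if n = j then x else 0"
 by (rule summable_finite[of "{j}" for j]) auto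

text \<open>The diagonal action of an operator on sequences of vectors.\<close>

lift_definition amplify :: "('a::real_inner \<Rightarrow>\<^sub>L 'a) => 'a ell2 => 'a ell2" is "%A x n. blinfun_apply A (x n)"
proof -
 fix A :: "'a \<Rightarrow>\<^sub>L 'a" and x :: "nat => 'a"
 assume x: "summable (%n. (norm (x n))^2)"
 show "summable (%n. (norm (A (x n)))^2)"
 proof (rule summable_comparison_test')
  show "summable (%n. (norm A)^2*(norm (x n))^2)" by (intro summable_mult x)
  show "norm ((norm (A (x n)))^2) <= (norm A)^2*(norm (x n))^2" for n
   using power_mono[OF norm_blinfun[of A "x n"], of 2] by (simp add: power_mult_distrib)
 qed
qed

lemma bounded_linear_amplify: "bounded_linear (amplify A)"
proof (rule bounded_linear_intro[where K = "norm A"])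
 show "norm (amplify A x) <= norm x*norm A" for x
 proof (rule norm_ell2_leI)
  fix k
  have "(\<Sum>n<k. (norm (ell2_nth (amplify A x) n))^2) <= (\<Sum>n<k. (norm A)^2*(norm (ell2_nth x n))^2)"
   using power_mono[OF norm_blinfun[of A], of _ 2] by (intro sum_mono) (simp add: power_mult_distrib amplify.rep_eq)
  also have "... = (norm A)^2*(\<Sum>n<k. (norm (ell2_nth x n))^2)" by (simp add: sum_distrib_left)
  also have "... <= (norm A)^2*(norm x)^2"
by (intro mult_left_mono ell2_sum_le) simp_all
  finally show "(\<Sum>n<k. (norm (ell2_nth (amplify A x) n))^2) <= (norm x*norm A)^2"
   by (simp add: power_mult_distrib mult.commute)
 qed simp
qed (rule ell2_eqI, simp add: plus_ell2.rep_eq scaleR_ell2.rep_eq amplify.rep_eq blinfun.add_right blinfun.scaleR_right)+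

lemma inner_ell2_single: "inner x (ell2_single j y) = inner (ell2_nth x j) y"
 unfolding inner_ell2.rep_eq by (subst suminf_finite[of "{j}"]) (auto simp: ell2_single.rep_eq)

lemma bounded_linear_ell2_single: "bounded_linear (ell2_single j)"
proof (rule bounded_linear_intro[where K = 1])
 have "(norm (ell2_single j x))^2 = (norm x)^2" for x :: 'a
  unfolding power2_norm_eq_inner inner_ell2_single by (simp add: ell2_single.rep_eq)
 thus "norm (ell2_single j x) <= norm x*1" for x :: 'a by simp
qed (rule ell2_eqI, simp add: plus_ell2.rep_eq scaleR_ell2.rep_eq ell2_single.rep_eq)+

lemma inner_amplify:
 assumes "!!x y. inner (blinfun_apply A x) y = inner x (blinfun_apply B y)"
 shows "inner (amplify A x) y = inner x (amplify B y)"
 by (simp add: inner_ell2.rep_eq amplify.rep_eq assms)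

subsection \<open>The double commutant theorem for normal functionals\<close>

lemma closure_binary:
 assumes "continuous_on UNIV (%p. F (fst p) (snd p))" "!!a b. a : A ==> b : B ==> F a b : closure C"
  and "a : closure A" "b : closure B"
 shows "F a b : closure C"
proof -
 have "(%p. F (fst p) (snd p)) ` closure (A \<times> B) <= closure C"
  by (rule image_closure_subset) (use assms(1,2) in "auto intro: continuous_on_subset")
 thus ?thesis using assms(3,4) by (force simp: closure_Times)
qed

lemma closure_unary:
 assumes "continuous_on (closure A) F" "!!a. a : A ==> F a : closure C" "a : closure A"
 shows "F a : closure C"
 using image_closure_subset[of A F "closure C"] assms by auto

lemma subspace_closure:
 assumes S: "subspace (S :: 'a::real_normed_vector set)"
 shows "subspace (closure S)"
 unfolding subspace_def
proof (intro conjI ballI allI)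
 note cl = subsetD[OF closure_subset[of S]]
 show "0 : closure S" by (intro cl subspace_0[OF S])
 fix x assume x: "x : closure S"
 show "c *R x : closure S" for c
  by (rule closure_unary[OF _ _ x]) (auto intro!: continuous_intros cl subspace_scale[OF S])
 fix y assume y: "y : closure S"
 show "x + y : closure S"
  by (rule closure_binary[OF _ _ x y]) (auto intro!: continuous_intros cl subspace_add[OF S])
qed

lemma projection_operator:
 fixes K :: "'a::{real_inner, complete_space} set"
 assumes K: "subspace K" "closed K"
 obtains P where "bounded_linear P" "!!x. P x : K" "!!x s. s : K ==> inner (x - P x) s = 0"
  "!!x p. p : K ==> (!!s. s : K ==> inner (x - p) s = 0) ==> P x = p"
proof -
 obtain P where P: "!!x. P x : K" "!!x s. s : K ==> inner (x - P x) s = 0"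
  using closed_subspace_projection[OF K] by metis
 have uniq: "P x = p" if p: "p : K" and orth: "!!s. s : K ==> inner (x - p) s = 0" for x p
 proof -
  have d: "P x - p : K" using K P p by (simp add: subspace_diff)
  have "inner (P x - p) (P x - p) = inner (x - p) (P x - p) - inner (x - P x) (P x - p)"
   by (simp add: inner_diff_left)
  also have "... = 0" using P(2)[OF d] orth[OF d] by simp
  finally show ?thesis by simp
 qed
 have "bounded_linear P"
 proof (rule bounded_linear_intro[where K = 1])
  show "P (x + y) = P x + P y" for x y
  proof (rule uniq)
   show "P x + P y : K" using K P by (simp add: subspace_add)
   show "inner (x + y - (P x + P y)) s = 0" if "s : K" for s
    using P(2)[OF that, of x] P(2)[OF that, of y] by (simp add: inner_add_left inner_diff_left)
  qed
  show "P (r *R x) = r *R P x" for r x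
  proof (rule uniq)
   show "r *R P x : K" using K P by (simp add: subspace_scale)
   show "inner (r *R x - r *R P x) s = 0" if "s : K" for s
    using P(2)[OF that, of x] by (simp add: inner_diff_left)
  qed
  show "norm (P x) <= norm x*1" for x
  proof -
   have "inner (P x) (P x) = inner x (P x)" using P(2)[OF P(1), of x x] by (simp add: inner_diff_left)
   also have "... <= norm x*norm (P x)" by (rule norm_cauchy_schwarz)
   finally have "norm (P x)*norm (P x) <= norm x*norm (P x)"
    by (metis power2_norm_eq_inner power2_eq_square)
   thus ?thesis by (cases "P x = 0") auto
  qed
 qed
 from that[OF this P(1) P(2) uniq] show ?thesis by blast
qed

text \<open>Unital star-algebras of bounded operators, not necessarily closed.\<close>

definition op_algebra :: "('h::complex_hilbert) op set => bool" where
 "op_algebra M \<longleftrightarrow> M <= \<B> & id_blinfun : M \<and>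
   (\<forall>A\<in>M. \<forall>B\<in>M. A + B : M & A oL B : M) & (\<forall>A\<in>M. adj A : M & (\<forall>c. c *C A : M))"

lemma op_algebraD:
 assumes "op_algebra M"
 shows "A : M ==> A : \<B>" "id_blinfun : M" "A : M ==> B : M ==> A + B : M"
  "A : M ==> B : M ==> A oL B : M" "A : M ==> adj A : M" "A : M ==> c *C A : M"
 using assms by (auto simp: op_algebra_def)

text \<open>Double commutant theorem on the amplification: an operator in the bicommutant is approximated
 by the algebra simultaneously on a square-summable sequence of vectors.\<close>

lemma bicommutant_density:
 fixes M :: "('h::complex_hilbert) op set"
 assumes M: "op_algebra M" and A: "A : commutant (commutant M)"
 shows "amplify A Y : closure ((%B. amplify B Y) ` M)"
proof -
 note Md = op_algebraD[OF M]
 let ?O = "(%B. amplify B Y) ` M"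
 define K where "K = closure ?O"
 have lin: "amplify (A + B) X = amplify A X + amplify B X" "amplify (r *R A) X = r *R amplify A X"
   "amplify (A oL B) X = amplify A (amplify B X)" for A B :: "'h op" and X r
  by (rule ell2_eqI, simp add: plus_ell2.rep_eq scaleR_ell2.rep_eq amplify.rep_eq blinfun.add_left blinfun.scaleR_left)+
 have "subspace ?O"
  unfolding subspace_def
 proof (intro conjI ballI allI)
  have "0 *C id_blinfun : M" by (intro Md(6) Md(2))
  hence "0 : M" by simp
  moreover have "amplify 0 Y = 0" by (rule ell2_eqI) (simp add: amplify.rep_eq zero_ell2.rep_eq)
  ultimately show "0 : ?O" by simp
  fix x assume "x : ?O"
  then obtain B where B: "B : M" "x = amplify B Y" by blast
  have "of_real r *C B : M" for r :: real using Md(6) B(1) .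
  thus "r *R x : ?O" for r
   by (simp add: scaleC_of_real B(2) lin(2)[symmetric])
  fix y assume "y : ?O"
  thus "x + y : ?O" using B Md(3) by (auto simp: lin(1)[symmetric])
 qed
 hence K: "subspace K" "closed K" unfolding K_def by (auto intro: subspace_closure)
 obtain P where P: "bounded_linear P" "!!x. P x : K" "!!x s. s : K ==> inner (x - P x) s = 0"
  "!!x p. p : K ==> (!!s. s : K ==> inner (x - p) s = 0) ==> P x = p"
  using projection_operator[OF K] by blast
 have inv: "amplify B s : K" if B: "B : M" and s: "s : K" for B s
 proof -
  have "amplify B ` closure ?O <= closure ?O"
  proof (rule image_closure_subset)
   show "continuous_on (closure ?O) (amplify B)"
    by (rule linear_continuous_on[OF bounded_linear_amplify])
   show "amplify B ` ?O <= closure ?O"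
    using Md(4)[OF B] closure_subset by (fastforce simp: lin(3)[symmetric])
  qed simp
  thus ?thesis using s by (auto simp: K_def)
 qed
 have comm: "P (amplify B x) = amplify B (P x)" if B: "B : M" for B x
 proof (rule P(4))
  show "amplify B (P x) : K" using inv[OF B P(2)] .
  fix s assume s: "s : K"
  have adj: "inner (B x) y = inner x (adj B y)" for x y
   using cinner_adj_right[OF Md(1)[OF B], of x y] by (metis Re_cinner)
  have "amplify B x - amplify B (P x) = amplify B (x - P x)"
   by (simp add: linear_diff bounded_linear.linear[OF bounded_linear_amplify])
  hence "inner (amplify B x - amplify B (P x)) s = inner (x - P x) (amplify (adj B) s)"
   by (simp add: inner_amplify[OF adj])
  also have "... = 0" using P(3) inv[OF Md(5)[OF B] s] .
  finally show "inner (amplify B x - amplify B (P x)) s = 0" .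
 qed
 have amp_single: "amplify B (ell2_single j x) = ell2_single j (B x)" for B :: "'h op" and j x
  by (rule ell2_eqI) (simp add: amplify.rep_eq ell2_single.rep_eq)
 \<comment> \<open>The matrix entries of the projection onto \<open>K\<close> belong to the commutant of \<open>M\<close>.\<close>
 define Pij where "Pij i j = Blinfun (%x. ell2_nth (P (ell2_single j x)) i)" for i j
 have Pij: "Pij i j x = ell2_nth (P (ell2_single j x)) i" for i j x
  unfolding Pij_def
  by (rule fun_cong[OF bounded_linear_Blinfun_apply])
    (intro bounded_linear_compose[OF bounded_linear_ell2_nth] bounded_linear_compose[OF P(1)] bounded_linear_ell2_single)
 have commB: "Pij i j (B x) = B (Pij i j x)" if B: "B : M" for B i j x
  unfolding Pij by (simp add: amp_single[symmetric] comm[OF B] amplify.rep_eq)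
 have PM: "Pij i j : commutant M" for i j
 proof -
  have "Pij i j (c *C x) = c *C Pij i j x" for c x
  proof -
   have "c *C id_blinfun : M" by (intro Md(6) Md(2))
   from commB[OF this, of i j x] show ?thesis by (simp add: scaleC_app)
  qed
  thus ?thesis unfolding commutant_def \<B>_def
   by (auto intro!: blinfun_eqI simp: commB)
 qed
 have A_comm: "A (Pij i j x) = Pij i j (A x)" for i j x
 proof -
  have "Pij i j oL A = A oL Pij i j" using A PM[of i j] unfolding commutant_def by blast
  thus ?thesis by (metis oL_app)
 qed
 have P_self: "inner (P x) y = inner x (P y)" for x y
  using P(3)[OF P(2)[of y], of x] P(3)[OF P(2)[of x], of y] by (simp add: inner_diff_left inner_diff_right inner_commute)
 have adjA: "inner (A u) v = inner u (adj A v)" for u v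
  using cinner_adj_right[of A u v] A by (metis (no_types, lifting) Re_cinner commutant_def mem_Collect_eq)
 have Pself: "inner (Pij i j u) v = inner u (Pij j i v)" for i j u v
  using P_self[of "ell2_single j u" "ell2_single i v"] unfolding Pij inner_commute[of "ell2_single j u"] inner_commute[of u] inner_ell2_single .
 have all: "amplify A (P X) = P (amplify A X)" for X
 proof (rule ell2_eqI)
  fix i
  have "inner (ell2_nth (amplify A (P X)) i) v = inner (ell2_nth (P (amplify A X)) i) v" for v
  proof -
   have "inner (A x) (Pij j i v) = inner x (Pij j i (adj A v))" for x j
    by (metis Pself A_comm adjA)
   hence "inner (amplify A X) (P (ell2_single i v)) = inner X (P (ell2_single i (adj A v)))"
    by (simp add: inner_ell2.rep_eq amplify.rep_eq Pij[symmetric])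
   thus ?thesis by (simp add: P_self[symmetric] inner_ell2_single amplify.rep_eq adjA)
  qed
  thus "ell2_nth (amplify A (P X)) i = ell2_nth (P (amplify A X)) i" using vector_eq_rdot by blast
 qed
 have "amplify id_blinfun Y = Y" by (rule ell2_eqI) (simp add: amplify.rep_eq)
 hence "Y : K" unfolding K_def using Md(2) closure_subset by force
 hence "P Y = Y" by (intro P(4)) auto
 thus ?thesis using all[of Y] P(2) unfolding K_def by metis
qed

text \<open>The restriction of \<open>F\<close> to \<open>N\<close> is a normal functional.\<close>

definition normal_form :: "('h::complex_hilbert) op set => ('h op => complex) => bool" where
 "normal_form N F \<longleftrightarrow> (\<exists>x y. square_summable x & square_summable y & (\<forall>A\<in>N. F A = normal_functional x y A))"

lemma square_summable_op:
 fixes A :: "('h::complex_hilbert) op"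
 shows "square_summable y ==> square_summable (%n. blinfun_apply A (y n))"
 using summable_norm_ell2[of "amplify A (Abs_ell2 y)"]
 by (simp add: square_summable_def amplify.rep_eq Abs_ell2_inverse)

lemma normal_functional_summable_norm:
 fixes x y :: "nat => 'h::complex_hilbert"
 assumes "square_summable x" "square_summable y"
 shows "summable (%n. norm (x n)*norm (y n))"
 using summable_inner_sq[of x y] assms unfolding square_summable_def by simp

lemma normal_functional_summable:
 fixes x y :: "nat => 'h::complex_hilbert"
 assumes "square_summable x" "square_summable y"
 shows "summable (%n. cinner (x n) (blinfun_apply A (y n)))"
 by (rule summable_comparison_test'[OF normal_functional_summable_norm[OF assms(1) square_summable_op[OF assms(2), of A]]])
   (simp add: cinner_norm_le)

lemma normal_functional_sums:
 fixes x y :: "nat => 'h::complex_hilbert"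
 assumes "square_summable x" "square_summable y"
 shows "(%n. cinner (x n) (blinfun_apply A (y n))) sums normal_functional x y A"
 unfolding normal_functional_def using normal_functional_summable[OF assms] by (rule summable_sums)

text \<open>On the amplification a normal functional is \<open>A \<mapsto> \<langle>x, A y\<rangle>\<close>, so that density suffices.\<close>

lemma normal_form_zero_bicommutant:
 fixes M :: "('h::complex_hilbert) op set"
 assumes M: "op_algebra M" and F: "normal_form (commutant (commutant M)) F"
  and zero: "!!B. B : M ==> F B = 0" and A: "A : commutant (commutant M)"
 shows "F A = 0"
proof -
 have MN: "M <= commutant (commutant M)" using op_algebraD(1)[OF M] by (auto simp: commutant_def)
 obtain x y where xy: "square_summable x" "square_summable y"
  and Feq: "!!B. B : commutant (commutant M) ==> F B = normal_functional x y B"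
  using F unfolding normal_form_def by blast
 have re: "Re (normal_functional x y A) = 0" if x: "square_summable x" and z: "!!B. B : M ==> normal_functional x y B = 0" for x
 proof -
  have nf: "Re (normal_functional x y B) = inner (Abs_ell2 x) (amplify B (Abs_ell2 y))" for B
   using sums_unique[OF sums_Re[OF normal_functional_sums[OF x xy(2), of B]]] x xy(2)
   by (simp add: inner_ell2.rep_eq amplify.rep_eq Abs_ell2_inverse square_summable_def Re_cinner)
  have "closure ((%B. amplify B (Abs_ell2 y)) ` M) <= {Z. inner (Abs_ell2 x) Z = 0}"
   by (intro closure_minimal closed_Collect_eq continuous_intros) (auto simp: nf[symmetric] z)
  thus ?thesis using bicommutant_density[OF M A] unfolding nf by blast
 qed
 have z: "normal_functional x y B = 0" if "B : M" for B using zero[OF that] Feq that MN by auto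
 have i: "normal_functional (%n. \<i> *C x n) y B = - \<i>*normal_functional x y B" for B
  using sums_unique[OF sums_mult[OF normal_functional_sums[OF xy, of B], of "- \<i>"]] by (simp add: normal_functional_def cinner_scaleC_left)
 have "square_summable (%n. \<i> *C x n)" using xy(1) by (simp add: square_summable_def norm_scaleC)
 from re[OF this] re[OF xy(1) z] show ?thesis by (simp add: Feq[OF A] i z complex_eq_iff)
qed

subsection \<open>Calculus of normal functionals\<close>

lemma normal_form_cinner: "normal_form N (%A. cinner x (blinfun_apply A y))"
proof -
 let ?x = "%n::nat. if n = 0 then x else 0" and ?y = "%n::nat. if n = 0 then y else 0"
 have "square_summable ?x" "square_summable ?y"
  unfolding square_summable_def by (rule summable_finite[of "{0}"]; simp)+
 moreover have "normal_functional ?x ?y A = cinner x (blinfun_apply A y)" for A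
  unfolding normal_functional_def by (subst suminf_finite[of "{0}"]) auto
 ultimately show ?thesis unfolding normal_form_def by metis
qed

lemma sums_interleave:
 fixes f g :: "nat => 'a::real_normed_vector"
 assumes "f sums a" "g sums b"
 shows "(%n. if even n then f (n div 2) else g (n div 2)) sums (a + b)"
proof -
 have "(%n. if even n then f (n div 2) else 0) sums a"
  by (subst sums_mono_reindex[of "%n. 2*n", symmetric])
    (use assms in "auto simp: strict_mono_def elim!: evenE")
 moreover have "(%n. if even n then 0 else g (n div 2)) sums b"
  by (subst sums_mono_reindex[of "%n. 2*n + 1", symmetric])
    (use assms in "auto simp: strict_mono_def elim!: oddE")
 ultimately show ?thesis
  by (rule sums_cong[THEN iffD1, OF _ sums_add, rotated]) auto
qed

lemma normal_form_add:
 fixes N :: "('h::complex_hilbert) op set"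
 assumes "normal_form N F" "normal_form N G"
 shows "normal_form N (%A. F A + G A)"
proof -
 obtain x y where xy: "square_summable x" "square_summable y" "!!A. A : N ==> F A = normal_functional x y A"
  using assms(1) unfolding normal_form_def by blast
 obtain x' y' where xy': "square_summable x'" "square_summable y'" "!!A. A : N ==> G A = normal_functional x' y' A"
  using assms(2) unfolding normal_form_def by blast
 let ?i = "%u v (n::nat). if even n then u (n div 2) else v (n div 2)"
 have ss: "square_summable (?i u v)" if "square_summable u" "square_summable v" for u v :: "nat => 'h"
 proof -
  have "(%n. if even n then (norm (u (n div 2)))^2 else (norm (v (n div 2)))^2) sums
   ((\<Sum>n. (norm (u n))^2) + (\<Sum>n. (norm (v n))^2))"
   using that unfolding square_summable_def by (intro sums_interleave summable_sums)
  thus ?thesis unfolding square_summable_def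
   by (rule sums_summable[OF sums_cong[THEN iffD1, rotated]]) auto
 qed
 have "(%n. if even n then cinner (x (n div 2)) (A (y (n div 2))) else cinner (x' (n div 2)) (A (y' (n div 2)))) sums
   (normal_functional x y A + normal_functional x' y' A)" for A :: "'h op"
  using xy xy' by (intro sums_interleave normal_functional_sums)
 hence "(%n. cinner (?i x x' n) (A (?i y y' n))) sums (normal_functional x y A + normal_functional x' y' A)" for A :: "'h op"
  by (rule sums_cong[THEN iffD1, rotated]) auto
 hence "normal_functional (?i x x') (?i y y') A = normal_functional x y A + normal_functional x' y' A" for A
  unfolding normal_functional_def[of "?i x x'"] by (rule sums_unique[symmetric])
 thus ?thesis unfolding normal_form_def using ss xy xy'
  by (intro exI[of _ "?i x x'"] exI[of _ "?i y y'"]) auto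
qed

lemma normal_form_mult:
 fixes N :: "('h::complex_hilbert) op set"
 assumes "normal_form N F"
 shows "normal_form N (%A. c*F A)"
proof -
 obtain x y where xy: "square_summable x" "square_summable y" "!!A. A : N ==> F A = normal_functional x y A"
  using assms(1) unfolding normal_form_def by blast
 have "square_summable (%n. cnj c *C x n)"
  using xy(1) unfolding square_summable_def by (simp add: norm_scaleC power_mult_distrib)
 moreover have "normal_functional (%n. cnj c *C x n) y A = c*normal_functional x y A" for A
  unfolding normal_functional_def
  by (simp add: cinner_scaleC_left suminf_mult normal_functional_summable xy)
 ultimately show ?thesis unfolding normal_form_def using xy by metis
qed

lemma normal_form_diff:
 assumes "normal_form N F" "normal_form N G"
 shows "normal_form N (%A. F A - G A)"
 using normal_form_add[OF assms(1) normal_form_mult[OF assms(2), of "-1"]] by simp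

text \<open>A normal map is composed with normal functionals.\<close>

lemma normal_form_comp:
 assumes "normal_on N \<Theta>" "normal_form N' F" "!!A. A : N ==> \<Theta> A : N'"
 shows "normal_form N (%A. F (\<Theta> A))"
 using assms unfolding normal_on_def normal_form_def by metis

lemma normal_form_normal_on:
 assumes "normal_on N \<Theta>"
 shows "normal_form N (%A. cinner x (blinfun_apply (\<Theta> A) y))"
 by (rule normal_form_comp[OF assms normal_form_cinner[of UNIV]]) simp

section \<open>Operator algebras\<close>

instance cstar_algebra < banach ..

lemma norm_contraction_le: "norm (T :: ('h::complex_hilbert) op) <= 1 ==> norm (T y) <= norm y"
 using norm_blinfun[of T y] mult_right_mono[of "norm T" 1 "norm y"] by simp

lemma cinner_contraction_le:
 assumes "norm (T :: ('h::complex_hilbert) op) <= 1"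
 shows "cmod (cinner x (T y)) <= norm x*norm y"
 by (rule order_trans[OF cinner_norm_le]) (intro mult_left_mono norm_contraction_le assms norm_ge_zero)

subsection \<open>Contractivity of star-homomorphisms\<close>

text \<open>For \<open>\<parallel>X\<parallel> < 1\<close> the equation \<open>2 Y = X + Y\<^sup>2\<close>, i.e. \<open>(1 - Y)\<^sup>2 = 1 - X\<close>, is solved by Banach's fixed point
 theorem; the product is an argument.\<close>

lemma square_root_fixed_point:
 fixes mul :: "'a::banach => 'a => 'a"
 assumes mul: "bounded_bilinear mul" "!!a b. norm (mul a b) <= norm a*norm b" and S: "closed S" "0 : S" and X: "norm X < 1"
  and cl: "!!Y. Y : S ==> (1/2) *R (X + mul Y Y) : S"
 shows "\<exists>Y\<in>S. (1/2) *R (X + mul Y Y) = Y & (\<forall>Z\<in>S. norm Z = norm Y --> (1/2) *R (X + mul Z Z) = Z --> Z = Y)"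
proof -
 define r where "r = (1 + norm X)/2"
 have r: "0 <= r" "r < 1" "norm X = 2*r - 1" using X by (auto simp: r_def field_simps)
 let ?f = "%Y. (1/2) *R (X + mul Y Y)" and ?D = "S \<inter> cball 0 r"
 have "\<exists>!Y. Y : ?D & ?f Y = Y"
 proof (rule Banach_fix[OF _ _ r(1,2)])
  show "complete ?D" using S(1) by (simp add: complete_eq_closed closed_Int)
  show "?D ~= {}" using S(2) r(1) by auto
  show "?f ` ?D <= ?D"
  proof (rule image_subsetI)
   fix Y assume "Y : ?D"
   hence Y: "Y : S" "norm Y <= r" by auto
   have "norm (mul Y Y) <= 1*1" by (intro order_trans[OF mul(2)] mult_mono) (use Y r in auto)
   thus "?f Y : ?D" using cl[OF Y(1)] norm_triangle_ineq[of X "mul Y Y"] r(3) by simp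
  qed
  show "dist (?f Y) (?f Z) <= r*dist Y Z" if "Y : ?D" "Z : ?D" for Y Z
  proof -
   have "?f Y - ?f Z = (1/2) *R (mul Y (Y - Z) + mul (Y - Z) Z)"
    by (simp add: bounded_bilinear.diff_left[OF mul(1)] bounded_bilinear.diff_right[OF mul(1)] scaleR_diff_right[symmetric])
   also have "norm ... <= (1/2)*(r*norm (Y - Z) + norm (Y - Z)*r)"
    unfolding norm_scaleR using that by (intro mult_mono order_trans[OF norm_triangle_ineq] add_mono order_trans[OF mul(2)]) (auto simp: r(1))
   finally show ?thesis by (simp add: dist_norm)
  qed
 qed
 thus ?thesis by (metis IntD1 IntD2 IntI mem_cball_0)
qed

text \<open>With \<open>B = 1 - \<Theta> Y\<close> for the square root of \<open>1 - a\<^sup>*a\<close> one has \<open>\<parallel>x\<parallel>\<^sup>2 - \<parallel>\<Theta> a x\<parallel>\<^sup>2 = \<parallel>B x\<parallel>\<^sup>2\<close>. The lemma covers representations of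
 abstract algebras and automorphisms of algebras of operators.\<close>

lemma star_hom_contractive:
 fixes mul :: "'a::{complex_normed_vector, banach} => 'a => 'a" and \<Theta> :: "'a => ('h::complex_hilbert) op"
 assumes mul: "bounded_bilinear mul" "!!a b. norm (mul a b) <= norm a*norm b"
  and S: "closed S" "0 : S" "!!a b. a : S ==> b : S ==> a + b : S" "!!a b. a : S ==> b : S ==> mul a b : S"
   "!!a. a : S ==> st a : S" "!!a c. a : S ==> c *C a : S"
  and st: "!!a. a : S ==> norm (st a) = norm a" "!!a. a : S ==> st (st a) = a" "!!a b. a : S ==> b : S ==> st (a + b) = st a + st b"
   "!!a b. a : S ==> b : S ==> st (mul a b) = mul (st b) (st a)" "!!a c. a : S ==> st (c *C a) = cnj c *C st a"
  and \<Theta>: "!!a. a : S ==> \<Theta> a : \<B>" "!!a b. a : S ==> b : S ==> \<Theta> (a + b) = \<Theta> a + \<Theta> b"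
   "!!a b. a : S ==> b : S ==> \<Theta> (mul a b) = \<Theta> a oL \<Theta> b" "!!a. a : S ==> \<Theta> (st a) = adj (\<Theta> a)" "!!a c. a : S ==> \<Theta> (c *C a) = c *C \<Theta> a"
  and a: "a : S"
 shows "norm (\<Theta> a) <= norm a"
proof -
 have le: "norm (\<Theta> a x) <= norm x" if a: "a : S" "norm a < 1" for a x
 proof -
  have sR: "(1/2) *R b = (1/2) *C b" for b :: 'a using scaleC_of_real[of "1/2" b] by simp
  let ?X = "mul (st a) a"
  have X: "?X : S" by (intro S a)
  have "norm ?X <= norm a*norm a" using mul(2)[of "st a" a] st(1)[OF a(1)] by simp
  also have "... < 1" using mult_strict_mono[OF a(2) a(2)] by simp
  finally obtain Y where Y: "Y : S" "(1/2) *C (?X + mul Y Y) = Y"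
   "!!Z. Z : S ==> norm Z = norm Y ==> (1/2) *C (?X + mul Z Z) = Z ==> Z = Y"
   using square_root_fixed_point[OF mul S(1,2), of ?X] unfolding sR by (metis S(3,4,6) X)
  have YY: "mul Y Y : S" by (intro S Y)
  have "st ((1/2) *C (?X + mul Y Y)) = (1/2) *C (?X + mul (st Y) (st Y))"
   using st(2-5) S(3,4,5) a(1) Y(1) X YY by simp
  hence stY: "st Y = Y" using Y S(5) st(1) by metis
  define z where "z = x - \<Theta> Y x"
  have adjY: "adj (\<Theta> Y) = \<Theta> Y" using \<Theta>(4)[OF Y(1)] stY by simp
  have "2 *C \<Theta> ((1/2) *C (?X + mul Y Y)) = (adj (\<Theta> a) oL \<Theta> a) + (\<Theta> Y oL \<Theta> Y)"
   using \<Theta>(2-5) S(3-5) a(1) Y(1) X YY by (simp add: scaleC_scaleC)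
  hence "(2 *C \<Theta> Y) x = ((adj (\<Theta> a) oL \<Theta> a) + (\<Theta> Y oL \<Theta> Y)) x" unfolding Y(2) by (rule arg_cong)
  hence "2 *R \<Theta> Y x = adj (\<Theta> a) (\<Theta> a x) + \<Theta> Y (\<Theta> Y x)"
   using scaleC_of_real[of 2 "\<Theta> Y x"] by (simp add: scaleC_app blinfun.add_left)
  hence "x - adj (\<Theta> a) (\<Theta> a x) = z - \<Theta> Y z" by (simp add: z_def blinfun.diff_right algebra_simps scaleR_2)
  hence "cinner x (x - adj (\<Theta> a) (\<Theta> a x)) = cinner x z - cinner (\<Theta> Y x) z"
   by (simp add: cinner_diff_right cinner_adj_right[OF \<Theta>(1)[OF Y(1)], unfolded adjY])
  also have "... = cinner z z" unfolding cinner_diff_left[symmetric] z_def[symmetric] ..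
  finally have "cinner x x - cinner (\<Theta> a x) (\<Theta> a x) = cinner z z"
   by (simp add: cinner_diff_right cinner_adj_right[OF \<Theta>(1)[OF a(1)]])
  hence "(norm x)^2 - (norm (\<Theta> a x))\<^sup>2 = (norm z)^2" unfolding cinner_self by (metis of_real_diff of_real_eq_iff)
  hence "(norm (\<Theta> a x))^2 <= (norm x)^2" by (smt (verit) zero_le_power2)
  thus ?thesis by (rule power2_le_imp_le) simp
 qed
 show ?thesis
 proof (rule dense_ge)
  fix c assume c: "norm a < c"
  hence c0: "c > 0" by (metis norm_ge_zero le_less_trans)
  show "norm (\<Theta> a) <= c"
  proof (rule norm_blinfun_bound)
   fix x
   have "norm (of_real (1/c) *C a) < 1" using c c0 unfolding scaleC_of_real by simp
   from le[OF S(6)[OF a] this, of x] show "norm (\<Theta> a x) <= c*norm x"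
    using c0 by (simp add: \<Theta>(5)[OF a] scaleC_app norm_scaleC norm_divide pos_divide_le_eq mult.commute)
  qed (use c0 in simp)
 qed
qed

lemma star_automorphismD:
 assumes "star_automorphism S \<Theta>" "A : S"
 shows "\<Theta> A : S" "\<Theta> (adj A) = adj (\<Theta> A)" "\<Theta> (c *C A) = c *C \<Theta> A"
  "B : S ==> \<Theta> (A + B) = \<Theta> A + \<Theta> B" "B : S ==> \<Theta> (A oL B) = \<Theta> A oL \<Theta> B"
  "B : S ==> \<Theta> A = \<Theta> B ==> A = B"
 using assms unfolding star_automorphism_def bij_betw_def by (auto dest: inj_onD)

lemma star_automorphism_id:
 assumes "star_automorphism S \<Theta>" "op_algebra S"
 shows "\<Theta> id_blinfun = id_blinfun"
proof -
 note Sd = op_algebraD[OF assms(2)]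
 obtain E where E: "E : S" "\<Theta> E = id_blinfun"
  using assms(1) Sd(2) unfolding star_automorphism_def bij_betw_def by (metis imageE)
 have "\<Theta> (id_blinfun oL E) = \<Theta> id_blinfun oL \<Theta> E" by (rule star_automorphismD(5)[OF assms(1) Sd(2) E(1)])
 moreover have "id_blinfun oL E = E" by (rule blinfun_eqI) simp
 moreover have "\<Theta> id_blinfun oL id_blinfun = \<Theta> id_blinfun" by (rule blinfun_eqI) simp
 ultimately show ?thesis using E(2) by simp
qed

lemma star_automorphism_diff:
 assumes "star_automorphism S \<Theta>" "op_algebra S" "A : S" "B : S"
 shows "\<Theta> (A - B) = \<Theta> A - \<Theta> B"
proof -
 note Sd = op_algebraD[OF assms(2)]
 have "A - B = A + (-1) *C B" by (simp add: scaleC_minus_one)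
 thus ?thesis
  using star_automorphismD(4)[OF assms(1,3) Sd(6)[OF assms(4), of "-1"]] star_automorphismD(3)[OF assms(1,4), of "-1"]
  by (simp add: scaleC_minus_one)
qed

lemma star_automorphism_contractive:
 assumes \<Theta>: "star_automorphism S \<Theta>" and S: "op_algebra S" "closed S" and A: "A : S"
 shows "norm (\<Theta> A) <= norm A"
proof (rule star_hom_contractive[where mul = "(oL)" and st = adj and S = S and \<Theta> = \<Theta>])
 note Sd = op_algebraD[OF S(1)] and Td = star_automorphismD[OF \<Theta>]
 show "0 : S" using Sd(6)[OF Sd(2), of 0] by simp
qed (use op_algebraD[OF S(1)] S(2) A star_automorphismD[OF \<Theta>] in "auto simp: bounded_bilinear_blinfun_compose norm_blinfun_compose adj_add adj_compose adj_scaleC")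

lemma star_norm: "norm (star a) = norm (a::'w::cstar_algebra)"
proof -
 have le: "norm a <= norm (star a)" for a :: 'w
 proof (cases "a = 0")
  case False
  have "norm a*norm a = norm (star a*a)" by (simp add: cstar_identity power2_eq_square)
  also have "... <= norm (star a)*norm a" by (rule norm_mult_ineq)
  finally show ?thesis using False by simp
 qed simp
 show ?thesis using le[of a] le[of "star a"] by (simp add: star_star)
qed

lemma star_rep_contractive:
 fixes rep :: "'w::cstar_algebra => ('h::complex_hilbert) op"
 assumes rep: "range rep <= \<B>" "!!a b. rep (a + b) = rep a + rep b" "!!c a. rep (c *C a) = c *C rep a"
   "!!a b. rep (a*b) = rep a oL rep b" "!!a. rep (star a) = adj (rep a)"
 shows "norm (rep a) <= norm a"
 by (rule star_hom_contractive[where mul = times and st = star and S = UNIV and \<Theta> = rep])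
   (use rep in "auto simp: bounded_bilinear_mult norm_mult_ineq star_norm star_star star_add star_mult star_scaleC")

subsection \<open>Commutants and spans\<close>

lemma blinfun_compose_assoc': "(A oL B) oL C = A oL (B oL C)"
 by (rule blinfun_eqI) simp

lemma commutant_bounded: "commutant M <= \<B>"
 by (auto simp: commutant_def)

lemma op_algebra_commutant:
 assumes "M <= \<B>" "!!A. A : M ==> adj A : M"
 shows "op_algebra (commutant M)"
proof -
 have comp: "A oL (B oL C) = (B oL C) oL A" if "A oL B = B oL A" "A oL C = C oL A" for A B C :: "'a op"
  using that by (metis blinfun_compose_assoc')
 have adjc: "A oL adj B = adj B oL A" if A: "A : M" and B: "B : commutant M" for A B
 proof -
  have b: "A : \<B>" "B : \<B>" "adj A : \<B>" using A B assms by (auto simp: commutant_def)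
  have "adj A oL B = B oL adj A" using assms(2)[OF A] B by (auto simp: commutant_def)
  hence "adj (adj A oL B) = adj (B oL adj A)" by simp
  thus ?thesis using b by (simp add: adj_compose)
 qed
 show ?thesis
  unfolding op_algebra_def
 proof (intro conjI ballI allI)
  show "id_blinfun : commutant M" by (auto simp: commutant_def intro!: blinfun_eqI)
  fix A assume A: "A : commutant M"
  thus "c *C A : commutant M" for c using assms(1)
   by (auto simp: commutant_def scaleC_compose_left scaleC_compose_right)
  show "adj A : commutant M" using A adjc by (auto simp: commutant_def)
  fix B assume B: "B : commutant M"
  show "A + B : commutant M" using A B
   by (auto simp: commutant_def blinfun_compose_add_left blinfun_compose_add_right)
  show "A oL B : commutant M" using A B by (auto simp: commutant_def intro!: comp)
 qed (rule commutant_bounded)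
qed

lemma closed_commutant: "closed (commutant M)"
proof -
 have eq: "commutant M = \<B> \<inter> (\<Inter>A\<in>M. {B. A oL B = B oL A})"
  by (auto simp: commutant_def)
 have "closed {B. A oL B = B oL A}" for A :: "'a op"
  by (intro closed_Collect_eq bounded_linear.continuous_on[OF bounded_bilinear.bounded_linear_right[OF bounded_bilinear_blinfun_compose]]
    bounded_linear.continuous_on[OF bounded_bilinear.bounded_linear_left[OF bounded_bilinear_blinfun_compose]] continuous_on_id)
 thus ?thesis unfolding eq by (intro closed_Int closed_INT closed_\<B> ballI)
qed

lemma subset_bicommutant: "M <= \<B> ==> M <= commutant (commutant M)"
 by (auto simp: commutant_def)

lemma commutant_antimono: "M <= N ==> commutant N <= commutant M"
 by (auto simp: commutant_def)

lemma bicommutant_mono: "M <= N ==> commutant (commutant M) <= commutant (commutant N)"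
 by (intro commutant_antimono)

text \<open>Weak criterion for membership in the bicommutant.\<close>

lemma in_bicommutantI:
 assumes M: "M <= \<B>" "!!A. A : M ==> adj A : M" and A: "A : \<B>"
  and c: "!!B x y. B : commutant M ==> cinner x (A (B y)) = cinner (adj B x) (A y)"
 shows "A : commutant (commutant M)"
proof -
 have "B oL A = A oL B" if B: "B : commutant M" for B
 proof (intro blinfun_eqI cinner_extR)
  fix x y
  have Bb: "B : \<B>" using B by (simp add: commutant_def)
  show "cinner x ((B oL A) y) = cinner x ((A oL B) y)"
   using c[OF B, of x y] by (simp add: cinner_adj_left[OF Bb])
 qed
 thus ?thesis using A by (auto simp: commutant_def[of "commutant M"])
qed

text \<open>The complex linear span.\<close>

inductive_set cspan :: "'a::complex_normed_vector set => 'a set" for X where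
 cspan_zero: "0 : cspan X"
| cspan_step: "x : X ==> y : cspan X ==> c *C x + y : cspan X"

lemma cspan_base: "x : X ==> x : cspan X"
 using cspan_step[of x X 0 1] cspan_zero[of X] by simp

lemma cspan_add: "x : cspan X ==> y : cspan X ==> x + y : cspan X"
 by (induction rule: cspan.induct) (auto simp: add.assoc intro: cspan_step)

lemma cspan_scaleC: "x : cspan X ==> c *C x : cspan X"
 by (induction rule: cspan.induct) (auto simp: scaleC_add_right scaleC_scaleC intro: cspan_step cspan_zero)

lemma cspan_\<B>: "X <= \<B> ==> cspan X <= \<B>"
proof
 fix A assume X: "X <= \<B>" and "A : cspan X"
 from this(2) show "A : \<B>" by (induction rule: cspan.induct) (use X in auto)
qed

lemma op_algebra_cspan:
 assumes X: "X <= \<B>" "id_blinfun : X" "!!A. A : X ==> adj A : X"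
  and mul: "!!A B. A : X ==> B : X ==> A oL B : cspan X"
 shows "op_algebra (cspan X)"
proof -
 have 1: "A oL B : cspan X" if A: "A : X" and B: "B : cspan X" for A B
  using B
 proof (induction rule: cspan.induct)
  case cspan_zero
  have "A oL 0 = 0" by simp
  thus ?case by (simp add: cspan.cspan_zero)
 next
  case (cspan_step x y c)
  thus ?case using A X(1) mul[OF A]
   by (auto simp: blinfun_compose_add_right scaleC_compose_right subset_iff intro!: cspan_add cspan_scaleC)
 qed
 have 2: "A oL B : cspan X" if A: "A : cspan X" and B: "B : cspan X" for A B
  using A
 proof (induction rule: cspan.induct)
  case cspan_zero
  have "0 oL B = 0" by simp
  thus ?case by (simp add: cspan.cspan_zero)
 next
  case (cspan_step x y c)
  thus ?case using B 1
   by (auto simp: blinfun_compose_add_left scaleC_compose_left intro!: cspan_add cspan_scaleC)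
 qed
 have 3: "adj A : cspan X" if "A : cspan X" for A
  using that
 proof (induction rule: cspan.induct)
  case (cspan_step x y c)
  hence "x : \<B>" "y : \<B>" using X(1) cspan_\<B>[OF X(1)] by auto
  hence "adj (c *C x + y) = cnj c *C adj x + adj y" by (subst adj_add) (auto simp: adj_scaleC)
  thus ?case using cspan_step X(3) by (auto intro: cspan.cspan_step)
 qed (simp add: cspan.cspan_zero)
 show ?thesis unfolding op_algebra_def
  using 2 3 X(2) cspan_\<B>[OF X(1)] by (auto intro: cspan_base cspan_add cspan_scaleC)
qed

lemma commutant_cspan:
 assumes "X <= \<B>"
 shows "commutant (cspan X) = commutant X"
proof
 show "commutant (cspan X) <= commutant X" by (intro commutant_antimono) (auto intro: cspan_base)
 show "commutant X <= commutant (cspan X)"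
 proof
  fix B assume B: "B : commutant X"
  have "A oL B = B oL A" if "A : cspan X" for A
   using that
  proof (induction rule: cspan.induct)
   case cspan_zero show ?case by simp
  next
   case (cspan_step x y c)
   thus ?case using B
    by (auto simp: blinfun_compose_add_left blinfun_compose_add_right scaleC_compose_left commutant_def
      scaleC_compose_right)
  qed
  thus "B : commutant (cspan X)" using B by (auto simp: commutant_def)
 qed
qed

lemma normal_functional_add:
 fixes x y :: "nat => 'h::complex_hilbert"
 assumes "square_summable x" "square_summable y"
 shows "normal_functional x y (A + B) = normal_functional x y A + normal_functional x y B"
 unfolding normal_functional_def
 by (simp add: blinfun.add_left cinner_add_right suminf_add normal_functional_summable assms)

lemma normal_functional_scaleC:
 fixes x y :: "nat => 'h::complex_hilbert"
 assumes "square_summable x" "square_summable y"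
 shows "normal_functional x y (c *C A) = c*normal_functional x y A"
 unfolding normal_functional_def
 by (simp add: scaleC_app cinner_scaleC_right suminf_mult normal_functional_summable assms)

text \<open>Normal functionals on a von Neumann algebra are determined by their values on a set of
 generators whose span is a star-algebra.\<close>

lemma normal_form_eq_on_bicommutant:
 assumes X: "X <= \<B>" "id_blinfun : X" "!!A. A : X ==> adj A : X"
  "!!A B. A : X ==> B : X ==> A oL B : cspan X"
  and FG: "normal_form (commutant (commutant X)) F" "normal_form (commutant (commutant X)) G"
  and eq: "!!B. B : X ==> F B = G B" and A: "A : commutant (commutant X)"
 shows "F A = G A"
proof -
 let ?N = "commutant (commutant X)"
 have alg: "op_algebra (cspan X)" by (rule op_algebra_cspan[OF X])
 have N: "commutant (commutant (cspan X)) = ?N" by (simp add: commutant_cspan[OF X(1)])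
 have D: "normal_form ?N (%A. F A - G A)" by (rule normal_form_diff[OF FG])
 then obtain x y where xy: "square_summable x" "square_summable y" "!!A. A : ?N ==> F A - G A = normal_functional x y A"
  unfolding normal_form_def by blast
 have XN: "X <= ?N" by (rule subset_bicommutant[OF X(1)])
 have sub: "cspan X <= ?N" using subset_bicommutant[OF cspan_\<B>[OF X(1)]] by (simp add: N)
 have "normal_functional x y B = 0" if "B : cspan X" for B
  using that
 proof (induction rule: cspan.induct)
  case cspan_zero show ?case by (simp add: normal_functional_def)
 next
  case (cspan_step z w c)
  have "normal_functional x y z = 0" using xy(3)[of z] eq[OF cspan_step(1)] XN cspan_step(1) by auto
  thus ?case using cspan_step by (simp add: normal_functional_add normal_functional_scaleC xy)
 qed
 hence z: "F B - G B = 0" if "B : cspan X" for B using xy(3)[of B] that sub by auto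
 have "F A - G A = 0"
  by (rule normal_form_zero_bicommutant[OF alg, unfolded N, of "%A. F A - G A"]) (use D z A in auto)
 thus ?thesis by simp
qed

subsection \<open>Weak integrals of operators\<close>

definition wint :: "'m measure => ('m => complex) => ('m => ('h::complex_hilbert) op) => 'h op => bool" where
 "wint \<mu> k T A \<longleftrightarrow>
   (\<forall>x y. integrable \<mu> (%s. k s*cinner x (T s y)) & cinner x (A y) = (\<integral>s. k s*cinner x (T s y) \<partial>\<mu>))"

lemma wintD:
 assumes "wint \<mu> k T A"
 shows "integrable \<mu> (%s. k s*cinner x (T s y))" "cinner x (A y) = (\<integral>s. k s*cinner x (T s y) \<partial>\<mu>)"
 using assms by (auto simp: wint_def)

lemma integrable_mult_bounded:
 fixes k f :: "'m => complex"
 assumes "integrable \<mu> k" "f : borel_measurable \<mu>" "!!s. cmod (f s) <= C"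
 shows "integrable \<mu> (%s. k s*f s)"
proof (rule BI_bound)
 show "integrable \<mu> (%s. of_real C*k s)" using assms(1) by (rule integrable_mult_right)
 show "(%s. k s*f s) : borel_measurable \<mu>" using assms(1,2) by (intro borel_measurable_times) auto
 have "cmod (k s*f s) <= cmod (of_real C*k s)" for s
 proof -
  have "C >= 0" using assms(3)[of s] norm_ge_zero[of "f s"] by linarith
  thus ?thesis using mult_left_mono[OF assms(3)[of s] norm_ge_zero[of "k s"]] by (simp add: norm_mult mult.commute)
 qed
 thus "AE s in \<mu>. norm (k s*f s) <= norm (of_real C*k s)" by simp
qed

lemma wint_exists:
 fixes T :: "'m => ('h::complex_hilbert) op"
 assumes k: "integrable \<mu> k" and m: "!!x y. (%s. cinner x (T s y)) : borel_measurable \<mu>"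
  and T: "!!s. T s : \<B>" "!!s. norm (T s) <= 1"
 shows "\<exists>A\<in>\<B>. wint \<mu> k T A"
proof -
 have bd: "cmod (cinner x (T s y)) <= norm x*norm y" for x y s by (rule cinner_contraction_le[OF T(2)])
 have int: "integrable \<mu> (%s. k s*cinner x (T s y))" for x y
  by (rule integrable_mult_bounded[OF k m bd])
 define b where "b x y = (\<integral>s. k s*cinner x (T s y) \<partial>\<mu>)" for x y
 define C where "C = (\<integral>s. cmod (k s) \<partial>\<mu>)"
 have C0: "C >= 0" by (simp add: C_def)
 have bb: "cmod (b x y) <= norm x*norm y * C" for x y
 proof -
  have "cmod (b x y) <= (\<integral>s. cmod (k s*cinner x (T s y)) \<partial>\<mu>)" unfolding b_def by (rule integral_norm_bound)
  also have "... <= (\<integral>s. norm x*norm y*cmod (k s) \<partial>\<mu>)"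
   using k int bd by (intro integral_mono integrable_norm)
    (auto simp: norm_mult mult.commute[of _ "cmod (k _)"] intro: mult_left_mono)
  finally show ?thesis by (simp add: C_def)
 qed
 have addr: "b x (y + z) = b x y + b x z" for x y z
  unfolding b_def by (simp add: blinfun.add_right cinner_add_right distrib_left int)
 have scr: "b x (c *C y) = c*b x y" for x y c
  unfolding b_def by (simp add: \<B>_scaleC[OF T(1)] cinner_scaleC_right mult.left_commute)
 have addl: "b (x + z) y = b x y + b z y" for x y z
  unfolding b_def by (simp add: cinner_add_left distrib_left int)
 have scl: "b (c *C x) y = cnj c*b x y" for x y c
  unfolding b_def by (simp add: cinner_scaleC_left mult.left_commute)
 have "\<exists>z. \<forall>x. b x y = cinner x z" for y
 proof -
  have "bounded_linear (%x. Re (b x y))"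
  proof (rule bounded_linear_intro[where K = "norm y * C"])
   show "Re (b (x + z) y) = Re (b x y) + Re (b z y)" for x z by (simp add: addl)
   show "Re (b (r *R x) y) = r *R Re (b x y)" for r x using scl[of "of_real r" x y] by (simp add: scaleC_of_real)
   show "norm (Re (b x y)) <= norm x*(norm y * C)" for x
    using bb[of x y] abs_Re_le_cmod[of "b x y"] by simp
  qed
  from riesz_real[OF this] obtain z where z: "!!x. Re (b x y) = inner x z" by blast
  have re: "Re (b x y) = Re (cinner x z)" for x by (simp add: z Re_cinner)
  have "Im (b x y) = Im (cinner x z)" for x
   using re[of "\<i> *C x"] by (simp add: scl cinner_i_left)
  with re show ?thesis by (metis complex_eqI)
 qed
 then obtain A where A: "!!x y. b x y = cinner x (A y)" by metis
 have "bounded_linear A"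
 proof (rule bounded_linear_intro[where K = C])
  show "A (x + y) = A x + A y" for x y by (rule cinner_extR) (simp add: A[symmetric] addr cinner_add_right)
  show "A (r *R x) = r *R A x" for r x
   by (rule cinner_extR) (use scr[of _ "of_real r" x] in "simp add: A[symmetric] scaleC_of_real cinner_scaleR_right")
  show "norm (A y) <= norm y * C" for y
  proof (rule norm_le_if_cinner_le)
   fix x :: 'h assume "norm x <= 1"
   hence "norm x*(norm y * C) <= 1*(norm y * C)" using C0 by (intro mult_right_mono) auto
   thus "cmod (cinner x (A y)) <= norm y * C" using bb[of x y] by (simp add: A)
  qed (use C0 in simp)
 qed
 hence app: "blinfun_apply (Blinfun A) = A" by (rule bounded_linear_Blinfun_apply)
 have "A (c *C x) = c *C A x" for c x by (rule cinner_extR) (simp add: A[symmetric] scr cinner_scaleC_right)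
 hence "Blinfun A : \<B>" by (simp add: \<B>_def app)
 moreover have "wint \<mu> k T (Blinfun A)" unfolding wint_def using int A by (auto simp: app b_def)
 ultimately show ?thesis by blast
qed

lemma wint_in_bicommutant:
 assumes M: "M <= \<B>" "!!A. A : M ==> adj A : M" and A: "A : \<B>"
  and w: "wint \<mu> k T A" and T: "!!s. T s : commutant (commutant M)"
 shows "A : commutant (commutant M)"
proof (rule in_bicommutantI[OF M A])
 fix B x y assume B: "B : commutant M"
 hence Bb: "B : \<B>" by (simp add: commutant_def)
 have "cinner x (T s (B y)) = cinner (adj B x) (T s y)" for s
 proof -
  have "B oL T s = T s oL B" using T[of s] B by (auto simp: commutant_def[of "commutant M"])
  hence "T s (B y) = B (T s y)" by (metis oL_app)
  thus ?thesis by (simp add: cinner_adj_left[OF Bb])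
 qed
 thus "cinner x (A (B y)) = cinner (adj B x) (A y)" by (simp add: wintD(2)[OF w])
qed

lemma wint_adj:
 assumes A: "A : \<B>" and T: "!!s. T s : \<B>" and w: "wint \<mu> k T A"
 shows "wint \<mu> (%s. cnj (k s)) (%s. adj (T s)) (adj A)"
proof -
 have eq: "cnj (k s)*cinner x (adj (T s) y) = cnj (k s*cinner y (T s x))" for s x y
  using cinner_adj_right[OF T, of x s y] cinner_commute[of "T s x" y] by simp
 show ?thesis unfolding wint_def
 proof (intro allI conjI)
  fix x y
  show "integrable \<mu> (%s. cnj (k s)*cinner x (adj (T s) y))"
   unfolding eq by (simp only: complex_integrable_cnj wintD(1)[OF w])
  have "cinner x (adj A y) = cnj (cinner y (A x))"
   using cinner_adj_right[OF A, of x y] cinner_commute[of "A x" y] by simp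
  thus "cinner x (adj A y) = (\<integral>s. cnj (k s)*cinner x (adj (T s) y) \<partial>\<mu>)"
   unfolding eq by (simp only: wintD(2)[OF w] BI_cnj)
 qed
qed

text \<open>Normal functionals may be interchanged with weak integrals.\<close>

lemma wint_normal_form:
 assumes w: "wint \<mu> k T A" and k: "integrable \<mu> k" and T: "!!s. norm (T s) <= 1" "!!s. T s : N"
  and F: "normal_form N F" and A: "A : N"
 shows "integrable \<mu> (%s. k s*F (T s))" "F A = (\<integral>s. k s*F (T s) \<partial>\<mu>)"
proof -
 obtain x y where xy: "square_summable x" "square_summable y" "!!A. A : N ==> F A = normal_functional x y A"
  using F unfolding normal_form_def by blast
 let ?f = "%n s. k s*cinner (x n) (T s (y n))"
 have int: "integrable \<mu> (?f n)" for n using wintD(1)[OF w] .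
 have bd: "cmod (?f n s) <= cmod (k s)*(norm (x n)*norm (y n))" for n s
 proof -
  have "cmod (cinner (x n) (T s (y n))) <= norm (x n)*norm (y n)" by (rule cinner_contraction_le[OF T(1)])
  thus ?thesis by (simp add: norm_mult mult_left_mono)
 qed
 have sxy: "summable (%n. norm (x n)*norm (y n))" by (rule normal_functional_summable_norm[OF xy(1,2)])
 have s1: "AE s in \<mu>. summable (%n. norm (?f n s))"
  by (intro AE_I2 summable_comparison_test'[OF summable_mult[OF sxy]]) (use bd in auto)
 have s2: "summable (%n. \<integral>s. norm (?f n s) \<partial>\<mu>)"
 proof (rule summable_comparison_test')
  show "summable (%n. (\<integral>s. cmod (k s) \<partial>\<mu>)*(norm (x n)*norm (y n)))" by (rule summable_mult[OF sxy])
  fix n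
  have "(\<integral>s. norm (?f n s) \<partial>\<mu>) <= (\<integral>s. cmod (k s)*(norm (x n)*norm (y n)) \<partial>\<mu>)"
   using int k bd by (intro integral_mono) auto
  thus "norm (\<integral>s. norm (?f n s) \<partial>\<mu>) <= (\<integral>s. cmod (k s) \<partial>\<mu>)*(norm (x n)*norm (y n))" by simp
 qed
 have F: "k s*F (T s) = (\<Sum>n. ?f n s)" for s
  unfolding xy(3)[OF T(2)] normal_functional_def
  by (rule suminf_mult[symmetric]) (rule normal_functional_summable[OF xy(1,2)])
 show "integrable \<mu> (%s. k s*F (T s))" unfolding F by (rule integrable_suminf[OF int s1 s2])
 show "F A = (\<integral>s. k s*F (T s) \<partial>\<mu>)" unfolding F
  by (simp add: integral_suminf[OF int s1 s2] xy(3)[OF A] normal_functional_def wintD(2)[OF w])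
qed

text \<open>The image of a weak integral under a normal map.\<close>

lemma wint_normal_on:
 assumes "wint \<mu> k T A" "integrable \<mu> k" "!!s. norm (T s) <= 1" "!!s. T s : N"
  and \<Theta>: "normal_on N \<Theta>" and A: "A : N"
 shows "wint \<mu> k (%s. \<Theta> (T s)) (\<Theta> A)"
 unfolding wint_def
 using wint_normal_form[OF assms(1-4) normal_form_normal_on[OF \<Theta>] A] by blast

text \<open>Normal functionals are continuous along bounded weakly convergent sequences.\<close>

lemma normal_form_weak_limit:
 assumes F: "normal_form N F" and A: "A : N" "!!n. An n : N" and bd: "!!n. norm (An n) <= C"
  and lim: "!!x y. (%n. cinner x (An n y)) ----> cinner x (A y)"
 shows "(%n. F (An n)) ----> F A"
proof -
 obtain x y where xy: "square_summable x" "square_summable y" "!!A. A : N ==> F A = normal_functional x y A"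
  using F unfolding normal_form_def by blast
 have sxy: "summable (%n. C*(norm (x n)*norm (y n)))"
  by (intro summable_mult normal_functional_summable_norm[OF xy(1,2)])
 have bd': "cmod (cinner (x j) (An n (y j))) <= C*(norm (x j)*norm (y j))" for n j
 proof -
  have "cmod (cinner (x j) (An n (y j))) <= norm (x j)*(norm (An n)*norm (y j))"
   by (intro order_trans[OF cinner_norm_le] mult_left_mono norm_blinfun) simp
  also have "... <= norm (x j)*(C*norm (y j))" using bd by (intro mult_left_mono mult_right_mono) auto
  finally show ?thesis by (simp add: ac_simps)
 qed
 have "(%n. \<Sum>j. cinner (x j) (An n (y j))) ----> (\<Sum>j. cinner (x j) (A (y j)))"
  by (rule tannerys_theorem[THEN conjunct2, THEN conjunct2, OF lim _ sxy])
    (auto intro!: always_eventually bd')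
 thus ?thesis using xy A by (simp add: normal_functional_def)
qed

section \<open>Fourier analysis of test functions\<close>

subsection \<open>Auxiliary integrals\<close>

lemma dominated_convergence_at_within:
 fixes f :: "'a => 'b::{banach, second_countable_topology}" and s :: "'t::first_countable_topology => 'a => 'b"
 assumes f: "f : borel_measurable M" and s: "!!t. t : S ==> s t : borel_measurable M" and w: "integrable M w"
  and lim: "AE x in M. ((%t. s t x) ---> f x) (at a within S)"
  and bound: "!!t x. t : S ==> norm (s t x) <= w x"
 shows "((%t. integral\<^sup>L M (s t)) ---> integral\<^sup>L M f) (at a within S)"
 unfolding tendsto_at_iff_sequentially
proof (intro allI impI)
 fix X :: "nat => 't" assume X: "\<forall>i. X i : S - {a}" "X ----> a"
 have "(%i. integral\<^sup>L M (s (X i))) ----> integral\<^sup>L M f"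
 proof (rule integral_dominated_convergence[OF f _ w])
  show "s (X i) : borel_measurable M" for i using X s by auto
  show "AE x in M. (%i. s (X i) x) ----> f x"
   using lim X by (auto simp: tendsto_at_iff_sequentially comp_def)
  show "AE x in M. norm (s (X i) x) <= w x" for i using X bound by auto
 qed
 thus "((%t. integral\<^sup>L M (s t)) \<circ> X) ----> integral\<^sup>L M f" by (simp add: comp_def)
qed

lemma gauss_integral_std:
 fixes t :: real
 shows "integrable lborel (%u. exp (cor (- u\<^sup>2/2) + \<i> * of_real (t*u)))"
  "(LI u. exp (cor (- u\<^sup>2/2) + \<i> * of_real (t*u))) = of_real (sqrt (2*pi)*exp (- t\<^sup>2/2))"
proof -
 let ?f = "%u. exp (cor (- u\<^sup>2/2) + \<i> * of_real (t*u))"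
 have eq: "std_normal_density u *R iexp (t*u) = of_real (1/sqrt (2*pi))*?f u" for u
  by (simp only: exp_add exp_of_real) (simp add: normal_density_def scaleR_conv_of_real)
 have "integrable lborel (%u. std_normal_density u *R iexp (t*u))"
  by (rule BI_bound[OF integrable_normal_density[of 1 0]]) (auto simp: )
 hence i: "integrable lborel (%u. of_real (1/sqrt (2*pi))*?f u)" by (simp only: eq)
 from integrable_mult_right[OF i, of "of_real (sqrt (2*pi))"] show "integrable lborel ?f" by simp
 have "char std_normal_distribution t = (LI u. std_normal_density u *R iexp (t*u))"
  unfolding char_def by (subst integral_density) (auto simp: )
 also have "... = of_real (1/sqrt (2*pi))*integral\<^sup>L lborel ?f" unfolding eq by simp
 finally have "of_real (1/sqrt (2*pi))*integral\<^sup>L lborel ?f = of_real (exp (- t\<^sup>2/2))"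
  by (simp add: char_std_normal_distribution)
 hence "of_real (sqrt (2*pi))*(of_real (1/sqrt (2*pi))*integral\<^sup>L lborel ?f) = of_real (sqrt (2*pi)) * of_real (exp (- t\<^sup>2/2))"
  by simp
 thus "integral\<^sup>L lborel ?f = of_real (sqrt (2*pi)*exp (- t\<^sup>2/2))" by simp
qed

lemma gauss_integral:
 fixes q :: real and \<beta> :: complex
 assumes q: "q > 0"
 shows "integrable lborel (%s. exp (cor (- (q * s^2)/2) + \<beta> * of_real s))" (is ?I)
  "(LI s. exp (cor (- (q * s^2)/2) + \<beta> * of_real s)) = of_real (sqrt (2*pi/q))*exp (\<beta>^2/of_real (2*q))" (is ?E)
proof -
 let ?f = "%s. exp (cor (- (q * s^2)/2) + \<beta> * of_real s)"
 define a b where "a = Re \<beta>" and "b = Im \<beta>"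
 have beta: "\<beta> = of_real a + \<i> * of_real b" by (simp add: a_def b_def complex_eq_iff)
 define c where "c = 1/sqrt q"
 have c: "c > 0" "c*c*q = 1" "c ~= 0" using q by (simp_all add: c_def)
 let ?g = "%u. exp (cor (- u\<^sup>2/2) + \<i> * of_real (b*c*u))"
 have "cor (- (q*(a/q + c*u)^2)/2) + \<beta> * of_real (a/q + c*u)
   = of_real (a^2/(2*q)) + \<i> * of_real (a*b/q) + (cor (- u\<^sup>2/2) + \<i> * of_real (b*c*u))" for u
 proof -
  have "q*(a/q + c*u)^2 = a^2/q + 2*a*(c*u) + (c*c*q)*u^2"
   using q by (simp add: power2_eq_square field_simps)
  thus ?thesis using c unfolding beta
   by (simp add: complex_eq_iff power2_eq_square field_simps)
 qed
 hence eq: "?f (a/q + c*u) = exp (of_real (a^2/(2*q)) + \<i> * of_real (a*b/q))*?g u" for u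
  by (simp only: exp_add)
 have "integrable lborel (%u. ?f (a/q + c*u))" unfolding eq by (intro integrable_mult_right gauss_integral_std)
 thus ?I using lborel_integrable_real_affine_iff[of c ?f "a/q"] c by blast
 have "integral\<^sup>L lborel ?f = \<bar>c\<bar> *R (LI u. ?f (a/q + c*u))"
  by (rule lborel_integral_real_affine[OF c(3)])
 also have "... = of_real c*(exp (of_real (a^2/(2*q)) + \<i> * of_real (a*b/q)) * of_real (sqrt (2*pi)*exp (- (b*c)\<^sup>2/2)))"
  unfolding eq integral_mult_right_zero gauss_integral_std(2) using c by (simp add: scaleR_conv_of_real)
 also have "... = of_real (c * sqrt (2*pi))*exp (of_real (a^2/(2*q)) + \<i> * of_real (a*b/q) + of_real (- (b*c)\<^sup>2/2))"
  by (simp only: exp_add exp_of_real of_real_mult ac_simps)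
 also have "of_real (a^2/(2*q)) + \<i> * of_real (a*b/q) + cor (- (b*c)\<^sup>2/2) = \<beta>^2/of_real (2*q)"
 proof -
  have bc: "(b*c)^2 = b^2/q" using q by (simp add: c_def power_divide)
  have "\<beta>^2 = (cor a)^2 + 2*\<i> * of_real a * of_real b - (of_real b)\<^sup>2"
   by (simp add: beta power2_sum power_mult_distrib)
  thus ?thesis by (simp add: bc add_divide_distrib diff_divide_distrib)
 qed
 also have "c * sqrt (2*pi) = sqrt (2*pi/q)" by (simp add: c_def real_sqrt_divide)
 finally show ?E .
qed

subsection \<open>Test functions\<close>

definition vderiv :: "(real => complex) => real => complex" where
 "vderiv g = (%t. vector_derivative g (at t))"

text \<open>Smoothness and compact support in terms of a sequence of successive derivatives.\<close>

lemma tf_iff: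
 "f : \<D> \<longleftrightarrow>
   (\<exists>a b. \<forall>x. f x ~= 0 --> a <= x & x <= b) \<and>
   (\<exists>F. F 0 = f & (\<forall>n x. (F n has_vector_derivative F (Suc n) x) (at x)))"
proof -
 have 1: "compact (supp f) \<longleftrightarrow> (\<exists>a b. \<forall>x. f x ~= 0 --> a <= x & x <= b)"
 proof -
  have "compact (supp f) \<longleftrightarrow> bounded {x. f x ~= 0}"
   by (simp add: supp_def)
  also have "... \<longleftrightarrow> (\<exists>a b. \<forall>x. f x ~= 0 --> a <= x & x <= b)"
  proof
   assume "bounded {x. f x ~= 0}"
   then obtain B where "!!x. f x ~= 0 ==> \<bar>x\<bar> <= B" by (auto simp: bounded_iff)
   thus "\<exists>a b. \<forall>x. f x ~= 0 --> a <= x & x <= b" by (intro exI[of _ "-B"] exI[of _ B]) (auto simp: abs_le_iff minus_le_iff)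
  next
   assume "\<exists>a b. \<forall>x. f x ~= 0 --> a <= x & x <= b"
   then obtain a b where "!!x. f x ~= 0 ==> x : {a..b}" by force
   thus "bounded {x. f x ~= 0}" by (intro bounded_subset[OF bounded_closed_interval[of a b]]) auto
  qed
  finally show ?thesis .
 qed
 have 2: "(\<forall>n x. ((%g t. vector_derivative g (at t)) ^^ n) f differentiable (at x)) \<longleftrightarrow>
   (\<exists>F. F 0 = f & (\<forall>n x. (F n has_vector_derivative F (Suc n) x) (at x)))"
 proof
  assume d: "\<forall>n x. ((%g t. vector_derivative g (at t)) ^^ n) f differentiable (at x)"
  thus "\<exists>F. F 0 = f & (\<forall>n x. (F n has_vector_derivative F (Suc n) x) (at x))"
   by (intro exI[of _ "%n. ((%g t. vector_derivative g (at t)) ^^ n) f"])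
     (auto simp: vector_derivative_works[symmetric])
 next
  assume "\<exists>F. F 0 = f & (\<forall>n x. (F n has_vector_derivative F (Suc n) x) (at x))"
  then obtain F where F: "F 0 = f" "!!n x. (F n has_vector_derivative F (Suc n) x) (at x)" by blast
  have "((%g t. vector_derivative g (at t)) ^^ n) f = F n" for n
   by (induction n) (auto simp: F(1) vector_derivative_at[OF F(2)])
  thus "\<forall>n x. ((%g t. vector_derivative g (at t)) ^^ n) f differentiable (at x)"
   using F(2) by (auto intro: differentiableI_vector)
 qed
 show ?thesis unfolding tf_def using 1 2 by simp
qed

lemma tf_derivs:
 assumes "f : \<D>"
 obtains F where "F 0 = f" "!!n x. (F n has_vector_derivative F (Suc n) x) (at x)"
 using assms[unfolded tf_iff, THEN conjunct2] by (elim exE conjE) blast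

lemma tf_interval:
 assumes "f : \<D>"
 obtains a b where "!!x. f x ~= 0 ==> a <= x & x <= b" "a < b"
proof -
 obtain a b where "\<forall>x. f x ~= 0 --> a <= x & x <= b"
  using assms[unfolded tf_iff, THEN conjunct1] by (elim exE)
 thus ?thesis by (intro that[of a "max b (a + 1)"]) force+
qed

lemma \<D>I:
 assumes "!!x. f x ~= 0 ==> a <= x & x <= b" "F 0 = f"
  "!!n x. (F n has_vector_derivative F (Suc n) x) (at x)"
 shows "f : \<D>"
 unfolding tf_iff using assms(1)
 by (intro conjI exI[of _ a] exI[of _ b] exI[of _ F] allI assms(2,3)) simp_all

lemma tf_deriv:
 assumes f: "f : \<D>" and fab: "!!x. f x ~= 0 ==> a <= x & x <= b"
 obtains f' where "f' : \<D>" "!!x. (f has_vector_derivative f' x) (at x)"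
  "!!x. f' x ~= 0 ==> a <= x & x <= b"
proof -
 obtain F where F: "F 0 = f" "!!n x. (F n has_vector_derivative F (Suc n) x) (at x)"
  using tf_derivs[OF f] by metis
 have ab: "a <= x & x <= b" if "F 1 x ~= 0" for x
 proof (rule ccontr)
  assume n: "\<not> (a <= x & x <= b)"
  have "(f has_vector_derivative 0) (at x)"
  proof (rule has_vector_derivative_transform_within_open)
   show "((%_. 0) has_vector_derivative 0) (at x)" by simp
   show "open ({..<a} \<union> {b<..})" "x : {..<a} \<union> {b<..}" using n by auto
   show "0 = f y" if "y : {..<a} \<union> {b<..}" for y using fab[of y] that by force
  qed
  hence "F 1 x = 0" using F(2)[of 0 x] F(1) by (simp add: vector_derivative_unique_at)
  thus False using that by simp
 qed
 have "F 1 : \<D>"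
  by (rule \<D>I[of _ a b "%n. F (Suc n)"]) (use ab F in auto)
 thus ?thesis using that F(2)[of 0] F(1) ab by auto
qed

lemma tf_continuous: "f : \<D> ==> continuous_on UNIV f"
 by (metis continuous_on_vector_derivative tf_derivs)

lemma tf_zero [simp]: "(%_. 0) : \<D>"
 by (rule \<D>I[of _ 0 0 "%n x. 0"]) auto

lemma tf_linear:
 assumes f: "f : \<D>" and L: "bounded_linear L"
 shows "(%x. L (f x) :: complex) : \<D>"
proof -
 obtain a b where ab: "!!x. f x ~= 0 ==> a <= x & x <= b" and "a < b" using tf_interval[OF f] by metis
 obtain F where F: "F 0 = f" "!!n x. (F n has_vector_derivative F (Suc n) x) (at x)"
  using tf_derivs[OF f] by metis
 have L0: "f x ~= 0" if "L (f x) ~= 0" for x using that L by (auto simp: linear_simps)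
 show ?thesis
  by (rule \<D>I[of _ a b "%n x. L (F n x)"])
    (use ab F L0 bounded_linear.has_vector_derivative[OF L] in auto)
qed

lemma tf_add:
 assumes f: "f : \<D>" and g: "g : \<D>"
 shows "(%x. f x + g x) : \<D>"
proof -
 obtain a b where ab: "!!x. f x ~= 0 ==> a <= x & x <= b" and "a < b" using tf_interval[OF f] by metis
 obtain c d where cd: "!!x. g x ~= 0 ==> c <= x & x <= d" and "c < d" using tf_interval[OF g] by metis
 obtain F where F: "F 0 = f" "!!n x. (F n has_vector_derivative F (Suc n) x) (at x)"
  using tf_derivs[OF f] by metis
 obtain G where G: "G 0 = g" "!!n x. (G n has_vector_derivative G (Suc n) x) (at x)"
  using tf_derivs[OF g] by metis
 have "\<forall>x. f x + g x ~= 0 --> min a c <= x & x <= max b d"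
 proof (intro allI impI)
  fix x assume "f x + g x ~= 0"
  then consider "f x ~= 0" | "g x ~= 0" by force
  thus "min a c <= x & x <= max b d" by cases (use ab[of x] cd[of x] in auto)
 qed
 thus ?thesis
  by (intro \<D>I[of _ "min a c" "max b d" "%n x. F n x + G n x"])
    (use F G in "auto intro!: has_vector_derivative_add")
qed

lemma tf_cmult: "f : \<D> ==> (%x. c*f x) : \<D>"
 by (rule tf_linear[OF _ bounded_linear_mult_right])

lemma tf_uminus: "f : \<D> ==> (%x. - f x) : \<D>"
 using tf_cmult[of f "-1"] by simp

lemma tf_diff: "f : \<D> ==> g : \<D> ==> (%x. f x - g x) : \<D>"
 using tf_add[OF _ tf_uminus, of f g] by simp

lemma tf_Re: "f : \<D> ==> (%x. cor (Re (f x))) : \<D>"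
 by (rule tf_linear[OF _ bounded_linear_compose[OF bounded_linear_of_real bounded_linear_Re]])

lemma tf_Im: "f : \<D> ==> (%x. cor (Im (f x))) : \<D>"
 by (rule tf_linear[OF _ bounded_linear_compose[OF bounded_linear_of_real bounded_linear_Im]])

lemma tf_affine:
 assumes f: "f : \<D>" and c: "c ~= 0"
 shows "(%x. f (c*x + d)) : \<D>"
proof -
 obtain a b where ab: "!!x. f x ~= 0 ==> a <= x & x <= b" and "a < b" using tf_interval[OF f] by metis
 obtain F where F: "F 0 = f" "!!n x. (F n has_vector_derivative F (Suc n) x) (at x)"
  using tf_derivs[OF f] by metis
 have der: "((%x. c ^ n *R F n (c*x + d)) has_vector_derivative c ^ Suc n *R F (Suc n) (c*x + d)) (at x)" for n x
 proof -
  have "((%x. c*x + d) has_vector_derivative c) (at x)"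
   by (auto intro!: derivative_eq_intros)
  from vector_diff_chain_at[OF this F(2)[of n "c*x + d"]]
  have "((%x. F n (c*x + d)) has_vector_derivative c *R F (Suc n) (c*x + d)) (at x)" by (simp add: comp_def)
  from has_vector_derivative_scaleR[OF _ this, of "%_. c ^ n" 0] show ?thesis by (simp add: mult.commute)
 qed
 let ?A = "min ((a - d)/c) ((b - d)/c)" and ?B = "max ((a - d)/c) ((b - d)/c)"
 have "?A <= x & x <= ?B" if "f (c*x + d) ~= 0" for x
  using ab[OF that] c by (cases "c > 0") (auto simp: field_simps)
 thus ?thesis
  by (intro \<D>I[of _ ?A ?B "%n x. c ^ n *R F n (c*x + d)"])
    (use der F(1) in auto)
qed

lemma tf_dilation:
 assumes "f : \<D>" "l > 0"
 shows "dilation l f : \<D>"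
proof -
 have g: "(%x. f ((1/l)*x + 0)) : \<D>" using assms by (intro tf_affine) auto
 have "(%x. cor (1/l)*cor (Re (f ((1/l)*x + 0))) + \<i>*cor (Im (f ((1/l)*x + 0)))) : \<D>"
  by (intro tf_add tf_cmult tf_Re[OF g] tf_Im[OF g])
 moreover have "dilation l f = (%x. cor (1/l)*cor (Re (f ((1/l)*x + 0))) + \<i>*cor (Im (f ((1/l)*x + 0))))"
  by (auto simp: dilation_def)
 ultimately show ?thesis by simp
qed

lemma compact_support_integral:
 fixes f :: "real => complex"
 assumes "continuous_on UNIV f" "!!x. f x ~= 0 ==> a <= x & x <= b"
 shows "integrable lborel f" "integral\<^sup>L lborel f = integral {a..b} f"
  "integral\<^sup>L lborel f = (LI x. indicator {a..b} x *R f x)"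
proof -
 have eq: "f = (%x. indicator {a..b} x *R f x)" using assms(2) by (auto simp: fun_eq_iff indicator_def)
 have "integrable lborel (%x. indicator {a..b} x *R f x)"
  by (rule borel_integrable_compact) (auto intro: continuous_on_subset[OF assms(1)])
 thus "integrable lborel f" using eq by simp
 hence "(f has_integral integral\<^sup>L lborel f) UNIV" by (rule has_integral_integral_lborel)
 hence "(f has_integral integral\<^sup>L lborel f) {a..b}"
  by (subst has_integral_restrict_UNIV[symmetric]) (rule has_integral_eq_rhs[OF has_integral_cong[THEN iffD1]], use assms(2) in auto)
 thus "integral\<^sup>L lborel f = integral {a..b} f" by (simp add: integral_unique)
 show "integral\<^sup>L lborel f = (LI x. indicator {a..b} x *R f x)" using eq by simp
qed

lemma tf_integrable: "f : \<D> ==> integrable lborel f"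
 by (metis compact_support_integral(1) tf_continuous tf_interval)

lemma tf_bounded:
 assumes "f : \<D>"
 obtains B where "B > 0" "!!x. cmod (f x) <= B"
proof -
 obtain a b where ab: "!!x. f x ~= 0 ==> a <= x & x <= b" and "a < b" using tf_interval[OF assms] by metis
 have "compact (f ` {a..b})"
  by (intro compact_continuous_image continuous_on_subset[OF tf_continuous[OF assms]]) auto
 then obtain B where "!!x. x : {a..b} ==> cmod (f x) <= B" by (metis bounded_iff compact_imp_bounded imageI)
 hence "cmod (f x) <= max B 1" for x using ab[of x] by (cases "f x = 0") (force simp: max_def)+
 thus ?thesis by (intro that[of "max B 1"]) auto
qed

subsection \<open>The Fourier transform of a test function\<close>

definition laplace :: "(real => complex) => complex => complex" where
 "laplace f z = cor (1/sqrt (2*pi))*(LI x. exp (- (\<i>*z*cor x))*f x)"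

lemma fourier_laplace: "fourier f p = laplace f (cor p)"
 by (simp add: fourier_def laplace_def mult.assoc)

lemma laplace_integrable:
 assumes "f : \<D>"
 shows "integrable lborel (%x. exp (- (\<i>*z*cor x))*f x)"
proof -
 obtain a b where ab: "!!x. f x ~= 0 ==> a <= x & x <= b" and "a < b" using tf_interval[OF assms] by metis
 show ?thesis
  by (rule compact_support_integral(1)[of _ a b])
    (use ab tf_continuous[OF assms] in "auto intro!: continuous_intros")
qed

lemma laplace_holomorphic:
 assumes f: "f : \<D>"
 shows "laplace f holomorphic_on UNIV"
proof -
 obtain a b where ab: "!!x. f x ~= 0 ==> a <= x & x <= b" and "a < b" using tf_interval[OF f] by metis
 note c = continuous_on_subset[OF tf_continuous[OF f]]
 have eq: "laplace f z = cor (1/sqrt (2*pi))*integral (cbox a b) (%x. exp (- (\<i>*z*cor x))*f x)" for z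
  unfolding laplace_def
  by (subst compact_support_integral(2)[of _ a b])
    (use ab tf_continuous[OF f] in "auto intro!: continuous_intros")
 have "(%z. integral (cbox a b) (%x. exp (- (\<i>*z*cor x))*f x)) holomorphic_on UNIV"
 proof (rule leibniz_rule_holomorphic[where fx = "%z x. exp (- (\<i>*z*cor x))*(- (\<i>*cor x))*f x"])
  show "((%z. exp (- (\<i>*z*cor t))*f t) has_field_derivative
    exp (- (\<i>*z*cor t))*(- (\<i>*cor t))*f t) (at z within UNIV)" for z t
   by (auto intro!: derivative_eq_intros)
  show "(%x. exp (- (\<i>*z*cor x))*f x) integrable_on cbox a b" for z
   by (intro integrable_continuous continuous_intros c) auto
  have "continuous_on (UNIV \<times> cbox a b) (%w. f (snd w))"
   by (rule continuous_on_compose2[OF tf_continuous[OF f]]) (auto intro: continuous_intros)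
  thus "continuous_on (UNIV \<times> cbox a b) (%(z, x). exp (- (\<i>*z*cor x))*(- (\<i>*cor x))*f x)"
   unfolding case_prod_unfold by (intro continuous_intros)
 qed simp
 thus ?thesis unfolding eq by (intro holomorphic_intros)
qed

lemma laplace_deriv:
 assumes f: "f : \<D>" and f': "f' : \<D>" and d: "!!x. (f has_vector_derivative f' x) (at x)"
 shows "laplace f' z = \<i>*z*laplace f z"
proof -
 obtain a b where ab: "!!x. f x ~= 0 ==> a <= x & x <= b" "a < b" using tf_interval[OF f] by metis
 obtain a' b' where ab': "!!x. f' x ~= 0 ==> a' <= x & x <= b'" using tf_interval[OF f'] by metis
 define c where "c = min a a' - 1"
 define e where "e = max b b' + 1"
 let ?E = "%x. exp (- (\<i>*z*cor x))"
 let ?h = "%x. ?E x*f' x - \<i>*z*(?E x*f x)"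
 note cont = continuous_on_subset[OF tf_continuous[OF f]] continuous_on_subset[OF tf_continuous[OF f']]
 have supp: "c <= x & x <= e" if "?h x ~= 0" for x
  using that ab(1)[of x] ab'[of x] by (cases "f x = 0"; cases "f' x = 0") (auto simp: c_def e_def)
 have E: "(?E has_vector_derivative (- (\<i>*z))*?E x) (at x)" for x
 proof -
  have "((%w. exp (- (\<i>*z*w))) has_field_derivative (- (\<i>*z))*exp (- (\<i>*z*cor x))) (at (cor x))"
   by (auto intro!: derivative_eq_intros)
  from has_vector_derivative_real_field[OF this, of UNIV] show ?thesis by simp
 qed
 have der: "((%x. ?E x*f x) has_vector_derivative ?h x) (at x within {c..e})" for x
 proof (rule has_vector_derivative_at_within)
  show "((%x. ?E x*f x) has_vector_derivative ?h x) (at x)"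
   using has_vector_derivative_mult[OF E[of x] d[of x]] by (simp add: algebra_simps)
 qed
 have "(LI x. ?h x) = (LI x. indicator {c..e} x *R ?h x)"
  by (rule compact_support_integral(3)[of _ c e]) (use supp cont in "auto intro!: continuous_intros")
 also have "... = ?E e*f e - ?E c*f c"
 proof (rule integral_FTC_atLeastAtMost)
  show "c <= e" using ab(2) by (auto simp: c_def e_def)
  show "continuous_on {c..e} ?h" by (intro continuous_intros cont) auto
 qed (rule der)
 also have "... = 0"
 proof -
  have "f c = 0" using ab(1)[of c] by (cases "f c = 0") (auto simp: c_def)
  moreover have "f e = 0" using ab(1)[of e] by (cases "f e = 0") (auto simp: e_def)
  ultimately show ?thesis by simp
 qed
 finally have "(LI x. ?E x*f' x) - \<i>*z*(LI x. ?E x*f x) = 0"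
  using laplace_integrable[OF f, of z] laplace_integrable[OF f', of z] by simp
 thus ?thesis by (simp add: laplace_def)
qed

lemma fourier_bound:
 assumes "integrable lborel f"
 shows "cmod (fourier f p) <= 1/sqrt (2*pi)*(LI x. cmod (f x))"
proof -
 have "cmod (LI x. exp (- (\<i>*cor (p*x)))*f x) <= (LI x. cmod (exp (- (\<i>*cor (p*x)))*f x))"
  by simp
 thus ?thesis unfolding fourier_def
  by (simp add: norm_mult norm_divide divide_right_mono)
qed

lemma fourier_decay:
 assumes f: "f : \<D>"
 obtains C where "C > 0" "!!p. cmod (fourier f p) <= C/(1 + p^2)"
proof -
 obtain a b where ab: "!!x. f x ~= 0 ==> a <= x & x <= b" "a < b" using tf_interval[OF f] by metis
 obtain f' where f': "f' : \<D>" "!!x. (f has_vector_derivative f' x) (at x)" "!!x. f' x ~= 0 ==> a <= x & x <= b"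
  using tf_deriv[OF f ab(1)] by blast
 obtain f'' where f'': "f'' : \<D>" "!!x. (f' has_vector_derivative f'' x) (at x)"
  using tf_deriv[OF f'(1), of a b] f'(3) by metis
 define C0 where "C0 = 1/sqrt (2*pi)*(LI x. cmod (f x))"
 define C2 where "C2 = 1/sqrt (2*pi)*(LI x. cmod (f'' x))"
 have C: "C0 >= 0" "C2 >= 0" by (simp_all add: C0_def C2_def)
 have "cmod (fourier f p) <= (C0 + C2 + 1)/(1 + p^2)" for p
 proof -
  have "fourier f'' p = \<i>*p*(\<i>*p*fourier f p)"
   using laplace_deriv[OF f'(1) f''(1) f''(2), of p] laplace_deriv[OF f f'(1) f'(2), of p] by (simp add: fourier_laplace)
  hence "p^2*cmod (fourier f p) = cmod (fourier f'' p)" by (simp add: norm_mult power2_eq_square)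
  also have "... <= C2" using fourier_bound[OF tf_integrable[OF f''(1)]] by (simp add: C2_def)
  finally have "p^2*cmod (fourier f p) <= C2" .
  moreover have "cmod (fourier f p) <= C0" using fourier_bound[OF tf_integrable[OF f]] by (simp add: C0_def)
  ultimately have "(1 + p^2)*cmod (fourier f p) <= C0 + C2 + 1" by (simp add: algebra_simps)
  moreover have "1 + p^2 > 0" by (simp add: add_pos_nonneg)
  ultimately show ?thesis by (simp add: pos_le_divide_eq mult.commute)
 qed
 thus ?thesis using C by (intro that[of "C0 + C2 + 1"]) auto
qed

lemma continuous_on_fourier: "f : \<D> ==> continuous_on UNIV (fourier f)"
 unfolding fourier_laplace[abs_def]
 by (rule continuous_on_compose2[OF holomorphic_on_imp_continuous_on[OF laplace_holomorphic]])
   (auto)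

lemma integrable_inverse_square: "integrable lborel (%p::real. C/(1 + p^2))"
proof -
 have "integrable lborel (%p::real. inverse (1 + p^2))"
  using integrable_inverse_1_plus_square by (simp add: set_integrable_def)
 from integrable_mult_right[OF this, of C] show ?thesis by (simp add: divide_inverse)
qed

lemma measurable_fourier: "f : \<D> ==> fourier f : borel_measurable lborel"
 using borel_cont[OF continuous_on_fourier] by simp

lemma fourier_integrable:
 assumes f: "f : \<D>"
 shows "integrable lborel (fourier f)"
proof -
 obtain C where C: "C > 0" "!!p. cmod (fourier f p) <= C/(1 + p^2)" using fourier_decay[OF f] by blast
 show ?thesis
  by (rule BI_bound[OF integrable_inverse_square[of C] measurable_fourier[OF f]])
    (use C in auto)
qed

lemma integrable_product_lborel:
 fixes f g :: "real => complex" and h :: "real \<times> real => complex"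
 assumes "integrable lborel f" "integrable lborel g" "h : borel_measurable borel"
  and "!!x y. cmod (h (x, y)) <= C"
 shows "integrable (lborel \<Otimes>\<^sub>M lborel) (case_prod (%x y. f x*g y*h (x, y)))"
proof (rule BI_bound)
 have m[measurable]: "f : borel_measurable borel" "g : borel_measurable borel"
  using assms(1,2)[THEN borel_measurable_integrable] by simp_all
 have h[measurable]: "h : borel_measurable (borel \<Otimes>\<^sub>M borel)" using assms(3) by (simp add: borel_prod)
 show "integrable (lborel \<Otimes>\<^sub>M lborel) (%z. of_real C*case_prod (%x y. f x*g y) z)"
 proof (rule integrable_mult_right, rule lborel_pair.Fubini_integrable)
  show "case_prod (%x y. f x*g y) : borel_measurable (lborel \<Otimes>\<^sub>M lborel)" by simp
  have "integrable lborel (%x. cmod (f x)*(\<integral>y. cmod (g y) \<partial>lborel))"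
   using assms(1) by (intro integrable_mult_left integrable_norm)
  thus "integrable lborel (%x. \<integral>y. norm (case (x, y) of (x, y) => f x*g y) \<partial>lborel)"
   by (simp add: norm_mult)
  show "AE x in lborel. integrable lborel (%y. case (x, y) of (x, y) => f x*g y)"
   using assms(2) by (intro AE_I2) simp
 qed
 show "case_prod (%x y. f x*g y*h (x, y)) : borel_measurable (lborel \<Otimes>\<^sub>M lborel)"
  by simp
 show "AE z in lborel \<Otimes>\<^sub>M lborel. norm (case z of (x, y) => f x*g y*h (x, y)) <= norm (of_real C*case_prod (%x y. f x*g y) z)"
  using order_trans[OF assms(4) abs_ge_self] by (intro AE_I2) (auto simp: norm_mult mult.commute intro!: mult_right_mono)
qed

lemma fubini_lborel:
 fixes f g :: "real => complex" and h :: "real \<times> real => complex"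
 assumes "integrable lborel f" "integrable lborel g" "h : borel_measurable borel"
  and "!!x y. cmod (h (x, y)) <= C"
 shows "(LI x. f x*(LI y. g y*h (x, y))) = (LI y. g y*(LI x. f x*h (x, y)))"
proof -
 have "(LI y. LI x. f x*g y*h (x, y)) = (LI x. LI y. f x*g y*h (x, y))"
  by (rule lborel_pair.Fubini_integral[OF integrable_product_lborel[OF assms]])
 moreover have e: "f x*g y*h (x, y) = g y*(f x*h (x, y))" for x y by simp
 have "(LI y. LI x. f x*g y*h (x, y)) = (LI y. g y*(LI x. f x*h (x, y)))"
  by (simp only: e integral_mult_right_zero)
 moreover have "(LI x. LI y. f x*g y*h (x, y)) = (LI x. f x*(LI y. g y*h (x, y)))"
  by (simp add: mult.assoc)
 ultimately show ?thesis by simp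
qed

text \<open>Fourier inversion, by Gaussian regularization.\<close>

lemma fourier_inversion:
 assumes f: "f : \<D>"
 shows "f x = cor (1/sqrt (2*pi))*(LI p. exp (\<i>*cor (p*x))*fourier f p)"
proof -
 let ?c = "cor (1/sqrt (2*pi))" and ?at = "at 0 within {0::real<..}"
 let ?g = "%e p. exp (cor (- (e^2*p^2)/2))" and ?k = "%p. exp (\<i>*cor (p*x))*fourier f p"
 let ?G = "%u. cor (exp (- u\<^sup>2/2))" and ?E = "%p y. exp (\<i>*cor (p*(x - y)))"
 obtain B where B: "!!x. cmod (f x) <= B" using tf_bounded[OF f] by blast
 have fm[measurable]: "f : borel_measurable borel" using borel_cont[OF tf_continuous[OF f]] .
 have gauss_eq: "?G u = exp (cor (- u\<^sup>2/2) + \<i> * of_real (0*u))" for u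
  by (simp add: exp_of_real[symmetric])
 have gauss_int: "integrable lborel (%u. ?G u)"
  unfolding gauss_eq by (rule gauss_integral_std(1))
 have gauss_val: "(LI u. ?G u) = cor (sqrt (2*pi))"
  unfolding gauss_eq gauss_integral_std(2) by simp
 have eqn: "(LI p. ?g e p*(?k p))
   = (LI u. ?G u*f (x + e*u))" if e: "e > 0" for e
 proof -
  have g: "integrable lborel (%p. ?g e p)"
   using gauss_integral(1)[of "e^2" 0] e by simp
  have g2: "(LI p. ?g e p*?E p y)
    = of_real (sqrt (2*pi)/e)*cor (exp (- ((y - x)/e)\<^sup>2/2))" for y
  proof -
   have "(LI p. ?g e p*?E p y)
     = (LI p. exp (cor (- (e^2*p^2)/2) + (\<i> * of_real (x - y)) * of_real p))"
    by (simp only: mult_exp_exp) (simp add: algebra_simps)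
   also have "... = of_real (sqrt (2*pi/e^2))*exp ((\<i> * of_real (x - y))^2/of_real (2*e^2))"
    using e by (intro gauss_integral(2)) simp
   also have "(\<i> * of_real (x - y))^2/of_real (2*e^2) = cor (- ((y - x)/e)\<^sup>2/2)"
    by (simp add: power_mult_distrib power_divide power2_commute[of "of_real x"])
   finally show ?thesis using e by (simp only: exp_of_real) (simp add: real_sqrt_divide)
  qed
  have "(LI p. ?g e p*(?k p))
    = ?c*(LI p. ?g e p*(LI y. f y*?E p y))"
  proof -
   have "?k p = ?c*(LI y. f y*?E p y)" for p
   proof -
    have "exp (\<i>*cor (p*x))*(LI y. exp (- (\<i>*cor (p*y)))*f y)
     = (LI y. exp (\<i>*cor (p*x))*(exp (- (\<i>*cor (p*y)))*f y))" by simp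
    also have "... = (LI y. f y*?E p y)"
     by (intro BI_cong refl) (simp add: exp_diff exp_minus field_simps)
    finally show ?thesis by (simp add: fourier_def)
   qed
   thus ?thesis by simp
  qed
  also have "(LI p. ?g e p*(LI y. f y*?E p y))
    = (LI y. f y*(LI p. ?g e p*?E p y))"
   using fubini_lborel[OF g tf_integrable[OF f], of "%(p, y). ?E p y" 1]
   by (simp add: borel_cont continuous_intros case_prod_unfold)
  also have "... = of_real (sqrt (2*pi))*(of_real (1/e)*(LI y. f y*cor (exp (- ((y - x)/e)\<^sup>2/2))))"
   unfolding g2 by (simp add: mult.left_commute[of "f _"])
  also have "(LI y. f y*cor (exp (- ((y - x)/e)\<^sup>2/2)))
    = \<bar>e\<bar> *R (LI u. f (x + e*u)*cor (exp (- ((x + e*u - x)/e)\<^sup>2/2)))"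
   using e by (intro lborel_integral_real_affine) simp
  finally show ?thesis using e by (simp add: scaleR_conv_of_real mult.commute)
 qed
 let ?L = "%e. (LI p. ?g e p*(?k p))"
 have "(?L ---> (LI p. ?k p)) ?at"
 proof (rule dominated_convergence_at_within)
  note mf = measurable_fourier[OF f]
  show "(%p. ?k p) : borel_measurable lborel"
   using mf by measurable
  show "(%p. ?g e p*(?k p)) : borel_measurable lborel" for e
   using mf by measurable
  show "integrable lborel (%p. cmod (fourier f p))" using fourier_integrable[OF f] by (rule integrable_norm)
  have "((%e. ?g e p*(?k p)) --->
    exp (cor (- (0^2*p^2)/2))*(?k p)) ?at" for p
   by (intro tendsto_intros) auto
  thus "AE p in lborel. ((%e. ?g e p*(?k p)) --->
    ?k p) ?at" by simp
  show "norm (?g e p*(?k p)) <= cmod (fourier f p)" for e p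
   by (simp add: norm_mult mult_left_le_one_le)
 qed
 moreover have "(?L ---> of_real (sqrt (2*pi))*f x) ?at"
 proof (rule Lim_transform_eventually)
  have "((%e. LI u. ?G u*f (x + e*u)) --->
    (LI u. ?G u*f x)) ?at"
  proof (rule dominated_convergence_at_within)
   show "integrable lborel (%u. cmod (?G u)*B)"
    using gauss_int by (intro integrable_mult_left integrable_norm)
   have c: "isCont f y" for y using tf_continuous[OF f] by (simp add: continuous_on_eq_continuous_at)
   have "((%e. f (x + e*u)) ---> f (x + 0*u)) ?at" for u
    by (rule isCont_tendsto_compose[OF c]) (intro tendsto_intros)
   thus "AE u in lborel. ((%e. ?G u*f (x + e*u)) ---> ?G u*f x) ?at"
    by simp
  qed (use B in "auto simp: norm_mult intro!: mult_left_mono")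
  thus "((%e. LI u. ?G u*f (x + e*u)) ---> of_real (sqrt (2*pi))*f x) ?at"
   using gauss_val by simp
  show "\<forall>\<^sub>F e in ?at. (LI u. ?G u*f (x + e*u)) = ?L e"
   using eqn by (auto simp: eventually_at intro!: exI[of _ 1])
 qed
 ultimately have "(LI p. ?k p) = of_real (sqrt (2*pi))*f x"
  by (rule tendsto_unique[rotated]) simp
 thus ?thesis by simp
qed

lemma fourier_eq_zero_imp:
 assumes "f : \<D>" "!!p. fourier f p = 0"
 shows "f = (%_. 0)"
 using fourier_inversion[OF assms(1)] assms(2) by auto

lemma plancherel:
 assumes f: "f : \<D>" and g: "g : \<D>"
 shows "(LI x. cnj (f x)*g x) = (LI p. cnj (fourier f p)*fourier g p)"
proof -
 let ?c = "cor (1/sqrt (2*pi))"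
 have cf: "integrable lborel (%x. cnj (f x))" using tf_integrable[OF f] by simp
 have "(LI x. cnj (f x)*g x) = (LI x. ?c*(cnj (f x)*(LI p. fourier g p*exp (\<i>*cor (p*x)))))"
  by (subst fourier_inversion[OF g]) (simp add: mult.commute)
 also have "... = ?c*(LI x. (cnj (f x)*(LI p. fourier g p*exp (\<i>*cor (p*x)))))"
  by simp
 also have "(LI x. (cnj (f x)*(LI p. fourier g p*exp (\<i>*cor (p*x)))))
  = (LI p. fourier g p*(LI x. cnj (f x)*exp (\<i>*cor (p*x))))"
  using fubini_lborel[OF cf fourier_integrable[OF g], of "%(x, p). exp (\<i>*cor (p*x))" 1]
  by (simp add: borel_cont continuous_intros case_prod_unfold)
 also have "?c*... = (LI p. fourier g p*(?c*(LI x. cnj (f x)*exp (\<i>*cor (p*x)))))"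
  by simp
 finally have eq: "(LI x. cnj (f x)*g x) = (LI p. fourier g p*(?c*(LI x. cnj (f x)*exp (\<i>*cor (p*x)))))" .
 have "?c*(LI x. cnj (f x)*exp (\<i>*cor (p*x))) = cnj (fourier f p)" for p
 proof -
  have "cnj (LI x. exp (- (\<i>*cor (p*x)))*f x) = (LI x. cnj (exp (- (\<i>*cor (p*x)))*f x))"
   by (rule BI_cnj[symmetric])
  also have "... = (LI x. cnj (f x)*exp (\<i>*cor (p*x)))"
   by (simp add: exp_cnj mult.commute)
  finally show ?thesis by (simp add: fourier_def)
 qed
 thus ?thesis unfolding eq by (simp only: mult.commute)
qed

subsection \<open>Supports from the growth of the Laplace transform\<close>

text \<open>Moments which grow geometrically: the exponential series may be integrated termwise.\<close>

lemma exp_moment_bound: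
 fixes u :: "real => real" and h :: "real => complex"
 assumes h: "integrable lborel h" and u: "u : borel_measurable borel" "!!x. 0 <= u x" "!!x. h x ~= 0 ==> u x <= U"
  and q: "!!k. cmod (LI x. of_real (u x ^ Suc k)*h x) <= D*q ^ Suc k"
 shows "cmod (LI x. of_real (1 - exp (- u x))*h x) <= D*(exp q - 1)"
proof -
 let ?c = "%k. inverse (fact (Suc k)) :: real" and ?g = "%k x. of_real ((- 1) ^ Suc k*inverse (fact (Suc k)))*(of_real (u x ^ Suc k)*h x)"
 have sums: "(%k. y ^ Suc k*?c k) sums (exp y - 1)" for y :: real
  using exp_converges[of y] by (subst sums_Suc_iff) (simp add: mult.commute)
 have cg: "cmod (?g k x) = u x ^ Suc k*?c k*cmod (h x)" for k x
  using u(2)[of x] by (simp only: norm_mult norm_of_real abs_mult power_abs) simp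
 have gb: "cmod (?g k x) <= U ^ Suc k*?c k*cmod (h x)" for k x
  unfolding cg using u(2)[of x] u(3)[of x] by (cases "h x = 0") (auto intro!: mult_right_mono power_mono simp del: power_Suc)
 have gi: "integrable lborel (?g k)" for k
 proof (rule BI_bound[OF integrable_mult_right[OF integrable_norm[OF h], of "U ^ Suc k*?c k"]])
  show "?g k : borel_measurable lborel" using u(1) borel_measurable_integrable[OF h] by simp
  show "AE x in lborel. norm (?g k x) <= norm (U ^ Suc k*?c k*cmod (h x))"
   unfolding real_norm_def by (intro AE_I2 order_trans[OF gb abs_ge_self])
 qed
 have sg: "(%k. ?g k x) sums (of_real (exp (- u x) - 1)*h x)" for x
  using sums_mult2[OF sums_of_real[OF sums[of "- u x"]], of "h x"] by (simp only: power_minus[of "u x"] of_real_mult mult_ac)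
 have S: "summable (%k. U ^ Suc k*?c k*y)" for y by (rule summable_mult2[OF sums_summable[OF sums]])
 have "(LI x. of_real (1 - exp (- u x))*h x) = - (LI x. (\<Sum>k. ?g k x))"
  unfolding sums_unique[OF sg, symmetric] Bochner_Integration.integral_minus[symmetric] by (simp add: algebra_simps)
 also have "(LI x. (\<Sum>k. ?g k x)) = (\<Sum>k. LI x. ?g k x)"
 proof (rule integral_suminf[OF gi])
  show "AE x in lborel. summable (%k. norm (?g k x))"
   by (rule AE_I2, rule summable_comparison_test'[OF S]) (simp only: real_norm_def abs_norm_cancel, rule gb)
  show "summable (%k. LI x. norm (?g k x))"
  proof (rule summable_comparison_test'[OF S[of "LI x. cmod (h x)"]])
   fix k
   have "(LI x. norm (?g k x)) <= (LI x. U ^ Suc k*?c k*cmod (h x))"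
    by (intro integral_mono integrable_norm integrable_mult_right gi h gb)
   thus "norm (LI x. norm (?g k x)) <= U ^ Suc k*?c k*(LI x. cmod (h x))" by (simp del: power_Suc)
  qed
 qed
 finally have "cmod (LI x. of_real (1 - exp (- u x))*h x) = cmod (\<Sum>k. LI x. ?g k x)" by (simp only: norm_minus_cancel)
 also have "... <= (\<Sum>k. D*(q ^ Suc k*?c k))"
 proof (rule norm_suminf_le)
  fix k
  have "cmod (LI x. ?g k x) = ?c k*cmod (LI x. of_real (u x ^ Suc k)*h x)"
   by (simp only: integral_mult_right_zero norm_mult norm_of_real abs_mult power_abs) simp
  also have "... <= ?c k*(D*q ^ Suc k)" by (rule mult_left_mono[OF q]) simp
  finally show "cmod (LI x. ?g k x) <= D*(q ^ Suc k*?c k)" by (simp only: mult_ac)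
 qed (rule summable_mult[OF sums_summable[OF sums]])
 also have "... = D*(exp q - 1)" using sums_mult[OF sums[of q], of D] by (simp only: sums_iff)
 finally show ?thesis .
qed

text \<open>If the two-sided Laplace transform of \<open>h\<close> grows at most like \<open>exp (M \<eta>)\<close>, then the integral of \<open>h\<close> over \<open>x > t\<close>
 vanishes for `t > M`: it is the limit of the integrals of `h(x) (1 - exp (- exp (\<eta> (x - t))))`.\<close>

lemma laplace_growth_tail:
 assumes h: "h : \<D>" and bound: "!!\<eta>. \<eta> >= \<eta>0 ==> cmod (laplace h (\<i> * of_real \<eta>)) <= C*exp (M*\<eta>)" and t: "t > M"
 shows "(LI x. indicator {t..} x *R h x) = 0"
proof -
 obtain a b where ab: "!!x. h x ~= 0 ==> a <= x & x <= b" using tf_interval[OF h] by metis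
 have hi: "integrable lborel h" by (rule tf_integrable[OF h])
 have hm[measurable]: "h : borel_measurable borel" using borel_cont[OF tf_continuous[OF h]] .
 let ?D = "sqrt (2*pi) * C" and ?q = "%\<eta>. exp (- (\<eta>*(t - M)))"
 let ?f = "%\<eta> x. cor (1 - exp (- exp (\<eta>*(x - t))))*h x"
 have Sb: "cmod (LI x. ?f \<eta> x) <= ?D*(exp (?q \<eta>) - 1)" if eta: "\<eta> >= max \<eta>0 1" for \<eta>
 proof (rule exp_moment_bound[OF hi])
  show "exp (\<eta>*(x - t)) <= exp (\<eta>*(b - t))" if "h x ~= 0" for x using ab[OF that] eta by (simp add: mult_left_mono)
  fix k
  let ?k = "real (Suc k)*\<eta>"
  have "1*\<eta> <= ?k" using eta by (intro mult_right_mono) auto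
  hence k: "\<eta>0 <= ?k" using eta by linarith
  have pe: "exp y ^ Suc k = exp (real (Suc k)*y)" for y :: real by (rule exp_of_nat_mult[symmetric])
  have "cor (exp (\<eta>*(x - t)) ^ Suc k)*h x = of_real (exp (- (?k*t)))*(exp (- (\<i>*(\<i> * of_real ?k) * of_real x))*h x)" for x
  proof -
   have "cor (exp (\<eta>*(x - t)) ^ Suc k) = exp (of_real (- (?k*t)))*exp (- (\<i>*(\<i> * of_real ?k) * of_real x))"
    unfolding pe exp_of_real[symmetric] exp_add[symmetric] by (simp add: algebra_simps)
   thus ?thesis by (simp only: exp_of_real mult.assoc)
  qed
  hence "cmod (LI x. cor (exp (\<eta>*(x - t)) ^ Suc k)*h x) = exp (- (?k*t))*(sqrt (2*pi)*cmod (laplace h (\<i> * of_real ?k)))"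
   by (simp only: integral_mult_right_zero norm_mult norm_of_real abs_exp_cancel laplace_def) simp
  also have "... <= exp (- (?k*t))*(sqrt (2*pi)*(C*exp (M*?k)))" by (intro mult_left_mono bound k) auto
  also have "... = ?D*?q \<eta> ^ Suc k" unfolding pe by (simp add: exp_add[symmetric] algebra_simps)
  finally show "cmod (LI x. of_real (exp (\<eta>*(x - t)) ^ Suc k)*h x) <= ?D*?q \<eta> ^ Suc k" .
 qed auto
 have "((%\<eta>. ?D*(exp (?q \<eta>) - 1)) ---> ?D*(exp 0 - 1)) at_top"
  using t by (intro tendsto_intros) real_asymp
 hence "((%\<eta>. ?D*(exp (?q \<eta>) - 1)) ---> 0) at_top" by simp
 hence "((%\<eta>. LI x. ?f \<eta> x) ---> 0) at_top"
  by (rule Lim_null_comparison[rotated]) (use Sb in \<open>auto simp: eventually_at_top_linorder intro!: exI[of _ "max \<eta>0 1"]\<close>)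
 moreover have "((%\<eta>. LI x. ?f \<eta> x) ---> (LI x. indicator {t..} x *R h x)) at_top"
 proof (rule integral_dominated_convergence_at_top)
  show "integrable lborel (%x. cmod (h x))" using hi by (rule integrable_norm)
  show "\<forall>\<^sub>F \<eta> in at_top. AE x in lborel. norm (?f \<eta> x) <= cmod (h x)"
   by (intro always_eventually) (auto simp: norm_mult intro!: mult_left_le_one_le simp del: of_real_diff)
  have "((%\<eta>. 1 - exp (- exp (\<eta>*(x - t)))) ---> indicator {t..} x) at_top" if "x ~= t" for x
  proof (cases "x > t")
   case True hence "((%\<eta>. 1 - exp (- exp (\<eta>*(x - t)))) ---> 1) at_top" by real_asymp
   thus ?thesis using True by simp
  next
   case False hence "x < t" using that by simp
   hence "((%\<eta>. 1 - exp (- exp (\<eta>*(x - t)))) ---> 0) at_top" by real_asymp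
   thus ?thesis using False that by simp
  qed
  from tendsto_mult_right[OF tendsto_of_real[OF this]]
  show "AE x in lborel. ((%\<eta>. ?f \<eta> x) ---> indicator {t..} x *R h x) at_top"
   using AE_lborel_singleton[of t] by (auto simp: scaleR_conv_of_real)
 qed measurable
 ultimately show ?thesis by (rule tendsto_unique[OF trivial_limit_at_top_linorder, rotated])
qed

text \<open>Application to the derivative.\<close>

lemma laplace_growth_support:
 assumes h: "h : \<D>" and C: "C >= 0"
  and bound: "!!\<eta>. \<eta> >= \<eta>0 ==> cmod (laplace h (\<i> * of_real \<eta>)) <= C*exp (M*\<eta>)" and x: "x > M"
 shows "h x = 0"
proof -
 obtain a b where ab: "!!x. h x ~= 0 ==> a <= x & x <= b" using tf_interval[OF h] by metis
 obtain h' where h': "h' : \<D>" "!!x. (h has_vector_derivative h' x) (at x)" "!!x. h' x ~= 0 ==> a <= x & x <= b"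
  using tf_deriv[OF h ab] by blast
 define e d where "e = max x b + 1" and "d = (x - M)/2"
 have d: "d > 0" "M + d < x" using x by (auto simp: d_def field_simps)
 have "cmod (laplace h' (\<i> * of_real \<eta>)) <= C/d*exp ((M + d)*\<eta>)" if "\<eta> >= max \<eta>0 0" for \<eta>
 proof -
  have "d*\<eta> <= exp (d*\<eta>)" using exp_ge_add_one_self[of "d*\<eta>"] by linarith
  hence "\<eta>*(C*exp (M*\<eta>)) <= exp (d*\<eta>)/d*(C*exp (M*\<eta>))" using C d by (intro mult_right_mono) (auto simp: field_simps)
  moreover have "cmod (laplace h' (\<i> * of_real \<eta>)) = \<eta>*cmod (laplace h (\<i> * of_real \<eta>))"
   unfolding laplace_deriv[OF h h'(1,2)] using that by (simp add: norm_mult)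
  moreover have "\<eta>*cmod (laplace h (\<i> * of_real \<eta>)) <= \<eta>*(C*exp (M*\<eta>))" using that by (intro mult_left_mono bound) auto
  moreover have "exp ((M + d)*\<eta>) = exp (d*\<eta>)*exp (M*\<eta>)" by (simp add: exp_add[symmetric] algebra_simps)
  ultimately show ?thesis by (simp add: mult_ac)
 qed
 hence "0 = (LI y. indicator {x..} y *R h' y)" by (rule laplace_growth_tail[OF h'(1) _ d(2), symmetric])
 also have "... = (LI y. indicator {x..e} y *R h' y)"
  by (intro BI_cong) (use h'(3) in "force simp: e_def indicator_def")+
 also have "... = h e - h x"
  by (rule integral_FTC_atLeastAtMost)
    (auto simp: e_def intro: has_vector_derivative_at_within h'(2) continuous_on_subset[OF tf_continuous[OF h'(1)]])
 also have "h e = 0" using ab[of e] by (force simp: e_def)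
 finally show ?thesis by simp
qed

section \<open>Double cones and the Poincare group in two dimensions\<close>

subsection \<open>Lorentz boosts\<close>

lemma vec2_eq_iff: "(x::real^2) = y \<longleftrightarrow> x $ 1 = y $ 1 & x $ 2 = y $ 2"
 by (simp add: vec_eq_iff forall_2)

lemma mat2_eq_iff: "(A::real^2^2) = B \<longleftrightarrow> A $ 1 $ 1 = B $ 1 $ 1 & A $ 1 $ 2 = B $ 1 $ 2 & A $ 2 $ 1 = B $ 2 $ 1 & A $ 2 $ 2 = B $ 2 $ 2"
 by (auto simp: vec_eq_iff forall_2)

lemma mat2_mult: "((A::real^2^2) ** B) $ i $ j = A $ i $ 1*B $ 1 $ j + A $ i $ 2*B $ 2 $ j"
 by (simp add: matrix_matrix_mult_def sum_2)

lemma mat2_vec: "((A::real^2^2) *v x) $ i = A $ i $ 1*x $ 1 + A $ i $ 2*x $ 2"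
 by (simp add: matrix_vector_mult_def sum_2)

lemma mat2_one: "(mat 1 :: real^2^2) $ 1 $ 1 = 1" "(mat 1 :: real^2^2) $ 1 $ 2 = 0"
  "(mat 1 :: real^2^2) $ 2 $ 1 = 0" "(mat 1 :: real^2^2) $ 2 $ 2 = 1"
 by (simp_all add: mat_def)

lemma lorentz_iff:
 "L : lorentz \<longleftrightarrow> L $ 2 $ 2 = L $ 1 $ 1 & L $ 2 $ 1 = L $ 1 $ 2 & (L $ 1 $ 1)^2 - (L $ 1 $ 2)\<^sup>2 = 1 & L $ 1 $ 1 > 0"
proof
 assume "L : lorentz"
 hence eq: "transpose L ** minkowski_metric ** L = minkowski_metric" and d: "det L = 1" and p: "L $ 1 $ 1 > 0"
  by (auto simp: lorentz_def)
 have m: "minkowski_metric $ 1 $ 1 = 1" "minkowski_metric $ 1 $ 2 = 0" "minkowski_metric $ 2 $ 1 = 0" "minkowski_metric $ 2 $ 2 = -1"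
  by (simp_all add: minkowski_metric_def)
 define a b c e where "a = L $ 1 $ 1" "b = L $ 1 $ 2" "c = L $ 2 $ 1" "e = L $ 2 $ 2"
 have 1: "a*a - c*c = 1" and 2: "a*b - c*e = 0"
  using eq by (auto simp: mat2_eq_iff mat2_mult m transpose_def a_b_c_e_def)
 have 3: "a*e - b*c = 1" using d by (simp add: det_2 a_b_c_e_def)
 have "e = (a*a - c*c)*e" using 1 by simp
 also have "... = a*(a*e - b*c) + c*(a*b - c*e)" by (simp add: algebra_simps)
 finally have e: "e = a" using 2 3 by simp
 have "b = (a*a - c*c)*b" using 1 by simp
 also have "... = a*(a*b - c*e) + c*(a*e - b*c)" by (simp add: algebra_simps)
 finally have b: "b = c" using 2 3 by simp
 show "L $ 2 $ 2 = L $ 1 $ 1 & L $ 2 $ 1 = L $ 1 $ 2 & (L $ 1 $ 1)^2 - (L $ 1 $ 2)\<^sup>2 = 1 & L $ 1 $ 1 > 0"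
  using 1 e b p by (simp add: a_b_c_e_def power2_eq_square)
next
 assume a: "L $ 2 $ 2 = L $ 1 $ 1 & L $ 2 $ 1 = L $ 1 $ 2 & (L $ 1 $ 1)^2 - (L $ 1 $ 2)\<^sup>2 = 1 & L $ 1 $ 1 > 0"
 have m: "minkowski_metric $ 1 $ 1 = 1" "minkowski_metric $ 1 $ 2 = 0" "minkowski_metric $ 2 $ 1 = 0" "minkowski_metric $ 2 $ 2 = -1"
  by (simp_all add: minkowski_metric_def)
 show "L : lorentz" using a
  by (simp add: lorentz_def mat2_eq_iff mat2_mult m transpose_def det_2 power2_eq_square)
qed

text \<open>The boost factor \<open>e\<^sup>\<chi>\<close> of a boost of rapidity \<open>\<chi>\<close>: the light-cone coordinates \<open>x\<^sub>2 + x\<^sub>1\<close> and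
 \<open>x\<^sub>2 - x\<^sub>1\<close> are multiplied by the factor and by its inverse.\<close>

definition boost_factor :: "real^2^2 => real" where
 "boost_factor L = L $ 1 $ 1 + L $ 1 $ 2"

lemma boost_factor:
 assumes "L : lorentz"
 shows "boost_factor L > 0" "L $ 1 $ 1 - L $ 1 $ 2 = 1/boost_factor L"
  "L $ 2 $ 2 = L $ 1 $ 1" "L $ 2 $ 1 = L $ 1 $ 2" "(L $ 1 $ 1)^2 - (L $ 1 $ 2)\<^sup>2 = 1" "L $ 1 $ 1 > 0"
  "\<bar>L $ 1 $ 2\<bar> < L $ 1 $ 1"
proof -
 note a = assms[unfolded lorentz_iff]
 show "L $ 2 $ 2 = L $ 1 $ 1" "L $ 2 $ 1 = L $ 1 $ 2" "(L $ 1 $ 1)^2 - (L $ 1 $ 2)\<^sup>2 = 1" "L $ 1 $ 1 > 0" using a by auto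
 have pr: "(L $ 1 $ 1 + L $ 1 $ 2)*(L $ 1 $ 1 - L $ 1 $ 2) = 1" using a by (simp add: power2_eq_square algebra_simps)
 have "\<bar>L $ 1 $ 2\<bar>\<^sup>2 < (L $ 1 $ 1)^2" using a by simp
 hence abs: "\<bar>L $ 1 $ 2\<bar> < L $ 1 $ 1" by (rule power2_less_imp_less) (use a in simp)
 thus "\<bar>L $ 1 $ 2\<bar> < L $ 1 $ 1" .
 from abs show p: "boost_factor L > 0" by (simp add: boost_factor_def)
 thus "L $ 1 $ 1 - L $ 1 $ 2 = 1/boost_factor L" using pr by (simp add: boost_factor_def field_simps)
qed

definition inverse_boost :: "real^2^2 => real^2^2" where
 "inverse_boost L = vector [vector [L $ 1 $ 1, - L $ 1 $ 2], vector [- L $ 1 $ 2, L $ 1 $ 1]]"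

lemma inverse_boost:
 assumes "L : lorentz"
 shows "inverse_boost L : lorentz" "L ** inverse_boost L = mat 1" "inverse_boost L ** L = mat 1" "matrix_inv L = inverse_boost L"
proof -
 note b = boost_factor[OF assms]
 show "inverse_boost L : lorentz" using b by (simp add: lorentz_iff inverse_boost_def)
 show 1: "L ** inverse_boost L = mat 1" using b(3-5)
  by (simp add: mat2_eq_iff mat2_mult mat2_one inverse_boost_def power2_eq_square)
 show 2: "inverse_boost L ** L = mat 1" using b(3-5)
  by (simp add: mat2_eq_iff mat2_mult mat2_one inverse_boost_def power2_eq_square)
 have "matrix_inv L ** L = mat 1"
  unfolding matrix_inv_def by (rule someI2[of _ "inverse_boost L"]) (use 1 2 in auto)
 hence "matrix_inv L ** (L ** inverse_boost L) = inverse_boost L" by (simp add: matrix_mul_assoc)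
 thus "matrix_inv L = inverse_boost L" by (simp add: 1)
qed

lemma mat1_lorentz [simp]: "mat 1 : lorentz"
 by (simp add: lorentz_iff mat2_one)

lemma lorentz_mult: "L : lorentz ==> L' : lorentz ==> L ** L' : lorentz"
proof -
 assume L: "L : lorentz" and L': "L' : lorentz"
 note a = boost_factor[OF L] and b = boost_factor[OF L']
 have "\<bar>L $ 1 $ 2*L' $ 1 $ 2\<bar> < L $ 1 $ 1*L' $ 1 $ 1" unfolding abs_mult
  using a(6,7) b(6,7) by (intro mult_strict_mono) auto
 hence pos: "L $ 1 $ 1*L' $ 1 $ 1 + L $ 1 $ 2*L' $ 1 $ 2 > 0" by simp
 have "(L $ 1 $ 1*L' $ 1 $ 1 + L $ 1 $ 2*L' $ 1 $ 2)^2 - (L $ 1 $ 1*L' $ 1 $ 2 + L $ 1 $ 2*L' $ 1 $ 1)\<^sup>2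
   = ((L $ 1 $ 1)^2 - (L $ 1 $ 2)\<^sup>2)*((L' $ 1 $ 1)^2 - (L' $ 1 $ 2)\<^sup>2)" by (simp add: power2_eq_square algebra_simps)
 thus ?thesis using a b pos by (simp add: lorentz_iff mat2_mult)
qed

lemma poincare_simps:
 "PG = lorentz \<times> UNIV"
 "(L, x) \<cdot> (L', x') = (L ** L', L *v x' + x)"
 "\<one>\<^bsub>poincare\<^esub> = (mat 1, 0)"
 by (simp_all add: poincare_def)

lemma poincare_mult_closed: "g : PG ==> h : PG ==> g \<cdot> h : PG"
 by (cases g; cases h) (auto simp: poincare_simps lorentz_mult)

definition poincare_inverse :: "poincare_elem => poincare_elem" where
 "poincare_inverse = (%(L, x). (inverse_boost L, - (inverse_boost L *v x)))"

lemma poincare_inverse: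
 assumes "g : PG"
 shows "poincare_inverse g : PG" "poincare_inverse g \<cdot> g = (mat 1, 0)"
  "g \<cdot> poincare_inverse g = (mat 1, 0)"
proof -
 obtain L x where g: "g = (L, x)" "L : lorentz" using assms by (cases g) (auto simp: poincare_simps)
 note i = inverse_boost[OF g(2)] and b = boost_factor[OF g(2)]
 show "poincare_inverse g : PG" using i by (simp add: g poincare_inverse_def poincare_simps)
 show "poincare_inverse g \<cdot> g = (mat 1, 0)"
  using i by (simp add: g poincare_inverse_def poincare_simps)
 have "L *v (inverse_boost L *v x) = x" by (simp add: matrix_vector_mul_assoc i)
 moreover have "L *v (- y) = - (L *v y)" for y by (simp add: vec2_eq_iff mat2_vec)
 ultimately have "L *v (- (inverse_boost L *v x)) + x = 0" by simp
 thus "g \<cdot> poincare_inverse g = (mat 1, 0)"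
  using i by (simp add: g poincare_inverse_def poincare_simps)
qed

lemma poincare_mult_assoc: "(g \<cdot> h) \<cdot> k = g \<cdot> (h \<cdot> k)"
 by (cases g; cases h; cases k)
   (simp add: poincare_simps matrix_mul_assoc vec2_eq_iff mat2_vec mat2_mult algebra_simps)

lemma poincare_one_left: "(mat 1, 0) \<cdot> g = g"
 by (cases g) (simp add: poincare_simps)

subsection \<open>Double cones as rectangles in light-cone coordinates\<close>

definition lc_rect :: "real => real => real => real => (real^2) set" where
 "lc_rect u0 u1 v0 v1 = {x. u0 < x $ 2 + x $ 1 & x $ 2 + x $ 1 < u1 & v0 < x $ 2 - x $ 1 & x $ 2 - x $ 1 < v1}"

definition lc_point :: "real => real => real^2" where
 "lc_point u v = vector [(u - v)/2, (u + v)/2]"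

lemma lc_point [simp]: "lc_point u v $ 1 = (u - v)/2" "lc_point u v $ 2 = (u + v)/2"
 by (simp_all add: lc_point_def)

lemma lc_point_coords [simp]: "lc_point u v $ 2 + lc_point u v $ 1 = u" "lc_point u v $ 2 - lc_point u v $ 1 = v"
 by (simp_all add: field_simps)

lemma lc_point_in_rect: "lc_point u v : lc_rect u0 u1 v0 v1 \<longleftrightarrow> u0 < u & u < u1 & v0 < v & v < v1"
 unfolding lc_rect_def mem_Collect_eq lc_point_coords by simp

lemma lc_rect_subset_iff:
 assumes "u0 < u1" "v0 < v1"
 shows "lc_rect u0 u1 v0 v1 <= lc_rect u0' u1' v0' v1' \<longleftrightarrow> u0' <= u0 & u1 <= u1' & v0' <= v0 & v1 <= v1'"
proof
 assume sub: "lc_rect u0 u1 v0 v1 <= lc_rect u0' u1' v0' v1'"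
 define um vm where "um = (u0 + u1)/2" and "vm = (v0 + v1)/2"
 have m: "u0 < um" "um < u1" "v0 < vm" "vm < v1" using assms by (auto simp: um_def vm_def)
 have u: "u0' < u & u < u1'" if "u0 < u" "u < u1" for u
  using sub lc_point_in_rect[of u vm u0 u1 v0 v1] lc_point_in_rect[of u vm u0' u1' v0' v1'] that m by blast
 have v: "v0' < v & v < v1'" if "v0 < v" "v < v1" for v
  using sub lc_point_in_rect[of um v u0 u1 v0 v1] lc_point_in_rect[of um v u0' u1' v0' v1'] that m by blast
 have "u0' <= u0" "u1 <= u1'" using assms(1) u
  by (meson dense_ge_bounded less_imp_le, meson dense_le_bounded less_imp_le)
 moreover have "v0' <= v0" "v1 <= v1'" using assms(2) v
  by (meson dense_ge_bounded less_imp_le, meson dense_le_bounded less_imp_le)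
 ultimately show "u0' <= u0 & u1 <= u1' & v0' <= v0 & v1 <= v1'" by blast
qed (auto simp: lc_rect_def)

lemma tcone_rect:
 assumes "L : lorentz"
 shows "tcone (L, x) a b = lc_rect (boost_factor L*a + (x $ 2 + x $ 1)) (boost_factor L*b + (x $ 2 + x $ 1))
   (a/boost_factor L + (x $ 2 - x $ 1)) (b/boost_factor L + (x $ 2 - x $ 1))" (is "_ = ?R")
proof -
 define e where "e = boost_factor L"
 note b = boost_factor[OF assms]
 have e: "e > 0" using b(1) by (simp add: e_def)
 have u: "(L *v y + x) $ 2 + (L *v y + x) $ 1 = e*(y $ 2 + y $ 1) + (x $ 2 + x $ 1)" for y
  using b(3,4) by (simp add: mat2_vec e_def boost_factor_def algebra_simps)
 have v: "(L *v y + x) $ 2 - (L *v y + x) $ 1 = (y $ 2 - y $ 1)/e + (x $ 2 - x $ 1)" for y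
 proof -
  have "(L *v y + x) $ 2 - (L *v y + x) $ 1 = (L $ 1 $ 1 - L $ 1 $ 2)*(y $ 2 - y $ 1) + (x $ 2 - x $ 1)"
   using b(3,4) by (simp add: mat2_vec algebra_simps)
  thus ?thesis using b(2) by (simp add: e_def)
 qed
 have cone: "y : cone_over a b \<longleftrightarrow> a < y $ 2 + y $ 1 & y $ 2 + y $ 1 < b & a < y $ 2 - y $ 1 & y $ 2 - y $ 1 < b" for y
  by (auto simp: cone_over_def)
 have inR: "L *v y + x : ?R \<longleftrightarrow> y : cone_over a b" for y
  unfolding lc_rect_def mem_Collect_eq u v cone e_def[symmetric] using e
  by (simp add: divide_less_cancel)
 show ?thesis
 proof (intro equalityI subsetI)
  fix z assume z: "z : ?R"
  define y where "y = inverse_boost L *v (z - x)"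
  have eq: "L *v y + x = z" using inverse_boost(2)[OF assms] by (simp add: y_def matrix_vector_mul_assoc)
  show "z : tcone (L, x) a b" using inR[of y] z unfolding eq by (auto simp: tcone_def eq[symmetric])
 qed (use inR in "auto simp: tcone_def")
qed

text \<open>The boost with boost factor \<open>e\<close>.\<close>

definition boost :: "real => real^2^2" where
 "boost e = vector [vector [(e + 1/e)/2, (e - 1/e)/2], vector [(e - 1/e)/2, (e + 1/e)/2]]"

lemma boost: "e > 0 ==> boost e : lorentz" "boost_factor (boost e) = e"
proof -
 assume e: "e > 0"
 have "((e + 1/e)/2)^2 - ((e - 1/e)/2)\<^sup>2 = 1" using e by (simp add: power2_eq_square field_simps)
 moreover have "(e + 1/e)/2 > 0" using e by (intro divide_pos_pos add_pos_pos) auto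
 ultimately show "boost e : lorentz" by (simp add: lorentz_iff boost_def)
next
 show "boost_factor (boost e) = e" by (simp add: boost_factor_def boost_def field_simps)
qed

lemma rect_is_cone:
 assumes "u0 < u1" "v0 < v1"
 obtains L x b where "L : lorentz" "0 < b" "lc_rect u0 u1 v0 v1 = tcone (L, x) 0 b"
  "boost_factor L = sqrt ((u1 - u0)/(v1 - v0))"
proof -
 define e where "e = sqrt ((u1 - u0)/(v1 - v0))"
 define b where "b = sqrt ((u1 - u0)*(v1 - v0))"
 have e: "e > 0" and b: "b > 0" using assms by (simp_all add: e_def b_def)
 have "e*b = sqrt ((u1 - u0)*(u1 - u0))" using assms by (simp add: e_def b_def flip: real_sqrt_mult)
 hence eb: "e*b = u1 - u0" using assms by simp
 have "b/e = sqrt ((v1 - v0)*(v1 - v0))" using assms by (simp add: e_def b_def flip: real_sqrt_divide)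
 hence be: "b/e = v1 - v0" using assms by simp
 have "lc_rect u0 u1 v0 v1 = tcone (boost e, lc_point u0 v0) 0 b"
  unfolding tcone_rect[OF boost(1)[OF e]] lc_point_coords boost(2) eb be by simp
 thus ?thesis using that boost[of e] e b by (simp add: e_def)
qed

lemma double_coneE:
 assumes "R : \<K>"
 obtains u0 u1 v0 v1 where "R = lc_rect u0 u1 v0 v1" "u0 < u1" "v0 < v1"
proof -
 obtain L x a b where R: "R = tcone (L, x) a b" "L : lorentz" "a < b"
  using assms by (auto simp: \<K>_def poincare_simps)
 show ?thesis using that tcone_rect[OF R(2), of x a b] R boost_factor(1)[OF R(2)] by (simp add: divide_strict_right_mono)
qed

lemma lc_rect_double_cone:
 assumes "u0 < u1" "v0 < v1"
 shows "lc_rect u0 u1 v0 v1 : \<K>"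
proof -
 obtain L x b where "L : lorentz" "0 < b" "lc_rect u0 u1 v0 v1 = tcone (L, x) 0 b"
  "boost_factor L = sqrt ((u1 - u0)/(v1 - v0))" by (rule rect_is_cone[OF assms])
 thus ?thesis unfolding \<K>_def
  by (intro CollectI exI[of _ "(L, x)"] exI[of _ "0::real"] exI[of _ b]) (simp add: poincare_simps)
qed

lemma scale_rect:
 assumes "l > 0"
 shows "(%x. l *R x) ` lc_rect u0 u1 v0 v1 = lc_rect (l*u0) (l*u1) (l * v0) (l * v1)"
proof (intro Set.set_eqI iffI)
 fix y assume "y : lc_rect (l*u0) (l*u1) (l * v0) (l * v1)"
 hence "(1/l) *R y : lc_rect u0 u1 v0 v1"
  using assms by (auto simp: lc_rect_def pos_less_divide_eq pos_divide_less_eq mult.commute add_divide_distrib[symmetric]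
    diff_divide_distrib[symmetric])
 thus "y : (%x. l *R x) ` lc_rect u0 u1 v0 v1" using assms by (intro image_eqI[of _ _ "(1/l) *R y"]) auto
next
 fix y assume "y : (%x. l *R x) ` lc_rect u0 u1 v0 v1"
 then obtain x where "y = l *R x" "x : lc_rect u0 u1 v0 v1" by blast
 thus "y : lc_rect (l*u0) (l*u1) (l * v0) (l * v1)"
  using assms by (auto simp: lc_rect_def distrib_left[symmetric] right_diff_distrib[symmetric])
qed

lemma closure_rect_subset_iff:
 assumes "u0 < u1" "v0 < v1"
 shows "closure (lc_rect u0 u1 v0 v1) <= lc_rect u0' u1' v0' v1' \<longleftrightarrow> u0' < u0 & u1 < u1' & v0' < v0 & v1 < v1'"
proof
 assume sub: "closure (lc_rect u0 u1 v0 v1) <= lc_rect u0' u1' v0' v1'"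
 let ?p = "lc_point u0 v0" and ?q = "lc_point u1 v1"
 have "(1 - t) *R ?p + t *R ?q : lc_rect u0 u1 v0 v1" if t: "0 < t" "t < 1" for t
 proof -
  have "(1 - t) *R ?p + t *R ?q = lc_point (u0 + t*(u1 - u0)) (v0 + t*(v1 - v0))"
   by (simp add: vec2_eq_iff field_simps)
  moreover have "0 < t*(u1 - u0)" "t*(u1 - u0) < 1*(u1 - u0)" "0 < t*(v1 - v0)" "t*(v1 - v0) < 1*(v1 - v0)"
   using t assms by (auto intro!: mult_strict_right_mono)
  ultimately show ?thesis by (simp add: lc_point_in_rect)
 qed
 hence "closure (open_segment ?p ?q) <= closure (lc_rect u0 u1 v0 v1)" by (intro closure_mono) (auto simp: in_segment)
 moreover have "?p ~= ?q" using assms by (auto simp: vec2_eq_iff)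
 ultimately have "{?p, ?q} <= lc_rect u0' u1' v0' v1'" using sub by (auto simp: closure_open_segment)
 thus "u0' < u0 & u1 < u1' & v0' < v0 & v1 < v1'" by (simp add: lc_point_in_rect)
next
 assume less: "u0' < u0 & u1 < u1' & v0' < v0 & v1 < v1'"
 let ?C = "{x::real^2. u0 <= x $ 2 + x $ 1} \<inter> {x. x $ 2 + x $ 1 <= u1} \<inter> {x. v0 <= x $ 2 - x $ 1} \<inter> {x. x $ 2 - x $ 1 <= v1}"
 have "closed ?C" by (intro closed_Collect_le continuous_intros)
 moreover have "lc_rect u0 u1 v0 v1 <= ?C" by (auto simp: lc_rect_def)
 ultimately have "closure (lc_rect u0 u1 v0 v1) <= ?C" by (rule closure_minimal[rotated])
 also have "... <= lc_rect u0' u1' v0' v1'" using less by (auto simp: lc_rect_def)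
 finally show "closure (lc_rect u0 u1 v0 v1) <= lc_rect u0' u1' v0' v1'" .
qed

lemma translate_cone:
 assumes "L : lorentz"
 shows "tcone (mat 1, y) a b = lc_rect (a + (y $ 2 + y $ 1)) (b + (y $ 2 + y $ 1)) (a + (y $ 2 - y $ 1)) (b + (y $ 2 - y $ 1))"
 using tcone_rect[of "mat 1" y a b] by (simp add: boost_factor_def mat2_one)

lemma cone_over_rect: "cone_over a b = lc_rect a b a b"
 by (auto simp: cone_over_def lc_rect_def)

section \<open>The action on test functions\<close>

lemma disp_pos: "m > 0 ==> disp m p > 0"
 by (simp add: disp_def add_nonneg_pos)

lemma disp_minus [simp]: "disp m (- p) = disp m p"
 by (simp add: disp_def)

lemma disp_ge_abs: "\<bar>p\<bar> <= disp m p"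
 unfolding disp_def by (rule real_le_rsqrt) simp

lemma disp_ge_mass: "m > 0 ==> m <= disp m p"
 unfolding disp_def by (rule real_le_rsqrt) simp

lemma disp_sq: "(disp m p)^2 = p^2 + m^2"
 by (simp add: disp_def)

lemma disp_le: "m > 0 ==> disp m p <= \<bar>p\<bar> + m"
 unfolding disp_def by (rule real_le_lsqrt) (auto simp: power2_sum)

lemma continuous_on_disp [continuous_intros]: "continuous_on A g ==> continuous_on A (%x. disp m (g x))"
 unfolding disp_def by (intro continuous_intros)

lemma Re_fourier_minus: "Re_fourier f (- p) = cnj (Re_fourier f p)"
 unfolding Re_fourier_def fourier_def
 by (simp add: exp_cnj flip: BI_cnj)

lemma Im_fourier_minus: "Im_fourier f (- p) = cnj (Im_fourier f p)"
 unfolding Im_fourier_def fourier_def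
 by (simp add: exp_cnj flip: BI_cnj)

lemma fourier_linear:
 assumes "f : \<D>" "g : \<D>"
 shows "fourier (%x. f x + g x) p = fourier f p + fourier g p" "fourier (%x. c*f x) p = c*fourier f p"
proof -
 note i = laplace_integrable[OF assms(1), of "of_real p"] laplace_integrable[OF assms(2), of "of_real p"]
 show "fourier (%x. f x + g x) p = fourier f p + fourier g p"
  using i unfolding fourier_laplace laplace_def by (simp add: distrib_left)
 show "fourier (%x. c*f x) p = c*fourier f p"
  unfolding fourier_laplace laplace_def by (simp add: mult.left_commute)
qed

lemma ReIm_fourier_linear:
 assumes "f : \<D>" "g : \<D>"
 shows "Re_fourier (%x. f x + g x) p = Re_fourier f p + Re_fourier g p"
  "Im_fourier (%x. f x + g x) p = Im_fourier f p + Im_fourier g p"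
  "Re_fourier (%x. cor r*f x) p = of_real r * Re_fourier f p"
  "Im_fourier (%x. cor r*f x) p = of_real r*Im_fourier f p"
 unfolding Re_fourier_def Im_fourier_def
 using fourier_linear[OF tf_Re[OF assms(1)] tf_Re[OF assms(2)]]
  fourier_linear[OF tf_Im[OF assms(1)] tf_Im[OF assms(2)]]
 by (simp_all)

lemma ftr_linear:
 assumes "f : \<D>" "g : \<D>"
 shows "ftr m (%x. f x + g x) p = ftr m f p + ftr m g p"
  "ftr m (%x. cor r*f x) p = of_real r*ftr m f p"
  "ftr m (%x. f x - g x) p = ftr m f p - ftr m g p"
proof -
 have add: "ftr m (%x. f x + g x) p = ftr m f p + ftr m g p"
  if "g : \<D>" for g
  using ReIm_fourier_linear[OF assms(1) that] by (simp add: ftr_def algebra_simps)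
 have mult: "ftr m (%x. cor r*f x) p = of_real r*ftr m f p"
  if "f : \<D>" for f r
  using ReIm_fourier_linear[OF that that] by (simp add: ftr_def algebra_simps)
 show "ftr m (%x. f x + g x) p = ftr m f p + ftr m g p" by (rule add[OF assms(2)])
 show "ftr m (%x. cor r*f x) p = of_real r*ftr m f p" by (rule mult[OF assms(1)])
 show "ftr m (%x. f x - g x) p = ftr m f p - ftr m g p"
  using add[OF tf_cmult[OF assms(2), of "cor (-1)"]] mult[OF assms(2), of "-1"] by simp
qed

lemma ftr_zero: "ftr m (%_. 0) p = 0"
 by (simp add: ftr_def Re_fourier_def Im_fourier_def fourier_def)

lemma ftr_parts:
 "Re_fourier f p = (ftr m f p + cnj (ftr m f (- p)))/2"
 "\<i> * of_real (disp m p)*Im_fourier f p = (ftr m f p - cnj (ftr m f (- p)))/2"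
 by (simp_all add: ftr_def Re_fourier_minus Im_fourier_minus)

lemma ftr_inj:
 assumes f: "f : \<D>" and m: "m > 0" and eq: "!!p. ftr m f p = 0"
 shows "f = (%_. 0)"
proof -
 have "Re_fourier f p = 0" "Im_fourier f p = 0" for p
  using ftr_parts[where f = f and p = p and m = m] disp_pos[OF m, of p] by (simp_all add: eq)
 hence "(%x. cor (Re (f x))) = (%_. 0)" "(%x. cor (Im (f x))) = (%_. 0)"
  unfolding Re_fourier_def Im_fourier_def
  by (auto intro!: fourier_eq_zero_imp tf_Re tf_Im f)
 thus ?thesis by (auto simp: fun_eq_iff complex_eq_iff)
qed

lemma ftr_eqD:
 assumes "f : \<D>" "g : \<D>" "m > 0" "!!p. ftr m f p = ftr m g p"
 shows "f = g"
 using ftr_inj[OF tf_diff[OF assms(1,2)] assms(3)] assms(4)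
 by (simp add: ftr_linear[OF assms(1,2)] fun_eq_iff)

text \<open>The relation underlying the definition of the action.\<close>

definition related :: "real => poincare_elem => (real => complex) => (real => complex) => bool" where
 "related m g f h \<longleftrightarrow> h : \<D> \<and>
   (\<forall>p. ftr m h p =
    exp (\<i>*cor (snd g $ 1*disp m p - snd g $ 2*p)) *
    ftr m f ((matrix_inv (fst g) *v vector [disp m p, p]) $ 2))"

lemma related_unique:
 "m > 0 ==> related m g f h ==> related m g f h' ==> h = h'"
 by (rule ftr_eqD) (auto simp: related_def)

lemma poincare_action_The: "poincare_action m g f = (THE h. related m g f h)"
 by (cases g) (simp add: poincare_action_def related_def)

lemma poincare_action_eq: "m > 0 ==> related m g f h ==> poincare_action m g f = h"
 unfolding poincare_action_The by (rule the_equality) (auto intro: related_unique)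

lemma inverse_boost_vec:
 assumes "L : lorentz"
 shows "(matrix_inv L *v vector [w, p]) $ 2 = L $ 1 $ 1*p - L $ 1 $ 2*w"
 by (simp add: inverse_boost(4)[OF assms] inverse_boost_def mat2_vec)

lemma disp_boost:
 assumes "L : lorentz" and m: "m > 0"
 shows "disp m (L $ 1 $ 1*p - L $ 1 $ 2*disp m p) = L $ 1 $ 1*disp m p - L $ 1 $ 2*p"
proof -
 note b = boost_factor[OF assms(1)]
 have "\<bar>L $ 1 $ 2\<bar>*\<bar>p\<bar> <= L $ 1 $ 1*disp m p" using b(6,7) disp_ge_abs[of p m] by (intro mult_mono) auto
 hence nn: "0 <= L $ 1 $ 1*disp m p - L $ 1 $ 2*p"
  using abs_ge_self[of "L $ 1 $ 2*p"] by (simp add: abs_mult)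
 have "(L $ 1 $ 1*p - L $ 1 $ 2*disp m p)^2 + m^2
   = (L $ 1 $ 1*disp m p - L $ 1 $ 2*p)^2 - ((L $ 1 $ 1)^2 - (L $ 1 $ 2)\<^sup>2)*((disp m p)^2 - p\<^sup>2) + m^2"
  by (simp add: power2_eq_square algebra_simps)
 also have "... = (L $ 1 $ 1*disp m p - L $ 1 $ 2*p)^2" using b(5) by (simp add: disp_sq)
 finally show ?thesis using nn unfolding disp_def[of m "L $ 1 $ 1*p - L $ 1 $ 2*disp m p"] by simp
qed

lemma related_iff:
 assumes "L : lorentz"
 shows "related m (L, x) f h \<longleftrightarrow> h : \<D> \<and>
   (\<forall>p. ftr m h p = exp (\<i>*cor (x $ 1*disp m p - x $ 2*p)) *
    ftr m f (L $ 1 $ 1*p - L $ 1 $ 2*disp m p))"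
 by (simp add: related_def inverse_boost_vec[OF assms])

lemma related_comp:
 assumes m: "m > 0" and g: "g : PG" "g' : PG"
  and r: "related m g' f f'" "related m g f' f''"
 shows "related m (g \<cdot> g') f f''"
proof -
 obtain L x L' x' where gg: "g = (L, x)" "g' = (L', x')" by force
 have L: "L : lorentz" "L' : lorentz" using g by (auto simp: gg poincare_simps)
 note LL = lorentz_mult[OF L]
 note b = boost_factor(3,4)[OF L(1)] and b' = boost_factor(3,4)[OF L(2)]
 have "ftr m f'' p = exp (\<i>*cor ((L *v x' + x) $ 1*disp m p - (L *v x' + x) $ 2*p)) *
    ftr m f ((L ** L') $ 1 $ 1*p - (L ** L') $ 1 $ 2*disp m p)" for p
 proof -
  let ?q = "L $ 1 $ 1*p - L $ 1 $ 2*disp m p"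
  have dq: "disp m ?q = L $ 1 $ 1*disp m p - L $ 1 $ 2*p" by (rule disp_boost[OF L(1) m])
  have "ftr m f'' p = exp (\<i>*cor (x $ 1*disp m p - x $ 2*p)) *
    (exp (\<i>*cor (x' $ 1*disp m ?q - x' $ 2*?q))*ftr m f (L' $ 1 $ 1*?q - L' $ 1 $ 2*disp m ?q))"
   using r unfolding gg related_iff[OF L(1)] related_iff[OF L(2)] by simp
  thus ?thesis unfolding dq mult.assoc[symmetric] exp_add[symmetric] using b b' by (simp add: mat2_vec mat2_mult algebra_simps)
 qed
 thus ?thesis using r(2) unfolding gg poincare_simps related_iff[OF LL] related_iff[OF L(1)] by simp
qed

lemma related_one: "f : \<D> ==> related m (mat 1, 0) f f"
 by (simp add: related_iff mat2_one)

lemma related_linear: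
 assumes "f : \<D>" "g : \<D>" "related m k f f'" "related m k g g'"
 shows "related m k (%x. f x + g x) (%x. f' x + g' x)"
  "related m k (%x. cor r*f x) (%x. cor r*f' x)"
 using assms unfolding related_def
 by (auto simp: tf_add tf_cmult ftr_linear distrib_left)

subsection \<open>Finite propagation speed\<close>

lemma Im_csqrt_le:
 fixes z w :: complex
 assumes w: "w^2 = z^2 + of_real (m^2)"
 shows "\<bar>Im w\<bar> <= \<bar>Im z\<bar>"
proof (rule ccontr)
 assume "\<not> ?thesis"
 hence gt: "\<bar>Im z\<bar> < \<bar>Im w\<bar>" by simp
 have re: "(Re w)^2 - (Im w)\<^sup>2 = (Re z)^2 - (Im z)\<^sup>2 + m^2" and im: "Re w*Im w = Re z*Im z"
  using w by (simp_all add: complex_eq_iff power2_eq_square algebra_simps)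
 have gt2: "(Im z)^2 < (Im w)^2" using gt by (metis abs_ge_zero power2_abs power_strict_mono zero_less_numeral)
 have a: "(Re w)^2*(Im w)^2 = (Re z)^2*(Im z)^2" using im by (metis power_mult_distrib)
 have gt3: "(Re z)^2 < (Re w)^2" using re gt2 by (smt (verit) zero_le_power2)
 have "(Re z)^2*(Im z)^2 < (Re w)^2*(Im w)^2" using gt2 gt3 by (intro mult_strict_mono) auto
 thus False using a by simp
qed

lemma laplace_cnj:
 assumes "!!x. Im (f x) = 0"
 shows "cnj (laplace f z) = laplace f (- cnj z)"
proof -
 have "cnj (f x) = f x" for x using assms by (simp add: complex_eq_iff)
 thus ?thesis unfolding laplace_def by (simp add: exp_cnj flip: BI_cnj)
qed

lemma laplace_le:
 assumes f: "f : \<D>" and supp: "!!y. f y ~= 0 ==> Re (\<xi> - \<i>*z * of_real y) <= B"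
 shows "cmod (exp \<xi>*laplace f z) <= 1/sqrt (2*pi)*(LI x. cmod (f x))*exp B"
proof -
 let ?F = "%y. exp \<xi>*(exp (- (\<i>*z*cor y))*f y)"
 have b: "cmod (?F y) <= cmod (f y)*exp B" for y
 proof (cases "f y = 0")
  case False
  have "cmod (?F y) = exp (Re (\<xi> - \<i>*z * of_real y))*cmod (f y)" by (simp add: norm_mult exp_add[symmetric])
  also have "... <= exp B*cmod (f y)" using supp[OF False] by (intro mult_right_mono) auto
  finally show ?thesis by (simp only: mult.commute)
 qed simp
 have i: "integrable lborel ?F" by (intro integrable_mult_right laplace_integrable f)
 have "cmod (LI y. ?F y) <= (LI y. cmod (f y)*exp B)"
  by (rule BI_norm_bound[OF i _ b]) (intro integrable_mult_left integrable_norm tf_integrable f)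
 moreover have "exp \<xi>*laplace f z = cor (1/sqrt (2*pi))*(LI y. ?F y)" by (simp add: laplace_def)
 ultimately show ?thesis by (simp add: norm_mult norm_divide divide_right_mono)
qed

text \<open>For a Poincare transform \<open>h\<close> of \<open>f\<close>, the Laplace transforms of the real and imaginary part of \<open>h\<close>
 are the even and odd part of `E z w` with respect to the energy variable \<open>w = sqrt (z^2 + m^2)\<close>.
 Points of the support of `f` are moved to points `(t', x')`, and `h` is supported in
 the intervals cut out of the time-zero line by the light cones at these points.\<close>

lemma finite_propagation:
 assumes m: "m > 0" and L: "L : lorentz" and f: "f : \<D>" and r: "related m (L, x) f h"
  and M: "!!y. f y ~= 0 ==> boost_factor L*y + (x $ 2 + x $ 1) <= M & y/boost_factor L + (x $ 2 - x $ 1) <= M"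
  and M': "!!y. f y ~= 0 ==> M' <= boost_factor L*y + (x $ 2 + x $ 1) & M' <= y/boost_factor L + (x $ 2 - x $ 1)"
  and \<xi>: "h \<xi> ~= 0"
 shows "M' <= \<xi> & \<xi> <= M"
proof -
 define c s where "c = L $ 1 $ 1" and "s = L $ 1 $ 2"
 define t x0 where "t = x $ 1" and "x0 = x $ 2"
 note b = boost_factor[OF L]
 have c0: "c > 0" using b(6) by (simp add: c_def)
 have h: "h : \<D>" using r by (simp add: related_def)
 define fR fI hR hI where "fR = (%x. cor (Re (f x)))" and "fI = (%x. cor (Im (f x)))"
  and "hR = (%x. cor (Re (h x)))" and "hI = (%x. cor (Im (h x)))"
 have tf: "fR : \<D>" "fI : \<D>" "hR : \<D>" "hI : \<D>"
  unfolding fR_def fI_def hR_def hI_def by (intro tf_Re tf_Im f h)+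
 \<comment> \<open>The transformed field in terms of momentum \<open>z\<close> and energy \<open>w\<close>, which may be complex.\<close>
 define E where "E z w = exp (\<i>*(of_real t*w - of_real x0*z)) *
   (laplace fR (of_real c*z - of_real s*w) + \<i>*(of_real c*w - of_real s*z)*laplace fI (of_real c*z - of_real s*w))" for z w
 have ftE: "ftr m h p = E (of_real p) (of_real (disp m p))" for p
  using r disp_boost[OF L m, of p] unfolding related_iff[OF L]
  by (simp add: E_def ftr_def Re_fourier_def Im_fourier_def fourier_laplace fR_def fI_def c_def s_def t_def x0_def)
 have cnjE: "cnj (E z w) = E (- cnj z) (- cnj w)" for z w
 proof -
  have "cnj (laplace fR z) = laplace fR (- cnj z)" "cnj (laplace fI z) = laplace fI (- cnj z)" for z
   by (auto simp: fR_def fI_def intro!: laplace_cnj)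
  thus ?thesis by (simp add: E_def exp_cnj algebra_simps)
 qed
 define w where "w z = csqrt (z^2 + of_real (m^2))" for z
 have w2: "(w z)^2 = z^2 + of_real (m^2)" for z by (simp add: w_def)
 have w_real: "w (of_real p) = of_real (disp m p)" for p
  using of_real_sqrt[of "p^2 + m^2"] by (simp add: w_def disp_def)
 let ?S = "{z::complex. Re z > 0}"
 have w_hol: "w holomorphic_on ?S"
  unfolding w_def
 proof (intro holomorphic_intros notI)
  fix z assume z: "z : ?S" and n: "z^2 + of_real (m^2) : \<real>\<^sub>\<le>\<^sub>0"
  hence "Im z = 0" by (simp add: complex_nonpos_Reals_iff power2_eq_square)
  hence "(Re z)^2 + m^2 <= 0" using n by (simp add: complex_nonpos_Reals_iff power2_eq_square)
  thus False using m by (simp add: sum_power2_le_zero_iff)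
 qed
 have lap_hol: "(%z. laplace k (u z)) holomorphic_on ?S" if "k : \<D>" "u holomorphic_on ?S" for k u
  using holomorphic_on_compose_gen[OF that(2) laplace_holomorphic[OF that(1)]] by (simp add: comp_def)
 have E_hol: "(%z. E z (w z)) holomorphic_on ?S" "(%z. E z (- w z)) holomorphic_on ?S"
  unfolding E_def by (intro holomorphic_intros lap_hol tf w_hol)+
 have lim1: "(1::complex) islimpt (of_real ` {0<..})"
  unfolding islimpt_approachable
 proof (intro allI impI)
  fix e :: real assume "e > 0"
  thus "\<exists>x'\<in>of_real ` {0<..}. x' ~= (1::complex) & dist x' 1 < e"
   by (intro bexI[of _ "of_real (1 + e/2)"] imageI) (auto simp: dist_norm)
 qed
 have zero: "g z = 0" if "g holomorphic_on ?S" "!!p. p > 0 ==> g (of_real p) = 0" "Re z > 0" for g z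
  by (rule analytic_continuation[OF that(1) _ _ _ _ lim1, of z])
    (use that in "auto simp: open_halfspace_Re_gt intro!: convex_connected convex_halfspace_Re_gt")
 have real: "laplace hR (of_real p) = (E (of_real p) (of_real (disp m p)) + E (of_real p) (- of_real (disp m p)))/2"
  "\<i> * of_real (disp m p)*laplace hI (of_real p) = (E (of_real p) (of_real (disp m p)) - E (of_real p) (- of_real (disp m p)))/2" for p
  using ftr_parts(1)[of h p m] ftr_parts(2)[of m p h] by (simp_all add: ftE cnjE Re_fourier_def Im_fourier_def fourier_laplace hR_def hI_def)
 have hR: "laplace hR z - (E z (w z) + E z (- w z))/2 = 0" if "Re z > 0" for z
  by (rule zero[OF _ _ that, of "%z. laplace hR z - (E z (w z) + E z (- w z))/2"], intro holomorphic_intros E_hol lap_hol tf, simp_all add: w_real real)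
 have hI: "\<i>*w z*laplace hI z - (E z (w z) - E z (- w z))/2 = 0" if "Re z > 0" for z
  by (rule zero[OF _ _ that, of "%z. \<i>*w z*laplace hI z - (E z (w z) - E z (- w z))/2"], intro holomorphic_intros E_hol lap_hol w_hol tf, simp_all add: w_real real)
 define A B where "A = 1/sqrt (2*pi)*(LI x. cmod (fR x))" and "B = 1/sqrt (2*pi)*(LI x. cmod (fI x))"
 have AB: "A >= 0" "B >= 0" by (simp_all add: A_def B_def)
 define D where "D = A + (c + \<bar>s\<bar>)*B"
 have D: "D >= 0" using AB c0 by (simp add: D_def)
 have bound: "cmod (E z v) <= D*(cmod z + m + 1)*exp G"
  if v2: "v^2 = z^2 + of_real (m^2)" and G: "!!y. f y ~= 0 ==> - (Im v * (t + s*y)) + Im z*(x0 + c*y) <= G" for z v G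
 proof -
  have "(cmod v)^2 = cmod (z^2 + of_real (m^2))" by (metis norm_power v2)
  also have "... <= (cmod z)^2 + m^2" by (rule order_trans[OF norm_triangle_ineq]) (simp add: norm_power)
  also have "... <= (cmod z + m)^2" using m by (simp add: power2_sum)
  finally have v: "cmod v <= cmod z + m" by (rule power2_le_imp_le) (use m in simp)
  let ?e = "exp (\<i>*(of_real t * v - of_real x0*z))" and ?l = "%k. laplace k (of_real c*z - of_real s * v)"
  have key: "cmod (?e*?l k) <= 1/sqrt (2*pi)*(LI x. cmod (k x))*exp G"
   if k: "k : \<D>" "!!y. k y ~= 0 ==> f y ~= 0" for k
   by (rule laplace_le[OF k(1)]) (use G[OF k(2)] in "simp add: algebra_simps")
  have kR: "cmod (?e*?l fR) <= A*exp G" unfolding A_def by (rule key[OF tf(1)]) (auto simp: fR_def)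
  have kI: "cmod (?e*?l fI) <= B*exp G" unfolding B_def by (rule key[OF tf(2)]) (auto simp: fI_def)
  have "cmod (of_real c * v - of_real s*z) <= c*cmod v + \<bar>s\<bar>*cmod z"
   by (rule order_trans[OF norm_triangle_ineq4]) (use c0 in "simp add: norm_mult")
  also have "... <= (c + \<bar>s\<bar>)*(cmod z + m + 1)"
   unfolding distrib_right using v c0 m by (intro add_mono mult_left_mono) auto
  finally have le: "cmod (of_real c * v - of_real s*z) <= (c + \<bar>s\<bar>)*(cmod z + m + 1)" .
  have "cmod (\<i>*(of_real c * v - of_real s*z)*(?e*?l fI)) <= (c + \<bar>s\<bar>)*(cmod z + m + 1)*(B*exp G)"
   unfolding norm_mult[of "\<i>*(of_real c * v - of_real s*z)"] by (rule mult_mono[OF _ kI]) (use le AB c0 m in "simp_all add: norm_mult")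
  moreover have "A*exp G*1 <= A*exp G*(cmod z + m + 1)" using AB m by (intro mult_left_mono) auto
  hence "cmod (?e*?l fR) <= A*exp G*(cmod z + m + 1)" using kR by simp
  moreover have eq: "E z v = ?e*?l fR + \<i>*(of_real c * v - of_real s*z)*(?e*?l fI)"
   unfolding E_def by (simp add: algebra_simps)
  ultimately have "cmod (E z v) <= A*exp G*(cmod z + m + 1) + (c + \<bar>s\<bar>)*(cmod z + m + 1)*(B*exp G)"
   unfolding eq by (intro order_trans[OF norm_triangle_ineq] add_mono)
  also have "... = D*(cmod z + m + 1)*exp G" by (simp add: D_def algebra_simps)
  finally show ?thesis .
 qed
 \<comment> \<open>\<open>\<sigma> = 1\<close> bounds the support from above, \<open>\<sigma> = - 1\<close> from below\<close>
 have side: "\<sigma>*\<xi> <= N" if k: "k = hR \<or> k = hI" and k0: "k \<xi> ~= 0" and \<sigma>: "\<bar>\<sigma>\<bar> = 1"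
  and N: "!!y. f y ~= 0 ==> \<sigma>*(x0 + c*y) + \<bar>t + s*y\<bar> <= N" for k \<xi> \<sigma> N
 proof (rule ccontr)
  assume "\<not> ?thesis"
  then obtain N' where N': "N < N'" "N' < \<sigma>*\<xi>" using dense by (metis not_le)
  have ktf: "k : \<D>" using k tf by auto
  have \<sigma>2: "\<sigma>*\<sigma> = 1" using \<sigma> by (metis abs_mult_self_eq mult.right_neutral)
  have lap_bound: "cmod (laplace k (of_real (\<sigma>*\<eta>)*\<i>)) <= D*(\<eta> + m + 1)*exp (\<eta>*N)" if eta: "\<eta> >= m + 1" for \<eta>
  proof -
   define z where "z n = cor (1/real (Suc n)) + of_real (\<sigma>*\<eta>)*\<i>" for n
   let ?i = "cor (\<sigma>*\<eta>)*\<i>" and ?D = "%z. D*(cmod z + m + 1)*exp (\<eta>*N)"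
   have zRe: "Re (z n) > 0" and zIm: "Im (z n) = \<sigma>*\<eta>" for n by (simp_all add: z_def)
   have "z ----> cor 0 + ?i" unfolding z_def by (intro tendsto_intros LIMSEQ_Suc lim_1_over_n)
   hence zlim: "z ----> ?i" by simp
   have Eb: "cmod (E (z n) v) <= ?D (z n)" if v: "v^2 = (z n)^2 + of_real (m^2)" for v n
   proof (rule bound[OF v])
    fix y assume y: "f y ~= 0"
    have "\<bar>Im v\<bar> <= \<eta>" using Im_csqrt_le[OF v] \<sigma> eta m by (simp add: zIm abs_mult)
    hence "\<bar>Im v\<bar>*\<bar>t + s*y\<bar> <= \<eta>*\<bar>t + s*y\<bar>" by (rule mult_right_mono) simp
    moreover have "- (Im v * (t + s*y)) <= \<bar>Im v\<bar>*\<bar>t + s*y\<bar>" by (metis abs_ge_minus_self abs_mult)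
    moreover have "\<eta>*(\<sigma>*(x0 + c*y) + \<bar>t + s*y\<bar>) <= \<eta>*N" using N[OF y] eta m by (intro mult_left_mono) auto
    ultimately show "- (Im v * (t + s*y)) + Im (z n)*(x0 + c*y) <= \<eta>*N" by (simp add: zIm algebra_simps)
   qed
   have wge: "1 <= cmod (w (z n))" for n
   proof -
    have "(m + 1)^2 <= (cmod (z n))^2" using abs_Im_le_cmod[of "z n"] eta m \<sigma> by (intro power_mono) (auto simp: zIm abs_mult)
    moreover have "(cmod (z n))^2 - m\<^sup>2 <= (cmod (w (z n)))^2"
     using norm_triangle_ineq2[of "(z n)^2" "- of_real (m^2)"] by (simp add: norm_power[symmetric] w2) (simp add: norm_power)
    ultimately have "1^2 <= (cmod (w (z n)))^2" using m by (simp add: power2_sum)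
    thus ?thesis by (rule power2_le_imp_le) simp
   qed
   have kb: "cmod (laplace k (z n)) <= ?D (z n)" for n
   proof -
    obtain u where u: "1 <= cmod u" "cmod (u*laplace k (z n)) <= (cmod (E (z n) (w (z n))) + cmod (E (z n) (- w (z n))))/2"
    proof (cases "k = hR")
     case True
     hence eq: "1*laplace k (z n) = (E (z n) (w (z n)) + E (z n) (- w (z n)))/2" using hR[OF zRe[of n]] by simp
     show ?thesis by (rule that[of 1], simp, unfold eq) (simp add: norm_divide norm_triangle_ineq)
    next
     case False
     hence eq: "\<i>*w (z n)*laplace k (z n) = (E (z n) (w (z n)) - E (z n) (- w (z n)))/2" using k hI[OF zRe[of n]] by simp
     show ?thesis by (rule that[of "\<i>*w (z n)"], simp add: norm_mult wge, unfold eq) (simp add: norm_divide norm_triangle_ineq4)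
    qed
    have "1*cmod (laplace k (z n)) <= cmod (u*laplace k (z n))" unfolding norm_mult using u(1) by (intro mult_right_mono) auto
    thus ?thesis using u(2) Eb[of "w (z n)" n] Eb[of "- w (z n)" n] w2 by simp
   qed
   have ic: "isCont (laplace k) ?i"
    using holomorphic_on_imp_continuous_on[OF laplace_holomorphic[OF ktf]] by (simp add: continuous_on_eq_continuous_at)
   have "(%n. ?D (z n)) ----> ?D ?i"
    by (intro tendsto_intros zlim)
   from LIMSEQ_le[OF tendsto_norm[OF isCont_tendsto_compose[OF ic zlim]] this]
   have "cmod (laplace k ?i) <= ?D ?i" using kb by blast
   thus ?thesis using \<sigma> eta m by (simp add: norm_mult abs_mult)
  qed
  define \<delta> where "\<delta> = N' - N"
  have \<delta>: "\<delta> > 0" using N' by (simp add: \<delta>_def)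
  have growth: "D*(\<eta> + m + 1)*exp (\<eta>*N) <= D*(1/\<delta> + m + 1)*exp (N'*\<eta>)" if eta: "\<eta> >= 0" for \<eta>
  proof -
   have "\<delta>*\<eta> <= exp (\<delta>*\<eta>)" using exp_ge_add_one_self[of "\<delta>*\<eta>"] by linarith
   hence "\<eta> <= 1/\<delta>*exp (\<delta>*\<eta>)" using \<delta> by (simp add: field_simps)
   moreover have "(m + 1)*1 <= (m + 1)*exp (\<delta>*\<eta>)" using \<delta> eta m by (intro mult_left_mono) auto
   ultimately have "D*(\<eta> + m + 1)*exp (\<eta>*N) <= D*((1/\<delta> + m + 1)*exp (\<delta>*\<eta>))*exp (\<eta>*N)"
    using D by (intro mult_right_mono mult_left_mono) (auto simp: algebra_simps)
   thus ?thesis by (simp add: \<delta>_def exp_add[symmetric] algebra_simps)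
  qed
  let ?k = "%x. k (\<sigma>*x)"
  have refl: "laplace ?k z = laplace k (of_real \<sigma>*z)" for z
   using lborel_integral_real_affine[of \<sigma> "%x. exp (- (\<i>*(of_real \<sigma>*z) * of_real x))*k x" 0] \<sigma> \<sigma>2
   by (auto simp: laplace_def mult_ac abs_if of_real_mult[symmetric] simp del: of_real_mult split: if_splits)
  have "?k (\<sigma>*\<xi>) = 0"
  proof (rule laplace_growth_support[of ?k "D*(1/\<delta> + m + 1)" "m + 1" N'])
   show "?k : \<D>" using tf_affine[OF ktf, of \<sigma> 0] \<sigma> by auto
   show "D*(1/\<delta> + m + 1) >= 0" using D \<delta> m by simp
   show "cmod (laplace ?k (\<i> * of_real \<eta>)) <= D*(1/\<delta> + m + 1)*exp (N'*\<eta>)" if "\<eta> >= m + 1" for \<eta>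
    using lap_bound[OF that] growth[of \<eta>] that m unfolding refl by (simp add: mult_ac)
  qed (rule N'(2))
  thus False using k0 \<sigma>2 by (simp add: mult.assoc[symmetric])
 qed
 have "hR \<xi> ~= 0 \<or> hI \<xi> ~= 0" using \<xi> by (auto simp: hR_def hI_def complex_eq_iff)
 then obtain k where k: "k = hR \<or> k = hI" "k \<xi> ~= 0" by blast
 have bt1: "boost_factor L*y + (x $ 2 + x $ 1) = (x0 + c*y) + (t + s*y)" for y
  by (simp add: boost_factor_def c_def s_def t_def x0_def algebra_simps)
 have bt2: "y/boost_factor L + (x $ 2 - x $ 1) = (x0 + c*y) - (t + s*y)" for y
  using b(2) by (simp add: c_def s_def t_def x0_def algebra_simps divide_inverse)
 have "1*(x0 + c*y) + \<bar>t + s*y\<bar> <= M" "- 1*(x0 + c*y) + \<bar>t + s*y\<bar> <= - M'" if "f y ~= 0" for y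
  using M[OF that] M'[OF that] unfolding bt1 bt2 by (auto simp: abs_if)
 thus ?thesis using side[OF k, of 1 M] side[OF k, of "- 1" "- M'"] by auto
qed

section \<open>The one-particle space\<close>

subsection \<open>A bump function\<close>

text \<open>The functions \<open>p(1/x) exp(-1/x)\<close> for \<open>x > 0\<close>, with \<open>p\<close> a polynomial, extended by zero.\<close>

definition flat_fun :: "real poly => real => real" where
 "flat_fun p x = (if x > 0 then poly p (1/x)*exp (- (1/x)) else 0)"

lemma poly_exp_tendsto: "((%y. poly p y*exp (- y)) ---> 0) at_top" for p :: "real poly"
proof -
 have eq: "poly p y*exp (- y) = (\<Sum>i\<le>degree p. coeff p i*(y ^ i/exp y))" for y
  by (simp add: poly_altdef sum_distrib_right exp_minus divide_inverse mult.assoc)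
 have "((%y. \<Sum>i\<le>degree p. coeff p i*(y ^ i/exp y)) ---> (\<Sum>i\<le>degree p. coeff p i*0)) at_top"
  by (intro tendsto_sum tendsto_mult tendsto_const tendsto_power_div_exp_0)
 thus ?thesis by (simp add: eq)
qed

lemma flat_fun_deriv: "(flat_fun p has_real_derivative flat_fun (monom 1 2*(p - pderiv p)) x) (at x)"
proof -
 consider "x > 0" | "x < 0" | "x = 0" by force
 thus ?thesis
 proof cases
  case 1
  have "((%x. poly p (1/x)*exp (- (1/x))) has_real_derivative
    poly (monom 1 2*(p - pderiv p)) (1/x)*exp (- (1/x))) (at x)"
  proof -
   have d: "((%x. 1/x) has_real_derivative - (1/x^2)) (at x)"
    using 1 by (auto intro!: derivative_eq_intros simp: power2_eq_square)
   have "((%x. poly p (1/x)) has_real_derivative poly (pderiv p) (1/x)*(- (1/x^2))) (at x)"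
    by (rule DERIV_chain2[OF poly_DERIV d])
   moreover have "((%x. exp (- (1/x))) has_real_derivative exp (- (1/x))*(- (- (1/x^2)))) (at x)"
    by (rule DERIV_chain2[OF DERIV_exp DERIV_minus[OF d]])
   ultimately show ?thesis
    by (rule DERIV_cong[OF DERIV_mult]) (simp add: poly_monom power_divide algebra_simps)
  qed
  hence "(flat_fun p has_real_derivative poly (monom 1 2*(p - pderiv p)) (1/x)*exp (- (1/x))) (at x)"
   by (rule has_field_derivative_transform_within_open[of _ _ _ "{0<..}"]) (use 1 in "auto simp: flat_fun_def")
  thus ?thesis using 1 by (simp add: flat_fun_def)
 next
  case 2
  have "(flat_fun p has_real_derivative 0) (at x)"
   by (rule has_field_derivative_transform_within_open[OF DERIV_const[of 0], of "{..<0}"]) (use 2 in "auto simp: flat_fun_def")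
  thus ?thesis using 2 by (simp add: flat_fun_def)
 next
  case 3
  have "((%y. poly (pCons 0 p) y*exp (- y)) ---> 0) at_top" by (rule poly_exp_tendsto)
  hence "((%h. poly (pCons 0 p) (inverse h)*exp (- inverse h)) ---> 0) (at_right 0)"
   by (rule filterlim_compose[OF _ filterlim_inverse_at_top_right])
  hence r: "((%h. flat_fun p h/h) ---> 0) (at_right 0)"
   by (rule Lim_transform_eventually)
     (auto simp: flat_fun_def eventually_at_filter field_simps)
  have l: "((%h. flat_fun p h/h) ---> 0) (at_left 0)"
   by (rule Lim_transform_eventually[OF tendsto_const]) (auto simp: flat_fun_def eventually_at_filter)
  from l r have "((%h. flat_fun p h/h) ---> 0) (at 0)" by (rule filterlim_split_at)
  hence "((%h. (flat_fun p (0 + h) - flat_fun p 0)/h) ---> 0) (at 0)" by (simp add: flat_fun_def)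
  thus ?thesis unfolding 3 DERIV_def by (simp add: flat_fun_def)
 qed
qed

inductive_set flat_algebra :: "(real => real) set" where
 "flat_fun p : flat_algebra"
| "(%x. flat_fun p (1 - x)) : flat_algebra"
| "f : flat_algebra ==> g : flat_algebra ==> (%x. f x + g x) : flat_algebra"
| "f : flat_algebra ==> g : flat_algebra ==> (%x. f x*g x) : flat_algebra"

lemma flat_algebra_deriv:
 "f : flat_algebra ==> \<exists>f'\<in>flat_algebra. \<forall>x. (f has_real_derivative f' x) (at x)"
proof (induction rule: flat_algebra.induct)
 case (1 p)
 show ?case using flat_fun_deriv by (intro bexI[OF _ flat_algebra.intros(1)]) auto
next
 case (2 p)
 have neg: "flat_fun (- q) x = - flat_fun q x" for q x by (simp add: flat_fun_def)
 have "((%x. flat_fun p (1 - x)) has_real_derivative flat_fun (- (monom 1 2*(p - pderiv p))) (1 - x)) (at x)" for x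
 proof -
  have "((%x. 1 - x) has_real_derivative -1) (at x)" by (auto intro!: derivative_eq_intros)
  from DERIV_chain2[OF flat_fun_deriv this, of p] show ?thesis by (simp add: neg)
 qed
 thus ?case by (intro bexI[OF _ flat_algebra.intros(2)]) auto
next
 case (3 f g)
 then obtain f' g' where "f' : flat_algebra" "!!x. (f has_real_derivative f' x) (at x)"
   "g' : flat_algebra" "!!x. (g has_real_derivative g' x) (at x)" by blast
 thus ?case by (intro bexI[OF _ flat_algebra.intros(3)[of f' g']]) (auto intro!: DERIV_add)
next
 case (4 f g)
 then obtain f' g' where d: "f' : flat_algebra" "!!x. (f has_real_derivative f' x) (at x)"
   "g' : flat_algebra" "!!x. (g has_real_derivative g' x) (at x)" by blast
 have "(%x. f' x*g x + g' x*f x) : flat_algebra"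
  using flat_algebra.intros(3)[OF flat_algebra.intros(4)[OF d(1) 4(2)] flat_algebra.intros(4)[OF d(3) 4(1)]] .
 thus ?case using d(2,4) by (intro bexI[of _ "%x. f' x*g x + g' x*f x"]) (auto intro!: DERIV_mult)
qed

text \<open>A non-negative real test function with support in the unit interval.\<close>

definition bump :: "real => complex" where
 "bump x = cor (flat_fun 1 x*flat_fun 1 (1 - x))"

lemma bump_pos: "0 < x ==> x < 1 ==> Re (bump x) > 0"
 and bump_zero: "x <= 0 \<or> 1 <= x ==> bump x = 0"
 and bump_nonneg: "0 <= Re (bump x)" and bump_real: "Im (bump x) = 0"
 by (auto simp: bump_def flat_fun_def)

lemma tf_bump: "bump : \<D>"
proof -
 let ?f = "%x. flat_fun 1 x*flat_fun 1 (1 - x)"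
 have base: "?f : flat_algebra" by (intro flat_algebra.intros)
 define D where "D f = (SOME f'. f' : flat_algebra & (\<forall>x. (f has_real_derivative f' x) (at x)))" for f :: "real => real"
 have D: "D f : flat_algebra & (\<forall>x. (f has_real_derivative D f x) (at x))" if "f : flat_algebra" for f
  using someI_ex[of "%f'. f' : flat_algebra & (\<forall>x. (f has_real_derivative f' x) (at x))"] flat_algebra_deriv[OF that]
  unfolding D_def by blast
 have mem: "(D ^^ n) ?f : flat_algebra" for n by (induction n) (use base D in auto)
 show ?thesis
 proof (rule \<D>I[of _ 0 1 "%n x. cor ((D ^^ n) ?f x)"])
  show "0 <= x & x <= 1" if "bump x ~= 0" for x using that bump_zero[of x] by force
  show "(%x. cor ((D ^^ 0) ?f x)) = bump" by (simp add: bump_def fun_eq_iff)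
  show "((%x. cor ((D ^^ n) ?f x)) has_vector_derivative cor ((D ^^ Suc n) ?f x)) (at x)" for n x
   using D[OF mem[of n]] by (auto intro!: has_vector_derivative_of_real)
 qed
qed

lemma continuous_integral_zero:
 fixes f :: "'a::euclidean_space => real"
 assumes f: "continuous_on UNIV f" "!!x. f x >= 0" "integrable lborel f" "(LI x. f x) = 0"
 shows "f x = 0"
proof (rule ccontr)
 let ?U = "{x. f x ~= 0}"
 assume n: "f x ~= 0"
 have U: "open ?U" by (intro open_Collect_neq f(1) continuous_on_const)
 have "AE x in lborel. f x = 0" using integral_nonneg_eq_0_iff_AE[OF f(3)] f(2,4) by simp
 hence "?U : null_sets lborel" using U by (subst AE_iff_null_sets) auto
 hence "negligible ?U" by (simp add: negligible_iff_null_sets null_sets_completionI)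
 thus False using open_not_negligible[OF U] n by blast
qed

lemma Re_fourier_bump: "Re_fourier bump 0 ~= 0"
proof -
 have b: "cor (Re (bump x)) = bump x" for x by (simp add: complex_eq_iff bump_real)
 have i: "integrable lborel (%x. Re (bump x))" using tf_integrable[OF tf_bump] by simp
 have "(LI x. Re (bump x)) ~= 0"
  using continuous_integral_zero[OF _ bump_nonneg i, of "1/2"] bump_pos[of "1/2"] tf_continuous[OF tf_bump]
  by (auto intro: continuous_intros)
 moreover have "(LI x. bump x) = cor (LI x. Re (bump x))"
  by (subst b[symmetric]) (rule integral_complex_of_real)
 ultimately show ?thesis by (simp add: Re_fourier_def fourier_def)
qed

subsection \<open>The scalar product of the one-particle space\<close>

definition minner :: "real => (real => complex) => (real => complex) => complex" where
 "minner m f g = (LI p. cnj (ftr m f p)*ftr m g p/cor (disp m p))/2"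

lemma continuous_on_ftr: "f : \<D> ==> continuous_on A (ftr m f)"
 unfolding ftr_def[abs_def] Re_fourier_def Im_fourier_def
 by (intro continuous_intros continuous_on_subset[OF continuous_on_fourier] tf_Re tf_Im) auto

lemma ftr_decay:
 assumes f: "f : \<D>"
 obtains C where "C > 0" "!!p. cmod (ftr m f p) <= C/(1 + disp m p)"
proof -
 obtain C1 where C1: "C1 > 0" "!!p. cmod (Re_fourier f p) <= C1/(1 + p^2)"
  using fourier_decay[OF tf_Re[OF f]] unfolding Re_fourier_def by metis
 obtain C2 where C2: "C2 > 0" "!!p. cmod (Im_fourier f p) <= C2/(1 + p^2)"
  using fourier_decay[OF tf_Im[OF f]] unfolding Im_fourier_def by metis
 define C where "C = (C1 + C2)*(2*(1 + m^2))"
 have "cmod (ftr m f p) <= C/(1 + disp m p)" for p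
 proof -
  let ?w = "disp m p"
  have d: "?w >= 0" by (simp add: disp_def)
  have q: "1 + p^2 > 0" by (simp add: add_pos_nonneg)
  have "(1 + ?w)^2 <= 2*(1 + ?w^2)" using sum_squares_bound[of 1 ?w] by (simp add: power2_sum)
  also have "... <= 2*(1 + m^2)*(1 + p^2)" unfolding disp_sq by (simp add: algebra_simps)
  finally have k: "(C1 + C2)*(1 + ?w)^2 <= C*(1 + p^2)" unfolding C_def mult.assoc using C1(1) C2(1) by (intro mult_left_mono) auto
  have "cmod (ftr m f p) <= cmod (Re_fourier f p) + ?w*cmod (Im_fourier f p)"
   unfolding ftr_def by (rule order_trans[OF norm_triangle_ineq]) (use d in "simp add: norm_mult")
  also have "... <= C1/(1 + p^2) + ?w*(C2/(1 + p^2))"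
   using C1 C2 d by (intro add_mono mult_left_mono) auto
  also have "... <= (C1 + C2)*(1 + ?w)/(1 + p^2)"
   unfolding times_divide_eq_right add_divide_distrib[symmetric] using C1(1) C2(1) d q by (intro divide_right_mono) (auto simp: algebra_simps)
  also have "... <= C/(1 + ?w)" using k d q by (simp add: divide_simps power2_eq_square)
  finally show ?thesis .
 qed
 moreover have "C > 0" unfolding C_def using C1(1) C2(1) by (intro mult_pos_pos) (auto simp: add_pos_nonneg)
 ultimately show ?thesis using that by blast
qed

lemma minner_integrable:
 assumes "f : \<D>" "g : \<D>" "m > 0"
 shows "integrable lborel (%p. cnj (ftr m f p)*ftr m g p/cor (disp m p))"
proof -
 obtain C D where C: "C > 0" "!!p. cmod (ftr m f p) <= C/(1 + disp m p)"
  and D: "D > 0" "!!p. cmod (ftr m g p) <= D/(1 + disp m p)"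
  using ftr_decay assms by metis
 show ?thesis
 proof (rule BI_bound[OF integrable_inverse_square[of "C*D/m"]])
  show "(%p. cnj (ftr m f p)*ftr m g p/cor (disp m p)) : borel_measurable lborel"
   using disp_pos[OF assms(3)] by (simp, intro borel_cont continuous_intros continuous_on_ftr assms)
    (simp add: less_imp_neq[symmetric])
  have "norm (cnj (ftr m f p)*ftr m g p/cor (disp m p)) <= C*D/m/(1 + p^2)" for p
  proof -
   let ?w = "disp m p"
   have w: "m <= ?w" "0 < ?w" using disp_ge_mass disp_pos assms(3) by blast+
   have "1 + p^2 <= (1 + ?w)*(1 + ?w)" using disp_sq[of m p] w(2) zero_le_power2[of m] by (simp add: power2_eq_square algebra_simps)
   hence "C*D/((1 + ?w)*(1 + ?w)) <= C*D/(1 + p^2)" using C(1) D(1) w by (intro divide_left_mono) (auto simp: add_pos_nonneg)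
   moreover have "cmod (ftr m f p)*cmod (ftr m g p) <= C/(1 + ?w)*(D/(1 + ?w))"
    using C D w by (intro mult_mono) auto
   ultimately have "cmod (ftr m f p)*cmod (ftr m g p)/?w <= C*D/(1 + p^2)/m"
    using w assms(3) C(1) D(1) by (intro frac_le) (auto simp: add_pos_nonneg)
   thus ?thesis using w by (simp add: norm_mult norm_divide mult.commute)
  qed
  thus "AE p in lborel. norm (cnj (ftr m f p)*ftr m g p/cor (disp m p)) <= norm (C*D/m/(1 + p^2))"
   unfolding real_norm_def by (intro AE_I2 order_trans[OF _ abs_ge_self])
 qed
qed

lemma minner_add_right:
 assumes "f : \<D>" "g : \<D>" "h : \<D>" "m > 0"
 shows "minner m h (%x. f x + g x) = minner m h f + minner m h g"
 using minner_integrable[OF assms(3,1,4)] minner_integrable[OF assms(3,2,4)]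
 by (simp add: minner_def ftr_linear[OF assms(1,2)] distrib_left add_divide_distrib)

lemma minner_diff_right:
 assumes "f : \<D>" "g : \<D>" "h : \<D>" "m > 0"
 shows "minner m h (%x. f x - g x) = minner m h f - minner m h g"
 using minner_integrable[OF assms(3,1,4)] minner_integrable[OF assms(3,2,4)]
 by (simp add: minner_def ftr_linear[OF assms(1,2)] right_diff_distrib diff_divide_distrib)

lemma minner_mult_right:
 assumes "f : \<D>"
 shows "minner m h (%x. cor r*f x) = of_real r*minner m h f"
proof -
 have eq: "cnj (ftr m h p)*ftr m (%x. cor r*f x) p/cor (disp m p)
   = of_real r*(cnj (ftr m h p)*ftr m f p/cor (disp m p))" for p
  by (simp add: ftr_linear[OF assms assms])
 show ?thesis unfolding minner_def eq integral_mult_right_zero by simp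
qed

lemma minner_commute: "minner m f g = cnj (minner m g f)"
 unfolding minner_def
 by (simp add: mult.commute flip: BI_cnj)

lemma mnsq_inner:
 assumes "m > 0"
 shows "cor (mnsq m f) = minner m f f"
  "mnsq m f = (LI p. (cmod (ftr m f p))^2/disp m p)/2"
proof -
 have "(cmod (cor (disp m p powr (- 1/2)) * Re_fourier f p +
       \<i>*cor (disp m p powr (1/2))*Im_fourier f p))^2 = (cmod (ftr m f p))^2/disp m p" for p
 proof -
  have w: "disp m p > 0" by (rule disp_pos[OF assms])
  have "disp m p powr (1/2) = disp m p powr (- 1/2)*disp m p"
   using w powr_add[of "disp m p" "- 1/2" 1] by simp
  hence "cor (disp m p powr (- 1/2)) * Re_fourier f p + \<i>*cor (disp m p powr (1/2))*Im_fourier f p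
    = cor (disp m p powr (- 1/2))*ftr m f p"
   by (simp add: ftr_def algebra_simps)
  moreover have "(disp m p powr (- 1/2))^2 = 1/disp m p"
  proof -
   have "(disp m p powr (- 1/2))^2 = disp m p powr (- 1/2 + - 1/2)" by (simp only: powr_add power2_eq_square)
   also have "... = 1/disp m p" using w by simp
   finally show ?thesis .
  qed
  ultimately show ?thesis by (simp add: norm_mult power_mult_distrib)
 qed
 thus 2: "mnsq m f = (LI p. (cmod (ftr m f p))^2/disp m p)/2"
  by (simp add: mnsq_def)
 have "cnj (ftr m f p)*ftr m f p/cor (disp m p) = cor ((cmod (ftr m f p))^2/disp m p)" for p
  by (simp only: mult.commute[of "cnj _"] complex_norm_square[symmetric] of_real_divide)
 thus "cor (mnsq m f) = minner m f f"
  unfolding 2 minner_def by (simp only: integral_complex_of_real) simp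
qed

lemma mnsq_integrable:
 assumes "f : \<D>" "m > 0"
 shows "integrable lborel (%p. (cmod (ftr m f p))^2/disp m p)"
proof -
 have "cnj (ftr m f p)*ftr m f p/cor (disp m p) = cor ((cmod (ftr m f p))^2/disp m p)" for p
  by (simp only: mult.commute[of "cnj _"] complex_norm_square[symmetric] of_real_divide)
 with minner_integrable[OF assms(1,1,2)] show ?thesis by (simp only: complex_of_real_integrable_eq)
qed

lemma mnsq_nonneg: "m > 0 ==> mnsq m f >= 0"
 unfolding mnsq_def by simp

lemma mnsq_eq_0:
 assumes f: "f : \<D>" and m: "m > 0" and z: "mnsq m f = 0"
 shows "f = (%_. 0)"
proof (rule ftr_inj[OF f m])
 fix p
 have w: "disp m p > 0" for p by (rule disp_pos[OF m])
 have "(cmod (ftr m f p))^2/disp m p = 0"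
  by (rule continuous_integral_zero[OF _ _ mnsq_integrable[OF f m]])
    (use z mnsq_inner(2)[OF m, of f] w in "auto intro!: continuous_intros continuous_on_ftr[OF f] simp: less_imp_le less_imp_neq[symmetric]")
 thus "ftr m f p = 0" using w[of p] by simp
qed

lemma mnsq_diff:
 assumes "f : \<D>" "g : \<D>" "m > 0"
 shows "mnsq m (%x. f x - g x) = mnsq m f + mnsq m g - 2 * Re (minner m f g)"
proof -
 note d = tf_diff[OF assms(1,2)]
 have left: "minner m (%x. f x - g x) h = minner m f h - minner m g h" if "h : \<D>" for h
  using minner_diff_right[OF assms(1,2) that assms(3)] by (simp add: minner_commute[of m _ h])
 have "cor (mnsq m (%x. f x - g x)) = minner m f f - minner m f g - (minner m g f - minner m g g)"
  unfolding mnsq_inner(1)[OF assms(3)]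
  by (simp add: minner_diff_right[OF assms(1,2) d assms(3)] left assms)
 hence "mnsq m (%x. f x - g x) = Re (minner m f f - minner m f g - (minner m g f - minner m g g))"
  by (metis Re_complex_of_real)
 moreover have "Re (minner m g f) = Re (minner m f g)" by (subst minner_commute) simp
 moreover have "Re (minner m f f) = mnsq m f" "Re (minner m g g) = mnsq m g"
  by (metis Re_complex_of_real mnsq_inner(1)[OF assms(3)])+
 ultimately show ?thesis by simp
qed

text \<open>The symplectic form is twice the imaginary part of the scalar product, by Plancherel's formula; the other terms of the
 scalar product are hermitian in p.\<close>

lemma sympl_minner:
 assumes f: "f : \<D>" and g: "g : \<D>" and m: "m > 0"
 shows "sympl f g = 2*Im (minner m f g)"
proof -
 let ?R = "%f x. cor (Re (f x))" and ?I = "%f x. cor (Im (f x))"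
 have x_int: "integrable lborel (%x. cnj (a x)*b x)" if "a : \<D>" "b : \<D>" for a b
  using integrable_mult_bounded[of lborel "%x. cnj (a x)" b] tf_integrable[OF that(1)] tf_bounded[OF that(2)]
   borel_cont[OF tf_continuous[OF that(2)]] by (metis complex_integrable_cnj measurable_lborel2)
 have p_int: "integrable lborel (%p. cnj (fourier a p)*fourier b p)" if "a : \<D>" "b : \<D>" for a b
  using integrable_mult_bounded[of lborel "%p. cnj (fourier a p)", OF _ measurable_fourier[OF that(2)] fourier_bound[OF tf_integrable[OF that(2)]]]
   fourier_integrable[OF that(1)] by simp
 note tf = tf_Re tf_Im f g
 let ?X = "%x. cnj (f x)*g x" and ?H = "%p. cnj (ftr m f p)*ftr m g p/cor (disp m p)"
 let ?Y = "%p. cnj (fourier (?R f) p)*fourier (?I g) p - cnj (fourier (?I f) p)*fourier (?R g) p"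
 have "cor (sympl f g) = (LI x. cor (Im (?X x)))"
  unfolding sympl_def integral_complex_of_real integral_Im[OF x_int[OF f g]] ..
 also have "... = (LI x. cnj (?R f x)*?I g x - cnj (?I f x)*?R g x)"
  by (intro BI_cong) simp_all
 also have "... = (LI p. ?Y p)"
  by (simp only: Bochner_Integration.integral_diff x_int p_int plancherel tf)
 finally have s: "cor (sympl f g) = (LI p. ?Y p)" .
 have H: "integrable lborel ?H" by (rule minner_integrable[OF f g m])
 have e: "?H p - cnj (?H (- p)) = 2*\<i>*?Y p" for p
  using disp_pos[OF m, of p] by (simp add: ftr_def Re_fourier_minus Im_fourier_minus divide_simps)
   (simp add: Re_fourier_def Im_fourier_def algebra_simps)
 have i: "integrable lborel (%p. cnj (?H (- p)))" "(LI p. cnj (?H (- p))) = cnj (LI p. ?H p)"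
  using lborel_integrable_real_affine[OF H, of "-1" 0] lborel_integral_real_affine[of "-1" ?H 0]
  unfolding complex_integrable_cnj BI_cnj by simp_all
 have "(LI p. ?H p) - cnj (LI p. ?H p) = 2*\<i> * of_real (sympl f g)"
  unfolding s i(2)[symmetric] Bochner_Integration.integral_diff[OF H i(1), symmetric] e integral_mult_right_zero ..
 thus ?thesis by (simp add: minner_def complex_eq_iff)
qed

subsection \<open>Translations and dilations in the one-particle space\<close>

lemma translation_related_iff:
 "related m (mat 1, x) f h \<longleftrightarrow> h : \<D> \<and>
   (\<forall>p. ftr m h p = exp (\<i>*cor (x $ 1*disp m p - x $ 2*p))*ftr m f p)"
 by (simp add: related_iff mat2_one)

lemma minner_translation:
 assumes "related m (mat 1, x) f f'"
 shows "minner m h f' = (LI p. exp (\<i>*cor (x $ 1*disp m p - x $ 2*p)) *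
   (cnj (ftr m h p)*ftr m f p/cor (disp m p)))/2"
 using assms by (simp add: minner_def translation_related_iff mult_ac)

lemma minner_translation_both:
 assumes "related m (mat 1, x) f f'" "related m (mat 1, x) g g'"
 shows "minner m f' g' = minner m f g"
proof -
 have "cnj (ftr m f' p)*ftr m g' p = cnj (ftr m f p)*ftr m g p" for p
 proof -
  let ?e = "exp (\<i>*cor (x $ 1*disp m p - x $ 2*p))"
  have "cnj (ftr m f' p)*ftr m g' p = (cnj ?e*?e)*(cnj (ftr m f p)*ftr m g p)"
   using assms by (simp add: translation_related_iff)
  also have "cnj ?e*?e = 1" by (simp only: mult.commute[of "cnj _"] complex_norm_square[symmetric]) simp
  finally show ?thesis by simp
 qed
 thus ?thesis by (simp add: minner_def)
qed

lemma mnsq_translation: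
 assumes "m > 0" "related m (mat 1, x) f f'"
 shows "mnsq m f' = mnsq m f"
 using minner_translation_both[OF assms(2,2)] mnsq_inner(1)[OF assms(1)] by (metis of_real_eq_iff)

lemma fourier_scale:
 assumes "l > 0"
 shows "fourier (%x. f (x/l)) p = of_real l*fourier f (l*p)"
 unfolding fourier_def
 using lborel_integral_real_affine[of l "%x. exp (- (\<i>*cor (p*x)))*f (x/l)" 0] assms
 by (simp add: scaleR_conv_of_real mult_ac)

lemma disp_scale: "l > 0 ==> l*disp m p = disp (l*m) (l*p)"
 unfolding disp_def by (simp add: power_mult_distrib real_sqrt_mult flip: distrib_left)

lemma ftr_dilation:
 assumes "l > 0"
 shows "ftr m (dilation l f) p = ftr (l*m) f (l*p)"
proof -
 have R: "Re_fourier (dilation l f) p = Re_fourier f (l*p)"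
 proof -
  have eq: "(%x. cor (Re (dilation l f x))) = (%x. cor (1/l)*cor (Re (f (x/l))))"
   by (auto simp: dilation_def)
  have mul: "fourier (%x. c*k x) p = c*fourier k p" for c and k :: "real => complex"
   unfolding fourier_def by (simp add: mult.left_commute)
  show ?thesis unfolding Re_fourier_def eq mul fourier_scale[OF assms, of "%x. cor (Re (f x))"] using assms by simp
 qed
 have "(%x. cor (Im (dilation l f x))) = (%x. cor (Im (f (x/l))))"
  by (auto simp: dilation_def)
 hence I: "Im_fourier (dilation l f) p = of_real l*Im_fourier f (l*p)"
  using fourier_scale[OF assms, of "%x. cor (Im (f x))" p] by (simp add: Im_fourier_def)
 have "cor (disp (l*m) (l*p)) = cor (disp m p) * of_real l"
  by (simp add: disp_scale[OF assms, symmetric])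
 thus ?thesis unfolding ftr_def R I by (simp only: mult.assoc)
qed

text \<open>A dilation turns the norm for mass \<open>m\<close> into the one for mass \<open>l m\<close>.\<close>

lemma mnsq_dilation:
 assumes "l > 0" "m > 0"
 shows "mnsq m (dilation l f) = mnsq (l*m) f"
proof -
 have lm: "l*m > 0" using assms by simp
 let ?F = "%q. (cmod (ftr (l*m) f q))^2/disp (l*m) q"
 have "mnsq m (dilation l f) = (LI p. l*?F (0 + l*p))/2"
  unfolding mnsq_inner(2)[OF assms(2)] ftr_dilation[OF assms(1)]
  using assms by (simp add: disp_scale[OF assms(1), symmetric])
 also have "(LI p. l*?F (0 + l*p)) = l*(LI p. ?F (0 + l*p))" by (rule integral_mult_right_zero)
 also have "l*(LI p. ?F (0 + l*p)) = (LI q. ?F q)"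
  using lborel_integral_real_affine[of l ?F 0] assms by simp
 finally show ?thesis by (simp add: mnsq_inner(2)[OF lm])
qed

text \<open>The infrared divergence: the norms for small masses diverge logarithmically if the integral
 of the real part does not vanish.\<close>

lemma mnsq_diverges:
 assumes f: "f : \<D>" and c: "Re_fourier f 0 ~= 0" and m: "m > 0"
 shows "filterlim (%l. mnsq (l*m) f) at_top (at_right 0)"
proof -
 define c where "c = cmod (Re_fourier f 0)/2"
 have c0: "c > 0" using assms(2) by (simp add: c_def)
 let ?F = "%z. cmod (Re_fourier f (fst z) + \<i>*cor (snd z)*Im_fourier f (fst z))"
 have "continuous_on UNIV ?F" unfolding Re_fourier_def Im_fourier_def
  by (intro continuous_intros continuous_on_compose2[OF continuous_on_fourier] tf_Re tf_Im f subset_UNIV)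
 hence "?F \<midarrow>(0, 0)\<rightarrow> ?F (0, 0)" unfolding continuous_on_def by (rule bspec) simp
 hence "\<forall>\<^sub>F z in at (0, 0). c < ?F z" by (rule order_tendstoD) (use c0 in "simp add: c_def")
 then obtain d where d: "d > 0" "!!z. z ~= (0, 0) ==> dist z (0, 0) < d ==> c < ?F z" unfolding eventually_at by auto
 define r where "r = d/4"
 have r: "r > 0" using d(1) by (simp add: r_def)
 have lower: "c^2/4*(ln r - ln (l*m)) <= mnsq (l*m) f" if l: "l > 0" "l*m < r" for l
 proof -
  have lm: "l*m > 0" using l m by simp
  let ?g = "%p. (cmod (ftr (l*m) f p))^2/disp (l*m) p"
  have pt: "c^2/2*(1/p*indicator {l*m..r} p) <= ?g p" for p
  proof (cases "p : {l*m..r}")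
   case True
   hence p: "p > 0" "p <= r" "l*m <= p" using lm by auto
   have w: "disp (l*m) p > 0" "disp (l*m) p <= 2*p" using disp_pos[OF lm] disp_le[OF lm, of p] p by auto
   have "dist (p, disp (l*m) p) (0, 0) <= \<bar>p\<bar> + \<bar>disp (l*m) p\<bar>"
    using sqrt_sum_squares_le_sum_abs by (simp add: dist_Pair_Pair)
   also have "... < d" using p w r by (simp add: r_def)
   finally have "c < cmod (ftr (l*m) f p)" using d(2)[of "(p, disp (l*m) p)"] p by (simp add: ftr_def)
   hence "c^2/(2*p) <= ?g p" using w c0 by (intro frac_le power_mono) auto
   thus ?thesis using True by simp
  qed (use disp_pos[OF lm, of p] in simp)
  have FTC: "has_bochner_integral lborel (%x. 1/x*indicator {l*m..r} x) (ln r - ln (l*m))"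
   by (rule has_bochner_integral_FTC_Icc_real) (use l lm in "auto intro!: derivative_eq_intros continuous_intros")
  have "c^2/2*(ln r - ln (l*m)) = (LI p. c^2/2*(1/p*indicator {l*m..r} p))"
   by (simp only: integral_mult_right_zero has_bochner_integral_integral_eq[OF FTC])
  also have "... <= (LI p. ?g p)"
   by (intro integral_mono integrable_mult_right integrable.intros[OF FTC] mnsq_integrable[OF f lm] pt)
  also have "... = 2*mnsq (l*m) f" by (simp add: mnsq_inner(2)[OF lm])
  finally show ?thesis by simp
 qed
 have "filterlim (%l. c^2/4*(ln r - ln (l*m))) at_top (at_right 0)" using c0 m by real_asymp
 thus ?thesis
 proof (rule filterlim_at_top_mono)
  have "\<forall>\<^sub>F l in at_right 0. l < r/m" using r m by (intro order_tendstoD(2)[OF tendsto_ident_at]) auto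
  thus "\<forall>\<^sub>F l in at_right 0. c^2/4*(ln r - ln (l*m)) <= mnsq (l*m) f"
   using eventually_at_right_less[of 0] by eventually_elim (use lower m in "auto simp: field_simps")
 qed
qed

section \<open>Weyl operators in the vacuum representation\<close>

text \<open>Continuity of a uniformly Lipschitz family of functionals passes from a total set to all vectors.\<close>

lemma continuous_family_total:
 fixes B :: "'v::complex_normed_vector => 's::topological_space => complex"
 assumes total: "closure (cspan X) = UNIV" and lip: "!!y z s. cmod (B y s - B z s) <= K*norm (y - z)"
  and lin: "!!y z c. continuous_on UNIV (B y) ==> continuous_on UNIV (B z) ==> continuous_on UNIV (B (c *C y + z))"
  and X: "continuous_on UNIV (B 0)" "!!y. y : X ==> continuous_on UNIV (B y)"
 shows "continuous_on UNIV (B y)"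
proof -
 have "y : closure {y. continuous_on UNIV (B y)}"
 proof (rule subsetD[OF closure_mono])
  show "cspan X <= {y. continuous_on UNIV (B y)}"
  proof
   fix z assume "z : cspan X"
   thus "z : {y. continuous_on UNIV (B y)}" by induction (auto intro: X lin)
  qed
 qed (simp add: total)
 then obtain u where u: "!!n. continuous_on UNIV (B (u n))" "u ----> y" by (auto simp: closure_sequential)
 have "(%n. K*norm (u n - y)) ----> K*0" by (intro tendsto_mult tendsto_const tendsto_norm_zero LIM_zero u)
 hence K0: "(%n. K*norm (u n - y)) ----> 0" by simp
 have "uniform_limit UNIV (%n. B (u n)) (B y) sequentially"
 proof (rule uniform_limitI)
  fix e :: real assume "e > 0"
  from order_tendstoD(2)[OF K0 this] show "\<forall>\<^sub>F n in sequentially. \<forall>s\<in>UNIV. dist (B (u n) s) (B y s) < e"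
   by eventually_elim (metis dist_norm le_less_trans lip)
 qed
 thus ?thesis using u(1) by (intro uniform_limit_theorem[where f = "%n. B (u n)"]) auto
qed

lemma weakly_continuous_total:
 fixes T :: "'s::topological_space => ('h::complex_hilbert) op"
 assumes total: "closure (cspan X) = UNIV" and T: "!!s. T s : \<B>" "!!s. norm (T s) <= 1"
  and cont: "!!x y. x : X ==> y : X ==> continuous_on UNIV (%s. cinner x (T s y))"
 shows "continuous_on UNIV (%s. cinner x (T s y))"
proof (rule continuous_family_total[OF total, of "%x s. cinner x (T s y)" "norm y"])
 show "cmod (cinner x (T s y) - cinner z (T s y)) <= norm y*norm (x - z)" for x z s
  using cinner_contraction_le[OF T(2), of "x - z" s y] by (simp add: cinner_diff_left mult.commute)
 fix x assume x: "x : X"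
 show "continuous_on UNIV (%s. cinner x (T s y))"
 proof (rule continuous_family_total[OF total, of "%y s. cinner x (T s y)" "norm x"])
  show "cmod (cinner x (T s y) - cinner x (T s z)) <= norm x*norm (y - z)" for y z s
   using cinner_contraction_le[OF T(2), of x s "y - z"] by (simp add: cinner_diff_right blinfun.diff_right)
 qed (auto simp: blinfun.add_right cinner_add_right \<B>_scaleC[OF T(1)] cinner_scaleC_right intro!: continuous_intros cont x)
qed (auto simp: cinner_add_left cinner_scaleC_left intro!: continuous_intros)

lemma closure_cspan_approx:
 fixes X :: "'a::complex_normed_vector set"
 assumes "closure (cspan X) = UNIV" "e > 0"
 obtains z where "z : cspan X" "norm (x - z) < e"
 using assms closure_approachable[of x "cspan X"] by (auto simp: dist_norm norm_minus_commute)

lemma continuous_on_normal_form: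
 fixes T :: "'s::metric_space => ('h::complex_hilbert) op"
 assumes F: "normal_form N F" and T: "!!s. T s : N" "!!s. norm (T s) <= 1"
  and cont: "!!x y. continuous_on UNIV (%s. cinner x (T s y))"
 shows "continuous_on UNIV (%s. F (T s))"
 unfolding continuous_on_sequentially
proof (intro ballI allI impI)
 fix x :: "nat => 's" and a :: 's assume "(\<forall>n. x n : (UNIV::'s set)) & x ----> a"
 hence x: "x ----> a" by simp
 have "(%n. F (T (x n))) ----> F (T a)"
  by (rule normal_form_weak_limit[OF F, of _ _ 1])
    (use T cont x in "auto simp: continuous_on_sequentially comp_def")
 thus "((%s. F (T s)) \<circ> x) ----> F (T a)" by (simp add: comp_def)
qed

text \<open>For isometries, weak continuity implies strong continuity.\<close>

lemma strongly_continuous_isometries: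
 fixes T :: "'s::metric_space => ('h::complex_hilbert) op"
 assumes iso: "!!s. norm (T s y) = norm y" and cont: "!!x. continuous_on UNIV (%s. cinner x (T s y))"
 shows "continuous_on UNIV (%s. T s y)"
 unfolding continuous_on_sequentially
proof (intro ballI allI impI)
 fix x :: "nat => 's" and a :: 's assume "(\<forall>n. x n : (UNIV::'s set)) & x ----> a"
 hence x: "x ----> a" by simp
 have "(%n. cinner (T a y) (T (x n) y)) ----> cinner (T a y) (T a y)"
  using cont[of "T a y"] x by (auto simp: continuous_on_sequentially comp_def)
 hence "(%n. 2*(norm y)^2 - 2 * Re (cinner (T a y) (T (x n) y))) ----> 2*(norm y)^2 - 2 * Re (cinner (T a y) (T a y))"
  by (intro tendsto_intros)
 hence "(%n. (norm (T a y - T (x n) y))^2) ----> 0"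
  by (simp add: norm_diff_sq_cinner iso cinner_self)
 hence "(%n. norm (T a y - T (x n) y)) ----> 0"
  by simp
 hence "(%n. norm (T (x n) y - T a y)) ----> 0" by (simp add: norm_minus_commute)
 thus "((%s. T s y) \<circ> x) ----> T a y"
  unfolding comp_def by (rule LIM_zero_cancel[OF tendsto_norm_zero_cancel])
qed

text \<open>The Weyl operators \<open>V f\<close> in the vacuum representation, and the vacuum vector \<open>\<Omega>\<close>. The vectors \<open>V f \<Omega>\<close> are
 the coherent vectors.\<close>

locale vacuum_weyl =
 fixes m :: real and W :: "(real => complex) => 'w::cstar_algebra" and \<omega> :: "'w => complex"
  and rep :: "'w => ('h::complex_hilbert) op" and vac :: 'h and V :: "(real => complex) => 'h op"
 assumes m: "m > 0" and weyl: "weyl_algebra W" and vs: "vacuum_state m W \<omega>" and gns: "gns_triple \<omega> rep vac"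
  and V: "V = rep \<circ> W"
begin

lemma rep: "rep a : \<B>" "rep (a + b) = rep a + rep b" "rep (c *C a) = c *C rep a"
   "rep (a*b) = rep a oL rep b" "rep (star a) = adj (rep a)" "rep 1 = id_blinfun"
   "cinner vac (rep a vac) = \<omega> a" "closure (range (%a. blinfun_apply (rep a) vac)) = UNIV"
 using gns by (auto simp: gns_triple_def)

lemma V_bounded [simp, intro]: "V f : \<B>"
 by (simp add: V rep)

lemma W_mult:
 assumes "f : \<D>" "g : \<D>"
 shows "W f*W g = exp (- (\<i>/2)*cor (sympl f g)) *C W (%x. f x + g x)"
 using weyl assms by (auto simp: weyl_algebra_def)

lemma V_mult:
 assumes "f : \<D>" "g : \<D>"
 shows "V f oL V g = exp (- (\<i>/2)*cor (sympl f g)) *C V (%x. f x + g x)"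
 using W_mult[OF assms] by (simp add: V rep(3,4)[symmetric])

lemma W_zero: "W (%_. 0) = 1"
proof -
 have "W (%_. 0)*W (%_. 0) = W (%_. 0)"
  using W_mult[of "%_. 0" "%_. 0"] by (simp add: sympl_def)
 hence "star (W (%_. 0))*W (%_. 0)*W (%_. 0) = star (W (%_. 0))*W (%_. 0)" by (simp add: mult.assoc)
 moreover have "star (W (%_. 0))*W (%_. 0) = 1" using weyl by (auto simp: weyl_algebra_def)
 ultimately show ?thesis by simp
qed

lemma V_zero: "V (%_. 0) = id_blinfun"
 by (simp add: V W_zero rep(6))

lemma sympl_self: "f : \<D> ==> sympl f (%x. - f x) = 0"
 using sympl_minner[of f "%x. - f x" m] m minner_mult_right[of f m f "-1"]
 by (simp add: tf_uminus flip: mnsq_inner(1)[OF m])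

lemma star_W: "f : \<D> ==> star (W f) = W (%x. - f x)"
proof -
 assume f: "f : \<D>"
 have "W f*W (%x. - f x) = 1"
  using W_mult[OF f tf_uminus[OF f]] sympl_self[OF f] by (simp add: W_zero)
 hence "star (W f)*W f*W (%x. - f x) = star (W f)" by (simp add: mult.assoc)
 moreover have "star (W f)*W f = 1" using weyl f by (auto simp: weyl_algebra_def)
 ultimately show ?thesis by simp
qed

lemma adj_V: "f : \<D> ==> adj (V f) = V (%x. - f x)"
 by (simp add: V rep(5)[symmetric] star_W)

lemma V_unitary:
 assumes "f : \<D>"
 shows "adj (V f) oL V f = id_blinfun" "V f oL adj (V f) = id_blinfun"
 using weyl assms by (auto simp: V rep(4,5,6)[symmetric] weyl_algebra_def)

lemma norm_V_apply:
 assumes "f : \<D>" shows "norm (V f x) = norm x"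
proof -
 have "cinner (V f x) (V f x) = cinner x ((adj (V f) oL V f) x)" by (simp add: cinner_adj_right)
 hence "cor ((norm (V f x))^2) = cor ((norm x)^2)" by (simp add: V_unitary[OF assms] cinner_self)
 thus ?thesis by (metis of_real_eq_iff norm_ge_zero power2_eq_iff_nonneg)
qed

lemma norm_V: "f : \<D> ==> norm (V f) <= 1"
 by (rule norm_blinfun_bound) (simp_all add: norm_V_apply)

lemma omega_W: "f : \<D> ==> \<omega> (W f) = cor (exp (- (1/2)*mnsq m f))"
 using vs by (auto simp: vacuum_state_def)

lemma norm_Omega: "norm vac = 1"
proof -
 have "cinner vac vac = 1" using rep(7)[of 1] rep(6) vs by (simp add: vacuum_state_def state_def)
 thus ?thesis by (metis cinner_self of_real_eq_1_iff power2_eq_1_iff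
  abs_norm_cancel abs_minus_cancel abs_one)
qed

lemma V_vacuum: "f : \<D> ==> cinner vac (V f vac) = cor (exp (- (1/2)*mnsq m f))"
 by (simp add: V rep(7) omega_W)

text \<open>The scalar products of coherent vectors.\<close>

lemma V_coherent:
 assumes h: "h : \<D>" and f: "f : \<D>"
 shows "cinner (V h vac) (V f vac) =
  exp (minner m h f - cor (mnsq m h/2) - cor (mnsq m f/2))"
proof -
 have nh: "(%x. - h x) : \<D>" by (rule tf_uminus[OF h])
 have mi: "minner m (%x. - h x) f = - minner m h f"
 proof -
  have "minner m f (%x. - h x) = - minner m f h" using minner_mult_right[OF h, of m f "-1"] by simp
  thus ?thesis by (metis complex_cnj_minus minner_commute)
 qed
 have s: "sympl (%x. - h x) f = - 2*Im (minner m h f)"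
  using sympl_minner[OF nh f m] by (simp add: mi)
 have d: "mnsq m (%x. - h x + f x) = mnsq m h + mnsq m f - 2 * Re (minner m h f)"
 proof -
  have "mnsq m (%x. f x - h x) = mnsq m f + mnsq m h - 2 * Re (minner m f h)"
   by (rule mnsq_diff[OF f h m])
  moreover have "Re (minner m f h) = Re (minner m h f)" by (subst minner_commute) simp
  moreover have "(%x. - h x + f x) = (%x. f x - h x)" by auto
  ultimately show ?thesis by simp
 qed
 have "cinner (V h vac) (V f vac) = cinner vac ((V (%x. - h x) oL V f) vac)"
  by (simp add: cinner_adj_right[symmetric] adj_V[OF h, symmetric])
 also have "... = exp (- (\<i>/2)*cor (sympl (%x. - h x) f))*cor (exp (- (1/2)*mnsq m (%x. - h x + f x)))"
  unfolding V_mult[OF nh f] using V_vacuum[OF tf_add[OF nh f]]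
  by (simp add: scaleC_app cinner_scaleC_right)
 also have "... = exp (- (\<i>/2)*cor (sympl (%x. - h x) f) + cor (- (1/2)*mnsq m (%x. - h x + f x)))"
  by (simp only: exp_add exp_of_real)
 also have "- (\<i>/2)*cor (sympl (%x. - h x) f) + cor (- (1/2)*mnsq m (%x. - h x + f x))
   = minner m h f - cor (mnsq m h/2) - cor (mnsq m f/2)"
  unfolding s d by (simp add: complex_eq_iff field_simps)
 finally show ?thesis .
qed

lemma V_coherent_norm:
 assumes h: "h : \<D>" and f: "f : \<D>"
 shows "cmod (cinner (V h vac) (V f vac)) = exp (- (mnsq m (%x. h x - f x)/2))"
 unfolding V_coherent[OF assms] mnsq_diff[OF assms m]
 by (simp add: field_simps)

lemma V_coherent_shift_norm:
 assumes h: "h : \<D>" and f: "f : \<D>" and g: "g : \<D>"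
 shows "cmod (cinner (V f (V h vac)) (V g (V h vac))) = exp (- (mnsq m (%x. f x - g x)/2))"
proof -
 have *: "V k (V h vac) = exp (- (\<i>/2)*cor (sympl k h)) *C V (%x. k x + h x) vac" if "k : \<D>" for k
  using V_mult[OF that h] by (metis oL_app scaleC_app)
 have n: "cmod (exp (- (\<i>/2)*cor r)) = 1" for r by simp
 show ?thesis unfolding *[OF f] *[OF g]
  using V_coherent_norm[OF tf_add[OF f h] tf_add[OF g h]]
  by (simp add: cinner_scaleC_left cinner_scaleC_right norm_mult)
qed

lemma total: "closure (cspan ((%f. V f vac) ` \<D>)) = UNIV"
proof -
 let ?W = "cspan (W ` \<D>)"
 have mul1: "W f*b : ?W" if f: "f : \<D>" and b: "b : ?W" for f b
  using b
 proof (induction rule: cspan.induct)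
  case (cspan_step x y c)
  then obtain g where g: "x = W g" "g : \<D>" by blast
  have "W f*x : ?W"
   unfolding g W_mult[OF f g(2)] by (intro cspan_scaleC cspan_base imageI tf_add f g)
  thus ?case using cspan_step by (simp add: distrib_left scaleC_mult_right cspan_add cspan_scaleC)
 qed (simp add: cspan.cspan_zero)
 have mul: "a*b : ?W" if a: "a : ?W" and b: "b : ?W" for a b
  using a by (induction rule: cspan.induct)
   (auto simp: distrib_right scaleC_mult_left cspan.cspan_zero intro!: cspan_add cspan_scaleC mul1 b)
 have star: "star a : ?W" if "a : ?W" for a
  using that
 proof (induction rule: cspan.induct)
  case (cspan_step x y c)
  then obtain g where g: "x = W g" "g : \<D>" by blast
  have "star x : ?W"
   unfolding g(1) star_W[OF g(2)] by (intro cspan_base imageI tf_uminus g)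
  thus ?case using cspan_step by (simp add: star_add star_scaleC cspan_add cspan_scaleC)
 qed (use star_norm[of "0::'w"] in "simp add: cspan.cspan_zero")
 have "star (a - b) = star a - star b" for a b :: 'w using star_add[of "a - b" b] by simp
 hence sc: "continuous_on X (star :: 'w => 'w)" for X unfolding continuous_on_iff dist_norm by (metis star_norm)
 note cl = subsetD[OF closure_subset[of ?W]]
 have "cstar_subalgebra times star (closure ?W)"
  unfolding cstar_subalgebra_def
 proof (intro conjI ballI allI)
  fix a b c assume ab: "a : closure ?W" "b : closure ?W"
  show "a + b : closure ?W" "a*b : closure ?W"
   by (rule closure_binary[OF _ _ ab]; intro continuous_intros cl cspan_add mul; assumption)+
  show "star a : closure ?W" by (rule closure_unary[OF sc _ ab(1)]) (intro cl star)
  show "c *C a : closure ?W"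
   by (rule closure_unary[OF linear_continuous_on[OF bounded_linear_scaleC] _ ab(1)]) (intro cl cspan_scaleC)
 qed (auto intro: cl cspan.cspan_zero)
 moreover have "W ` \<D> <= closure ?W" by (auto intro: cl cspan_base)
 ultimately have S: "closure ?W = UNIV" using weyl by (auto simp: weyl_algebra_def cstar_generated_def)
 have sp: "rep b vac : closure (cspan ((%f. V f vac) ` \<D>))" if "b : ?W" for b
 proof -
  have "rep b vac : cspan ((%f. V f vac) ` \<D>)"
   using that
  proof (induction rule: cspan.induct)
   case cspan_zero
   have "rep 0 = 0" using rep(3)[of 0 0] by simp
   thus ?case by (simp add: cspan.cspan_zero)
  qed (auto simp: rep V blinfun.add_left scaleC_app intro!: cspan.cspan_step)
  thus ?thesis using closure_subset by blast
 qed
 have rl: "bounded_linear rep"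
 proof (rule bounded_linear_intro[where K = 1])
  show "rep (r *R x) = r *R rep x" for r x using rep(3)[of "of_real r" x] by (simp add: scaleC_of_real)
  show "norm (rep a) <= norm a*1" for a using star_rep_contractive[of rep a] by (auto simp: rep image_subset_iff)
 qed (rule rep)
 have "rep a vac : closure (cspan ((%f. V f vac) ` \<D>))" for a
  by (rule closure_unary[where F = "%a. rep a vac" and A = ?W, OF linear_continuous_on[OF bounded_linear_compose[OF blinfun.bounded_linear_left rl]] sp]) (auto simp: S)
 hence "closure (range (%a. blinfun_apply (rep a) vac)) <= closure (cspan ((%f. V f vac) ` \<D>))"
  by (intro closure_minimal) auto
 thus ?thesis using rep(8) by auto
qed

lemma V_inj:
 assumes f: "f : \<D>" and g: "g : \<D>" and eq: "V f = V g"
 shows "f = g"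
proof -
 have "cmod (cinner (V f vac) (V g vac)) = 1"
  unfolding eq cinner_self norm_V_apply[OF g] norm_Omega by simp
 hence "mnsq m (%x. f x - g x) = 0" unfolding V_coherent_norm[OF f g] by simp
 from mnsq_eq_0[OF tf_diff[OF f g] m this] show ?thesis by (auto simp: fun_eq_iff)
qed

text \<open>Weak continuity of families of Weyl operators.\<close>

lemma mnsq_mult:
 assumes f: "f : \<D>"
 shows "mnsq m (%x. of_real r*f x) = r^2*mnsq m f"
 unfolding mnsq_inner(2)[OF m] ftr_linear(2)[OF f f]
 by (simp add: norm_mult power_mult_distrib flip: times_divide_eq_right)

lemma mnsq_add:
 assumes "f : \<D>" "g : \<D>"
 shows "mnsq m (%x. f x + g x) = mnsq m f + mnsq m g + 2 * Re (minner m f g)"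
 using mnsq_diff[OF assms(1) tf_uminus[OF assms(2)] m] mnsq_mult[OF assms(2), of "-1"] minner_mult_right[OF assms(2), of m f "-1"]
 by simp

lemma V_weakly_continuous:
 fixes F :: "'s::metric_space => real => complex"
 assumes F: "!!s. F s : \<D>"
  and c1: "!!h. h : \<D> ==> continuous_on UNIV (%s. minner m h (F s))"
  and c2: "continuous_on UNIV (%s. mnsq m (F s))"
 shows "continuous_on UNIV (%s. cinner x (V (F s) y))"
proof (rule weakly_continuous_total[OF total])
 fix x y assume "x : (%f. V f vac) ` \<D>" "y : (%f. V f vac) ` \<D>"
 then obtain h k where h: "h : \<D>" "x = V h vac" and k: "k : \<D>" "y = V k vac" by blast
 have c1': "continuous_on UNIV (%s. minner m (F s) k)"
  by (subst minner_commute) (intro continuous_intros c1 k)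
 have "cinner x (V (F s) y) = exp (- (\<i>/2)*cor (2*Im (minner m (F s) k))) *
   exp (minner m h (F s) + minner m h k - cor (mnsq m h/2) -
    cor ((mnsq m (F s) + mnsq m k + 2 * Re (minner m (F s) k))/2))" for s
 proof -
  have "V (F s) y = exp (- (\<i>/2)*cor (sympl (F s) k)) *C V (%x. F s x + k x) vac"
   using V_mult[OF F k(1), of s] by (metis k(2) oL_app scaleC_app)
  thus ?thesis
   using V_coherent[OF h(1) tf_add[OF F k(1)], of s]
   by (simp add: h(2) cinner_scaleC_right sympl_minner[OF F k(1) m] mnsq_add[OF F k(1)] minner_add_right[OF F k(1) h(1) m])
 qed
 thus "continuous_on UNIV (%s. cinner x (V (F s) y))"
  by (simp only:) (intro continuous_intros c1 c1' c2 h; simp)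
qed (use F norm_V in auto)

lemma continuous_minner_mult:
 assumes f: "f : \<D>"
 shows "continuous_on UNIV (%s. cinner x (V (%t. cor s*f t) y))"
proof (rule V_weakly_continuous)
 show "(%t. cor s*f t) : \<D>" for s by (rule tf_cmult[OF f])
 show "continuous_on UNIV (%s. minner m h (%t. cor s*f t))" for h
  unfolding minner_mult_right[OF f] by (intro continuous_intros)
 show "continuous_on UNIV (%s. mnsq m (%t. cor s*f t))"
  unfolding mnsq_mult[OF f] by (intro continuous_intros)
qed

lemma continuous_minner_translation:
 fixes F :: "real^2 => real => complex"
 assumes f: "f : \<D>" and F: "!!y. related m (mat 1, y) f (F y)" and h: "h : \<D>"
 shows "continuous_on UNIV (%y. minner m h (F y))"
 unfolding continuous_on_def minner_translation[OF F]
proof (intro ballI tendsto_divide tendsto_const)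
 fix a
 let ?k = "%p. cnj (ftr m h p)*ftr m f p/cor (disp m p)"
 let ?e = "%y p. exp (\<i>*cor ((y::real^2) $ 1*disp m p - y $ 2*p))"
 have ki: "integrable lborel ?k" by (rule minner_integrable[OF h f m])
 have em: "?e y : borel_measurable lborel" for y
  by (simp, intro borel_cont continuous_intros)
 show "((%y. LI p. ?e y p*?k p) ---> (LI p. ?e a p*?k p)) (at a within UNIV)"
 proof (rule dominated_convergence_at_within)
  show "integrable lborel (%p. cmod (?k p))" using ki by (rule integrable_norm)
  show "AE p in lborel. ((%y. ?e y p*?k p) ---> ?e a p*?k p) (at a within UNIV)" by (intro AE_I2 tendsto_intros)
  show "norm (?e y p*?k p) <= cmod (?k p)" for y p by (simp only: norm_mult[of "?e y p"] norm_exp_i_times mult_1 order_refl)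
 qed (intro borel_measurable_times em borel_measurable_integrable[OF ki])+
qed simp

lemma continuous_translation:
 fixes F :: "real^2 => real => complex"
 assumes f: "f : \<D>" and F: "!!y. related m (mat 1, y) f (F y)"
 shows "continuous_on UNIV (%s. cinner x (V (F s) y))"
proof (rule V_weakly_continuous)
 show "F s : \<D>" for s using F by (simp add: related_def)
 show "continuous_on UNIV (%s. minner m h (F s))" if "h : \<D>" for h
  by (rule continuous_minner_translation[OF f F that])
 show "continuous_on UNIV (%s. mnsq m (F s))"
  by (simp add: mnsq_translation[OF m F])
qed

end

section \<open>The local net\<close>

lemma tcone_comp:
 "tcone (g \<cdot> h) a b = (%y. fst g *v y + snd g) ` tcone h a b"
 by (cases g; cases h) (simp add: poincare_simps tcone_def image_image matrix_vector_mul_assoc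
  matrix_vector_right_distrib add.assoc)

lemma tcone_one: "tcone (mat 1, 0) a b = cone_over a b"
 by (simp add: tcone_def)

definition tf_in :: "real => real => (real => complex) set" where
 "tf_in a b = {f : \<D>. supp f <= {a<..<b}}"

lemma tf_in_iff:
 "f : tf_in a b \<longleftrightarrow> f : \<D> & (\<exists>c d. a < c & d < b & (\<forall>y. f y ~= 0 --> c <= y & y <= d))" (is "?l \<longleftrightarrow> _ & ?r")
proof (intro iffI conjI)
 assume f: ?l
 thus "f : \<D>" by (simp add: tf_in_def)
 have c: "compact (supp f)" and s: "supp f <= {a<..<b}" using f by (auto simp: tf_in_def tf_def)
 have sub: "f y ~= 0 ==> y : supp f" for y using closure_subset[of "{x. f x ~= 0}"] by (auto simp: supp_def)
 show ?r
 proof (cases "supp f = {}")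
  case True thus ?thesis using sub by (intro exI[of _ "a + 1"] exI[of _ "b - 1"]) auto
 next
  case False
  obtain c where c1: "c : supp f" "\<forall>y\<in>supp f. c <= y" using compact_attains_inf[OF c False] by blast
  obtain d where d1: "d : supp f" "\<forall>y\<in>supp f. y <= d" using compact_attains_sup[OF c False] by blast
  show ?thesis using c1 d1 s sub by (intro exI[of _ c] exI[of _ d]) auto
 qed
next
 assume "f : \<D> & ?r"
 then obtain c d where f: "f : \<D>" "a < c" "d < b" "\<forall>y. f y ~= 0 --> c <= y & y <= d" by blast
 have "supp f <= {c..d}" unfolding supp_def by (rule closure_minimal) (use f(4) in auto)
 also have "... <= {a<..<b}" using f by auto
 finally show ?l using f by (simp add: tf_in_def)
qed

lemma tf_in_add: "f : tf_in a b ==> g : tf_in a b ==> (%x. f x + g x) : tf_in a b"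
proof -
 assume "f : tf_in a b" "g : tf_in a b"
 then obtain c d c' d' where "f : \<D>" "a < c" "d < b" "\<forall>y. f y ~= 0 --> c <= y & y <= d"
  "g : \<D>" "a < c'" "d' < b" "\<forall>y. g y ~= 0 --> c' <= y & y <= d'" by (metis tf_in_iff)
 thus ?thesis unfolding tf_in_iff
  by (intro conjI exI[of _ "min c c'"] exI[of _ "max d d'"] tf_add)
    (force simp: le_max_iff_disj min_le_iff_disj)+
qed

lemma tf_in_uminus: "f : tf_in a b ==> (%x. - f x) : tf_in a b"
 by (simp add: tf_in_iff tf_uminus)

lemma tf_in_zero: "(%_. 0) : tf_in a b"
 by (simp add: tf_in_def supp_def)

lemma rect_shift: "(%y. mat 1 *v y + x) ` lc_rect u0 u1 v0 v1 =
  lc_rect (u0 + (x $ 2 + x $ 1)) (u1 + (x $ 2 + x $ 1)) (v0 + (x $ 2 - x $ 1)) (v1 + (x $ 2 - x $ 1))"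
proof (intro equalityI subsetI)
 fix y assume y: "y : lc_rect (u0 + (x $ 2 + x $ 1)) (u1 + (x $ 2 + x $ 1)) (v0 + (x $ 2 - x $ 1)) (v1 + (x $ 2 - x $ 1))"
 show "y : (%y. mat 1 *v y + x) ` lc_rect u0 u1 v0 v1"
  by (rule image_eqI[of _ _ "y - x"]) (use y in "auto simp: lc_rect_def")
qed (auto simp: lc_rect_def)

lemma continuous_on_adj: "continuous_on \<B> (adj :: ('h::complex_hilbert) op => 'h op)"
 unfolding continuous_on_iff dist_norm by (metis adj_diff norm_adj \<B>_intros(4))

lemma op_algebra_closure:
 assumes U: "op_algebra U"
 shows "op_algebra (closure U)"
 unfolding op_algebra_def
proof (intro conjI ballI allI)
 note Ud = op_algebraD[OF U] and cl = subsetD[OF closure_subset[of U]]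
 show b: "closure U <= \<B>" by (rule closure_minimal) (use Ud(1) closed_\<B> in auto)
 show "id_blinfun : closure U" by (intro cl Ud)
 fix A assume A: "A : closure U"
 show "c *C A : closure U" for c
  by (rule closure_unary[OF linear_continuous_on[OF bounded_linear_scaleC] _ A]) (intro cl Ud)
 show "adj A : closure U" by (rule closure_unary[OF continuous_on_subset[OF continuous_on_adj b] _ A]) (intro cl Ud)
 fix B assume B: "B : closure U"
 show "A + B : closure U" by (rule closure_binary[OF _ _ A B]) (intro continuous_intros cl Ud; assumption)+
 show "A oL B : closure U"
  by (rule closure_binary[OF bounded_bilinear.continuous_on[OF bounded_bilinear_blinfun_compose] _ A B]) (intro continuous_intros cl Ud; assumption)+
qed

text \<open>The quasi-local algebra of an isotonous family of operator algebras.\<close>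

lemma quasi_local_op_algebra:
 assumes F: "!!R. R : \<K> ==> op_algebra (F R)"
  and mono: "!!R R'. R : \<K> ==> R' : \<K> ==> R <= R' ==> F R <= F R'"
 shows "op_algebra (quasi_local F)" "closed (quasi_local F)"
proof -
 let ?U = "\<Union>R\<in>\<K>. F R"
 have cone: "\<exists>R\<in>\<K>. R1 <= R & R2 <= R" if r: "R1 : \<K>" "R2 : \<K>" for R1 R2
 proof -
  obtain u0 u1 v0 v1 where 1: "R1 = lc_rect u0 u1 v0 v1" "u0 < u1" "v0 < v1" using double_coneE[OF r(1)] by metis
  obtain u0' u1' v0' v1' where 2: "R2 = lc_rect u0' u1' v0' v1'" "u0' < u1'" "v0' < v1'" using double_coneE[OF r(2)] by metis
  show ?thesis
   by (rule bexI[of _ "lc_rect (min u0 u0') (max u1 u1') (min v0 v0') (max v1 v1')"])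
     (unfold 1(1) 2(1), (auto simp: lc_rect_def)[1], intro lc_rect_double_cone, use 1 2 in auto)
 qed
 have two: "\<exists>R\<in>\<K>. A : F R & B : F R" if ab: "A : ?U" "B : ?U" for A B
 proof -
  obtain R1 R2 where r: "R1 : \<K>" "A : F R1" "R2 : \<K>" "B : F R2" using ab by blast
  obtain R where "R : \<K>" "R1 <= R" "R2 <= R" using cone[OF r(1,3)] by blast
  thus ?thesis using mono[OF r(1), of R] mono[OF r(3), of R] r by blast
 qed
 have "op_algebra ?U" unfolding op_algebra_def
 proof (intro conjI ballI allI)
  show "?U <= \<B>" using op_algebraD(1)[OF F] by blast
  have "lc_rect 0 1 0 1 : \<K>" by (rule lc_rect_double_cone) auto
  thus "id_blinfun : ?U" using op_algebraD(2)[OF F] by blast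
  fix A assume A: "A : ?U"
  show "adj A : ?U" "c *C A : ?U" for c using A op_algebraD(5)[OF F] op_algebraD(6)[OF F] by blast+
  fix B assume "B : ?U"
  then obtain R where "R : \<K>" "A : F R" "B : F R" using two[OF A] by blast
  thus "A + B : ?U" "A oL B : ?U" using op_algebraD(3,4)[OF F, of R A B] by blast+
 qed
 thus "op_algebra (quasi_local F)"
  unfolding quasi_local_def by (rule op_algebra_closure)
qed (simp add: quasi_local_def)

text \<open>The net \<open>N\<close> of local algebras with its quasi-local algebra \<open>QL\<close>, the Poincare automorphisms \<open>\<alpha>\<close>, among
 them the translations \<open>sh\<close>, and the dilations \<open>\<phi>\<close>.\<close>

locale weyl_net = vacuum_weyl m W \<omega> rep vac V
 for m and W :: "(real => complex) => 'w::cstar_algebra" and \<omega> and rep :: "'w => ('h::complex_hilbert) op"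
  and vac and V +
 fixes \<alpha> :: "poincare_elem => 'h op => 'h op" and \<phi> :: "real => 'h op => 'h op"
 assumes \<alpha>: "g : PG ==> weyl_automorphism m V (poincare_action m g) (\<alpha> g)"
  and \<phi>: "l > 0 ==> weyl_automorphism m V (dilation l) (\<phi> l)"
begin

abbreviation "N \<equiv> local_algebra m V"
abbreviation "QL \<equiv> quasi_local N"
abbreviation "act \<equiv> poincare_action m"
abbreviation "sh x \<equiv> \<alpha> (mat 1, x)"

lemma PG_trans [simp]: "(mat 1, x) : PG"
 by (simp add: poincare_simps)

lemma local_subset_QL: "R : \<K> ==> N R <= QL"
 unfolding quasi_local_def using closure_subset by fast

lemma cone_double_cone: "g : PG ==> a < b ==> tcone g a b : \<K>"
 unfolding \<K>_def by blast

lemma V_act_local: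
 assumes "g : PG" "a < b" "f : tf_in a b"
 shows "V (act g f) : N (tcone g a b)"
 unfolding local_algebra_def
 by (rule subset_bicommutant[THEN subsetD], blast) (use assms[unfolded tf_in_def] in blast)

lemma act_one: "f : \<D> ==> act (mat 1, 0) f = f"
 by (rule poincare_action_eq[OF m related_one])

lemma V_local: "a < b ==> f : tf_in a b ==> V f : N (cone_over a b)"
 using V_act_local[of "(mat 1, 0)" a b f] act_one[of f] by (auto simp: tcone_one tf_in_def)

lemma V_QL: "f : \<D> ==> V f : QL"
proof -
 assume f: "f : \<D>"
 obtain a b where ab: "!!x. f x ~= 0 ==> a <= x & x <= b" "a < b" using tf_interval[OF f] by metis
 have "f : tf_in (a - 1) (b + 1)" unfolding tf_in_iff using f ab by (intro conjI exI[of _ a] exI[of _ b]) auto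
 from V_local[OF _ this] ab have "V f : N (cone_over (a - 1) (b + 1))" by simp
 thus ?thesis using local_subset_QL[OF cone_double_cone[of "(mat 1, 0)" "a - 1" "b + 1"]] ab
  by (auto simp: tcone_one)
qed

lemma \<alpha>_props:
 assumes "g : PG"
 shows "star_automorphism QL (\<alpha> g)" "R : \<K> ==> normal_on (N R) (\<alpha> g)" "f : \<D> ==> \<alpha> g (V f) = V (act g f)"
 using \<alpha>[OF assms] by (auto simp: weyl_automorphism_def)

lemma \<phi>_props:
 assumes "l > 0"
 shows "star_automorphism QL (\<phi> l)" "R : \<K> ==> normal_on (N R) (\<phi> l)" "f : \<D> ==> \<phi> l (V f) = V (dilation l f)"
 using \<phi>[OF assms] by (auto simp: weyl_automorphism_def)

text \<open>The existence of the transformed test function need not be proved by analysis of Fourier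
 transforms: if no test function were related to f, then the same would hold for 2 f, and both
 Weyl operators would have the same image under the injective map \<open>\<alpha> g\<close>.\<close>

lemma act_related:
 assumes g: "g : PG" and f: "f : \<D>"
 shows "related m g f (act g f)"
proof (rule ccontr)
 assume n: "\<not> ?thesis"
 have no: "\<not> related m g f h" for h using n poincare_action_eq[OF m] by metis
 let ?f = "%x. cor 2*f x"
 have f2: "?f : \<D>" by (rule tf_cmult[OF f])
 have "\<not> related m g ?f h" for h
  using related_linear(2)[OF f2 f2, of m g h h "1/2"] no by auto
 hence "act g ?f = act g f" unfolding poincare_action_The using no by presburger
 hence "\<alpha> g (V ?f) = \<alpha> g (V f)" by (simp add: \<alpha>_props(3)[OF g] f f2[simplified])
 hence "V ?f = V f" by (rule star_automorphismD(6)[OF \<alpha>_props(1)[OF g] V_QL[OF f2] V_QL[OF f]])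
 hence "?f = f" by (rule V_inj[OF f2 f])
 hence "f x = 0" for x by (metis (no_types, lifting) mult_2 add_cancel_left_left of_real_numeral)
 hence "f = (%_. 0)" by auto
 thus False using no[of "%_. 0"] by (simp add: related_def ftr_zero)
qed

lemma tf_act: "g : PG ==> f : \<D> ==> act g f : \<D>"
 using act_related by (auto simp: related_def)

lemma act_comp: "g : PG ==> h : PG ==> f : \<D> ==>
  act g (act h f) = act (g \<cdot> h) f"
 by (rule poincare_action_eq[OF m, symmetric], rule related_comp[OF m])
   (auto intro: act_related tf_act)

lemma act_add: "g : PG ==> f : \<D> ==> h : \<D> ==>
  act g (%x. f x + h x) = (%x. act g f x + act g h x)"
 by (rule poincare_action_eq[OF m], rule related_linear(1)) (auto intro: act_related)

lemma act_cmult: "g : PG ==> f : \<D> ==>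
  act g (%x. cor r*f x) = (%x. cor r*act g f x)"
 by (rule poincare_action_eq[OF m], rule related_linear(2)) (auto intro: act_related)

lemma act_uminus: "g : PG ==> f : \<D> ==> act g (%x. - f x) = (%x. - act g f x)"
 using act_cmult[of g f "-1"] by simp

text \<open>Finite propagation speed: a localized Weyl operator may be written in the frame of any
 larger double cone.\<close>

lemma change_frame:
 assumes g: "g1 : PG" "g2 : PG" and ab: "a1 < b1"
  and sub: "tcone g1 a1 b1 <= tcone g2 a2 b2" and f: "f : tf_in a1 b1"
 shows "\<exists>f2\<in>tf_in a2 b2. act g1 f = act g2 f2"
proof -
 define h where "h = poincare_inverse g2 \<cdot> g1"
 have hc: "h : PG" unfolding h_def by (intro poincare_mult_closed poincare_inverse g)
 obtain L x where hLx: "h = (L, x)" and L: "L : lorentz" using hc by (cases h) (auto simp: poincare_simps)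
 have "tcone h a1 b1 <= (%y. fst (poincare_inverse g2) *v y + snd (poincare_inverse g2)) ` tcone g2 a2 b2"
  unfolding h_def tcone_comp by (rule image_mono[OF sub])
 also have "... = cone_over a2 b2"
  unfolding tcone_comp[symmetric] poincare_inverse(2)[OF g(2)] by (rule tcone_one)
 finally have s: "tcone (L, x) a1 b1 <= lc_rect a2 b2 a2 b2" by (simp add: hLx cone_over_rect)
 define e where "e = boost_factor L"
 have e: "e > 0" using boost_factor(1)[OF L] by (simp add: e_def)
 have s2: "a2 <= e*a1 + (x $ 2 + x $ 1)" "e*b1 + (x $ 2 + x $ 1) <= b2" "a2 <= a1/e + (x $ 2 - x $ 1)" "b1/e + (x $ 2 - x $ 1) <= b2"
  using s unfolding tcone_rect[OF L] e_def[symmetric]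
  by (subst (asm) lc_rect_subset_iff; use e ab in "simp add: divide_strict_right_mono")+
 obtain c d where cd: "f : \<D>" "a1 < c" "d < b1" "!!y. f y ~= 0 ==> c <= y & y <= d"
  using f by (metis tf_in_iff)
 define M where "M = max (e*d + (x $ 2 + x $ 1)) (d/e + (x $ 2 - x $ 1))"
 define M' where "M' = min (e*c + (x $ 2 + x $ 1)) (c/e + (x $ 2 - x $ 1))"
 have "e*d < e*b1" "d/e < b1/e" "e*a1 < e*c" "a1/e < c/e" using e cd by (auto simp: divide_strict_right_mono)
 hence MM: "M < b2" "a2 < M'" using s2 by (auto simp: M_def M'_def)
 have hr: "related m (L, x) f (act h f)" using act_related[OF hc cd(1)] by (simp add: hLx)
 have le: "c <= y & y <= d ==> e*c <= e*y & c/e <= y/e & e*y <= e*d & y/e <= d/e" for y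
  using e by (auto intro: divide_right_mono)
 have "M' <= y & y <= M" if y: "act h f y ~= 0" for y
  by (rule finite_propagation[OF m L cd(1) hr _ _ y])
    (use le[OF cd(4)] in "auto simp: M_def M'_def e_def[symmetric] le_max_iff_disj min_le_iff_disj")
 hence "act h f : tf_in a2 b2"
  unfolding tf_in_iff using MM tf_act[OF hc cd(1)] by blast
 moreover have "g2 \<cdot> h = g1"
  unfolding h_def poincare_mult_assoc[symmetric] poincare_inverse(3)[OF g(2)] by (rule poincare_one_left)
 hence "act g1 f = act g2 (act h f)" using act_comp[OF g(2) hc cd(1)] by simp
 ultimately show ?thesis by blast
qed

text \<open>The Weyl operators which generate the local algebra of the double cone \<open>g O\<close>, \<open>O\<close> being based on \<open>(a, b)\<close>.\<close>

definition frame_gens where "frame_gens g a b = (%f. V (act g f)) ` tf_in a b"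

lemma local_algebra_frame:
 assumes g: "g : PG" "a < b"
 shows "N (tcone g a b) = commutant (commutant (frame_gens g a b))"
proof -
 have "{V (act g' f) |g' a' b' f. g' : PG & a' < b' & tcone g a b = tcone g' a' b' \<and>
   f : \<D> & supp f <= {a'<..<b'}} = frame_gens g a b" (is "?X = _")
 proof (intro equalityI subsetI)
  fix A assume "A : ?X"
  then obtain g' a' b' f where A: "A = V (act g' f)" "g' : PG" "a' < b'"
   "tcone g a b = tcone g' a' b'" "f : tf_in a' b'" by (auto simp: tf_in_def)
  show "A : frame_gens g a b" using change_frame[OF A(2) g(1) A(3) _ A(5), of a b] A(1,4) by (auto simp: frame_gens_def)
 next
  fix A assume "A : frame_gens g a b"
  then obtain f where "A = V (act g f)" "f : \<D>" "supp f <= {a<..<b}" by (auto simp: frame_gens_def tf_in_def)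
  thus "A : ?X" using g by blast
 qed
 thus ?thesis by (simp add: local_algebra_def)
qed

lemma frame_gens:
 assumes g: "g : PG"
 shows "frame_gens g a b <= \<B>" "id_blinfun : frame_gens g a b" "A : frame_gens g a b ==> adj A : frame_gens g a b"
  "A : frame_gens g a b ==> B : frame_gens g a b ==> A oL B : cspan (frame_gens g a b)"
proof -
 have t: "f : tf_in a b ==> f : \<D>" for f by (simp add: tf_in_def)
 show "frame_gens g a b <= \<B>" by (auto simp: frame_gens_def)
 have "act g (%_. 0) = (%_. 0)" using act_cmult[OF g tf_zero, of 0] by simp
 thus "id_blinfun : frame_gens g a b" unfolding frame_gens_def
  by (intro image_eqI[OF _ tf_in_zero]) (simp add: V_zero)
 show "adj A : frame_gens g a b" if a: "A : frame_gens g a b"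
 proof -
  obtain f where f: "A = V (act g f)" "f : tf_in a b" using a by (auto simp: frame_gens_def)
  have "adj A = V (act g (%x. - f x))"
   by (simp add: f adj_V[OF tf_act[OF g t[OF f(2)]]] act_uminus[OF g t[OF f(2)]])
  thus ?thesis using tf_in_uminus[OF f(2)] by (auto simp: frame_gens_def)
 qed
 show "A oL B : cspan (frame_gens g a b)" if a: "A : frame_gens g a b" and b: "B : frame_gens g a b"
 proof -
  obtain f where f: "A = V (act g f)" "f : tf_in a b" using a by (auto simp: frame_gens_def)
  obtain h where h: "B = V (act g h)" "h : tf_in a b" using b by (auto simp: frame_gens_def)
  show ?thesis unfolding f(1) h(1) V_mult[OF tf_act[OF g t[OF f(2)]] tf_act[OF g t[OF h(2)]]]
   unfolding act_add[OF g t[OF f(2)] t[OF h(2)], symmetric]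
   unfolding frame_gens_def by (intro cspan_scaleC cspan_base imageI tf_in_add[OF f(2) h(2)])
 qed
qed

lemma double_cone_frame:
 assumes "R : \<K>"
 obtains g a b where "g : PG" "a < b" "R = tcone g a b"
 using assms by (auto simp: \<K>_def)

lemma local_op_algebra: "R : \<K> ==> op_algebra (N R)"
proof (erule double_cone_frame)
 fix g a b assume "g : PG" "a < b" and R: "R = tcone g a b"
 note fg = frame_gens[OF this(1), where a = a and b = b]
 show ?thesis unfolding R local_algebra_frame[OF `g : PG` \<open>a < b\<close>]
  by (intro op_algebra_commutant) (use op_algebra_commutant[OF fg(1,3)] in "auto simp: op_algebra_def")
qed

lemma closed_local: "closed (N R)"
 by (simp add: local_algebra_def closed_commutant)

lemma isotony:
 assumes "R : \<K>" "R' : \<K>" "R <= R'"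
 shows "N R <= N R'"
proof -
 obtain g a b where g: "g : PG" "a < b" "R = tcone g a b" using double_cone_frame[OF assms(1)] by metis
 obtain g' a' b' where g': "g' : PG" "a' < b'" "R' = tcone g' a' b'" using double_cone_frame[OF assms(2)] by metis
 have "frame_gens g a b <= frame_gens g' a' b'"
  using change_frame[OF g(1) g'(1) g(2)] assms(3) by (fastforce simp: frame_gens_def g g')
 thus ?thesis unfolding g(3) g'(3) local_algebra_frame[OF g(1,2)] local_algebra_frame[OF g'(1,2)] by (rule bicommutant_mono)
qed

lemma QL_algebra: "op_algebra QL" "closed QL"
 by (rule quasi_local_op_algebra; rule local_op_algebra isotony; assumption)+

lemmas QLD = op_algebraD[OF QL_algebra(1)]
lemmas \<alpha>D = star_automorphismD[OF \<alpha>_props(1)] star_automorphism_id[OF \<alpha>_props(1) QL_algebra(1)]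
 star_automorphism_diff[OF \<alpha>_props(1) QL_algebra(1)] star_automorphism_contractive[OF \<alpha>_props(1) QL_algebra]
lemmas \<phi>D = star_automorphismD[OF \<phi>_props(1)] star_automorphism_id[OF \<phi>_props(1) QL_algebra(1)]
 star_automorphism_diff[OF \<phi>_props(1) QL_algebra(1)] star_automorphism_contractive[OF \<phi>_props(1) QL_algebra]

lemma QL_diff: "A : QL ==> B : QL ==> A - B : QL"
 using QLD(3)[OF _ QLD(6)[of B "-1"], of A] by (simp add: scaleC_minus_one)

text \<open>Functionals on the quasi-local algebra are determined by their values on Weyl operators.\<close>

lemma local_eqI:
 assumes R: "R : \<K>" and F: "normal_form (N R) F" "normal_form (N R) F'"
  and eq: "!!g a b f. R = tcone g a b ==> g : PG ==> a < b ==> f : tf_in a b ==> F (V (act g f)) = F' (V (act g f))"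
  and A: "A : N R"
 shows "F A = F' A"
proof -
 obtain g a b where g: "g : PG" "a < b" "R = tcone g a b" using double_cone_frame[OF R] by metis
 note lf = local_algebra_frame[OF g(1,2), folded g(3)]
 show ?thesis
  by (rule normal_form_eq_on_bicommutant[OF frame_gens[OF g(1), where a = a and b = b]])
    (unfold lf[symmetric], use F A in auto, use eq[OF g(3,1,2)] in "auto simp: frame_gens_def")
qed

lemma QL_eqI:
 assumes F: "!!R. R : \<K> ==> normal_form (N R) F" "!!R. R : \<K> ==> normal_form (N R) F'"
  and eq: "!!f. f : \<D> ==> F (V f) = F' (V f)"
  and lip: "!!A B. A : QL ==> B : QL ==> cmod (F A - F B) <= C*norm (A - B)" "!!A B. A : QL ==> B : QL ==> cmod (F' A - F' B) <= C*norm (A - B)"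
  and A: "A : QL"
 shows "F A = F' A"
proof -
 obtain u where u: "!!n. u n : (\<Union>R\<in>\<K>. N R)" "u ----> A"
  using A by (auto simp: quasi_local_def closure_sequential)
 have eq': "F (u n) = F' (u n)" for n
 proof -
  obtain R where R: "R : \<K>" "u n : N R" using u(1) by blast
  show ?thesis
   by (rule local_eqI[OF R(1) F(1,2)[OF R(1)] _ R(2)]) (auto intro!: eq tf_act simp: tf_in_def)
 qed
 have uQ: "u n : QL" for n using u(1)[of n] local_subset_QL by blast
 have "(%n. norm (A - u n)) ----> 0"
  using tendsto_norm_zero[OF LIM_zero[OF u(2)]] by (simp add: norm_minus_commute)
 hence "(%n. C*norm (A - u n) + C*norm (A - u n)) ----> C*0 + C*0" by (intro tendsto_intros)
 moreover have le: "cmod (F A - F' A) <= C*norm (A - u n) + C*norm (A - u n)" for n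
  using lip(1)[OF A uQ[of n]] lip(2)[OF A uQ[of n]] norm_triangle_ineq4[of "F A - F (u n)" "F' A - F' (u n)"]
  by (simp add: eq')
 ultimately have "cmod (F A - F' A) <= C*0 + C*0" using LIMSEQ_le_const by blast
 thus ?thesis by simp
qed

lemma \<alpha>_lip:
 assumes "g : PG" "A : QL" "B : QL"
 shows "cmod (cinner x (\<alpha> g A y) - cinner x (\<alpha> g B y)) <= norm x*norm y*norm (A - B)"
proof -
 have "cinner x (\<alpha> g A y) - cinner x (\<alpha> g B y) = cinner x (\<alpha> g (A - B) y)"
  by (simp add: \<alpha>D(8)[OF assms] cinner_diff_right blinfun.diff_left)
 also have "cmod ... <= norm x*(norm (\<alpha> g (A - B))*norm y)"
  by (intro order_trans[OF cinner_norm_le] mult_left_mono norm_blinfun norm_ge_zero)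
 also have "... <= norm x*(norm (A - B)*norm y)"
  by (intro mult_left_mono mult_right_mono \<alpha>D(9) QL_diff assms norm_ge_zero)
 finally show ?thesis by (simp add: mult_ac)
qed

lemma automorphism_local:
 assumes h: "h : PG" "a < b" and k: "k : PG" "c < d"
  and T: "normal_on (N (tcone h a b)) \<Theta>" "!!f. f : tf_in a b ==> \<Theta> (V (act h f)) : frame_gens k c d"
  and A: "A : N (tcone h a b)" "\<Theta> A : \<B>"
 shows "\<Theta> A : N (tcone k c d)"
 unfolding local_algebra_frame[OF k]
proof (rule in_bicommutantI[OF frame_gens(1,3)[OF k(1)] A(2)])
 fix B x y assume B: "B : commutant (frame_gens k c d)"
 show "cinner x (\<Theta> A (B y)) = cinner (adj B x) (\<Theta> A y)"
 proof (rule normal_form_eq_on_bicommutant[OF frame_gens[OF h(1), where a = a and b = b], of "%A. cinner x (\<Theta> A (B y))" "%A. cinner (adj B x) (\<Theta> A y)"])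
  fix D assume "D : frame_gens h a b"
  hence "\<Theta> D oL B = B oL \<Theta> D" and "B : \<B>" using B T(2) by (auto simp: commutant_def frame_gens_def[of h])
  thus "cinner x (\<Theta> D (B y)) = cinner (adj B x) (\<Theta> D y)"
   by (metis oL_app cinner_adj_left)
 qed (use A normal_form_normal_on[OF T(1)] in "simp_all add: local_algebra_frame[OF h]")
qed

lemma local_bounded: "A : N (tcone h a b) ==> h : PG ==> a < b ==> A : QL"
 using local_subset_QL[OF cone_double_cone] by blast

lemma \<alpha>_local:
 assumes g: "g : PG" and h: "h : PG" "a < b" and A: "A : N (tcone h a b)"
 shows "\<alpha> g A : N (tcone (g \<cdot> h) a b)"
proof (rule automorphism_local[OF h poincare_mult_closed[OF g h(1)] h(2) \<alpha>_props(2)[OF g cone_double_cone[OF h]] _ A])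
 show "\<alpha> g (V (act h f)) : frame_gens (g \<cdot> h) a b" if f: "f : tf_in a b" for f
  using f tf_act[OF h(1)] by (auto simp: frame_gens_def tf_in_def \<alpha>_props(3)[OF g] act_comp[OF g h(1)])
qed (rule QLD(1)[OF \<alpha>D(1)[OF g local_bounded[OF A h]]])

lemma dilation_tf_in:
 assumes l: "l > 0" and f: "f : tf_in a b"
 shows "dilation l f : tf_in (l*a) (l*b)"
proof -
 obtain c d where cd: "f : \<D>" "a < c" "d < b" "!!x. f x ~= 0 ==> c <= x & x <= d" using f by (metis tf_in_iff)
 have "l*c <= x & x <= l*d" if "dilation l f x ~= 0" for x
 proof -
  have "f (x/l) ~= 0" using that by (auto simp: dilation_def)
  from cd(4)[OF this] show ?thesis using l by (simp add: field_simps)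
 qed
 thus ?thesis unfolding tf_in_iff using cd l tf_dilation[OF cd(1) l] mult_strict_left_mono by blast
qed

lemma \<phi>_local:
 assumes l: "l > 0" and ab: "a < b" and A: "A : N (tcone (mat 1, 0) a b)"
 shows "\<phi> l A : N (tcone (mat 1, 0) (l*a) (l*b))"
proof (rule automorphism_local[OF PG_trans ab PG_trans _ \<phi>_props(2)[OF l cone_double_cone[OF PG_trans ab]] _ A])
 show "\<phi> l (V (act (mat 1, 0) f)) : frame_gens (mat 1, 0) (l*a) (l*b)" if f: "f : tf_in a b" for f
 proof -
  have "f : \<D>" using f by (simp add: tf_in_def)
  hence "\<phi> l (V (act (mat 1, 0) f)) = V (act (mat 1, 0) (dilation l f))"
   by (simp add: act_one \<phi>_props(3)[OF l] tf_dilation l)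
  thus ?thesis using dilation_tf_in[OF l f] by (auto simp: frame_gens_def)
 qed
 show "\<phi> l A : \<B>" by (rule QLD(1)[OF \<phi>D(1)[OF l local_bounded[OF A PG_trans ab]]])
 show "l*a < l*b" using l ab by simp
qed

lemma \<alpha>_comp:
 assumes g: "g : PG" and h: "h : PG" and A: "A : QL"
 shows "\<alpha> g (\<alpha> h A) = \<alpha> (g \<cdot> h) A"
proof (intro blinfun_eqI cinner_extR)
 fix x y
 have gh: "g \<cdot> h : PG" by (rule poincare_mult_closed[OF g h])
 show "cinner x (\<alpha> g (\<alpha> h A) y) = cinner x (\<alpha> (g \<cdot> h) A y)"
 proof (rule QL_eqI[where C = "norm x*norm y", OF _ _ _ _ _ A])
  fix R assume R: "R : \<K>"
  then obtain k a b where k: "k : PG" "a < b" "R = tcone k a b" using double_cone_frame by metis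
  show "normal_form (N R) (%A. cinner x (\<alpha> (g \<cdot> h) A y))"
   by (intro normal_form_normal_on \<alpha>_props(2) gh R)
  show "normal_form (N R) (%A. cinner x (\<alpha> g (\<alpha> h A) y))"
   by (rule normal_form_comp[OF \<alpha>_props(2)[OF h R] normal_form_normal_on[OF \<alpha>_props(2)[OF g]], of "tcone (h \<cdot> k) a b"])
     (auto simp: k(3) intro!: cone_double_cone \<alpha>_local poincare_mult_closed h k)
 next
  fix f assume f: "f : \<D>"
  show "cinner x (\<alpha> g (\<alpha> h (V f)) y) = cinner x (\<alpha> (g \<cdot> h) (V f) y)"
   by (simp add: \<alpha>_props(3)[OF g] \<alpha>_props(3)[OF h] \<alpha>_props(3)[OF gh] f tf_act[OF h] act_comp[OF g h])
 next
  fix A B assume AB: "A : QL" "B : QL"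
  show "cmod (cinner x (\<alpha> (g \<cdot> h) A y) - cinner x (\<alpha> (g \<cdot> h) B y)) <= norm x*norm y*norm (A - B)"
   by (rule \<alpha>_lip[OF gh AB])
  have "cmod (cinner x (\<alpha> g (\<alpha> h A) y) - cinner x (\<alpha> g (\<alpha> h B) y)) <= norm x*norm y*norm (\<alpha> h A - \<alpha> h B)"
   by (intro \<alpha>_lip g \<alpha>D(1) h AB)
  also have "... <= norm x*norm y*norm (A - B)"
   using \<alpha>D(9)[OF h QL_diff[OF AB]] by (simp add: \<alpha>D(8)[OF h AB] mult_left_mono)
  finally show "cmod (cinner x (\<alpha> g (\<alpha> h A) y) - cinner x (\<alpha> g (\<alpha> h B) y)) <= norm x*norm y*norm (A - B)" .
 qed
qed

lemma sh_sh: "A : QL ==> sh x (sh y A) = sh (x + y) A"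
 by (simp add: \<alpha>_comp poincare_simps add.commute)

lemma cinner_lip:
 fixes A B :: "'h op" and x y :: 'h
 shows "cmod (cinner x (A y) - cinner x (B y)) <= norm x*norm y*norm (A - B)"
 unfolding cinner_diff_right[symmetric] blinfun.diff_left[symmetric]
 using mult_left_mono[OF norm_blinfun[of "A - B" y] norm_ge_zero[of x]] cinner_norm_le[of x "(A - B) y"] by (simp add: mult_ac)

lemma sh_zero: "A : QL ==> sh 0 A = A"
 by (intro blinfun_eqI cinner_extR, rule QL_eqI[of "%A. cinner _ (sh 0 A _)"])
   (auto intro!: normal_form_normal_on \<alpha>_props(2) normal_form_cinner \<alpha>_lip cinner_lip simp: \<alpha>_props(3) act_one)

lemma vacuum_invariant: "A : QL ==> cinner vac (sh x A vac) = cinner vac (A vac)"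
 by (rule QL_eqI[of "%A. cinner vac (sh x A vac)"])
   (auto intro!: normal_form_normal_on \<alpha>_props(2) normal_form_cinner \<alpha>_lip cinner_lip
    simp: \<alpha>_props(3) V_vacuum tf_act mnsq_translation[OF m act_related])

lemma norm_sh: "A : QL ==> norm (sh x A vac) = norm (A vac)"
proof -
 assume A: "A : QL"
 have b: "A : \<B>" "sh x A : \<B>" using A QLD(1) \<alpha>D(1)[OF PG_trans] by auto
 have "cinner (sh x A vac) (sh x A vac) = cinner vac (sh x (adj A oL A) vac)"
  by (simp add: \<alpha>D(2,5) A QLD(5) cinner_adj_right b)
 also have "... = cinner (A vac) (A vac)"
  by (simp add: vacuum_invariant A QLD(4,5) cinner_adj_right b)
 finally show ?thesis unfolding cinner_self of_real_eq_iff by simp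
qed

lemma sh_local:
 assumes uv: "u0 < u1" "v0 < v1" and A: "A : N (lc_rect u0 u1 v0 v1)"
 shows "sh x A : N (lc_rect (u0 + (x $ 2 + x $ 1)) (u1 + (x $ 2 + x $ 1)) (v0 + (x $ 2 - x $ 1)) (v1 + (x $ 2 - x $ 1)))"
proof -
 obtain L y b where L: "L : lorentz" "0 < b" and r: "lc_rect u0 u1 v0 v1 = tcone (L, y) 0 b" using rect_is_cone[OF uv] by metis
 have "sh x A : N (tcone ((mat 1, x) \<cdot> (L, y)) 0 b)"
  by (rule \<alpha>_local) (use A L in "auto simp: r poincare_simps")
 thus ?thesis unfolding tcone_comp r[symmetric] by (simp only: fst_conv snd_conv rect_shift)
qed

text \<open>Locality.\<close>

lemma locality:
 assumes uv: "u0 < u1" "v0 < v1" "u1 <= u0'" "v1 <= v0'" "u0' < u1'" "v0' < v1'"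
  and A: "A : N (lc_rect u0 u1 v0 v1)" and B: "B : N (lc_rect u0' u1' v0' v1')"
 shows "A oL B = B oL A"
proof -
 obtain L x b where L: "L : lorentz" "0 < b" and r: "lc_rect u0 u1 v0 v1 = tcone (L, x) 0 b" using rect_is_cone[OF uv(1,2)] by metis
 define g where "g = (L, x)"
 have g: "g : PG" using L by (simp add: g_def poincare_simps)
 define e where "e = boost_factor L"
 have e: "e > 0" using boost_factor(1)[OF L(1)] by (simp add: e_def)
 have tc: "tcone g p q = lc_rect (e*p + (x $ 2 + x $ 1)) (e*q + (x $ 2 + x $ 1)) (p/e + (x $ 2 - x $ 1)) (q/e + (x $ 2 - x $ 1))" for p q
  unfolding g_def e_def by (rule tcone_rect[OF L(1)])
 have sub: "lc_rect u0 u1 v0 v1 <= tcone g 0 b" "tcone g 0 b <= lc_rect u0 u1 v0 v1" by (simp_all add: r g_def)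
 have u1: "u1 = e*b + (x $ 2 + x $ 1)" "v1 = b/e + (x $ 2 - x $ 1)"
  using sub unfolding tc
  by (subst (asm) lc_rect_subset_iff, use uv in simp, use uv in simp,
    subst (asm) lc_rect_subset_iff, use e L in "simp_all")+
 define c where "c = Max {b + 1, (u1' - (x $ 2 + x $ 1))/e, (v1' - (x $ 2 - x $ 1))*e}"
 have c: "b < c" "u1' <= e*c + (x $ 2 + x $ 1)" "v1' <= c/e + (x $ 2 - x $ 1)"
 proof -
  have "b + 1 <= c" "(u1' - (x $ 2 + x $ 1))/e <= c" "(v1' - (x $ 2 - x $ 1))*e <= c" unfolding c_def by (intro Max_ge; simp)+
  thus "b < c" "u1' <= e*c + (x $ 2 + x $ 1)" "v1' <= c/e + (x $ 2 - x $ 1)" using e by (simp_all add: field_simps)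
 qed
 have s2: "lc_rect u0' u1' v0' v1' <= tcone g b c"
  unfolding tc by (subst lc_rect_subset_iff) (use uv u1 c in auto)
 have comm: "P oL Q = Q oL P" if P: "P : frame_gens g 0 b" and Q: "Q : frame_gens g b c" for P Q
 proof -
  obtain f where f: "P = V (act g f)" "f : tf_in 0 b" using P by (auto simp: frame_gens_def)
  obtain h where h: "Q = V (act g h)" "h : tf_in b c" using Q by (auto simp: frame_gens_def)
  have t: "f : \<D>" "h : \<D>" using f h by (auto simp: tf_in_def)
  have d: "f y = 0 \<or> h y = 0" for y using f(2) h(2) unfolding tf_in_iff by force
  have "(%y. cnj (f y)*h y) = (%y. 0)" "(%y. cnj (h y)*f y) = (%y. 0)" using d by (simp_all add: fun_eq_iff disj_commute)
  hence "sympl f h = 0" "sympl h f = 0" unfolding sympl_def by simp_all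
  hence "V f oL V h = V h oL V f" unfolding V_mult[OF t] V_mult[OF t(2,1)] by (simp add: add.commute)
  hence "\<alpha> g (V f oL V h) = \<alpha> g (V h oL V f)" by simp
  thus ?thesis by (simp add: \<alpha>D(5)[OF g] V_QL t f(1) h(1) \<alpha>_props(3)[OF g])
 qed
 have "B : N (tcone g b c)"
  using isotony[OF lc_rect_double_cone[OF uv(5,6)] cone_double_cone[OF g c(1)] s2] B by blast
 hence B': "B : commutant (commutant (frame_gens g b c))" by (simp add: local_algebra_frame[OF g c(1)])
 have A': "A : commutant (commutant (frame_gens g 0 b))" using A by (simp add: r g_def[symmetric] local_algebra_frame[OF g L(2)])
 have "frame_gens g b c <= commutant (frame_gens g 0 b)"
  using comm frame_gens(1)[OF g, of b c] by (auto simp: commutant_def)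
 hence "commutant (commutant (frame_gens g 0 b)) <= commutant (frame_gens g b c)" by (rule commutant_antimono)
 hence "A : commutant (frame_gens g b c)" using A' by blast
 thus ?thesis using B' by (auto simp: commutant_def)
qed

end

section \<open>Translates approximating a vector of positive energy\<close>

lemma integral_truncation:
 fixes f :: "real => complex"
 assumes f: "integrable lborel f"
 shows "(%n. integral {- real n..real n} f) ----> (LI x. f x)" "cmod (integral {- real n..real n} f) <= (LI x. cmod (f x))"
proof -
 have eq: "integral {- real n..real n} f = (LI x. indicator {- real n..real n} x *R f x)" for n
  using set_borel_integral_eq_integral(2)[of "{- real n..real n}" f] integrable_mult_indicator[OF _ f, of "{- real n..real n}"]
  by (simp add: set_integrable_def set_lebesgue_integral_def)
 show "(%n. integral {- real n..real n} f) ----> (LI x. f x)" unfolding eq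
 proof (rule integral_dominated_convergence[where w = "%x. cmod (f x)"])
  have "(%n. indicator {- real n..real n} x *R f x) ----> f x" for x
  proof (rule tendsto_eventually, rule eventually_sequentiallyI[of "nat \<lceil>\<bar>x\<bar>\<rceil>"])
   fix n assume "nat \<lceil>\<bar>x\<bar>\<rceil> <= n"
   hence "\<bar>x\<bar> <= real n" by simp
   thus "indicator {- real n..real n} x *R f x = f x" by (auto simp: indicator_def)
  qed
  thus "AE x in lborel. (%n. indicator {- real n..real n} x *R f x) ----> f x" by simp
 qed (use f in "auto simp: indicator_def")
 show "cmod (integral {- real n..real n} f) <= (LI x. cmod (f x))" unfolding eq
  by (rule order_trans[OF integral_norm_bound], intro integral_mono integrable_norm f integrable_mult_indicator)
    (auto simp: indicator_def)
qed

lemma resolvent_kernel: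
 assumes \<eta>: "\<eta> > 0"
 shows "integrable lborel (%s::real. C/(s^2 + \<eta>^2))" "(LI s. 1/(s^2 + \<eta>^2)) = pi/\<eta>"
proof -
 have eq: "(%s. C/((0 + \<eta> * s)^2 + \<eta>^2)) = (%s. C/\<eta>^2/(1 + s^2))" for C
  by (intro ext) (simp add: power_mult_distrib distrib_left mult.commute)
 show "integrable lborel (%s. C/(s^2 + \<eta>^2))"
  using lborel_integrable_real_affine_iff[of \<eta> "%s. C/(s^2 + \<eta>^2)" 0] integrable_inverse_square[of "C/\<eta>^2"] \<eta> unfolding eq by blast
 have "(LI s. inverse (1 + s^2 :: real)) = pi"
  using LBINT_inverse_1_plus_square by (simp add: interval_lebesgue_integral_def set_lebesgue_integral_def)
 hence "(LI s. 1/\<eta>^2/(1 + s^2)) = 1/\<eta>^2*pi"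
  using integral_mult_right_zero[of lborel "1/\<eta>^2" "%s. inverse (1 + s^2)"] by (simp add: divide_inverse)
 thus "(LI s. 1/(s^2 + \<eta>^2)) = pi/\<eta>"
  using lborel_integral_real_affine[of \<eta> "%s. 1/(s^2 + \<eta>^2)" 0] \<eta> unfolding eq by (simp add: power2_eq_square)
qed

text \<open>The kernels \<open>H(s) / (s\<^sup>2 + \<eta>\<^sup>2)\<close>, where \<open>H\<close> is holomorphic slightly beyond the closed upper half-plane, bounded there
 and vanishes at the pole \<open>\<i> \<eta>\<close>.\<close>

definition half_plane_kernel :: "(real => complex) => bool" where
 "half_plane_kernel k \<longleftrightarrow> (\<exists>H \<rho> \<eta> C. H holomorphic_on {z. Im z > - \<rho>} & 0 < \<rho> & \<rho> <= \<eta> & (\<forall>z. Im z >= 0 --> cmod (H z) <= C) \<and>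
   H (\<i> * of_real \<eta>) = 0 & k = (%s. H (of_real s)/of_real (s^2 + \<eta>^2)))"

lemma half_plane_kernel_mult:
 assumes k: "half_plane_kernel k" and F: "F holomorphic_on UNIV" "!!z. Im z >= 0 ==> cmod (F z) <= B"
 shows "half_plane_kernel (%s. k s*F (of_real s))"
proof -
 obtain H \<rho> \<eta> C where H: "H holomorphic_on {z. Im z > - \<rho>}" "0 < \<rho>" "\<rho> <= \<eta>" "!!z. Im z >= 0 ==> cmod (H z) <= C"
  "H (\<i> * of_real \<eta>) = 0" "k = (%s. H (of_real s)/of_real (s^2 + \<eta>^2))" using k unfolding half_plane_kernel_def by blast
 have "(%z. H z*F z) holomorphic_on {z. Im z > - \<rho>}" by (intro holomorphic_intros H holomorphic_on_subset[OF F(1)]) auto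
 moreover have "cmod (H z*F z) <= C*B" if "Im z >= 0" for z
  unfolding norm_mult using H(4)[OF that] F(2)[OF that] by (intro mult_mono) (auto intro: order_trans[OF norm_ge_zero])
 ultimately show ?thesis unfolding half_plane_kernel_def using H
  by (intro exI[of _ "%z. H z*F z"] exI[of _ \<rho>] exI[of _ \<eta>] exI[of _ "C*B"]) auto
qed

text \<open>Such a kernel has mean zero: the contour is closed by a large half circle.\<close>

lemma half_plane_integral:
 assumes "half_plane_kernel k"
 shows "continuous_on UNIV k" "integrable lborel k" "(LI s. k s) = 0"
proof -
 obtain H \<rho> \<eta> C where H: "H holomorphic_on {z. Im z > - \<rho>}" and \<rho>: "0 < \<rho>" "\<rho> <= \<eta>" and C: "!!z. Im z >= 0 ==> cmod (H z) <= C"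
  and z: "H (\<i> * of_real \<eta>) = 0" and k: "k = (%s. H (of_real s)/of_real (s^2 + \<eta>^2))" using assms unfolding half_plane_kernel_def by blast
 define a where "a = \<i>*cor \<eta>"
 have a: "Im a = \<eta>" "cmod a = \<eta>" "H a = 0" using \<rho> z by (auto simp: a_def norm_mult)
 have sq: "(w + a)*(w - a) = w^2 + of_real (\<eta>^2)" for w by (simp add: a_def algebra_simps power2_eq_square)
 let ?S = "{z. Im z > - \<rho>}" and ?f = "%z. H z/(z + a)"
 let ?k = "%w. ?f w/(w - a)"
 have S: "open ?S" "convex ?S" using open_halfspace_Im_gt[of "- \<rho>"] convex_halfspace_Im_gt[of "- \<rho>"] by simp_all
 have "z + a ~= 0" if "Im z > - \<rho>" for z using that \<rho> a(1) by (auto simp: add_eq_0_iff2)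
 hence f: "?f holomorphic_on ?S" by (intro holomorphic_intros H) auto
 have kk: "?k (of_real s) = k s" for s unfolding divide_divide_eq_left sq k by simp
 have C0: "0 <= C" using order_trans[OF norm_ge_zero C[of 0]] by simp
 have pos: "s^2 + \<eta>^2 > 0" for s using \<rho> by (simp add: add_nonneg_pos)
 show kc: "continuous_on UNIV k" unfolding k
  by (intro continuous_intros continuous_on_compose2[OF holomorphic_on_imp_continuous_on[OF H]])
    (use \<rho> pos in "auto intro!: continuous_intros simp del: of_real_add simp: less_imp_neq[symmetric]")
 show I: "integrable lborel k"
 proof (rule BI_bound[OF resolvent_kernel(1)[of \<eta> C]])
  have "cmod (k s) <= C/(s^2 + \<eta>^2)" for s
   unfolding k norm_divide norm_of_real using C[of "of_real s"] by (simp add: divide_right_mono)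
  thus "AE s in lborel. norm (k s) <= norm (C/(s^2 + \<eta>^2))" using C0 by auto
 qed (use \<rho> borel_cont[OF kc] in auto)
 have b: "cmod (integral {- real n..real n} k) <= C/((real n)^2 - \<eta>\<^sup>2)*real n*pi" if n: "\<eta> < real n" for n
 proof -
  define R where "R = real n"
  have R: "\<eta> < R" "0 < R" "\<eta>^2 < R^2" using n \<rho> by (auto simp: R_def power_strict_mono)
  let ?l = "linepath (- of_real R) (of_real R :: complex)" and ?c = "part_circlepath 0 R 0 pi"
  have pc: "cmod w = R & Im w >= 0" if "w : path_image ?c" for w
   using that R unfolding path_image_part_circlepath' by (auto simp: closed_segment_eq_real_ivl norm_mult sin_ge_zero)
  have "w : ?S - {a}" if "w : path_image (?l +++ ?c)" for w
  proof -
   have "w : path_image ?l \<or> w : path_image ?c" using that path_image_join_subset by blast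
   thus ?thesis using pc[of w] \<rho> R a by (auto simp: closed_segment_def)
  qed
  hence "(?k has_contour_integral (2*pi*\<i>*winding_number (?l +++ ?c) a*?f a)) (?l +++ ?c)"
   by (intro Cauchy_integral_formula_convex_simple[OF S(2) f]) (use \<rho> S a in "auto simp: interior_open")
  hence 0: "(?k has_contour_integral 0) (?l +++ ?c)" by (simp add: a)
  note c1 = contour_integrable_joinD1[OF has_contour_integral_integrable[OF 0] valid_path_linepath]
   and c2 = contour_integrable_joinD2[OF has_contour_integral_integrable[OF 0] valid_path_part_circlepath]
  have "contour_integral ?l ?k + contour_integral ?c ?k = 0"
   using contour_integral_unique[OF 0] contour_integral_join[OF c1 c2 valid_path_linepath valid_path_part_circlepath] by metis
  hence "cmod (contour_integral ?l ?k) = cmod (contour_integral ?c ?k)"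
   unfolding add_eq_0_iff2 by (simp only: norm_minus_cancel)
  also have "... <= C/(R^2 - \<eta>\<^sup>2) * R*\<bar>pi - 0\<bar>"
  proof (rule contour_integral_bound_part_circlepath[OF c2])
   show "0 <= C/(R^2 - \<eta>\<^sup>2)" using C0 R by simp
   fix w assume w: "w : path_image ?c"
   have "R^2 - \<eta>\<^sup>2 <= cmod (w^2 + of_real (\<eta>^2))"
    using norm_diff_ineq[of "w^2" "of_real (\<eta>^2)"] pc[OF w] by (simp add: norm_power)
   thus "norm (?k w) <= C/(R^2 - \<eta>\<^sup>2)"
    unfolding divide_divide_eq_left sq norm_divide using C[of w] pc[OF w] R C0 by (intro frac_le) auto
  qed (use R in auto)
  also have "contour_integral ?l ?k = integral {- R..R} k"
   unfolding kk[abs_def, symmetric] by (subst contour_integral_linepath_Reals_eq) (use R in auto)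
  finally show ?thesis by (simp add: R_def)
 qed
 have "(%n. integral {- real n..real n} k) ----> 0"
 proof (rule Lim_null_comparison)
  obtain n0 where n0: "\<eta> < real n0" using reals_Archimedean2 by blast
  show "\<forall>\<^sub>F n in sequentially. norm (integral {- real n..real n} k) <= C/((real n)^2 - \<eta>\<^sup>2)*real n*pi"
   by (rule eventually_sequentiallyI[of n0], rule b) (use n0 in linarith)
 qed real_asymp
 thus "(LI s. k s) = 0" using LIMSEQ_unique[OF integral_truncation(1)[OF I]] by blast
qed

text \<open>Truncated energies give entire functions.\<close>

lemma positive_energy_integral:
 fixes a :: "real => complex" and E :: "real => real"
 assumes k: "half_plane_kernel k"
  and a: "continuous_on UNIV a" "integrable lborel a" and E: "continuous_on UNIV E" "!!p. E p >= 0"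
 shows "(LI s. k s*exp (LI p. a p*exp (\<i> * of_real s * of_real (E p)))) = 0"
proof -
 let ?A = "LI p. cmod (a p)" and ?g = "%z p. a p*exp (\<i>*z * of_real (E p))"
 define F where "F n z = integral {- real n..real n} (?g z)" for n z
 have int: "integrable lborel (?g z)" and nrm: "cmod (?g z p) <= cmod (a p)" if "Im z >= 0" for z p
 proof -
  show le: "cmod (?g z p) <= cmod (a p)" for p using that E(2)[of p] by (simp add: norm_mult mult_left_le)
  show "integrable lborel (?g z)" by (rule BI_bound[OF a(2)])
   (use le in "auto intro!: borel_cont continuous_intros a E")
 qed
 have bd: "cmod (exp (F n z)) <= exp ?A" if "Im z >= 0" for n z
  using order_trans[OF order_trans[OF abs_Re_le_cmod integral_truncation(2)[OF int[OF that], of n]]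
   integral_mono[OF integrable_norm[OF int[OF that]] integrable_norm[OF a(2)] nrm[OF that]]] by (simp add: F_def)
 have hol: "(%z. exp (F n z)) holomorphic_on UNIV" for n
 proof -
  let ?h = "%z p. a p*(exp (\<i>*z * of_real (E p))*(\<i> * of_real (E p)))"
  have "(%z. integral (cbox (- real n) (real n)) (?g z)) holomorphic_on UNIV"
  proof (rule leibniz_rule_holomorphic[where fx = ?h])
   show "((%z. ?g z p) has_field_derivative ?h z p) (at z within UNIV)" for z p by (auto intro!: derivative_eq_intros)
   show "?g z integrable_on cbox (- real n) (real n)" for z
    by (intro integrable_continuous continuous_intros continuous_on_subset[OF a(1)] continuous_on_subset[OF E(1)]) auto
   show "continuous_on (UNIV \<times> cbox (- real n) (real n)) (%(z, p). ?h z p)" unfolding split_beta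
    by (intro continuous_intros continuous_on_compose2[OF a(1)] continuous_on_compose2[OF E(1)]) auto
  qed auto
  thus ?thesis unfolding F_def[abs_def] by (intro holomorphic_intros) simp
 qed
 note hp = half_plane_integral[OF half_plane_kernel_mult[OF k hol bd]]
 have "(%n. LI s. k s*exp (F n (of_real s))) ----> (LI s. k s*exp (LI p. ?g (of_real s) p))"
 proof (rule integral_dominated_convergence[where w = "%s. cmod (k s)*exp ?A"])
  have 1: "(%n. k s*exp (F n (of_real s))) ----> k s*exp (LI p. ?g (of_real s) p)" for s
   unfolding F_def by (intro tendsto_intros integral_truncation(1) int) simp
  thus "AE s in lborel. (%n. k s*exp (F n (of_real s))) ----> k s*exp (LI p. ?g (of_real s) p)" by simp
  show m: "(%s. k s*exp (F n (of_real s))) : borel_measurable lborel" for n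
   by (rule borel_measurable_integrable[OF hp(2)])
  show "(%s. k s*exp (LI p. ?g (of_real s) p)) : borel_measurable lborel"
   by (rule borel_measurable_LIMSEQ_metric[OF m 1])
  show "AE s in lborel. norm (k s*exp (F n (of_real s))) <= cmod (k s)*exp ?A" for n
   unfolding norm_mult by (intro AE_I2 mult_left_mono bd) auto
 qed (use half_plane_integral(2)[OF k] in simp)
 thus ?thesis using hp(3) LIMSEQ_unique[OF _ tendsto_const] by simp
qed

text \<open>Continuous bounded functions which are annihilated by all these kernels.\<close>

definition annihilated :: "(real => complex) => bool" where
 "annihilated F \<longleftrightarrow> continuous_on UNIV F & (\<exists>B. \<forall>s. cmod (F s) <= B) & (\<forall>k. half_plane_kernel k --> (LI s. k s*F s) = 0)"

lemma annihilated_integrable: "integrable lborel k ==> annihilated F ==> integrable lborel (%s. k s*F s)"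
 using integrable_mult_bounded[of lborel k F] borel_cont[of F] by (auto simp: annihilated_def)

lemma annihilated_lincomb:
 assumes F: "annihilated F" "annihilated F'"
 shows "annihilated (%s. c*F s + F' s)"
proof -
 obtain B B' where B: "!!s. cmod (F s) <= B" "!!s. cmod (F' s) <= B'" using F unfolding annihilated_def by metis
 have "cmod (c*F s + F' s) <= cmod c*B + B'" for s
  by (rule order_trans[OF norm_triangle_ineq]) (auto simp: norm_mult intro!: add_mono mult_left_mono B)
 moreover have "(LI s. c*(k s*F s) + k s*F' s) = 0" if "half_plane_kernel k" for k
  using annihilated_integrable[OF half_plane_integral(2)[OF that]] F that unfolding annihilated_def by (simp add: F)
 ultimately show ?thesis using F unfolding annihilated_def
  by (auto intro!: continuous_intros simp: algebra_simps)
qed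

lemma annihilated_limit:
 assumes "!!e. e > 0 ==> \<exists>F'. annihilated F' & (\<forall>s. cmod (F s - F' s) <= e)"
 shows "annihilated F"
proof -
 have "\<forall>n. \<exists>F'. annihilated F' & (\<forall>s. cmod (F s - F' s) <= inverse (real (Suc n)))" using assms by simp
 then obtain G where G: "!!n. annihilated (G n)" "!!n s. cmod (F s - G n s) <= inverse (real (Suc n))" by metis
 have "uniform_limit UNIV G F sequentially"
 proof (rule uniform_limitI)
  fix e :: real assume "e > 0"
  from order_tendstoD(2)[OF LIMSEQ_inverse_real_of_nat this] show "\<forall>\<^sub>F n in sequentially. \<forall>s\<in>UNIV. dist (G n s) (F s) < e"
   by eventually_elim (use G(2) in "auto simp: dist_norm norm_minus_commute intro: le_less_trans")
 qed
 hence c: "continuous_on UNIV F" by (rule uniform_limit_theorem[rotated]) (use G(1) in "auto simp: annihilated_def")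
 obtain B where "!!s. cmod (G 0 s) <= B" using G(1)[of 0] unfolding annihilated_def by metis
 hence B: "cmod (F s) <= B + 1" for s using G(2)[of s 0] norm_triangle_sub[of "F s" "G 0 s"] by (simp add: add_mono order_trans)
 have "(LI s. k s*F s) = 0" if k: "half_plane_kernel k" for k
 proof -
  note K = half_plane_integral(2)[OF k]
  have i: "integrable lborel (%s. k s*F s)"
   using integrable_mult_bounded[OF K _ B] borel_cont[OF c] by simp
  note j = annihilated_integrable[OF K G(1)]
  have "cmod (LI s. k s*F s - k s*G n s) <= (LI s. cmod (k s)*inverse (real (Suc n)))" for n
   by (intro BI_norm_bound Bochner_Integration.integrable_diff i j integrable_mult_left integrable_norm K)
     (simp only: right_diff_distrib[symmetric] norm_mult mult_left_mono[OF G(2)] norm_ge_zero)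
  hence "cmod (LI s. k s*F s) <= (LI s. cmod (k s))*inverse (real (Suc n))" for n
   using i j G(1) k by (simp add: annihilated_def)
  hence "cmod (LI s. k s*F s) <= (LI s. cmod (k s))*0"
   by (intro LIMSEQ_le_const[OF tendsto_mult[OF tendsto_const LIMSEQ_inverse_real_of_nat]]) blast
  thus ?thesis by simp
 qed
 thus ?thesis using c B by (auto simp: annihilated_def)
qed

lemma riemann_sum_bound:
 fixes F :: "real => complex"
 assumes k: "integrable lborel k" "integrable lborel (%s. k s*F s)" and d: "!!s t. \<bar>s - t\<bar> <= h ==> cmod (F s - F t) <= d" and h: "h >= 0"
 shows "cmod ((LINT s:{a..<a + real n*h}|lborel. k s*F s) -
  (\<Sum>j<n. (LINT s:{a + real j*h..<a + real (Suc j)*h}|lborel. k s)*F (a + real j*h))) <= d*(LINT s:{a..<a + real n*h}|lborel. cmod (k s))"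
proof (induction n)
 case (Suc n)
 let ?t = "a + real n*h" and ?u = "a + real (Suc n)*h"
 have si: "set_integrable lborel S f" if "integrable lborel f" "S : sets borel" for S and f :: "real => 'b::{banach, second_countable_topology}"
  using integrable_mult_indicator[of S lborel f] that by (simp add: set_integrable_def)
 note si = si[OF k(1)] si[OF k(2)] si[OF integrable_norm[OF k(1)]]
 have "?t <= ?u" "a <= ?t" using h by (auto simp: mult_right_mono)
 hence U: "{a..<?u} = {a..<?t} \<union> {?t..<?u}" by auto
 have "(LINT s:{?t..<?u}|lborel. k s*F s) - (LINT s:{?t..<?u}|lborel. k s)*F ?t = (LINT s:{?t..<?u}|lborel. k s*F s - k s*F ?t)"
  using si by (simp add: set_integral_diff)
 also have "cmod ... <= (LINT s:{?t..<?u}|lborel. d*cmod (k s))"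
  unfolding set_lebesgue_integral_def
 proof (rule BI_norm_bound)
  fix s show "norm (indicat_real {?t..<?u} s *R (k s*F s - k s*F ?t)) <= indicat_real {?t..<?u} s *R (d*cmod (k s))"
   using d[of s ?t] by (cases "s : {?t..<?u}") (auto simp: right_diff_distrib[symmetric] norm_mult mult.commute[of d] distrib_right intro!: mult_left_mono)
 qed (fold set_integrable_def, use si in auto)
 finally show ?case using Suc.IH norm_triangle_ineq unfolding U
  by (simp add: set_integral_Un si distrib_left) (smt (verit, best) add_diff_add norm_triangle_ineq)
qed (simp add: set_lebesgue_integral_def)

text \<open>For a family of annihilated functions with a common bound and a common modulus of continuity the value at 0 is approximated,
 uniformly in the family, by a linear combination of values on any given interval. Up to annihilated kernels the evaluation at 0
 is close to a Poisson kernel, and this kernel may be multiplied by a function which is 1 at the pole and small outside the interval.\<close>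

lemma annihilated_approx:
 assumes mod: "!!d. d > 0 ==> \<exists>\<delta>>0. \<forall>F\<in>\<F>. \<forall>s t. \<bar>s - t\<bar> < \<delta> --> cmod (F s - F t) <= d"
  and ann: "!!F. F : \<F> ==> annihilated F" and M: "!!F s. F : \<F> ==> cmod (F s) <= M" "M > 0" and r: "r > 0" and \<epsilon>: "\<epsilon> > 0"
 shows "\<exists>(n::nat) c t. (\<forall>j<n. \<bar>t j - s0\<bar> < r) & (\<forall>F\<in>\<F>. cmod (F 0 - (\<Sum>j<n. c j*F (t j))) <= \<epsilon>)"
proof -
 obtain \<delta> where \<delta>: "\<delta> > 0" "!!F s t. F : \<F> ==> \<bar>s - t\<bar> < \<delta> ==> cmod (F s - F t) <= \<epsilon>/4" using mod[of "\<epsilon>/4"] \<epsilon> by auto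
 \<comment> \<open>The Poisson kernel \<open>P\<close> is so narrow that its average of \<open>F\<close> is within \<open>\<epsilon> / 2\<close> of \<open>F 0\<close>.\<close>
 define \<eta> where "\<eta> = \<epsilon>*\<delta>/(16*M)"
 have \<eta>: "\<eta> > 0" using \<epsilon> \<delta> M(2) by (simp add: \<eta>_def)
 define P where "P s = \<eta>/pi/(s^2 + \<eta>^2)" for s
 have Pi: "integrable lborel P" unfolding P_def by (rule resolvent_kernel(1)[OF \<eta>])
 have p: "s^2 + \<eta>^2 > 0" "s^2 + \<delta>^2 > 0" for s using \<eta> \<delta> by (auto simp: add_nonneg_pos)
 have P0: "P s >= 0" for s using \<eta> by (simp add: P_def)
 have P1: "(LI s. P s) = 1"
  using resolvent_kernel(2)[OF \<eta>] integral_mult_right_zero[of lborel "\<eta>/pi" "%s. 1/(s^2 + \<eta>^2)"] \<eta> by (simp add: P_def)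
 let ?T = "%s. \<epsilon>/4*P s + \<epsilon>*\<delta>/(4*pi)*(1/(s^2 + \<delta>^2))"
 have tail: "P s*cmod (F 0 - F s) <= ?T s" if F: "F : \<F>" for F s
 proof (cases "\<bar>s\<bar> < \<delta>")
  case True
  hence "P s*cmod (F 0 - F s) <= P s*(\<epsilon>/4)" using \<delta>(2)[OF F, of 0 s] by (intro mult_left_mono P0) auto
  moreover have "\<epsilon>*\<delta>/(4*pi)*(1/(s^2 + \<delta>^2)) >= 0" using \<epsilon> \<delta>(1) by simp
  ultimately show ?thesis by (simp add: mult.commute)
 next
  case False
  hence "\<delta>^2 <= s^2" using \<delta>(1) by (metis abs_le_square_iff abs_of_pos not_le)
  hence "1/(s^2 + \<eta>^2) <= 2/(s^2 + \<delta>^2)" using p[of s] \<eta> by (simp add: field_simps add_increasing2)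
  hence "2*M*\<eta>/pi*(1/(s^2 + \<eta>^2)) <= 2*M*\<eta>/pi*(2/(s^2 + \<delta>^2))" using M(2) \<eta> by (intro mult_left_mono) auto
  also have "2*M*\<eta>/pi*(2/(s^2 + \<delta>^2)) = \<epsilon>*\<delta>/(4*pi)*(1/(s^2 + \<delta>^2))" using M(2) by (simp add: \<eta>_def)
  finally have "P s*(2*M) <= \<epsilon>*\<delta>/(4*pi)*(1/(s^2 + \<delta>^2))" by (simp add: P_def mult_ac)
  moreover have "P s*cmod (F 0 - F s) <= P s*(2*M)"
   using norm_triangle_ineq4[of "F 0" "F s"] M(1)[OF F, of 0] M(1)[OF F, of s] by (intro mult_left_mono P0) auto
  moreover have "\<epsilon>/4*P s >= 0" using P0 \<epsilon> by simp
  ultimately show ?thesis by linarith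
 qed
 have Ti: "integrable lborel ?T" by (intro Bochner_Integration.integrable_add integrable_mult_right Pi resolvent_kernel(1) \<delta>)
 have T1: "(LI s. ?T s) = \<epsilon>/2"
  by (subst Bochner_Integration.integral_add) (simp_all only: integral_mult_right_zero integrable_mult_right Pi P1 resolvent_kernel[OF \<delta>(1)], use \<delta>(1) in simp)
 define a where "a = \<i>*cor \<eta>"
 define D d where "D = \<eta>/(s0^2 + 4*\<eta>^2)" and "d = D/2"
 have d: "d > 0" using \<eta> by (simp add: d_def D_def add_nonneg_pos)
 define \<rho> where "\<rho> = min \<eta> (r^2/4*d)"
 have \<rho>: "0 < \<rho>" "\<rho> <= \<eta>" "\<rho> <= r^2/4*d" using \<eta> d r by (auto simp: \<rho>_def)
 \<comment> \<open>The real part of \<open>q\<close> is at least \<open>2 d\<close> at the pole \<open>a\<close> of \<open>P\<close>, and at most \<open>d\<close> on the line outside the interval.\<close>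
 define q where "q z = \<i>/(z - of_real s0 + \<i> * of_real \<rho>)" for z
 have Req: "Re (q z) = (Im z + \<rho>)/((Re z - s0)^2 + (Im z + \<rho>)^2)" for z by (simp add: q_def Re_divide)
 have qa: "2*d <= Re (q a)"
 proof -
  have "(\<eta> + \<rho>)^2 <= (2*\<eta>)^2" using \<rho> by (intro power_mono) auto
  hence "\<eta>/(s0^2 + 4*\<eta>^2) <= (\<eta> + \<rho>)/(s0^2 + (\<eta> + \<rho>)^2)"
   using \<rho> by (intro frac_le) (auto simp: add_nonneg_pos)
  thus ?thesis by (simp add: Req d_def D_def[symmetric] a_def)
 qed
 obtain N where N: "exp (- d) ^ N < \<epsilon>/4/M" using real_arch_pow_inv[of "\<epsilon>/4/M" "exp (- d)"] \<epsilon> M(2) d by auto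
 define G where "G z = exp (q z - q a) ^ N" for z
 have cG: "cmod (G z) = exp (Re (q z) - Re (q a)) ^ N" for z by (simp add: G_def norm_power)
 have small: "cmod (G (of_real s)) <= \<epsilon>/4/M" if s: "\<bar>s - s0\<bar> >= r/2" for s
 proof -
  have "(r/2)^2 <= (s - s0)^2" using s r by (metis abs_le_square_iff abs_of_pos half_gt_zero)
  hence "\<rho>/((s - s0)^2 + \<rho>^2) <= (r^2/4*d)/(r/2)^2" using \<rho> r by (intro frac_le) (auto simp: add_increasing2)
  hence "Re (q (of_real s)) - Re (q a) <= - d" using qa r by (simp add: Req power_divide)
  hence "exp (Re (q (of_real s)) - Re (q a)) ^ N <= exp (- d) ^ N" by (intro power_mono) auto
  thus ?thesis using N by (simp add: cG)
 qed
 define K where "K = exp (1/\<rho>) ^ N"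
 have K: "cmod (G z) <= K" if "Im z >= 0" for z
 proof -
  have "\<rho> <= cmod (z - of_real s0 + \<i> * of_real \<rho>)" using that \<rho> abs_Im_le_cmod[of "z - of_real s0 + \<i> * of_real \<rho>"] by simp
  hence "cmod (q z) <= 1/\<rho>" using \<rho> by (simp add: q_def norm_divide frac_le)
  hence "Re (q z) - Re (q a) <= 1/\<rho>" using qa d complex_Re_le_cmod[of "q z"] by linarith
  thus ?thesis unfolding cG K_def by (intro power_mono) auto
 qed
 have K0: "K > 0" by (simp add: K_def)
 have nz: "z - of_real s0 + \<i> * of_real \<rho> ~= 0" if "Im z > - \<rho>" for z using that by (auto simp: complex_eq_iff)
 have Gh: "G holomorphic_on {z. Im z > - \<rho>}" unfolding G_def[abs_def] q_def by (intro holomorphic_intros) (use nz in auto)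
 have Gc: "continuous_on UNIV (%s. G (of_real s))"
  by (rule continuous_on_compose2[OF holomorphic_on_imp_continuous_on[OF Gh]]) (use \<rho> in "auto intro: continuous_intros")
 define k where "k s = of_real (P s)*G (of_real s)" for s
 have ki: "integrable lborel k" unfolding k_def
  by (rule integrable_mult_bounded[where C = K]) (use Pi K borel_cont[OF Gc] in auto)
 have hk: "half_plane_kernel (%s. of_real (P s) - k s)" unfolding half_plane_kernel_def
 proof (intro exI conjI allI impI)
  show "(%z. of_real (\<eta>/pi)*(1 - G z)) holomorphic_on {z. Im z > - \<rho>}" by (intro holomorphic_intros Gh)
  show "cmod (of_real (\<eta>/pi)*(1 - G z)) <= \<eta>/pi*(1 + K)" if "Im z >= 0" for z
   using order_trans[OF norm_triangle_ineq4[of 1 "G z"]] K[OF that] \<eta> unfolding norm_mult norm_of_real by (intro mult_mono) auto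
  show "of_real (\<eta>/pi)*(1 - G (\<i> * of_real \<eta>)) = 0" by (simp add: G_def a_def)
  show "(%s. of_real (P s) - k s) = (%s. of_real (\<eta>/pi)*(1 - G (of_real s))/of_real (s^2 + \<eta>^2))"
   by (intro ext) (simp add: k_def P_def diff_divide_distrib right_diff_distrib)
 qed (use \<rho> in auto)
 have kK: "cmod (k s) <= P s*K" for s using K[of "of_real s"] P0[of s] by (simp add: k_def norm_mult mult_left_mono)
 obtain \<delta>' where \<delta>': "\<delta>' > 0" "!!F s t. F : \<F> ==> \<bar>s - t\<bar> < \<delta>' ==> cmod (F s - F t) <= \<epsilon>/4/K"
  using mod[of "\<epsilon>/4/K"] \<epsilon> K0 by auto
 obtain n where n: "n > 0" "inverse (real n) < \<delta>' / r" using ex_inverse_of_nat_less[of "\<delta>' / r"] \<delta>'(1) r by auto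
 define h where "h = r/real n"
 have h: "0 < h" "h < \<delta>'" "real n*h = r" using n r by (auto simp: h_def field_simps)
 let ?a = "s0 - r/2"
 let ?t = "%j. ?a + real j*h" and ?I = "{?a..<?a + real n*h}"
 let ?c = "%j. LINT s:{?t j..<?t (Suc j)}|lborel. k s"
 have "\<bar>?t j - s0\<bar> < r" if "j < n" for j
 proof -
  have "real j*h < real n*h" "0 <= real j*h" using that h(1) by simp_all
  thus ?thesis using r unfolding abs_less_iff h(3) by linarith
 qed
 moreover have "cmod (F 0 - (\<Sum>j<n. ?c j*F (?t j))) <= \<epsilon>" if F: "F : \<F>" for F
 proof -
  have PF: "integrable lborel (%s. of_real (P s)*F s)" and kF: "integrable lborel (%s. k s*F s)"
   by (intro annihilated_integrable ann F integrable_of_real Pi ki)+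
  have kI: "integrable lborel (%s. indicator ?I s *R (k s*F s))" using integrable_mult_indicator[OF _ kF] by simp
  have PF0: "integrable lborel (%s. of_real (P s)*F 0)" using Pi by simp
  have "(LI s. (of_real (P s) - k s)*F s) = 0" using hk ann[OF F] unfolding annihilated_def by blast
  hence eq: "F 0 - (LINT s:?I|lborel. k s*F s)
    = (LI s. of_real (P s)*F 0 - of_real (P s)*F s + (k s*F s - indicator ?I s *R (k s*F s)))"
   using Pi P1 PF kF kI by (simp add: set_lebesgue_integral_def left_diff_distrib)
  have "cmod (F 0 - (LINT s:?I|lborel. k s*F s)) <= (LI s. ?T s + \<epsilon>/4*P s)" unfolding eq
  proof (rule BI_norm_bound)
   fix s
   have "cmod (k s*F s - indicator ?I s *R (k s*F s)) <= \<epsilon>/4*P s"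
   proof (cases "s : ?I")
    case False
    hence "\<bar>s - s0\<bar> >= r/2" unfolding h(3) atLeastLessThan_iff by linarith
    note small[OF this]
    hence "cmod (G (of_real s))*cmod (F s) <= \<epsilon>/4/M*M" using M(1)[OF F, of s] M(2) \<epsilon> by (intro mult_mono) auto
    from mult_left_mono[OF this P0[of s]] show ?thesis using False M(2) P0[of s] by (simp add: k_def norm_mult mult_ac)
   qed (use P0 \<epsilon> in simp)
   moreover have "cmod (of_real (P s)*F 0 - of_real (P s)*F s) <= ?T s"
    using tail[OF F, of s] P0[of s] by (simp add: right_diff_distrib[symmetric] norm_mult)
   ultimately show "norm (of_real (P s)*F 0 - of_real (P s)*F s + (k s*F s - indicator ?I s *R (k s*F s))) <= ?T s + \<epsilon>/4*P s"
    by (rule norm_triangle_mono[rotated])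
  qed (intro Bochner_Integration.integrable_add Bochner_Integration.integrable_diff PF0 PF kF kI Ti Pi integrable_mult_right)+
  also have "... = \<epsilon>/2 + \<epsilon>/4" using Ti T1 Pi P1 by (subst Bochner_Integration.integral_add) auto
  finally have 1: "cmod (F 0 - (LINT s:?I|lborel. k s*F s)) <= \<epsilon>/2 + \<epsilon>/4" .
  have "cmod ((LINT s:?I|lborel. k s*F s) - (\<Sum>j<n. ?c j*F (?t j))) <= \<epsilon>/4/K*(LINT s:?I|lborel. cmod (k s))"
   by (rule riemann_sum_bound[OF ki kF]) (use h \<delta>'(2)[OF F] in auto)
  moreover have "(LINT s:?I|lborel. cmod (k s)) <= (LI s. P s*K)" unfolding set_lebesgue_integral_def
   by (intro integral_mono integrable_mult_indicator integrable_norm ki integrable_mult_left Pi)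
     (use kK P0 K0 in "auto simp: indicator_def")
  hence "\<epsilon>/4/K*(LINT s:?I|lborel. cmod (k s)) <= \<epsilon>/4/K*K" using P1 \<epsilon> K0 by (intro mult_left_mono) auto
  ultimately show ?thesis using 1 K0 norm_triangle_ineq[of "F 0 - (LINT s:?I|lborel. k s*F s)" "(LINT s:?I|lborel. k s*F s) - (\<Sum>j<n. ?c j*F (?t j))"]
   by simp
 qed
 ultimately show ?thesis by (intro exI[of _ n] exI[of _ ?c] exI[of _ ?t] conjI) blast+
qed

context weyl_net
begin

lemma weyl_span_QL: "A : cspan (V ` \<D>) ==> A : QL"
 by (induction rule: cspan.induct) (use QLD(2) in "auto intro!: QLD(3) QLD(6) V_QL simp: QLD(6)[of id_blinfun 0, simplified]")

lemma weyl_span_dense: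
 assumes "e > 0" obtains A where "A : cspan (V ` \<D>)" "norm (x - A vac) < e"
proof -
 obtain y where y: "y : cspan ((%f. V f vac) ` \<D>)" "norm (x - y) < e"
  using closure_cspan_approx[OF total assms] by metis
 have "\<exists>A\<in>cspan (V ` \<D>). A vac = y" using y(1)
 proof (induction rule: cspan.induct)
  case cspan_zero thus ?case by (intro bexI[of _ 0] cspan.cspan_zero) simp
 next
  case (cspan_step x y c)
  then obtain f A where "f : \<D>" "x = V f vac" "A : cspan (V ` \<D>)" "A vac = y" by blast
  thus ?case by (intro bexI[of _ "c *C V f + A"] cspan.cspan_step) (auto simp: blinfun.add_left scaleC_app)
 qed
 thus ?thesis using y(2) that by metis
qed

text \<open>By positivity of the energy, matrix elements of translates along timelike or light-like directions on the
 vacuum are boundary values of functions on a half-plane. This is seen on coherent vectors.\<close>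

lemma orbit_annihilated:
 assumes e: "\<bar>e $ 2\<bar> <= e $ 1" and Z: "Z : QL"
 shows "annihilated (%s. cinner y (sh (s *R e) Z vac))"
proof -
 define E where "E p = e $ 1*disp m p - e $ 2*p" for p
 have E: "E p >= 0" for p
 proof -
  have "e $ 2*p <= \<bar>e $ 2\<bar>*\<bar>p\<bar>" by (metis abs_ge_self abs_mult)
  also have "... <= e $ 1*disp m p" using e disp_ge_abs[of p m] by (intro mult_mono) auto
  finally show ?thesis by (simp add: E_def)
 qed
 have 1: "annihilated (%s. cinner (V h vac) (V (act (mat 1, s *R e) f) vac))" if h: "h : \<D>" and f: "f : \<D>" for h f
 proof -
  let ?f = "%s. act (mat 1, s *R e) f" and ?a = "%p. cnj (ftr m h p)*ftr m f p/(2 * of_real (disp m p))"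
  let ?x = "%s. LI p. ?a p*exp (\<i> * of_real s * of_real (E p))"
  let ?c = "exp (- cor (mnsq m h/2) - of_real (mnsq m f/2))"
  note r = act_related[OF PG_trans f] and tf = tf_act[OF PG_trans f]
  have eq: "cinner (V h vac) (V (?f s) vac) = ?c*exp (?x s)" for s
  proof -
   have "minner m h (?f s) = ?x s" unfolding minner_translation[OF r] integral_divide_zero[symmetric]
    by (rule BI_cong) (simp_all add: E_def algebra_simps)
   thus ?thesis unfolding V_coherent[OF h tf] mnsq_translation[OF m r]
    by (simp only: exp_add[symmetric]) (simp add: algebra_simps)
  qed
  have "2*cor (disp m p) ~= 0" for p using disp_pos[OF m, of p] by simp
  hence ac: "continuous_on UNIV ?a" by (intro continuous_intros continuous_on_ftr f h) blast
  have ai: "integrable lborel ?a" using integrable_divide[OF minner_integrable[OF h f m], of 2]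
   by (simp only: divide_divide_eq_left mult.commute)
  have "(LI s. k s*(?c*exp (?x s))) = 0" if "half_plane_kernel k" for k
   using positive_energy_integral[OF that ac ai _ E] integral_mult_right_zero[of lborel ?c "%s. k s*exp (?x s)"]
   by (simp add: E_def[abs_def] mult.left_commute continuous_intros)
  moreover have "continuous_on UNIV (%s. cinner (V h vac) (V (?f s) vac))"
   by (rule continuous_on_compose2[OF continuous_translation[OF f r]]) (auto intro: continuous_intros)
  moreover have "cmod (cinner (V h vac) (V (?f s) vac)) <= 1" for s
   using cinner_norm_le[of "V h vac"] norm_V_apply[OF h] norm_V_apply[OF tf] norm_Omega by (metis mult_1)
  ultimately show ?thesis unfolding annihilated_def eq by blast
 qed
 have 0: "annihilated (%s. 0)" by (auto simp: annihilated_def)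
 have 2: "annihilated (%s. cinner (V h vac) (sh (s *R e) A vac))" if h: "h : \<D>" and A: "A : cspan (V ` \<D>)" for h A
  using A
 proof (induction rule: cspan.induct)
  case cspan_zero
  have "sh x 0 = 0" for x using \<alpha>D(3)[OF PG_trans QLD(2), of x 0] by simp
  thus ?case using 0 by simp
 next
  case (cspan_step x y c)
  then obtain f where f: "f : \<D>" "x = V f" by blast
  have "sh z (c *C x + y) = c *C V (act (mat 1, z) f) + sh z y" for z
   using weyl_span_QL[OF cspan_step(2)] V_QL[OF f(1)] by (simp add: f(2) \<alpha>D(3,4) QLD(6) \<alpha>_props(3) f(1))
  thus ?case using annihilated_lincomb[OF 1[OF h f(1)] cspan_step(3), of c]
   by (simp add: blinfun.add_left scaleC_app cinner_add_right cinner_scaleC_right)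
 qed
 have 3: "annihilated (%s. cinner (B vac) (sh (s *R e) A vac))" if B: "B : cspan (V ` \<D>)" and A: "A : cspan (V ` \<D>)" for B A
  using B
 proof (induction rule: cspan.induct)
  case (cspan_step x y c)
  then obtain f where f: "f : \<D>" "x = V f" by blast
  show ?case using annihilated_lincomb[OF 2[OF f(1) A] cspan_step(3), of "cnj c"]
   by (simp add: f(2) blinfun.add_left scaleC_app cinner_add_left cinner_scaleC_left)
 qed (use 0 in simp)
 show ?thesis
 proof (rule annihilated_limit)
  fix d :: real assume d: "d > 0"
  have pos: "d/(2*(norm x + 1)) > 0" for x :: 'h using d by (simp add: add_nonneg_pos)
  obtain A where A: "A : cspan (V ` \<D>)" "norm (Z vac - A vac) < d/(2*(norm y + 1))" using weyl_span_dense[OF pos] .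
  obtain B where B: "B : cspan (V ` \<D>)" "norm (y - B vac) < d/(2*(norm (A vac) + 1))" using weyl_span_dense[OF pos] .
  have AQ: "A : QL" by (rule weyl_span_QL[OF A(1)])
  have "cmod (cinner y (sh (s *R e) Z vac) - cinner (B vac) (sh (s *R e) A vac)) <= d" for s
  proof -
   have "cinner y (sh (s *R e) Z vac) - cinner (B vac) (sh (s *R e) A vac) =
     cinner y (sh (s *R e) (Z - A) vac) + cinner (y - B vac) (sh (s *R e) A vac)"
    by (simp add: \<alpha>D(8) Z AQ blinfun.diff_left cinner_diff_right cinner_diff_left)
   also have "cmod ... <= norm y*norm ((Z - A) vac) + norm (y - B vac)*norm (A vac)"
    using norm_sh[OF QL_diff[OF Z AQ]] norm_sh[OF AQ] cinner_norm_le by (metis norm_triangle_mono)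
   also have "... <= (norm y + 1)*(d/(2*(norm y + 1))) + d/(2*(norm (A vac) + 1))*(norm (A vac) + 1)"
    using A(2) B(2) d by (intro add_mono mult_mono) (auto simp: blinfun.diff_left)
   also have "... = d" by (simp add: field_simps add_nonneg_eq_0_iff)
   finally show ?thesis .
  qed
  thus "\<exists>F'. annihilated F' & (\<forall>s. cmod (cinner y (sh (s *R e) Z vac) - F' s) <= d)" using 3[OF B(1) A(1)] by blast
 qed
qed

text \<open>Families of operators indexed by the scale on which small rescaled translations act uniformly.\<close>

definition equicontinuous :: "(real => 'h op) => bool" where
 "equicontinuous Z \<longleftrightarrow> (\<exists>M. \<forall>l>0. Z l : QL & norm (Z l) <= M) \<and>
   (\<forall>\<epsilon>>0. \<exists>\<delta>>0. \<forall>x. norm x < \<delta> --> (\<forall>l>0. norm (sh (l *R x) (Z l) - Z l) <= \<epsilon>))"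

text \<open>Linear combinations, with coefficients independent of the scale, of rescaled translates.\<close>

inductive_set shifts :: "(real => 'h op) => (real^2) set => (real => 'h op) set" for Z D where
 shifts_zero: "(!!l. l > 0 ==> B l = 0) ==> B : shifts Z D"
| shifts_step: "x : D ==> B : shifts Z D ==> (!!l. l > 0 ==> B' l = c *C sh (l *R x) (Z l) + B l) ==> B' : shifts Z D"

lemma shifts_approx:
 assumes Z: "equicontinuous Z" and e: "\<bar>e $ 2\<bar> <= e $ 1" and r: "r > 0" and \<epsilon>: "\<epsilon> > 0"
 shows "\<exists>B\<in>shifts Z ((%s. s *R e) ` {s0 - r<..<s0 + r}). \<forall>l>0. norm (Z l vac - B l vac) <= \<epsilon>"
proof -
 obtain M0 where M0: "!!l. l > 0 ==> Z l : QL & norm (Z l) <= M0" using Z unfolding equicontinuous_def by metis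
 define M where "M = max 1 M0"
 have M: "M > 0" "!!l. l > 0 ==> Z l : QL" "!!l. l > 0 ==> norm (Z l) <= M" using M0 by (auto simp: M_def le_max_iff_disj)
 define v where "v l s = sh (l *R s *R e) (Z l) vac" for l s
 have vd: "norm (v l s - v l t) <= norm (sh (l *R (s - t) *R e) (Z l) - Z l)" if l: "l > 0" for l s t
 proof -
  have Q: "sh (l *R (s - t) *R e) (Z l) : QL" by (intro \<alpha>D(1) PG_trans M(2) l)
  have "sh (l *R s *R e) (Z l) - sh (l *R t *R e) (Z l) = sh (l *R t *R e) (sh (l *R (s - t) *R e) (Z l) - Z l)"
   unfolding \<alpha>D(8)[OF PG_trans Q M(2)[OF l]] sh_sh[OF M(2)[OF l]] by (simp add: algebra_simps)
  hence "norm (v l s - v l t) = norm ((sh (l *R (s - t) *R e) (Z l) - Z l) vac)"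
   using norm_sh[OF QL_diff[OF Q M(2)[OF l]]] by (simp only: v_def blinfun.diff_left[symmetric])
  also have "... <= norm (sh (l *R (s - t) *R e) (Z l) - Z l)" using norm_blinfun[of _ vac] norm_Omega by (metis mult.right_neutral)
  finally show ?thesis .
 qed
 have mod: "\<exists>\<delta>>0. \<forall>l>0. \<forall>s t. \<bar>s - t\<bar> < \<delta> --> norm (v l s - v l t) <= d" if d: "d > 0" for d
 proof -
  obtain \<delta> where \<delta>: "\<delta> > 0" "!!x l. norm x < \<delta> ==> l > 0 ==> norm (sh (l *R x) (Z l) - Z l) <= d"
   using Z d unfolding equicontinuous_def by metis
  have pos: "norm e + 1 > 0" by (rule add_nonneg_pos) auto
  have sm: "norm ((s - t) *R e) < \<delta>" if "\<bar>s - t\<bar> < \<delta>/(norm e + 1)" for s t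
  proof -
   have "\<bar>s - t\<bar>*norm e <= \<bar>s - t\<bar>*(norm e + 1)" by (simp add: distrib_left)
   also have "... < \<delta>" using that pos by (simp add: pos_less_divide_eq)
   finally show ?thesis by simp
  qed
  show ?thesis
   by (intro exI[of _ "\<delta>/(norm e + 1)"] conjI allI impI) (use \<delta> pos in simp, rule order_trans[OF vd \<delta>(2)[OF sm]])
 qed
 have v0: "v l 0 = Z l vac" if "l > 0" for l using sh_zero[OF M(2)[OF that]] by (simp add: v_def)
 have vM: "norm (v l s) <= M" if "l > 0" for l s
  using norm_sh[OF M(2)[OF that]] norm_blinfun[of "Z l" vac] M(3)[OF that] by (simp add: v_def norm_Omega)
 have ann: "annihilated (%s. cinner y (v l s))" if "l > 0" for y l
 proof -
  have "\<bar>(l *R e) $ 2\<bar> <= (l *R e) $ 1" using e that by (simp add: abs_mult)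
  from orbit_annihilated[OF this M(2)[OF that], of y] show ?thesis by (simp add: v_def mult.commute)
 qed
 let ?F = "(%(y, l) s. cinner y (v l s)) ` (cball 0 1 \<times> {0<..})"
 have cb: "cmod (cinner y x) <= norm x" if "norm y <= 1" for x y :: 'h
  using cinner_norm_le[of y x] mult_right_mono[OF that norm_ge_zero[of x]] by simp
 have "\<exists>(n::nat) c t. (\<forall>j<n. \<bar>t j - s0\<bar> < r) & (\<forall>F\<in>?F. cmod (F 0 - (\<Sum>j<n. c j*F (t j))) <= \<epsilon>)"
 proof (rule annihilated_approx[OF _ _ _ M(1) r \<epsilon>])
  fix d :: real assume "d > 0"
  from mod[OF this] show "\<exists>\<delta>>0. \<forall>F\<in>?F. \<forall>s t. \<bar>s - t\<bar> < \<delta> --> cmod (F s - F t) <= d"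
   by (fastforce simp: cinner_diff_right[symmetric] intro: order_trans[OF cb])
 qed (use ann vM in "auto intro: order_trans[OF cb]")
 then obtain n :: nat and c t where tc: "(\<forall>j<n. \<bar>t j - s0\<bar> < r) & (\<forall>F\<in>?F. cmod (F 0 - (\<Sum>j<n. c j*F (t j))) <= \<epsilon>)" by (elim exE)
 note c = bspec[OF conjunct2[OF tc] image_eqI[OF refl SigmaI], simplified]
 have main: "norm (v l 0 - (\<Sum>j<n. c j *C v l (t j))) <= \<epsilon>" if l: "l > 0" for l
  by (rule norm_le_if_cinner_le) (use c[OF _ l] \<epsilon> in "simp_all add: cinner_diff_right cinner_sum_right cinner_scaleC_right")
 let ?B = "%k l. \<Sum>j<k. c j *C sh (l *R t j *R e) (Z l)"
 have Bs: "?B k : shifts Z ((%s. s *R e) ` {s0 - r<..<s0 + r})" if "k <= n" for k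
  using that
 proof (induction k)
  case (Suc k)
  have b: "s0 - r < t k" "t k < s0 + r" using spec[OF conjunct1[OF tc], of k] Suc.prems by auto
  show ?case
  proof (rule shifts_step[where x = "t k *R e" and c = "c k" and B = "?B k"])
   show "t k *R e : (%s. s *R e) ` {s0 - r<..<s0 + r}" by (rule imageI) (use b in simp)
   show "?B k : shifts Z ((%s. s *R e) ` {s0 - r<..<s0 + r})" using Suc by simp
  qed (simp add: add.commute)
 qed (simp add: shifts_zero)
 have Bn: "norm (Z l vac - ?B n l vac) <= \<epsilon>" if "l > 0" for l
  using main[OF that] unfolding v0[OF that] by (simp add: v_def blinfun.sum_left scaleC_app)
 show ?thesis by (intro bexI[of _ "?B n"] allI impI Bn Bs order_refl)
qed

end

section \<open>Scaling algebras and the algebra of scale-covariant observables\<close>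

context weyl_net
begin

lemma shifts_QL: "B : shifts Z D ==> (!!l. l > 0 ==> Z l : QL) ==> l > 0 ==> B l : QL"
proof (induction arbitrary: l rule: shifts.induct)
 case (shifts_zero B)
 thus ?case using QLD(6)[OF QLD(2), of 0] by simp
next
 case (shifts_step x B B' c)
 thus ?case by (simp add: QLD(3,6) \<alpha>D(1))
qed

lemma shifts_combine:
 assumes Z: "!!l. l > 0 ==> Z l : QL" and D: "!!y. y : D ==> x + y : D'" and C: "C : shifts Z D"
  and B: "B : shifts Z D'" and B': "!!l. l > 0 ==> B' l = c *C sh (l *R x) (C l) + B l"
 shows "B' : shifts Z D'"
 using C B'
proof (induction arbitrary: B' rule: shifts.induct)
 case (shifts_zero C)
 have s0: "sh z 0 = 0" for z using \<alpha>D(3)[OF PG_trans QLD(2), of z 0] by simp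
 have "B' l = B l" if "l > 0" for l using shifts_zero that s0 by simp
 note eq = this
 show ?case using B
 proof cases
  case shifts_zero
  thus ?thesis by (intro shifts.shifts_zero) (metis eq)
 next
  case (shifts_step y B0 d)
  show ?thesis by (rule shifts.shifts_step[OF shifts_step(1,2), where c = d]) (use eq shifts_step(3) in metis)
 qed
next
 case (shifts_step y C C' d)
 let ?B = "%l. c *C sh (l *R x) (C l) + B l"
 have "B' l = (c*d) *C sh (l *R (x + y)) (Z l) + ?B l" if l: "l > 0" for l
 proof -
  have q: "sh (l *R y) (Z l) : QL" "C l : QL" using shifts_step(2) l by (auto intro!: \<alpha>D(1) Z shifts_QL[where Z = Z])
  show ?thesis
   by (simp add: shifts_step(3,5) l q \<alpha>D(3,4) QLD(6) sh_sh Z scaleC_add_right scaleC_scaleC scaleR_add_right)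
 qed
 thus ?case by (intro shifts.shifts_step[OF D[OF shifts_step(1)] shifts_step(4)]) auto
qed

lemma shifts_bounded:
 assumes "B : shifts Z D" and Z: "!!l. l > 0 ==> Z l : QL & norm (Z l) <= M"
 shows "\<exists>C. \<forall>l>0. norm (B l) <= C"
 using assms(1)
proof (induction rule: shifts.induct)
 case (shifts_step x B B' c)
 then obtain C where C: "!!l. l > 0 ==> norm (B l) <= C" by blast
 have "norm (B' l) <= cmod c*M + C" if l: "l > 0" for l
  unfolding shifts_step(3)[OF l]
  by (rule order_trans[OF norm_triangle_ineq], intro add_mono C l, simp add: norm_scaleC, intro mult_left_mono)
    (use \<alpha>D(9)[OF PG_trans, of "Z l"] Z[OF l] in "auto intro: order_trans")
 thus ?case by blast
qed (intro exI[of _ 0], simp)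

lemma shifts_commute:
 assumes "B : shifts Z D" and A: "A : \<B>" and l: "l > 0"
  and c: "!!x. x : D ==> A oL sh (l *R x) (Z l) = sh (l *R x) (Z l) oL A"
 shows "A oL B l = B l oL A"
 using assms(1)
 by (induction rule: shifts.induct)
   (auto simp: l c blinfun_compose_add_left blinfun_compose_add_right scaleC_compose_left scaleC_compose_right[OF A])

text \<open>Vectors depending on the scale which are approximated, along the filter P, by operators of S applied to the vacuum.\<close>

definition apx :: "real filter => (real => 'h op) set => (real => 'h) => bool" where
 "apx P S v \<longleftrightarrow> (\<forall>e>0. \<exists>B\<in>S. \<forall>\<^sub>F l in P. norm (v l - B l vac) <= e)"

lemma apx_in: "(B :: real => 'h op) : S ==> \<forall>\<^sub>F l in P. v l = B l vac ==> apx P S v"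
 unfolding apx_def by (intro allI impI bexI[of _ B]) (auto elim: eventually_mono)

lemma apx_mono: "apx P S v ==> S <= S' ==> P' <= P ==> apx P' S' v"
 unfolding apx_def by (meson filter_leD subsetD)

lemma apx_trans:
 assumes "!!e. e > 0 ==> \<exists>w. apx P S w & (\<forall>\<^sub>F l in P. norm (v l - w l) <= e)"
 shows "apx P S v"
 unfolding apx_def
proof (intro allI impI)
 fix e :: real assume "e > 0"
 hence e: "e/2 > 0" by simp
 obtain w where w: "apx P S w" "\<forall>\<^sub>F l in P. norm (v l - w l) <= e/2" using assms[OF e] by blast
 obtain B where B: "B : S" "\<forall>\<^sub>F l in P. norm (w l - B l vac) <= e/2" using w(1) e unfolding apx_def by blast
 have "\<forall>\<^sub>F l in P. norm (v l - B l vac) <= e" using w(2) B(2) by eventually_elim (use norm_diff_triangle_le in fastforce)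
 thus "\<exists>B\<in>S. \<forall>\<^sub>F l in P. norm (v l - B l vac) <= e" using B(1) by blast
qed

lemma apx_cong: "apx P S w ==> \<forall>\<^sub>F l in P. v l = w l ==> apx P S v"
 by (rule apx_trans, intro exI[of _ w]) (auto elim!: eventually_mono)

lemma apx_apply:
 fixes T :: "real => 'h op"
 assumes v: "apx P S v" and T: "\<forall>\<^sub>F l in P. norm (T l) <= M" and S: "!!B. B : S ==> apx P S' (%l. T l (B l vac))"
 shows "apx P S' (%l. T l (v l))"
proof (rule apx_trans)
 fix e :: real assume "e > 0"
 hence e: "e/(\<bar>M\<bar> + 1) > 0" by simp
 obtain B where B: "B : S" "\<forall>\<^sub>F l in P. norm (v l - B l vac) <= e/(\<bar>M\<bar> + 1)" using v e unfolding apx_def by blast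
 have "\<forall>\<^sub>F l in P. norm (T l (v l) - T l (B l vac)) <= (\<bar>M\<bar> + 1)*(e/(\<bar>M\<bar> + 1))" using T B(2)
  by eventually_elim (unfold blinfun.diff_right[symmetric], intro order_trans[OF norm_blinfun] mult_mono, auto)
 thus "\<exists>w. apx P S' w & (\<forall>\<^sub>F l in P. norm (T l (v l) - w l) <= e)" using S[OF B(1)] by auto
qed

lemma apx_lincomb:
 assumes v: "apx P S v" and w: "apx P S w" and S: "!!B C. B : S ==> C : S ==> (%l. c *C B l + C l) : S"
 shows "apx P S (%l. c *C v l + w l)"
 unfolding apx_def
proof (intro allI impI)
 fix e :: real assume "e > 0"
 hence e: "e/2/(cmod c + 1) > 0" "e/2 > 0" by (auto simp: add_nonneg_pos)
 obtain B where B: "B : S" "\<forall>\<^sub>F l in P. norm (v l - B l vac) <= e/2/(cmod c + 1)" using v e(1) unfolding apx_def by blast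
 obtain C where C: "C : S" "\<forall>\<^sub>F l in P. norm (w l - C l vac) <= e/2" using w e(2) unfolding apx_def by blast
 have "\<forall>\<^sub>F l in P. norm (c *C v l + w l - (c *C B l + C l) vac) <= e" using B(2) C(2)
 proof eventually_elim
  case (elim l)
  have "c *C v l + w l - (c *C B l + C l) vac = c *C (v l - B l vac) + (w l - C l vac)"
   by (simp add: blinfun.add_left scaleC_app scaleC_diff_right)
  also have "norm ... <= (cmod c + 1)*(e/2/(cmod c + 1)) + e/2"
   by (intro order_trans[OF norm_triangle_ineq] add_mono elim, unfold norm_scaleC, intro mult_mono elim) auto
  also have "... = e" unfolding times_divide_eq_right[of _ "e/2"] by (subst nonzero_mult_div_cancel_left) (use norm_ge_zero[of c] in linarith)+
  finally show ?case .
 qed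
 thus "\<exists>B\<in>S. \<forall>\<^sub>F l in P. norm (c *C v l + w l - B l vac) <= e" by (rule bexI[OF _ S[OF B(1) C(1)]])
qed

abbreviation "pos_scales \<equiv> principal {0::real<..}"

text \<open>Approximation by translates near an arbitrary point, by combining both light-like directions.\<close>

definition near :: "real^2 => real => (real^2) set" where
 "near x r = {y. \<bar>(y $ 2 + y $ 1) - (x $ 2 + x $ 1)\<bar> < r & \<bar>(y $ 2 - y $ 1) - (x $ 2 - x $ 1)\<bar> < r}"

lemma shifts_near:
 assumes Z: "equicontinuous Z" and r: "r > 0"
 shows "apx pos_scales (shifts Z (near x r)) (%l. Z l vac)"
proof -
 have ZQ: "!!l. l > 0 ==> Z l : QL" using Z by (auto simp: equicontinuous_def)
 let ?D = "(%s. s *R lc_point 1 0) ` {x $ 2 + x $ 1 - r<..<x $ 2 + x $ 1 + r}"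
  and ?E = "(%s. s *R lc_point 0 (- 1)) ` {x $ 1 - x $ 2 - r<..<x $ 1 - x $ 2 + r}"
 have A: "apx pos_scales (shifts Z ?D) (%l. Z l vac)" "apx pos_scales (shifts Z ?E) (%l. Z l vac)"
  unfolding apx_def eventually_principal Ball_def greaterThan_iff by (intro allI impI shifts_approx[OF Z _ r]; simp)+
 have n: "y + z : near x r" if "y : ?D" "z : ?E" for y z using that by (auto simp: near_def)
 have lc: "(%l. c *C B l + C l) : shifts Z (near x r)" if "B : shifts Z (near x r)" "C : shifts Z (near x r)" for B C c
  by (rule shifts_combine[OF ZQ _ that, of 0]) (use shifts_QL[OF that(1) ZQ] in "simp_all add: sh_zero")
 have sy: "apx pos_scales (shifts Z (near x r)) (%l. sh (l *R y) (Z l) vac)" if y: "y : ?D" for y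
  unfolding apx_def eventually_principal
 proof (intro allI impI)
  fix e :: real assume "e > 0"
  then obtain C where C: "C : shifts Z ?E" "\<forall>l\<in>{0<..}. norm (Z l vac - C l vac) <= e" using A(2) unfolding apx_def eventually_principal by blast
  have "norm (sh (l *R y) (Z l) vac - sh (l *R y) (C l) vac) <= e" if "l : {0<..}" for l
  proof -
   note q = ZQ[of l] shifts_QL[OF C(1) ZQ, of l]
   show ?thesis using C(2) that norm_sh[OF QL_diff[OF q], of "l *R y"] by (simp add: \<alpha>D(8) q blinfun.diff_left)
  qed
  moreover have "(%l. sh (l *R y) (C l)) : shifts Z (near x r)"
   by (rule shifts_combine[OF ZQ _ C(1), where x = y and c = 1 and B = "%_. 0"]) (use n[OF y] in "auto intro: shifts_zero")
  ultimately show "\<exists>B\<in>shifts Z (near x r). \<forall>l\<in>{0<..}. norm (sh (l *R y) (Z l) vac - B l vac) <= e" by (rule_tac bexI) auto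
 qed
 have "apx pos_scales (shifts Z (near x r)) (%l. id_blinfun (B l vac))" if "B : shifts Z ?D" for B
  using that
 proof (induction rule: shifts.induct)
  case (shifts_zero B) thus ?case by (intro apx_in[OF shifts.shifts_zero]) (auto simp: eventually_principal)
 next
  case (shifts_step y B B' c)
  from apx_lincomb[OF sy[OF shifts_step(1)] shifts_step(4) lc, of c] show ?case
   by (rule apx_cong) (auto simp: eventually_principal shifts_step(3) blinfun.add_left scaleC_app)
 qed
 from apx_apply[OF A(1) _ this, of 1] show ?thesis by (simp add: norm_blinfun_id_le)
qed

end

text \<open>The scaling algebras \<open>SA O\<close>, and the algebras \<open>PA O\<close> of operators whose dilates are approximated by them
 along the filter \<open>K\<close> of scales.\<close>

locale scaling_net = weyl_net m W \<omega> rep vac V \<alpha> \<phi>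
 for m and W :: "(real => complex) => 'w::cstar_algebra" and \<omega> and rep :: "'w => ('h::complex_hilbert) op"
  and vac and V and \<alpha> and \<phi> +
 fixes G :: "poincare_elem set" and K :: "'k filter" and scl :: "'k => real"
 assumes G: "subgroup G poincare" "spacetime_shifts <= G" and K: "K ~= bot" "filterlim scl (at_right 0) K"
begin

abbreviation "SA \<equiv> scaling_algebra N \<alpha> G"
abbreviation "PA \<equiv> phi_algebra N \<alpha> \<phi> G vac K scl"
abbreviation "lim1 \<equiv> at (mat 1, 0) within G"
abbreviation "scaled l g \<equiv> (fst g, l *R snd (g :: poincare_elem))"

lemma G_scaled: "g : G ==> scaled l g : PG"
 using subgroup.subset[OF G(1)] by (cases g) (auto simp: poincare_simps)

lemma G_translation: "(mat 1, x) : G"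
 using G(2) by (auto simp: spacetime_shifts_def)

lemma dc_rect [simp]: "u0 < u1 ==> v0 < v1 ==> lc_rect u0 u1 v0 v1 : \<K>"
 by (rule lc_rect_double_cone)

lemma dc_scale: "R : \<K> ==> l > 0 ==> (%x. l *R x) ` R : \<K>"
 by (erule double_coneE) (simp add: scale_rect)

lemma SA_local: "A : SA R ==> l > 0 ==> A l : N ((%x. l *R x) ` R)"
 by (simp add: scaling_algebra_def)

lemma SA_QL: "A : SA R ==> R : \<K> ==> l > 0 ==> A l : QL"
 using SA_local local_subset_QL[OF dc_scale] by blast

lemma SA_cong:
 assumes A: "A : SA R" and eq: "!!l. l > 0 ==> A' l = A l"
 shows "A' : SA R"
proof -
 have "uniform_limit {0<..} (%g l. \<alpha> (scaled l g) (A l)) A lim1 \<longleftrightarrow> uniform_limit {0<..} (%g l. \<alpha> (scaled l g) (A' l)) A' lim1"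
  by (rule uniform_limit_cong) (simp_all add: eq)
 moreover have "A' ` {0<..} = A ` {0<..}" by (rule image_cong) (simp_all add: eq)
 ultimately show ?thesis using A eq by (simp add: scaling_algebra_def)
qed

lemma SA_mono: "A : SA R ==> R : \<K> ==> R' : \<K> ==> R <= R' ==> A : SA R'"
 unfolding scaling_algebra_def by (auto intro: subsetD[OF isotony[OF dc_scale dc_scale image_mono]])

lemma SA_I:
 assumes A: "A : SA R" and A': "A' : SA R" and R: "R : \<K>"
  and loc: "!!l. l > 0 ==> B l : N ((%x. l *R x) ` R)" and bd: "bounded (B ` {0<..})"
  and lim: "uniform_limit {0<..} (%g l. f (\<alpha> (scaled l g) (A l)) (\<alpha> (scaled l g) (A' l))) B lim1"
  and f: "!!g X Y. g : PG ==> X : QL ==> Y : QL ==> f (\<alpha> g X) (\<alpha> g Y) = \<alpha> g (f X Y)"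
  and B: "!!l. l > 0 ==> B l = f (A l) (A' l)"
 shows "B : SA R"
proof -
 have "\<forall>\<^sub>F g in lim1. \<forall>l\<in>{0<..}. f (\<alpha> (scaled l g) (A l)) (\<alpha> (scaled l g) (A' l)) = \<alpha> (scaled l g) (B l)"
  unfolding eventually_at_filter using f[OF G_scaled SA_QL[OF A R] SA_QL[OF A' R]] B by auto
 with lim have "uniform_limit {0<..} (%g l. \<alpha> (scaled l g) (B l)) B lim1" by (subst (asm) uniform_limit_cong) auto
 thus ?thesis using loc bd by (simp add: scaling_algebra_def)
qed

lemma SA_bounded: "A : SA R ==> bounded (A ` {0<..})"
 by (simp add: scaling_algebra_def)

lemma SA_limit: "A : SA R ==> uniform_limit {0<..} (%g l. \<alpha> (scaled l g) (A l)) A lim1"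
 by (simp add: scaling_algebra_def)

lemma SA_id: "R : \<K> ==> (%_. id_blinfun) : SA R"
proof -
 assume R: "R : \<K>"
 have "\<forall>\<^sub>F g in lim1. \<forall>l\<in>{0<..}. id_blinfun = \<alpha> (scaled l g) id_blinfun"
  unfolding eventually_at_filter by (auto simp: \<alpha>D(7)[OF G_scaled])
 hence "uniform_limit {0<..} (%g l. \<alpha> (scaled l g) id_blinfun) (%_. id_blinfun) lim1"
  by (subst uniform_limit_cong[of _ "%_ _. id_blinfun", symmetric]) (auto simp: uniform_limit_const)
 thus ?thesis using op_algebraD(2)[OF local_op_algebra[OF dc_scale[OF R]]] by (auto simp: scaling_algebra_def image_constant_conv)
qed

lemma SA_algebra:
 assumes A: "A : SA R" and B: "B : SA R" and R: "R : \<K>"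
 shows SA_add: "(%l. A l + B l) : SA R" and SA_compose: "(%l. A l oL B l) : SA R" and SA_scaleC: "(%l. c *C A l) : SA R"
proof -
 note lo = op_algebraD[OF local_op_algebra[OF dc_scale[OF R]]] and loc = SA_local[OF A] SA_local[OF B]
 show "(%l. A l + B l) : SA R"
  by (rule SA_I[where f = "(+)", OF A B R])
    (auto intro!: lo loc bounded_plus_comp SA_bounded[OF A] SA_bounded[OF B] uniform_limit_add SA_limit[OF A] SA_limit[OF B] simp: \<alpha>D(4))
 show "(%l. A l oL B l) : SA R"
 proof (rule SA_I[where f = "(oL)", OF A B R])
  show "uniform_limit {0<..} (%g l. \<alpha> (scaled l g) (A l) oL \<alpha> (scaled l g) (B l)) (%l. A l oL B l) lim1"
   by (intro bounded_bilinear.bounded_uniform_limit[OF bounded_bilinear_blinfun_compose] SA_limit[OF A] SA_limit[OF B] SA_bounded[OF A] SA_bounded[OF B])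
  obtain a where a: "!!l. l > 0 ==> norm (A l) <= a" using SA_bounded[OF A] by (auto simp: bounded_iff)
  obtain b where "!!l. l > 0 ==> norm (B l) <= b" using SA_bounded[OF B] by (auto simp: bounded_iff)
  with a have "norm (A l oL B l) <= a*b" if "l > 0" for l
   using that by (intro order_trans[OF norm_blinfun_compose] mult_mono) (auto intro: order_trans[OF norm_ge_zero])
  thus "bounded ((%l. A l oL B l) ` {0<..})" by (auto simp: bounded_iff)
 qed (auto intro!: lo loc simp: \<alpha>D(5))
 show "(%l. c *C A l) : SA R"
 proof (rule SA_I[where f = "%A _. c *C A", OF A A R])
  show "uniform_limit {0<..} (%g l. c *C \<alpha> (scaled l g) (A l)) (%l. c *C A l) lim1"
   by (intro bounded_linear.uniform_limit[OF bounded_linear_scaleC] SA_limit[OF A])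
  show "bounded ((%l. c *C A l) ` {0<..})" using bounded_linear_image[OF SA_bounded[OF A] bounded_linear_scaleC[of c]] by (simp add: image_image)
 qed (auto intro!: lo loc simp: \<alpha>D(3))
qed

lemma SA_lincomb: "A : SA R ==> B : SA R ==> R : \<K> ==> (%l. c *C A l + B l) : SA R"
 by (intro SA_add[OF SA_scaleC])

lemma SA_zero: "R : \<K> ==> (%_. 0) : SA R"
 by (rule SA_cong[OF SA_scaleC[OF SA_id SA_id, of R 0]]) auto

text \<open>Translates of a scaling function: the translation is conjugated by the elements of G.\<close>

lemma SA_shift:
 assumes A: "A : SA (lc_rect u0 u1 v0 v1)" and uv: "u0 < u1" "v0 < v1"
  and R: "R : \<K>" "lc_rect (u0 + (x $ 2 + x $ 1)) (u1 + (x $ 2 + x $ 1)) (v0 + (x $ 2 - x $ 1)) (v1 + (x $ 2 - x $ 1)) <= R"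
 shows "(%l. sh (l *R x) (A l)) : SA R"
proof -
 let ?R = "lc_rect (u0 + (x $ 2 + x $ 1)) (u1 + (x $ 2 + x $ 1)) (v0 + (x $ 2 - x $ 1)) (v1 + (x $ 2 - x $ 1))"
 note AQ = SA_QL[OF A dc_rect[OF uv]]
 have loc: "sh (l *R x) (A l) : N ((%x. l *R x) ` ?R)" if l: "l > 0" for l
  using sh_local[of "l*u0" "l*u1" "l * v0" "l * v1" "A l" "l *R x"] SA_local[OF A l] uv l by (simp add: scale_rect algebra_simps)
 obtain M where M: "!!l. l > 0 ==> norm (A l) <= M" using SA_bounded[OF A] by (auto simp: bounded_iff)
 have bd: "bounded ((%l. sh (l *R x) (A l)) ` {0<..})"
  by (auto simp: bounded_iff intro!: order_trans[OF \<alpha>D(9)[OF PG_trans AQ] M])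
 let ?c = "%g :: poincare_elem. (fst g, fst g *v x + snd g - x)"
 have cG: "?c g : G" if "g : G" for g
 proof -
  have "(mat 1, - x) \<cdot> (g \<cdot> (mat 1, x)) : G"
   by (intro subgroup.m_closed[OF G(1)] G_translation that)
  thus ?thesis by (cases g) (simp add: poincare_simps)
 qed
 have "filterlim ?c lim1 lim1"
  unfolding filterlim_at
 proof (intro conjI)
  have "((%g. (fst g, fst g *v x + snd g - x)) ---> (fst (mat 1 :: real^2^2, 0 :: real^2), fst (mat 1 :: real^2^2, 0 :: real^2) *v x + snd (mat 1 :: real^2^2, 0 :: real^2) - x)) (at (mat 1, 0) within G)"
   unfolding matrix_vector_mult_def by (intro tendsto_intros)
  thus "(?c ---> (mat 1, 0)) lim1" by simp
  show "\<forall>\<^sub>F g in lim1. ?c g : G & ?c g ~= (mat 1, 0)"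
   unfolding eventually_at_filter using cG by (auto intro!: always_eventually)
 qed
 from filterlim_compose[OF SA_limit[OF A] this]
 have lim: "uniform_limit {0<..} (%g l. \<alpha> (scaled l (?c g)) (A l)) A lim1" by simp
 have "uniform_limit {0<..} (%g l. \<alpha> (scaled l g) (sh (l *R x) (A l))) (%l. sh (l *R x) (A l)) lim1"
 proof (rule uniform_limitI)
  fix e :: real assume "e > 0"
  from uniform_limitD[OF lim this]
  have "\<forall>\<^sub>F g in lim1. g : G & (\<forall>l\<in>{0<..}. dist (\<alpha> (scaled l (?c g)) (A l)) (A l) < e)"
   by (simp add: eventually_at_filter)
  thus "\<forall>\<^sub>F g in lim1. \<forall>l\<in>{0<..}. dist (\<alpha> (scaled l g) (sh (l *R x) (A l))) (sh (l *R x) (A l)) < e"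
  proof (rule eventually_mono, intro ballI)
   fix g :: poincare_elem and l :: real assume g: "g : G & (\<forall>l\<in>{0<..}. dist (\<alpha> (scaled l (?c g)) (A l)) (A l) < e)" and l0: "l : {0<..}"
   hence l: "l > 0" by simp
   have c: "scaled l (?c g) : PG" "scaled l g : PG" using G_scaled[OF cG] G_scaled g by auto
   have "scaled l g \<cdot> (mat 1, l *R x) = (mat 1, l *R x) \<cdot> scaled l (?c g)"
    by (cases g) (simp add: poincare_simps algebra_simps)
   hence "\<alpha> (scaled l g) (sh (l *R x) (A l)) = sh (l *R x) (\<alpha> (scaled l (?c g)) (A l))"
    using \<alpha>_comp[OF c(2) PG_trans AQ[OF l]] \<alpha>_comp[OF PG_trans c(1) AQ[OF l]] by simp
   moreover have "\<alpha> (scaled l (?c g)) (A l) : QL" by (rule \<alpha>D(1)[OF c(1) AQ[OF l]])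
   ultimately show "dist (\<alpha> (scaled l g) (sh (l *R x) (A l))) (sh (l *R x) (A l)) < e"
    using g l AQ[OF l] \<alpha>D(9)[OF PG_trans QL_diff, of "\<alpha> (scaled l (?c g)) (A l)" "A l"]
    by (force simp: dist_norm \<alpha>D(8)[symmetric] intro: order_le_less_trans)
  qed
 qed
 hence "(%l. sh (l *R x) (A l)) : SA ?R" using loc bd by (simp add: scaling_algebra_def)
 thus ?thesis by (rule SA_mono) (use uv R in auto)
qed

lemma shifts_SA:
 assumes A: "A : SA (lc_rect u0 u1 v0 v1)" and uv: "u0 < u1" "v0 < v1" and R: "R : \<K>"
  and D: "!!x. x : D ==> lc_rect (u0 + (x $ 2 + x $ 1)) (u1 + (x $ 2 + x $ 1)) (v0 + (x $ 2 - x $ 1)) (v1 + (x $ 2 - x $ 1)) <= R"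
  and B: "B : shifts A D"
 shows "B : SA R"
 using B
proof (induction rule: shifts.induct)
 case (shifts_zero B)
 thus ?case by (intro SA_cong[OF SA_zero[OF R]]) simp
next
 case (shifts_step x B B' c)
 show ?case by (rule SA_cong[OF SA_add[OF SA_scaleC[OF SA_shift[OF A uv R D[OF shifts_step(1)]] shifts_step(4) R, of c] shifts_step(4) R]]) (simp add: shifts_step(3))
qed

lemma SA_equicontinuous:
 assumes A: "A : SA R" and R: "R : \<K>"
 shows "equicontinuous A"
 unfolding equicontinuous_def
proof (intro conjI allI impI)
 show "\<exists>M. \<forall>l>0. A l : QL & norm (A l) <= M" using SA_bounded[OF A] SA_QL[OF A R] by (auto simp: bounded_iff)
 fix e :: real assume e: "e > 0"
 from uniform_limitD[OF SA_limit[OF A] this]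
 obtain d where d: "d > 0" "!!g l. g : G ==> g ~= (mat 1, 0) ==> dist g (mat 1, 0) < d ==> l > 0 ==> dist (\<alpha> (scaled l g) (A l)) (A l) < e"
  unfolding eventually_at by auto
 have "norm (sh (l *R x) (A l) - A l) <= e" if "norm x < d" "l > 0" for x l
 proof (cases "x = 0")
  case True thus ?thesis using e sh_zero[OF SA_QL[OF A R that(2)]] by simp
 next
  case False
  thus ?thesis using d(2)[OF G_translation, of x l] that by (simp add: dist_norm)
 qed
 thus "\<exists>d>0. \<forall>x. norm x < d --> (\<forall>l>0. norm (sh (l *R x) (A l) - A l) <= e)" using d(1) by blast
qed

text \<open>Far translates commute with a given local algebra.\<close>

lemma far_shifts:
 assumes A: "A : SA (lc_rect u0 u1 v0 v1)" and uv: "u0 < u1" "v0 < v1" "w0 < w1" "z0 < z1"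
 obtains D where "apx pos_scales (shifts A D) (%l. A l vac)" "!!b. b : shifts A D ==> \<exists>C. \<forall>l>0. norm (b l) <= C"
  "!!b l X. b : shifts A D ==> l > 0 ==> X : N ((%x. l *R x) ` lc_rect w0 w1 z0 z1) ==> X oL b l = b l oL X"
proof
 let ?x = "lc_point (w1 - u0 + 1) (z1 - v0 + 1)"
 note eq = SA_equicontinuous[OF A dc_rect[OF uv(1,2)]]
 show "apx pos_scales (shifts A (near ?x 1)) (%l. A l vac)" by (rule shifts_near[OF eq]) simp
 obtain M where "!!l. l > 0 ==> A l : QL & norm (A l) <= M" using eq unfolding equicontinuous_def by metis
 thus "\<exists>C. \<forall>l>0. norm (b l) <= C" if "b : shifts A (near ?x 1)" for b by (rule shifts_bounded[OF that])
 fix b l X assume b: "b : shifts A (near ?x 1)" and l: "l > 0" and X: "X : N ((%x. l *R x) ` lc_rect w0 w1 z0 z1)"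
 show "X oL b l = b l oL X"
 proof (rule shifts_commute[OF b _ l])
  show "X : \<B>" using X op_algebraD(1)[OF local_op_algebra[OF dc_scale[OF dc_rect[OF uv(3,4)] l]]] by blast
  fix y assume "y : near ?x 1"
  hence y: "w1 < u0 + (y $ 2 + y $ 1)" "z1 < v0 + (y $ 2 - y $ 1)" unfolding near_def lc_point_coords by auto
  have s: "sh (l *R y) (A l) : N (lc_rect (l*(u0 + (y $ 2 + y $ 1))) (l*(u1 + (y $ 2 + y $ 1))) (l*(v0 + (y $ 2 - y $ 1))) (l*(v1 + (y $ 2 - y $ 1))))"
   using sh_local[of "l*u0" "l*u1" "l * v0" "l * v1" "A l" "l *R y"] SA_local[OF A l] uv l by (simp add: scale_rect algebra_simps)
  have X': "X : N (lc_rect (l*w0) (l*w1) (l*z0) (l*z1))" using X l by (simp add: scale_rect)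
  show "X oL sh (l *R y) (A l) = sh (l *R y) (A l) oL X"
   by (rule locality[OF _ _ _ _ _ _ X' s]) (use l uv y in "auto intro: mult_left_mono mult_strict_left_mono")
 qed
qed

text \<open>A product with translates is approximated on the vacuum by localized elements.\<close>

lemma SA_product_near:
 assumes X: "X : SA (lc_rect u0 u1 v0 v1)" and Y: "Y : SA (lc_rect u0 u1 v0 v1)" and uv: "u0 < u1" "v0 < v1"
  and r: "r > 0" and R: "R : \<K>" "lc_rect (u0 - 2*r) (u1 + 2*r) (v0 - 2*r) (v1 + 2*r) <= R"
  and b: "b : shifts Y D"
 shows "apx pos_scales (SA R) (%l. b l (X l vac))"
 using b
proof (induction rule: shifts.induct)
 case (shifts_zero B)
 thus ?case by (intro apx_in[OF SA_zero[OF R(1)]]) (simp add: eventually_principal)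
next
 case (shifts_step x B B' c)
 define xu xv where "xu = x $ 2 + x $ 1" and "xv = x $ 2 - x $ 1"
 note Yq = SA_QL[OF Y dc_rect[OF uv]] and Xe = SA_equicontinuous[OF X dc_rect[OF uv]]
 obtain M where M: "!!l. l > 0 ==> norm (Y l) <= M" using SA_bounded[OF Y] by (auto simp: bounded_iff)
 let ?R = "lc_rect (u0 - r + xu) (u1 + r + xu) (v0 - r + xv) (v1 + r + xv)"
 have Rd: "?R : \<K>" using uv r by simp
 have "apx pos_scales (SA R) (%l. sh (l *R x) (Y l) (X l vac))"
 proof (rule apx_apply[OF shifts_near[OF Xe r, of x]])
  show "\<forall>\<^sub>F l in pos_scales. norm (sh (l *R x) (Y l)) <= M"
   by (auto simp: eventually_principal intro: order_trans[OF \<alpha>D(9)[OF PG_trans Yq] M])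
  fix C assume C: "C : shifts X (near x r)"
  let ?P = "%l. sh (l *R x) (Y l) oL C l"
  have P: "?P : SA ?R"
   using uv r by (intro SA_compose SA_shift[OF Y uv Rd] shifts_SA[OF X uv Rd _ C])
    (auto simp: near_def xu_def xv_def lc_rect_subset_iff)
  have "shifts ?P (near (- x) r) <= SA R"
  proof (rule subsetI, rule shifts_SA[OF P _ _ R(1)])
   fix y assume y: "y : near (- x) r"
   show "lc_rect (u0 - r + xu + (y $ 2 + y $ 1)) (u1 + r + xu + (y $ 2 + y $ 1)) (v0 - r + xv + (y $ 2 - y $ 1)) (v1 + r + xv + (y $ 2 - y $ 1)) <= R"
    by (rule order_trans[OF _ R(2)]) (use uv r y in "auto simp: near_def xu_def xv_def lc_rect_subset_iff")
  qed (use uv r in auto)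
  from apx_mono[OF shifts_near[OF SA_equicontinuous[OF P Rd] r] this order_refl]
  show "apx pos_scales (SA R) (%l. sh (l *R x) (Y l) (C l vac))" by simp
 qed
 from apx_lincomb[OF this shifts_step(4) SA_lincomb[OF _ _ R(1)], of c] show ?case
  by (rule apx_cong) (auto simp: eventually_principal shifts_step(3) blinfun.add_left scaleC_app)
qed

text \<open>The filter \<open>KF\<close> of the scales themselves; \<open>ap A R\<close>: the dilates of \<open>A\<close> are approximated on the vacuum.\<close>

abbreviation "KF \<equiv> filtermap scl K"
abbreviation "ap A R \<equiv> apx KF (SA R) (%l. \<phi> l A vac)"

lemma KF: "KF <= at_right 0" "KF ~= bot" "KF <= pos_scales"
proof -
 show k: "KF <= at_right 0" "KF ~= bot" using K by (simp_all add: filterlim_def filtermap_bot_iff)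
 show "KF <= pos_scales" by (rule order_trans[OF k(1)]) (simp add: at_within_def le_infI2)
qed

lemma KF_pos: "\<forall>\<^sub>F l in KF. l > 0"
 using filter_leD[OF KF(3)] by (simp add: eventually_principal)

lemma K_pos: "\<forall>\<^sub>F k in K. scl k > 0"
 using KF_pos by (simp add: eventually_filtermap)

lemma PA_iff:
 assumes R: "R : \<K>"
 shows "A : PA R \<longleftrightarrow> A : N R & (\<forall>l>0. \<phi> l A : N ((%x. l *R x) ` R)) \<and>
  (\<forall>R'\<in>\<K>. closure R <= R' --> ap A R' & ap (adj A) R')" (is "?l \<longleftrightarrow> ?r")
proof -
 let ?S = "%B B' k. norm ((\<phi> (scl k) A - B (scl k)) vac) + norm ((adj (\<phi> (scl k) A) - B' (scl k)) vac)"
 have adj: "\<forall>\<^sub>F k in K. adj (\<phi> (scl k) A) = \<phi> (scl k) (adj A)" if "A : N R"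
  using K_pos by eventually_elim (use that local_subset_QL[OF R] in "auto simp: \<phi>D(2)")
 have bd: "bounded ((%l. \<phi> l A) ` {0<..})" if "A : N R"
  using \<phi>D(9) local_subset_QL[OF R] that by (auto simp: bounded_iff)
 have 1: "ap A R' & ap (adj A) R'"
  if A: "A : N R" and lim: "!!e. e > 0 ==> \<exists>B\<in>SA R'. \<exists>B'\<in>SA R'. Limsup K (%k. ereal (?S B B' k)) < ereal e" for R'
 proof -
  have "\<exists>B\<in>SA R'. \<exists>B'\<in>SA R'. (\<forall>\<^sub>F k in K. norm (\<phi> (scl k) A vac - B (scl k) vac) <= e) & (\<forall>\<^sub>F k in K. norm (\<phi> (scl k) (adj A) vac - B' (scl k) vac) <= e)" if "e > 0" for e
  proof -
   obtain B B' where B: "B : SA R'" "B' : SA R'" "Limsup K (%k. ereal (?S B B' k)) < ereal e" using lim[OF `e > 0`] by blast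
   have "\<forall>\<^sub>F k in K. norm (\<phi> (scl k) A vac - B (scl k) vac) <= e & norm (\<phi> (scl k) (adj A) vac - B' (scl k) vac) <= e"
    using Limsup_lessD[OF B(3)] adj[OF A] by eventually_elim (simp add: blinfun.diff_left, smt (verit) norm_ge_zero)
   thus ?thesis using B unfolding eventually_conj_iff by blast
  qed
  thus ?thesis unfolding apx_def eventually_filtermap by blast
 qed
 have 2: "\<exists>B\<in>SA R'. \<exists>B'\<in>SA R'. Limsup K (%k. ereal (?S B B' k)) < ereal e"
  if A: "A : N R" and a: "ap A R' & ap (adj A) R'" and e: "e > 0" for R' and e :: real
 proof -
  have "e/4 > 0" using e by simp
  note a' = a[THEN conjunct1, unfolded apx_def eventually_filtermap, rule_format, OF this] a[THEN conjunct2, unfolded apx_def eventually_filtermap, rule_format, OF this]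
  obtain B where B: "B : SA R'" "\<forall>\<^sub>F k in K. norm (\<phi> (scl k) A vac - B (scl k) vac) <= e/4" using a'(1) by blast
  obtain B' where B': "B' : SA R'" "\<forall>\<^sub>F k in K. norm (\<phi> (scl k) (adj A) vac - B' (scl k) vac) <= e/4" using a'(2) by blast
  have "\<forall>\<^sub>F k in K. ereal (?S B B' k) <= ereal (e/2)"
   using B(2) B'(2) adj[OF A] by eventually_elim (simp add: blinfun.diff_left)
  hence "Limsup K (%k. ereal (?S B B' k)) <= ereal (e/2)" by (rule Limsup_bounded)
  also have "... < ereal e" using e by simp
  finally show ?thesis using B(1) B'(1) by blast
 qed
 show ?thesis
 proof
  assume ?l
  note D = this[unfolded phi_algebra_def bullet_scaling_algebra_def mem_Collect_eq]
  have "ap A R' & ap (adj A) R'" if "R' : \<K>" "closure R <= R'" for R'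
   by (rule 1) (use D that in blast)+
  thus ?r using D by blast
 next
  assume ?r thus ?l unfolding phi_algebra_def bullet_scaling_algebra_def using 2 bd by blast
 qed
qed

lemma ap_lincomb:
 assumes "ap A R" "ap B R" "R : \<K>" "A : QL" "B : QL"
 shows "ap (c *C A + B) R"
 using apx_lincomb[OF assms(1,2) SA_lincomb[OF _ _ assms(3)], of c]
 by (rule apx_cong) (use assms(4,5) in "auto intro!: eventually_mono[OF KF_pos] simp: \<phi>D(3,4) QLD(6) blinfun.add_left scaleC_app")

text \<open>The dilated product is approximated: the right factor is replaced on the vacuum by a sum of far translates,
 which commutes with the left factor and is then moved back.\<close>

lemma ap_compose:
 assumes X: "X : PA (lc_rect u0 u1 v0 v1)" and Y: "Y : PA (lc_rect u0 u1 v0 v1)" and uv: "u0 < u1" "v0 < v1"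
  and R: "R : \<K>" "closure (lc_rect u0 u1 v0 v1) <= R"
 shows "ap (X oL Y) R"
proof -
 let ?R0 = "lc_rect u0 u1 v0 v1"
 note PX = X[unfolded PA_iff[OF dc_rect[OF uv]]] and PY = Y[unfolded PA_iff[OF dc_rect[OF uv]]]
 have XY: "X : QL" "Y : QL" using PX PY local_subset_QL[OF dc_rect[OF uv]] by auto
 obtain a0 a1 b0 b1 where R': "R = lc_rect a0 a1 b0 b1" "a0 < a1" "b0 < b1" using double_coneE[OF R(1)] by metis
 have "a0 < u0 & u1 < a1 & b0 < v0 & v1 < b1" using R(2) closure_rect_subset_iff[OF uv] by (simp add: R'(1))
 then obtain r where r: "r > 0" "a0 + 3*r <= u0" "u1 + 3*r <= a1" "b0 + 3*r <= v0" "v1 + 3*r <= b1"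
  by (intro that[of "min (min (u0 - a0) (a1 - u1)) (min (v0 - b0) (b1 - v1))/3"]) auto
 let ?R1 = "lc_rect (u0 - r) (u1 + r) (v0 - r) (v1 + r)"
 have R1: "?R1 : \<K>" "closure ?R0 <= ?R1" "u0 - r < u1 + r" "v0 - r < v1 + r"
  using uv r by (auto simp: closure_rect_subset_iff)
 have sub: "lc_rect (u0 - r - 2*r) (u1 + r + 2*r) (v0 - r - 2*r) (v1 + r + 2*r) <= R"
  unfolding R'(1) by (subst lc_rect_subset_iff) (use r uv in auto)
 have nX: "\<forall>\<^sub>F l in KF. norm (\<phi> l X) <= norm X" using KF_pos by eventually_elim (rule \<phi>D(9)[OF _ XY(1)])
 have "apx KF (SA R) (%l. \<phi> l X (\<phi> l Y vac))"
 proof (rule apx_apply[OF _ nX])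
  show "ap Y ?R1" using PY R1(1,2) by blast
  fix Y' assume Y': "Y' : SA ?R1"
  obtain D where D: "apx pos_scales (shifts Y' D) (%l. Y' l vac)" "!!b. b : shifts Y' D ==> \<exists>C. \<forall>l>0. norm (b l) <= C"
   "!!b l A. b : shifts Y' D ==> l > 0 ==> A : N ((%x. l *R x) ` ?R0) ==> A oL b l = b l oL A"
   using far_shifts[OF Y' R1(3,4) uv] by metis
  show "apx KF (SA R) (%l. \<phi> l X (Y' l vac))"
  proof (rule apx_apply[OF apx_mono[OF D(1) order_refl KF(3)] nX])
   fix b assume b: "b : shifts Y' D"
   obtain C where C: "!!l. l > 0 ==> norm (b l) <= C" using D(2)[OF b] by blast
   have "apx KF (SA R) (%l. b l (\<phi> l X vac))"
   proof (rule apx_apply[OF _ eventually_mono[OF KF_pos C]])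
    show "ap X ?R1" using PX R1(1,2) by blast
    show "apx KF (SA R) (%l. b l (X' l vac))" if "X' : SA ?R1" for X'
     by (rule apx_mono[OF SA_product_near[OF that Y' R1(3,4) r(1) R(1) sub b] order_refl KF(3)])
   qed
   thus "apx KF (SA R) (%l. \<phi> l X (b l vac))"
    by (rule apx_cong) (use KF_pos in eventually_elim, use D(3)[OF b] PX in "metis oL_app")
  qed
 qed
 thus ?thesis by (rule apx_cong) (use KF_pos in eventually_elim, simp add: \<phi>D(5) XY)
qed

lemma PA_op_algebra:
 assumes R: "R : \<K>"
 shows "op_algebra (PA R)"
proof -
 obtain u0 u1 v0 v1 where r: "R = lc_rect u0 u1 v0 v1" "u0 < u1" "v0 < v1" using double_coneE[OF R] by metis
 note P = PA_iff[OF R] and lo = op_algebraD[OF local_op_algebra[OF R]] and ls = op_algebraD[OF local_op_algebra[OF dc_scale[OF R]]]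
 have Q: "A : QL" if "A : PA R" for A using that local_subset_QL[OF R] by (auto simp: P)
 have b: "A : \<B>" if "A : PA R" for A using that lo(1) by (auto simp: P)
 have i: "ap id_blinfun R'" if "R' : \<K>" for R'
  by (intro apx_in[OF SA_id[OF that]] eventually_mono[OF KF_pos]) (simp add: \<phi>D(7))
 have i': "id_blinfun : PA R" unfolding P using i by (auto simp: \<phi>D(7) lo(2) ls(2))
 have lin: "c *C A + B : PA R" if AB: "A : PA R" "B : PA R" for A B c
  using AB Q[OF AB(1)] Q[OF AB(2)] unfolding P
  by (auto intro!: lo(3,6) ls(3,6) ap_lincomb QLD(5) simp: \<phi>D(3,4) QLD(6) adj_add adj_scaleC b[OF AB(1)] b[OF AB(2)] \<B>_intros)
 have z: "0 : PA R" using lin[OF i' i', of "-1"] by (simp add: scaleC_minus_one)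
 have ad: "adj A : PA R" if A: "A : PA R" for A
  using A Q[OF A] b[OF A] unfolding P by (auto intro!: lo(5) ls(5) simp: \<phi>D(2))
 have "A oL B : PA R" if AB: "A : PA R" "B : PA R" for A B
 proof -
  have "ap (A oL B) R' & ap (adj (A oL B)) R'" if "R' : \<K>" "closure R <= R'" for R'
   unfolding adj_compose[OF b[OF AB(1)] b[OF AB(2)]]
   using ap_compose[OF AB[unfolded r(1)] r(2,3) that[unfolded r(1)]] ap_compose[OF ad[OF AB(2), unfolded r(1)] ad[OF AB(1), unfolded r(1)] r(2,3) that[unfolded r(1)]] by blast
  thus ?thesis using AB Q[OF AB(1)] Q[OF AB(2)] by (auto intro!: lo(4) ls(4) simp: P \<phi>D(5))
 qed
 moreover have "A + B : PA R" if "A : PA R" "B : PA R" for A B using lin[OF that, of 1] by simp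
 moreover have "c *C A : PA R" if "A : PA R" for A c using lin[OF that z, of c] by simp
 ultimately show ?thesis unfolding op_algebra_def by (intro conjI ballI allI subsetI i' ad b)
qed

lemma PA_mono:
 assumes R: "R : \<K>" "R' : \<K>" "R <= R'"
 shows "PA R <= PA R'"
proof
 fix A assume A: "A : PA R"
 have "N ((%x. l *R x) ` R) <= N ((%x. l *R x) ` R')" if "l > 0" for l
  by (intro isotony dc_scale image_mono R that)
 thus "A : PA R'"
  using A isotony[OF R] closure_mono[OF R(3)] unfolding PA_iff[OF R(1)] PA_iff[OF R(2)] by (meson order_trans subsetD)
qed

lemma PA_quasi_local: "op_algebra (quasi_local PA)" "closed (quasi_local PA)"
 by (rule quasi_local_op_algebra; rule PA_op_algebra PA_mono; assumption)+

end

section \<open>Decoherence in the scaling limit, and the ideals\<close>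

lemma tendsto_positive_eq:
 fixes f :: "real => 'a::real_normed_vector"
 assumes "(f ---> L) P" "!!l. l > 0 ==> g l = f l" "P <= at_right 0"
 shows "(g ---> L) P"
proof (rule Lim_transform_eventually[OF assms(1)])
 have "\<forall>\<^sub>F l in P. l > (0::real)" by (rule filter_leD[OF assms(3)]) (simp add: eventually_at_right_less)
 thus "\<forall>\<^sub>F l in P. f l = g l" by eventually_elim (simp add: assms(2))
qed

lemma tendsto_positive_le:
 fixes f :: "real => 'a::real_normed_vector"
 assumes "(b ---> 0) P" "!!l. l > 0 ==> norm (f l) <= b l" "P <= at_right 0"
 shows "(f ---> 0) P"
proof (rule Lim_null_comparison[OF _ assms(1)])
 have "\<forall>\<^sub>F l in P. l > (0::real)" by (rule filter_leD[OF assms(3)]) (simp add: eventually_at_right_less)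
 thus "\<forall>\<^sub>F l in P. norm (f l) <= b l" by eventually_elim (rule assms(2))
qed

lemma scaleC_tendsto: "(f ---> c) F ==> (g ---> x) F ==> ((%y. f y *C g y) ---> c *C (x :: 'a::complex_normed_vector)) F"
proof (rule bounded_bilinear.tendsto[of scaleC])
 show "bounded_bilinear (scaleC :: complex => 'a => 'a)"
  by unfold_locales (auto simp: scaleC_add_left scaleC_add_right norm_scaleC scaleC_scaleC scaleC_of_real[symmetric] scaleR_conv_of_real
   mult.commute intro!: exI[of _ 1])
qed

context weyl_net
begin

text \<open>\<open>nul P h A\<close>: the dilates of A annihilate the dilated coherent vector of h in the limit.\<close>

definition nul :: "real filter => (real => complex) => 'h op => bool" where
 "nul P h A \<longleftrightarrow> ((%l. norm (\<phi> l A (V (dilation l h) vac))) ---> 0) P"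

lemma eventually_scale_pos: "P <= at_right 0 ==> \<forall>\<^sub>F l in P. l > (0::real)"
 by (erule filter_leD) (simp add: eventually_at_right_less)

lemma norm_coherent: "l > 0 ==> h : \<D> ==> norm (V (dilation l h) vac) = 1"
 by (simp add: norm_V_apply tf_dilation norm_Omega)

lemma nul_bound:
 assumes P: "P <= at_right 0" and n: "nul P h A" and b: "!!l. l > 0 ==> norm (\<phi> l B (V (dilation l h) vac)) <= c*norm (\<phi> l A (V (dilation l h) vac))"
 shows "nul P h B"
proof -
 have "((%l. c*norm (\<phi> l A (V (dilation l h) vac))) ---> c*0) P" using n unfolding nul_def by (intro tendsto_intros)
 hence "((%l. c*norm (\<phi> l A (V (dilation l h) vac))) ---> 0) P" by simp
 thus ?thesis unfolding nul_def by (rule tendsto_positive_le[OF _ _ P]) (use b in simp)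
qed

lemma nul_left:
 assumes P: "P <= at_right 0" and n: "nul P h A" and Q: "A : QL" "C : QL"
 shows "nul P h (C oL A)"
proof (rule nul_bound[OF P n])
 fix l :: real assume l: "l > 0"
 show "norm (\<phi> l (C oL A) (V (dilation l h) vac)) <= norm C*norm (\<phi> l A (V (dilation l h) vac))"
  unfolding \<phi>D(5)[OF l Q(2,1)] oL_app
  by (intro order_trans[OF norm_blinfun] mult_right_mono \<phi>D(9)[OF l Q(2)] norm_ge_zero)
qed

lemma nul_scaleC: "P <= at_right 0 ==> nul P h A ==> A : QL ==> nul P h (c *C A)"
 by (rule nul_bound[where c = "cmod c"]) (auto simp: \<phi>D(3) scaleC_app norm_scaleC)

lemma nul_add:
 assumes P: "P <= at_right 0" and n: "nul P h A" "nul P h B" and Q: "A : QL" "B : QL"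
 shows "nul P h (A + B)"
proof -
 let ?v = "%l. V (dilation l h) vac"
 have "((%l. norm (\<phi> l A (?v l)) + norm (\<phi> l B (?v l))) ---> 0 + 0) P" using n unfolding nul_def by (intro tendsto_intros)
 hence "((%l. norm (\<phi> l A (?v l)) + norm (\<phi> l B (?v l))) ---> 0) P" by simp
 thus ?thesis unfolding nul_def
  by (rule tendsto_positive_le[OF _ _ P]) (simp add: \<phi>D(4)[OF _ Q] blinfun.add_left norm_triangle_ineq)
qed

lemma nul_limit:
 assumes P: "P <= at_right 0" and h: "h : \<D>" and A: "A : QL"
  and lim: "!!e. e > 0 ==> \<exists>A'\<in>QL. nul P h A' & norm (A - A') <= e"
 shows "nul P h A"
 unfolding nul_def
proof (rule tendstoI)
 fix e :: real assume "e > 0"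
 hence e: "e/2 > 0" by simp
 obtain A' where A': "A' : QL" "nul P h A'" "norm (A - A') <= e/2" using lim[OF e] by blast
 show "\<forall>\<^sub>F l in P. dist (norm (\<phi> l A (V (dilation l h) vac))) 0 < e"
  using tendstoD[OF A'(2)[unfolded nul_def] e] eventually_scale_pos[OF P]
 proof eventually_elim
  case (elim l)
  let ?v = "V (dilation l h) vac"
  have "norm (\<phi> l (A - A') ?v) <= norm (A - A')"
   using norm_blinfun[of "\<phi> l (A - A')" ?v] \<phi>D(9)[OF elim(2) QL_diff[OF A A'(1)]] norm_coherent[OF elim(2) h] by simp
  moreover have "\<phi> l A ?v = \<phi> l (A - A') ?v + \<phi> l A' ?v" by (simp add: \<phi>D(8)[OF elim(2) A A'(1)] blinfun.diff_left)
  ultimately show ?case using A'(3) elim(1) norm_triangle_ineq[of "\<phi> l (A - A') ?v" "\<phi> l A' ?v"] by simp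
 qed
qed

lemma nul_id: "nul P h id_blinfun ==> P <= at_right 0 ==> P ~= bot ==> h : \<D> ==> False"
proof -
 assume n: "nul P h id_blinfun" and P: "P <= at_right 0" "P ~= bot" and h: "h : \<D>"
 have "((%l. 1::real) ---> 0) P"
  by (rule tendsto_positive_eq[OF n[unfolded nul_def] _ P(1)]) (simp add: \<phi>D(7) norm_coherent h)
 from tendsto_unique[OF P(2) this tendsto_const] show False by simp
qed

lemma nul_ideal:
 assumes S: "op_algebra S" "closed S" "S <= QL" and P: "P <= at_right 0"
  and J: "J = {A : S. \<forall>i\<in>I. nul P (hh i) (A oL bb i)}" and i: "!!i. i : I ==> hh i : \<D> & bb i : QL"
 shows "closed J" "A : J ==> B : J ==> A + B : J" "A : J ==> c *C A : J" "(!!A B. A : J ==> B : S ==> A oL B : J) ==> closed_ideal J S"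
proof -
 note Sd = op_algebraD[OF S(1)]
 have Q: "A oL bb i : QL" if "A : S" "i : I" for A i using that S(3) i by (auto intro: QLD(4))
 have z: "0 : S" using Sd(6)[OF Sd(2), of 0] by simp
 have "nul P h 0" for h
  using \<phi>D(3)[OF _ QLD(2), of _ 0] eventually_scale_pos[OF P] unfolding nul_def by (intro tendsto_eventually) (auto elim: eventually_mono)
 hence 0: "0 : J" using z by (simp add: J)
 show sc: "c *C A : J" if "A : J" for A c
  using that Q unfolding J by (auto intro!: Sd(6) nul_scaleC[OF P] simp: scaleC_compose_left)
 show ad: "A + B : J" if "A : J" "B : J" for A B
  using that Q unfolding J by (auto intro!: Sd(3) nul_add[OF P] simp: blinfun_compose_add_left)
 have le: "A oL B : J" if "A : S" "B : J" for A B
 proof -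
  have "nul P (hh j) ((A oL B) oL bb j)" if j: "j : I" for j
   unfolding blinfun_compose_assoc' by (rule nul_left[OF P]) (use `A : S` `B : J` Q j S(3) in "auto simp: J")
  thus ?thesis using that by (auto simp: J Sd(4))
 qed
 have "closure J <= J"
 proof
  fix A assume A: "A : closure J"
  have AS: "A : S" using closure_mono[of J S] A S(2) by (auto simp: J)
  have "nul P (hh j) (A oL bb j)" if j: "j : I" for j
  proof (rule nul_limit[OF P conjunct1[OF i[OF j]] Q[OF AS j]])
   fix e :: real assume "e > 0"
   hence ep: "e/(norm (bb j) + 1) > 0" by (simp add: add_nonneg_pos)
   then obtain B where B: "B : J" "dist B A < e/(norm (bb j) + 1)" using A by (meson closure_approachable)
   have "norm ((A oL bb j) - (B oL bb j)) <= norm (A - B)*norm (bb j)"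
    unfolding blinfun_compose_diff_left[symmetric] by (rule norm_blinfun_compose)
   also have "... <= e/(norm (bb j) + 1)*(norm (bb j) + 1)"
    using B(2) ep by (intro mult_mono) (auto simp: dist_norm norm_minus_commute)
   also have "... = e" by (simp add: add_nonneg_eq_0_iff)
   finally show "\<exists>A'\<in>QL. nul P (hh j) A' & norm ((A oL bb j) - A') <= e" using B(1) Q j unfolding J by blast
  qed
  thus "A : J" using AS by (simp add: J)
 qed
 thus cl: "closed J" unfolding closure_eq[symmetric] by (rule subset_antisym[OF _ closure_subset])
 have "J <= S" by (auto simp: J)
 thus "closed_ideal J S" if right: "!!A B. A : J ==> B : S ==> A oL B : J"
  unfolding closed_ideal_def by (intro conjI ballI allI 0 sc ad le right cl)
qed

text \<open>Operators which are smeared Weyl operators at all scales.\<close>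

definition smeared :: "'h op => (real^2 => complex) => (real^2 => real => complex) => bool" where
 "smeared A g F \<longleftrightarrow> A : QL & integrable lborel g & (\<forall>y. F y : \<D>) \<and>
   (\<forall>l>0. wint lborel g (%y. V (dilation l (F y))) (\<phi> l A) & (\<forall>x. continuous_on UNIV (%y. V (dilation l (F y)) x)))"

lemma dilation_add: "dilation l (%x. f x + g x) = (%x. dilation l f x + dilation l g x)"
 and dilation_uminus: "dilation l (%x. - f x) = (%x. - dilation l f x)"
 and dilation_diff: "dilation l (%x. f x - g x) = (%x. dilation l f x - dilation l g x)"
 by (auto simp: dilation_def algebra_simps add_divide_distrib diff_divide_distrib)

lemma V_uminus_apply: "f : \<D> ==> cinner x (V (%t. - f t) y) = cnj (cinner y (V f x))"
 by (metis V_bounded adj_V cinner_adj_right cinner_commute)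

lemma smeared_adj:
 assumes "smeared A g F" shows "smeared (adj A) (%y. cnj (g y)) (%y x. - F y x)"
proof -
 note s = assms[unfolded smeared_def]
 have F: "F y : \<D>" for y using s by blast
 have "wint lborel (%y. cnj (g y)) (%y. V (dilation l (%x. - F y x))) (\<phi> l (adj A))"
  and "continuous_on UNIV (%y. V (dilation l (%x. - F y x)) x)" if l: "l > 0" for l x
 proof -
  note dF = tf_dilation[OF F l]
  show "wint lborel (%y. cnj (g y)) (%y. V (dilation l (%x. - F y x))) (\<phi> l (adj A))"
   using wint_adj[of "\<phi> l A" "%y. V (dilation l (F y))" lborel g] s l
   by (simp add: \<phi>D(2) adj_V[OF dF] dilation_uminus QLD(1) \<phi>D(1))
  have "continuous_on UNIV (%y. cinner z (V (%x. - dilation l (F y) x) x))" for z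
   unfolding V_uminus_apply[OF dF] by (intro continuous_on_cnj continuous_on_cinner_right) (use s l in blast)
  thus "continuous_on UNIV (%y. V (dilation l (%x. - F y x)) x)"
   unfolding dilation_uminus by (rule strongly_continuous_isometries[OF norm_V_apply[OF tf_uminus[OF dF]]])
 qed
 thus ?thesis using s unfolding smeared_def by (auto intro: QLD(5) tf_uminus)
qed

text \<open>A smeared Weyl operator maps a dilated coherent vector to an integral of dilated coherent vectors.\<close>

lemma nul_smeared_right:
 assumes A: "A : QL" "!!h. h : \<D> ==> nul (at_right 0) h A" and B: "smeared B g F" and h: "h : \<D>"
 shows "nul (at_right 0) h (A oL B)"
proof -
 note s = B[unfolded smeared_def]
 have F: "F y : \<D>" for y using s by blast
 let ?v = "%l. V (dilation l h) vac"
 let ?u = "%l y. V (dilation l (F y)) (?v l)"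
 let ?t = "%l y. norm (\<phi> l A (?u l y))"
 have tb: "?t l y <= norm A" if l: "l > 0" for l y
  using norm_blinfun[of "\<phi> l A" "?u l y"] \<phi>D(9)[OF l A(1)]
  by (simp add: norm_V_apply[OF tf_dilation[OF F l]] norm_coherent[OF l h])
 have t0: "((%l. ?t l y) ---> 0) (at_right 0)" for y
 proof -
  have "?t l y = norm (\<phi> l A (V (dilation l (%x. F y x + h x)) vac))" if l: "l > 0" for l
  proof -
   have pb: "\<phi> l A : \<B>" by (rule QLD(1)[OF \<phi>D(1)[OF l A(1)]])
   have "?u l y = exp (- (\<i>/2) * of_real (sympl (dilation l (F y)) (dilation l h))) *C V (dilation l (%x. F y x + h x)) vac"
    unfolding dilation_add using arg_cong[OF V_mult[OF tf_dilation[OF F l] tf_dilation[OF h l]], of "%A. A vac"]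
    by (simp only: oL_app scaleC_app)
   moreover have "cmod (exp (- (\<i>/2) * of_real r)) = 1" for r by simp
   ultimately show ?thesis by (simp only: \<B>_scaleC[OF pb] norm_scaleC)
  qed
  thus ?thesis by (rule tendsto_positive_eq[OF A(2)[OF tf_add[OF F h], of y, unfolded nul_def] _ order_refl])
 qed
 have tc: "continuous_on UNIV (?t l)" if l: "l > 0" for l
  using s l by (intro continuous_on_norm bounded_linear.continuous_on[OF blinfun.bounded_linear_right]) auto
 have gg: "integrable lborel g" using s by blast
 note gi = integrable_norm[OF gg]
 have tm: "?t l : borel_measurable lborel" if "l > 0" for l using borel_cont[OF tc[OF that]] by simp
 have m: "(%y. cmod (g y)*?t l y) : borel_measurable lborel" if l: "l > 0" for l
  by (intro borel_measurable_times borel_measurable_integrable[OF gi] tm l)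
 have D: "((%l. LI y. cmod (g y)*?t l y) ---> (LINT y|(lborel::(real^2) measure). 0)) (at_right 0)"
 proof (rule dominated_convergence_at_within[where w = "%y. cmod (g y)*norm A"])
  show "AE y in lborel. ((%l. cmod (g y)*?t l y) ---> 0) (at_right 0)"
   using tendsto_mult_right_zero[OF t0] by simp
 qed (use gi m tb in "auto intro: mult_left_mono")
 have bd: "norm (\<phi> l (A oL B) (?v l)) <= (LI y. cmod (g y)*?t l y)" if l: "l > 0" for l
 proof (rule norm_le_if_cinner_le)
  have pb: "\<phi> l A : \<B>" by (rule QLD(1)[OF \<phi>D(1)[OF l A(1)]])
  have BQ: "B : QL" and wi: "wint lborel g (%y. V (dilation l (F y))) (\<phi> l B)" using s l by auto
  have mi: "integrable lborel (%y. cmod (g y)*?t l y)"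
   by (rule BI_bound[OF integrable_mult_left[OF gi, of "norm A"] m[OF l]])
     (use tb[OF l] in "auto intro!: mult_left_mono")
  show "0 <= (LI y. cmod (g y)*?t l y)" by simp
  fix x :: 'h assume x: "norm x <= 1"
  have e: "cinner x (\<phi> l A z) = cinner (adj (\<phi> l A) x) z" for z by (simp add: cinner_adj_left pb)
  have "cinner x (\<phi> l (A oL B) (?v l)) = (LI y. g y*cinner x (\<phi> l A (?u l y)))"
   by (simp add: \<phi>D(5)[OF l A(1) BQ] e wintD(2)[OF wi])
  also have "cmod ... <= (LI y. cmod (g y)*?t l y)"
  proof (rule order_trans[OF integral_norm_bound integral_mono[OF _ mi]])
   show "integrable lborel (%y. norm (g y*cinner x (\<phi> l A (?u l y))))"
    unfolding e by (intro integrable_norm wintD(1)[OF wi])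
   show "norm (g y*cinner x (\<phi> l A (?u l y))) <= cmod (g y)*?t l y" for y
    unfolding norm_mult using cinner_norm_le[of x "\<phi> l A (?u l y)"] mult_right_mono[OF x, of "?t l y"]
    by (intro mult_left_mono) auto
  qed
  finally show "cmod (cinner x (\<phi> l (A oL B) (?v l))) <= (LI y. cmod (g y)*?t l y)" .
 qed
 show ?thesis unfolding nul_def
  by (rule tendsto_positive_le[OF D[simplified] _ order_refl]) (use bd in simp)
qed

text \<open>If differences of the test functions have non-vanishing mean, the coherent vectors become orthogonal.\<close>

lemma decoherence:
 assumes A: "smeared A g F" and dec: "!!y. g y ~= 0 ==> AE y' in lborel. g y' ~= 0 --> Re_fourier (%x. F y x - F y' x) 0 ~= 0"
  and h: "h : \<D>"
 shows "nul (at_right 0) h A"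
proof -
 note s = A[unfolded smeared_def]
 have F: "F y : \<D>" for y using s by blast
 have AQ: "A : QL" and gi: "integrable lborel g" using s by auto
 let ?v = "%l. V (dilation l h) vac"
 let ?w = "%l. \<phi> l A (?v l)"
 let ?T = "%l y. V (dilation l (F y)) (?v l)"
 have wi: "wint lborel g (%y. V (dilation l (F y))) (\<phi> l A)" if "l > 0" for l using s that by blast
 have nT: "norm (?T l y) = 1" if "l > 0" for l y by (simp add: norm_V_apply[OF tf_dilation[OF F that]] norm_coherent that h)
 have nA: "norm (?w l) <= norm A" if "l > 0" for l
  using norm_blinfun[of "\<phi> l A" "?v l"] \<phi>D(9)[OF that AQ] norm_coherent[OF that h] by simp
 note dct = dominated_convergence_at_within[where f = "%_. 0", simplified]
 have 1: "((%l. g y*cinner (?w l) (?T l y)) ---> 0) (at_right 0)" for y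
 proof (cases "g y = 0")
  case False
  have "((%l. LI y'. g y'*cinner (?T l y) (?T l y')) ---> (LINT y'|(lborel::(real^2) measure). 0)) (at_right 0)"
  proof (rule dominated_convergence_at_within[where w = "%y'. cmod (g y')"])
   show "AE y' in lborel. ((%l. g y'*cinner (?T l y) (?T l y')) ---> 0) (at_right 0)"
    using dec[OF False]
   proof eventually_elim
    case (elim y')
    show ?case
    proof (cases "g y' = 0")
     case False
     let ?d = "%x. F y x - F y' x"
     have "filterlim (%l. mnsq (l*m) ?d/2) at_top (at_right 0)"
      using filterlim_tendsto_pos_mult_at_top[OF tendsto_const[of "1/2::real"] _ mnsq_diverges[OF tf_diff[OF F F] _ m]] elim False by simp
     hence "((%l. exp (- (mnsq (l*m) ?d/2))) ---> 0) (at_right 0)"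
      by (intro filterlim_compose[OF exp_at_bot] filterlim_compose[OF filterlim_uminus_at_bot_at_top])
     moreover have "cmod (cinner (?T l y) (?T l y')) = exp (- (mnsq (l*m) ?d/2))" if l: "l > 0" for l
      unfolding V_coherent_shift_norm[OF tf_dilation[OF h l] tf_dilation[OF F l] tf_dilation[OF F l]]
       dilation_diff[symmetric] mnsq_dilation[OF l m] ..
     ultimately have "((%l. cmod (cinner (?T l y) (?T l y'))) ---> 0) (at_right 0)"
      by (rule tendsto_positive_eq[OF _ _ order_refl])
     thus ?thesis by (rule tendsto_mult_right_zero[OF tendsto_norm_zero_cancel])
    qed simp
   qed
   show "cmod (g y'*cinner (?T l y) (?T l y')) <= cmod (g y')" if "l : {0<..}" for l y'
    using cinner_norm_le[of "?T l y" "?T l y'"] nT that by (simp add: norm_mult mult_left_le)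
   show "(%y'. g y'*cinner (?T l y) (?T l y')) : borel_measurable lborel" if "l : {0<..}" for l
    using wintD(1)[OF wi] that by (intro borel_measurable_integrable) auto
  qed (use gi in auto)
  hence "((%l. cinner (?T l y) (?w l)) ---> 0) (at_right 0)"
   unfolding Bochner_Integration.integral_zero by (rule tendsto_positive_eq[OF _ wintD(2)[OF wi] order_refl])
  hence "((%l. cnj (cinner (?T l y) (?w l))) ---> cnj 0) (at_right 0)" by (rule tendsto_cnj)
  thus ?thesis by (simp add: cinner_commute[of "\<phi> _ A _"] tendsto_mult_right_zero)
 qed simp
 have "((%l. LI y. g y*cinner (?w l) (?T l y)) ---> (LINT y|(lborel::(real^2) measure). 0)) (at_right 0)"
 proof (rule dominated_convergence_at_within[where w = "%y. cmod (g y)*norm A"])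
  show "(%y. g y*cinner (?w l) (?T l y)) : borel_measurable lborel" if "l : {0<..}" for l
   using wintD(1)[OF wi] that by (intro borel_measurable_integrable) auto
  show "cmod (g y*cinner (?w l) (?T l y)) <= cmod (g y)*norm A" if "l : {0<..}" for l y
   using cinner_norm_le[of "?w l" "?T l y"] nT[of l y] nA[of l] that unfolding norm_mult by (intro mult_left_mono) auto
 qed (use gi 1 in auto)
 hence "((%l. cinner (?w l) (?w l)) ---> 0) (at_right 0)"
  unfolding Bochner_Integration.integral_zero by (rule tendsto_positive_eq[OF _ wintD(2)[OF wi] order_refl])
 hence "((%l. sqrt (cmod (cinner (?w l) (?w l)))) ---> sqrt (cmod 0)) (at_right 0)" by (intro tendsto_intros)
 thus ?thesis unfolding nul_def cinner_self by (simp add: norm_power)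
qed

text \<open>Regularized Weyl operators are smeared. The translations are first confined to a ball containing the
 support of the smearing function, so that all translates belong to one local algebra.\<close>

definition retract :: "real => real^2 => real^2" where
 "retract b y = (b/max b (norm y)) *R y"

lemma retract:
 assumes "b > 0"
 shows "continuous_on UNIV (retract b)" "norm (retract b y) <= b" "norm y <= b ==> retract b y = y"
proof -
 have "max b (norm y) ~= 0" for y :: "real^2" using assms by (smt (verit) max.cobounded1)
 thus "continuous_on UNIV (retract b)" unfolding retract_def[abs_def] by (intro continuous_intros) auto
 show "norm (retract b y) <= b"
  using assms by (simp add: retract_def pos_divide_le_eq)
 show "norm y <= b ==> retract b y = y" using assms by (simp add: retract_def)
qed

lemma act_translation_local:
 assumes f: "f : tf_in a b" and ab: "a < b" and y: "norm y <= c"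
 shows "act (mat 1, y) f : tf_in (a - 2*c) (b + 2*c)"
proof -
 have y': "\<bar>y $ 1\<bar> <= c" "\<bar>y $ 2\<bar> <= c" using y component_le_norm_cart[of y] by (auto intro: order_trans)
 have "tcone (mat 1, y) a b <= tcone (mat 1, 0) (a - 2*c) (b + 2*c)"
  unfolding translate_cone[OF mat1_lorentz] by (subst lc_rect_subset_iff) (use ab y' in auto)
 from change_frame[OF PG_trans PG_trans ab this f] obtain f2
  where "f2 : tf_in (a - 2*c) (b + 2*c)" "act (mat 1, y) f = act (mat 1, 0) f2" by blast
 thus ?thesis using act_one[of f2] by (simp add: tf_in_def)
qed

lemma smearedI:
 assumes g: "continuous_on UNIV g" "\<forall>y. g y ~= 0 --> norm y <= c" and c: "c > 0" and f: "f : tf_in a b" and ab: "a < b"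
  and A: "A : \<B>" "wint lborel g (%y. V (act (mat 1, y) f)) A"
 shows "smeared A g (%y. act (mat 1, retract c y) f)" "integrable lborel g" "A : N (cone_over (a - 2*c) (b + 2*c))"
proof -
 let ?F = "%y. act (mat 1, retract c y) f" and ?a = "a - 2*c" and ?b = "b + 2*c"
 have ft: "f : \<D>" using f by (simp add: tf_in_def)
 have F: "?F y : tf_in ?a ?b" for y by (rule act_translation_local[OF f ab retract(2)[OF c]])
 have Ft: "?F y : \<D>" for y using F by (simp add: tf_in_def)
 have ab': "?a < ?b" using ab c by simp
 have R: "cone_over ?a ?b : \<K>" using cone_double_cone[OF PG_trans ab', of 0] by (simp add: tcone_one)
 have VF: "V (?F y) : N (cone_over ?a ?b)" for y by (rule V_local[OF ab' F])
 have "integrable lborel (%y. indicator (cball 0 c) y *R g y)"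
  by (rule borel_integrable_compact) (auto intro: continuous_on_subset[OF g(1)])
 moreover have "(%y. indicator (cball 0 c) y *R g y) = g" using g(2) by (fastforce simp: indicator_def)
 ultimately show gi: "integrable lborel g" by simp
 have eq: "g y*cinner x (V (?F y) z) = g y*cinner x (V (act (mat 1, y) f) z)" for x y z
  using retract(3)[OF c, of y] g(2) by (cases "g y = 0") auto
 have wi: "wint lborel g (%y. V (?F y)) A" using A(2) unfolding wint_def eq .
 show AN: "A : N (cone_over ?a ?b)"
  unfolding local_algebra_frame[OF PG_trans ab', of 0, unfolded tcone_one]
  by (rule wint_in_bicommutant[OF frame_gens(1,3)[OF PG_trans] A(1) wi])
    (use VF in "auto simp: local_algebra_frame[OF PG_trans ab', of 0, unfolded tcone_one, symmetric]")
 hence AQ: "A : QL" using local_subset_QL[OF R] by blast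
 have "wint lborel g (%y. V (dilation l (?F y))) (\<phi> l A)" "continuous_on UNIV (%y. V (dilation l (?F y)) x)" if l: "l > 0" for l x
 proof -
  have p: "\<phi> l (V (?F y)) = V (dilation l (?F y))" for y by (rule \<phi>_props(3)[OF l Ft])
  show "wint lborel g (%y. V (dilation l (?F y))) (\<phi> l A)"
   using wint_normal_on[OF wi gi norm_V[OF Ft] VF \<phi>_props(2)[OF l R] AN] by (simp only: p)
  have "continuous_on UNIV (%y. cinner u (V (?F y) v))" for u v
   by (rule continuous_on_compose2[OF continuous_translation[OF ft act_related[OF PG_trans ft]] retract(1)[OF c]]) auto
  hence "continuous_on UNIV (%y. cinner u (\<phi> l (V (?F y)) v))" for u v
   by (rule continuous_on_normal_form[OF normal_form_normal_on[OF \<phi>_props(2)[OF l R]] VF norm_V[OF Ft]])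
  thus "continuous_on UNIV (%y. V (dilation l (?F y)) x)"
   unfolding p by (rule strongly_continuous_isometries[OF norm_V_apply[OF tf_dilation[OF Ft l]]])
 qed
 thus "smeared A g ?F" unfolding smeared_def using AQ gi Ft by blast
qed

lemma regularized_wint:
 fixes A :: "'h op"
 assumes g: "continuous_on UNIV g" "\<forall>y. g y ~= 0 --> norm y <= c" and f: "f : \<D>"
 shows "\<exists>A\<in>\<B>. wint lborel g (%y. V (act (mat 1, y) f)) A \<and>
   (\<forall>x. ((%y. g y *C V (act (mat 1, y) f) x) has_integral A x) UNIV)"
  and "(!!x. ((%y. g y *C V (act (mat 1, y) f) x) has_integral A x) UNIV) ==> wint lborel g (%y. V (act (mat 1, y) f)) A"
proof -
 let ?T = "%y. V (act (mat 1, y) f)"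
 have Ft: "act (mat 1, y) f : \<D>" for y by (rule tf_act[OF PG_trans f])
 have wc: "continuous_on UNIV (%y. cinner u (?T y v))" for u v
  by (rule continuous_translation[OF f act_related[OF PG_trans f]])
 have ci: "integrable lborel k" if k: "continuous_on UNIV k" "!!y. g y = 0 ==> k y = 0" for k :: "real^2 => complex"
 proof -
  have "(%y. indicator (cball 0 c) y *R k y) = k" using g(2) k(2) by (fastforce simp: indicator_def)
  thus ?thesis using borel_integrable_compact[OF compact_cball continuous_on_subset[OF k(1)], of 0 c] by simp
 qed
 have wi: "integrable lborel (%y. g y*cinner u (?T y v))" for u v by (rule ci) (auto intro: continuous_on_mult g(1) wc)
 have hi: "((%y. g y*cinner u (?T y v)) has_integral cinner u I) UNIV" if "((%y. g y *C ?T y v) has_integral I) UNIV" for u v I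
  using has_integral_linear[OF that bounded_linear_cinner[of u]] by (simp add: comp_def cinner_scaleC_right)
 show "wint lborel g ?T A" if A: "!!x. ((%y. g y *C ?T y x) has_integral A x) UNIV"
  unfolding wint_def using wi has_integral_unique[OF hi[OF A] has_integral_integral_lborel[OF wi]] by blast
 obtain A where A: "A : \<B>" "wint lborel g ?T A"
  using wint_exists[of lborel g ?T] ci[OF g(1)] borel_cont[OF wc] norm_V[OF Ft] by auto
 have "((%y. g y *C ?T y x) has_integral A x) UNIV" for x
 proof -
  have "continuous_on UNIV (%y. ?T y x)" by (rule strongly_continuous_isometries[OF norm_V_apply[OF Ft] wc])
  hence sc: "continuous_on UNIV (%y. g y *C ?T y x)"
   unfolding continuous_on_def by (auto intro!: scaleC_tendsto simp: g(1)[unfolded continuous_on_def, rule_format])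
  obtain a where a: "cball 0 c <= cbox (- a) (a :: real^2)" using bounded_subset_cbox_symmetric[OF bounded_cball] by metis
  have "(%y. g y *C ?T y x) integrable_on UNIV"
  proof (rule integrable_on_superset[OF integrable_continuous[OF continuous_on_subset[OF sc]], of "- a" a])
   show "g y *C ?T y x = 0" if "y \<notin> cbox (- a) a" for y
   proof -
    have "y \<notin> cball 0 c" using that a by blast
    hence "g y = 0" using g(2) by auto
    thus ?thesis by simp
   qed
  qed auto
  then obtain I where I: "((%y. g y *C ?T y x) has_integral I) UNIV" by blast
  have "I = A x"
   by (rule cinner_extR) (simp add: wintD(2)[OF A(2)] has_integral_unique[OF hi[OF I] has_integral_integral_lborel[OF wi]])
  thus ?thesis using I by simp
 qed
 thus "\<exists>A\<in>\<B>. wint lborel g ?T A & (\<forall>x. ((%y. g y *C ?T y x) has_integral A x) UNIV)" using A by blast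
qed

subsection \<open>A decoherent smeared Weyl operator\<close>

definition tent :: "real^2 => complex" where
 "tent y = of_real (max 0 (1/(4*m) - norm (y - vector [1/(2*m), 0])))"

lemma tent:
 shows "continuous_on UNIV tent" "tent y ~= 0 ==> norm y <= 1/m" "tent y ~= 0 ==> 0 < y $ 1 & y $ 1 < 1/m"
proof -
 show "continuous_on UNIV tent" unfolding tent_def[abs_def] by (intro continuous_intros)
 let ?c = "vector [1/(2*m), 0] :: real^2"
 assume "tent y ~= 0"
 hence n: "norm (y - ?c) < 1/(4*m)" by (auto simp: tent_def)
 have "norm ?c = 1/(2*m)" using m by (simp add: norm_vec_def L2_set_def sum_2)
 hence "norm y <= 1/(2*m) + 1/(4*m)" using n norm_triangle_sub[of y ?c] by linarith
 also have "... <= 1/m" using m by (simp add: field_simps)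
 finally show "norm y <= 1/m" .
 have "\<bar>y $ 1 - 1/(2*m)\<bar> < 1/(4*m)" using component_le_norm_cart[of "y - ?c" 1] n by simp
 hence "1/(2*m) - 1/(4*m) < y $ 1" "y $ 1 < 1/(2*m) + 1/(4*m)" by auto
 moreover have "1/(2*m) - 1/(4*m) > 0" "1/(2*m) + 1/(4*m) < 1/m" using m by (simp_all add: field_simps)
 ultimately show "0 < y $ 1 & y $ 1 < 1/m" by simp
qed

lemma tent_integral: "(LI y. tent y) ~= 0"
proof
 assume z: "(LI y. tent y) = 0"
 have "integrable lborel (%y. indicator (cball 0 (1/m)) y *R tent y)"
  by (rule borel_integrable_compact) (auto intro: continuous_on_subset[OF tent(1)])
 moreover have "(%y. indicator (cball 0 (1/m)) y *R tent y) = tent" using tent(2) by (fastforce simp: indicator_def)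
 ultimately have ti: "integrable lborel tent" by simp
 have "Re (tent (vector [1/(2*m), 0])) = 0"
  by (rule continuous_integral_zero[of "%y. Re (tent y)"])
    (use z integral_Re[OF ti] integrable_Re[OF ti] tent(1) in \<open>auto intro: continuous_intros simp: tent_def[of "_ :: real^2"]\<close>)
 thus False using m by (simp add: tent_def)
qed

lemma Re_fourier_translate:
 assumes f: "f : \<D>" "!!x. Im (f x) = 0"
 shows "Re_fourier (act (mat 1, y) f) 0 = of_real (cos (m*y $ 1)) * Re_fourier f 0"
proof -
 have I: "Im_fourier f p = 0" for p by (simp add: Im_fourier_def fourier_def f(2))
 have a: "Im (Re_fourier f 0) = 0" using Re_fourier_minus[of f 0] by (simp add: complex_eq_iff)
 have "ftr m (act (mat 1, y) f) 0 = cis (y $ 1*m) * Re_fourier f 0"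
  using act_related[OF PG_trans f(1), of y] m unfolding translation_related_iff
  by (simp add: ftr_def[of m f] I disp_def cis_conv_exp)
 thus ?thesis
  unfolding ftr_parts(1)[of "act (mat 1, y) f" 0 m] by (simp add: complex_eq_iff a mult.commute[of m])
qed

lemma Re_fourier_diff:
 "f : \<D> ==> g : \<D> ==> Re_fourier (%x. f x - g x) p = Re_fourier f p - Re_fourier g p"
 unfolding ftr_parts(1)[of _ p m] by (simp add: ftr_linear(3) diff_divide_distrib[symmetric])

lemma bump_tf_in: "bump : tf_in (- 1) 2"
 unfolding tf_in_iff by (rule conjI[OF tf_bump], rule exI[of _ 0], rule exI[of _ 1]) (use bump_zero linear in force)

text \<open>At time \<open>t\<close> the bump has mean proportional to \<open>cos (m t)\<close>, and this is injective on the support of the tent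
 function, which is centred at the time \<open>1 / (2 m)\<close>.\<close>

lemma decoherent_operator:
 obtains A a b F where "a < b" "A : N (cone_over a b)" "A : regularized_weyl V \<alpha>" "smeared A tent F" "!!y. F y : tf_in a b"
  "cinner vac (A vac) ~= 0" "!!h. h : \<D> ==> nul (at_right 0) h A & nul (at_right 0) h (adj A)"
proof -
 have c: "1/m > 0" using m by simp
 obtain A where A: "A : \<B>" "wint lborel tent (%y. V (act (mat 1, y) bump)) A"
   "!!x. ((%y. tent y *C V (act (mat 1, y) bump) x) has_integral A x) UNIV"
  using regularized_wint(1)[of tent "1/m", OF tent(1) _ tf_bump] tent(2) by blast
 let ?F = "%y. act (mat 1, retract (1/m) y) bump"
 have ab: "(- 1 :: real) < 2" "- 1 - 2*(1/m) < 2 + 2*(1/m)" using c by linarith+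
 have ts: "\<forall>y. tent y ~= 0 --> norm y <= 1/m" using tent(2) by blast
 note sm = smearedI[OF tent(1) ts c bump_tf_in ab(1) A(1,2)]
 have "compact (closure {y. tent y ~= 0})"
  by (rule compact_closure[THEN iffD2], rule bounded_subset[OF bounded_cball[of 0 "1/m"]]) (use tent(2) in auto)
 hence reg: "A : regularized_weyl V \<alpha>"
  unfolding regularized_weyl_def mem_Collect_eq
  by (intro exI[of _ tent] exI[of _ bump]) (use tent(1) tf_bump A(3) \<alpha>_props(3)[OF PG_trans tf_bump] in simp)
 have "cinner vac (A vac) = (LI y. tent y * of_real (exp (- (1/2)*mnsq m bump)))"
  using wintD(2)[OF A(2), of vac vac] tf_bump
  by (simp add: V_vacuum tf_act mnsq_translation[OF m act_related[OF PG_trans tf_bump]])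
 hence ne: "cinner vac (A vac) ~= 0" using tent_integral by simp
 have dec: "AE y' in lborel. tent y' ~= 0 --> Re_fourier (%x. ?F y x - ?F y' x) 0 ~= 0" if y: "tent y ~= 0" for y
  using AE_lborel_inner_neq[of "axis 1 1 :: real^2" "y $ 1"]
 proof (rule AE_mp[OF _ AE_I2], simp, intro impI notI)
  fix y' :: "real^2" assume ne: "y' \<bullet> axis 1 1 ~= y $ 1" and y': "tent y' ~= 0" and z: "Re_fourier (%x. ?F y x - ?F y' x) 0 = 0"
  have r: "retract (1/m) z = z" if "tent z ~= 0" for z by (rule retract(3)[OF c tent(2)[OF that]])
  have F: "act (mat 1, z) bump : \<D>" for z by (rule tf_act[OF PG_trans tf_bump])
  have "Re_fourier (%x. ?F y x - ?F y' x) 0 = Re_fourier (?F y) 0 - Re_fourier (?F y') 0"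
   by (rule Re_fourier_diff[OF F F])
  hence "of_real (cos (m*y $ 1)) * Re_fourier bump 0 = of_real (cos (m*y' $ 1)) * Re_fourier bump 0"
   using z unfolding r[OF y] r[OF y'] Re_fourier_translate[OF tf_bump bump_real] by simp
  hence "cos (m*y $ 1) = cos (m*y' $ 1)" using Re_fourier_bump by simp
  moreover have "0 <= m*z $ 1 & m*z $ 1 <= pi" if "tent z ~= 0" for z
  proof -
   have "m*z $ 1 <= m*(1/m)" using tent(3)[OF that] m by (intro mult_left_mono) auto
   thus ?thesis using tent(3)[OF that] m pi_gt3 by simp
  qed
  ultimately have "m*y $ 1 = m*y' $ 1" using y y' by (metis cos_inj_pi)
  thus False using ne m by (simp add: cart_eq_inner_axis)
 qed
 have dec': "AE y' in lborel. cnj (tent y') ~= 0 --> Re_fourier (%x. - ?F y x - - ?F y' x) 0 ~= 0" if y: "cnj (tent y) ~= 0" for y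
 proof -
  have F: "?F z : \<D>" for z by (rule tf_act[OF PG_trans tf_bump])
  have "(%x. - ?F y x - - ?F y' x) = (%x. ?F y' x - ?F y x)" for y' by auto
  hence "Re_fourier (%x. - ?F y x - - ?F y' x) 0 = - Re_fourier (%x. ?F y x - ?F y' x) 0" for y'
   by (simp add: Re_fourier_diff[OF F F])
  thus ?thesis using dec[of y] that by simp
 qed
 show ?thesis
 proof (rule that[of "- 1 - 2*(1/m)" "2 + 2*(1/m)" A ?F])
  show "?F y : tf_in (- 1 - 2*(1/m)) (2 + 2*(1/m))" for y
   by (rule act_translation_local[OF bump_tf_in _ retract(2)[OF c]]) simp
  show "nul (at_right 0) h A & nul (at_right 0) h (adj A)" if h: "h : \<D>" for h
   using decoherence[OF sm(1) dec h] decoherence[OF smeared_adj[OF sm(1)] dec' h] by blast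
  show "A : regularized_weyl V \<alpha>" by (rule reg)
 qed (rule ab sm(3) sm(1) ne)+
qed

lemma local_subset_bounded: "R : \<K> ==> N R <= \<B>"
 using op_algebraD(1)[OF local_op_algebra] by blast

lemma local_cstar: "R : \<K> ==> op_cstar_subalgebra (N R)"
 using op_algebraD[OF local_op_algebra, of R] op_algebraD(6)[OF local_op_algebra, of R id_blinfun 0] by (simp add: cstar_subalgebra_def closed_local)

abbreviation "WR \<equiv> weyl_reg_algebra m V \<alpha>"

lemma WR_mono: "R : \<K> ==> R' : \<K> ==> R <= R' ==> WR R <= WR R'"
 unfolding weyl_reg_algebra_def cstar_generated_def using isotony[of R R'] by blast

lemma WR_subset: "R : \<K> ==> WR R <= N R"
 unfolding weyl_reg_algebra_def cstar_generated_def using local_cstar by blast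

lemma id_regularized: "id_blinfun : regularized_weyl V \<alpha>"
proof -
 have z: "act (mat 1, y) (%_. 0) = (%_. 0)" for y using act_cmult[OF PG_trans tf_zero, of y 0] by simp
 let ?c = "LI y. tent y" and ?g = "%y. tent y/(LI y. tent y)"
 have g: "continuous_on UNIV ?g" "\<forall>y. ?g y ~= 0 --> norm y <= 1/m" using tent(1,2) tent_integral by (auto intro!: continuous_intros)
 obtain A :: "'h op" where A: "wint lborel ?g (%y. id_blinfun) A" "!!x. ((%y. ?g y *C id_blinfun x) has_integral A x) UNIV"
  using regularized_wint(1)[OF g tf_zero] unfolding z V_zero by blast
 have "A = id_blinfun"
  by (intro blinfun_eqI cinner_extR) (use wintD(2)[OF A(1)] tent_integral in simp)
 moreover have "compact (closure {y. ?g y ~= 0})"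
  by (rule compact_closure[THEN iffD2], rule bounded_subset[OF bounded_cball[of 0 "1/m"]]) (use g(2) in auto)
 moreover have "((%y. ?g y *C sh y (V (%_. 0)) x) has_integral A x) UNIV" for x using A(2)[of x] by (simp add: V_zero \<alpha>D(7))
 hence "A : regularized_weyl V \<alpha>" if "compact (closure {y. ?g y ~= 0})"
  unfolding regularized_weyl_def using g(1) tf_zero that by blast
 ultimately show ?thesis by blast
qed

lemma WR_op_algebra:
 assumes R: "R : \<K>" shows "op_algebra (WR R)"
proof -
 have "id_blinfun : WR R"
  unfolding weyl_reg_algebra_def cstar_generated_def using id_regularized op_algebraD(2)[OF local_op_algebra[OF R]] by blast
 moreover have "op_cstar_subalgebra (WR R)"
  unfolding weyl_reg_algebra_def cstar_generated_def cstar_subalgebra_def by auto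
 ultimately show ?thesis using WR_subset[OF R] local_subset_bounded[OF R] unfolding op_algebra_def cstar_subalgebra_def by blast
qed

lemma regularized_smeared: "B : regularized_weyl V \<alpha> ==> B : \<B> ==> \<exists>g F. smeared B g F"
proof -
 assume "B : regularized_weyl V \<alpha>" and B: "B : \<B>"
 then obtain g f where g: "continuous_on UNIV g" "compact (closure {y. g y ~= 0})" and f: "f : \<D>"
  and I: "!!x. ((%y. g y *C V (act (mat 1, y) f) x) has_integral B x) UNIV"
  unfolding regularized_weyl_def by (auto simp: \<alpha>_props(3))
 have "bounded {y. g y ~= 0}" by (rule bounded_subset[OF compact_imp_bounded[OF g(2)] closure_subset])
 then obtain c where c: "c > 0" "\<forall>y. g y ~= 0 --> norm y <= c" by (auto simp: bounded_pos)
 obtain a b where ab: "!!x. f x ~= 0 ==> a <= x & x <= b" "a < b" using tf_interval[OF f] by metis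
 have f': "f : tf_in (a - 1) (b + 1)" unfolding tf_in_iff by (rule conjI[OF f], rule exI[of _ a], rule exI[of _ b]) (use ab in auto)
 show ?thesis
  using smearedI(1)[OF g(1) c(2,1) f' _ B regularized_wint(2)[OF g(1) c(2) f I]] ab(2) by auto
qed

text \<open>The operators annihilating all coherent vectors in the limit form an ideal of the regularized Weyl algebra;
 the multipliers on the right form a C*-algebra which contains the generators.\<close>

lemma blinfun_compose_id: "A oL id_blinfun = (A :: 'h op)"
 by (rule blinfun_eqI) simp

lemma weyl_reg_not_simple: "\<not> simple_algebra (quasi_local WR)"
proof
 assume simple: "simple_algebra (quasi_local WR)"
 let ?S = "quasi_local WR"
 define JQ where "JQ = {A : QL. \<forall>h\<in>\<D>. nul (at_right 0) h (A oL id_blinfun)}"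
 let ?J = "{A : ?S. \<forall>h\<in>\<D>. nul (at_right 0) h (A oL id_blinfun)}"
 define MB where "MB = {B : QL. \<forall>A\<in>JQ. A oL B : JQ & A oL adj B : JQ}"
 have MB: "B : MB \<longleftrightarrow> B : QL & (\<forall>A\<in>JQ. A oL B : JQ & A oL adj B : JQ)" for B by (simp add: MB_def)
 have JQD: "A : JQ \<longleftrightarrow> A : QL & (\<forall>h\<in>\<D>. nul (at_right 0) h A)" for A by (simp add: JQ_def blinfun_compose_id)
 have S: "op_algebra ?S" "closed ?S" by (rule quasi_local_op_algebra; rule WR_op_algebra WR_mono; assumption)+
 have SQ: "?S <= QL"
  unfolding quasi_local_def[of WR] by (rule closure_minimal) (use WR_subset local_subset_QL QL_algebra(2) in blast)+
 note nJ = nul_ideal[OF QL_algebra subset_refl order_refl, where I = \<D> and hh = "%h. h" and bb = "%_. id_blinfun" and J = JQ, OF JQ_def]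
 have JQ: "closed JQ" "!!A B. A : JQ ==> B : JQ ==> A + B : JQ" "!!A c. A : JQ ==> c *C A : JQ"
  by (rule nJ(1) nJ(2) nJ(3); use QLD(2) in blast)+
 have multiplier: "op_cstar_subalgebra MB"
  unfolding cstar_subalgebra_def
 proof (intro conjI ballI allI)
  have b: "B : \<B>" if "B : MB" for B using that QLD(1) unfolding MB by blast
  have "A oL 0 : JQ & A oL adj 0 : JQ" if A: "A : JQ" for A
  proof -
   have "A oL 0 = 0 *C A" by simp
   thus ?thesis using JQ(3)[OF A, of 0] by (simp only: adj_zero)
  qed
  moreover have "0 : QL" using QLD(6)[OF QLD(2), of 0] by simp
  ultimately show "0 : MB" unfolding MB by blast
  show "B + C : MB" if B: "B : MB" and C: "C : MB" for B C
  proof -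
   have "A oL (B + C) : JQ & A oL adj (B + C) : JQ" if "A : JQ" for A
    unfolding adj_add[OF b[OF B] b[OF C]] blinfun_compose_add_right using B C that JQ(2) unfolding MB by blast
   thus ?thesis using B C QLD(3) unfolding MB by blast
  qed
  show "B oL C : MB" if B: "B : MB" and C: "C : MB" for B C
  proof -
   have "A oL (B oL C) : JQ & A oL adj (B oL C) : JQ" if "A : JQ" for A
    unfolding adj_compose[OF b[OF B] b[OF C]] blinfun_compose_assoc'[symmetric] using B C that unfolding MB by blast
   thus ?thesis using B C QLD(4) unfolding MB by blast
  qed
  show "adj B : MB" if B: "B : MB" for B
  proof -
   have "adj (adj B) = B" by (rule adj_adj[OF b[OF B]])
   thus ?thesis using B QLD(5) unfolding MB by simp
  qed
  show "c *C B : MB" if B: "B : MB" for B c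
  proof -
   have "A oL (c *C B) : JQ & A oL adj (c *C B) : JQ" if A: "A : JQ" for A
   proof -
    have Ab: "A : \<B>" using A QLD(1) unfolding JQD by blast
    show ?thesis unfolding adj_scaleC[OF b[OF B]] scaleC_compose_right[OF Ab] using B A JQ(3) unfolding MB by blast
   qed
   thus ?thesis using B QLD(6) unfolding MB by blast
  qed
  have "B : MB" if B: "B : closure MB" for B
  proof -
   have cl: "closure MB <= QL" by (rule closure_minimal) (use QL_algebra(2) MB in auto)
   hence cb: "closure MB <= \<B>" using QLD(1) by blast
   have "A oL B : JQ & A oL adj B : JQ" if A: "A : JQ" for A
   proof -
    note bl = bounded_linear.continuous_on[OF bounded_bilinear.bounded_linear_right[OF bounded_bilinear_blinfun_compose], of _ _ A]
    have "(%C. A oL C) ` closure MB <= JQ" "(%C. A oL adj C) ` closure MB <= JQ"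
     by (rule image_closure_subset[OF bl[OF continuous_on_id] JQ(1)], use A MB in blast)
       (rule image_closure_subset[OF bl[OF continuous_on_subset[OF continuous_on_adj cb]] JQ(1)], use A MB in blast)
    thus ?thesis using B by blast
   qed
   thus ?thesis using B cl unfolding MB by blast
  qed
  thus "closed MB" unfolding closure_eq[symmetric] by (intro subset_antisym closure_subset subsetI)
 qed
 have gen: "N R \<inter> regularized_weyl V \<alpha> <= MB" if R: "R : \<K>" for R
 proof
  fix B assume B: "B : N R \<inter> regularized_weyl V \<alpha>"
  obtain g F where s: "smeared B g F" using regularized_smeared B local_subset_bounded[OF R] by blast
  have BQ: "B : QL" "adj B : QL" using s smeared_adj[OF s] by (auto simp: smeared_def)
  have "A oL B : JQ & A oL adj B : JQ" if "A : JQ" for A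
   using nul_smeared_right[OF _ _ s, of A] nul_smeared_right[OF _ _ smeared_adj[OF s], of A] that BQ QLD(4)[of A] unfolding JQD by blast
  thus "B : MB" using BQ unfolding MB by blast
 qed
 have WB: "WR R <= MB" if "R : \<K>" for R
  unfolding weyl_reg_algebra_def[of m V \<alpha> R] cstar_generated_def by (rule Inter_lower) (use multiplier gen[OF that] in blast)
 have "closed MB" using multiplier unfolding cstar_subalgebra_def by (rule conjunct1)
 hence SB: "?S <= MB" unfolding quasi_local_def[of WR] by (intro closure_minimal UN_least WB)
 have right: "A oL B : ?J" if A: "A : ?J" and B: "B : ?S" for A B
 proof -
  have "A : JQ" using A SQ unfolding JQD blinfun_compose_id by blast
  hence "A oL B : JQ" using subsetD[OF SB B] MB[of B] by blast
  thus ?thesis using op_algebraD(4)[OF S(1) _ B] A unfolding JQD blinfun_compose_id by blast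
 qed
 have J: "closed_ideal ?J ?S"
  by (rule nul_ideal(4)[OF S SQ order_refl, where I = \<D> and hh = "%h. h" and bb = "%_. id_blinfun", OF refl])
    (use QLD(2) in blast, rule right)
 obtain A a b where A: "a < b" "A : N (cone_over a b)" "A : regularized_weyl V \<alpha>" "cinner vac (A vac) ~= 0"
  "!!h. h : \<D> ==> nul (at_right 0) h A" using decoherent_operator by metis
 have dc: "cone_over a b : \<K>" using cone_double_cone[OF PG_trans A(1), of 0] by (simp add: tcone_one)
 have "A : WR (cone_over a b)" unfolding weyl_reg_algebra_def cstar_generated_def using A(2,3) by blast
 hence "A : ?S" unfolding quasi_local_def using dc by (intro subsetD[OF closure_subset]) blast
 hence "A : ?J" "A ~= 0" using A(4,5) by (auto simp: blinfun_compose_id)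
 moreover have "\<not> nul (at_right 0) (%_. 0) id_blinfun" using nul_id[OF _ order_refl _ tf_zero] by auto
 hence "id_blinfun : ?S" "id_blinfun \<notin> ?J"
  using op_algebraD(2)[OF S(1)] tf_zero unfolding blinfun_compose_id by blast+
 ultimately show False using simple J unfolding simple_algebra_def by blast
qed

end

context scaling_net
begin

text \<open>The ideal of those operators which annihilate, along the scales, all vectors created from the vacuum by the algebra.\<close>

lemma PA_not_simple: "\<not> simple_algebra (quasi_local PA)"
proof
 assume simple: "simple_algebra (quasi_local PA)"
 let ?S = "quasi_local PA" and ?P = KF
 let ?J = "{A : ?S. \<forall>B\<in>?S. nul ?P (%_. 0) (A oL B)}"
 note P = KF(1,2)
 have PQ: "PA R <= QL" if "R : \<K>" for R using local_subset_QL[OF that] by (auto simp: phi_algebra_def)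
 have SQ: "?S <= QL" unfolding quasi_local_def[of PA] by (rule closure_minimal) (use PQ QL_algebra(2) in auto)
 have J: "closed_ideal ?J ?S"
  by (rule nul_ideal(4)[OF PA_quasi_local SQ P(1), where I = ?S and hh = "%_ _. 0" and bb = "%B. B"])
    (use SQ op_algebraD(4)[OF PA_quasi_local(1)] in "auto simp: blinfun_compose_assoc'")
 obtain A a b F where A: "a < b" "A : N (cone_over a b)" "smeared A tent F" "!!y. F y : tf_in a b" "cinner vac (A vac) ~= 0"
  "!!h. h : \<D> ==> nul (at_right 0) h A & nul (at_right 0) h (adj A)" using decoherent_operator by metis
 have R: "lc_rect a b a b : \<K>" using A(1) by simp
 have AQ: "A : QL" using A(3) by (simp add: smeared_def)
 have van: "V (dilation l (%_. 0)) vac = vac" for l by (simp add: dilation_def V_zero)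
 have Al: "\<phi> l A : N ((%x. l *R x) ` lc_rect a b a b)" if l: "l > 0" for l
  using \<phi>_local[OF l A(1)] A(2) l by (simp add: tcone_one cone_over_rect scale_rect)
 let ?z = "%v. apx KF {%_. 0} v"
 have nul_iff: "nul ?P (%_. 0) X \<longleftrightarrow> ?z (%l. \<phi> l X vac)" for X
  unfolding nul_def van tendsto_iff apx_def by (auto elim!: eventually_mono dest: spec[of _ "_/2"] less_imp_le simp: half_gt_zero_iff)
 have small: "?z (%l. \<phi> l X vac)" if "nul (at_right 0) (%_. 0) X" for X
  using that unfolding nul_iff[symmetric] nul_def by (rule tendsto_mono[OF P(1)])
 have "ap X R'" if "nul (at_right 0) (%_. 0) X" "R' : \<K>" for X R'
  by (rule apx_mono[OF small[OF that(1)]]) (use SA_zero[OF that(2)] in auto)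
 hence AP: "A : PA (lc_rect a b a b)"
  unfolding PA_iff[OF R] using A(2,6) Al by (auto simp: cone_over_rect)
 \<comment> \<open>\<open>B \<Omega>\<close> is approximated by far translates, which commute with the dilates of \<open>A\<close>.\<close>
 have nB: "nul ?P (%_. 0) (A oL B)" if B: "B : PA R'" and R': "R' : \<K>" for B R'
 proof -
  have BQ: "B : QL" using B PQ[OF R'] by blast
  obtain u0 u1 v0 v1 where r: "R' = lc_rect u0 u1 v0 v1" "u0 < u1" "v0 < v1" using double_coneE[OF R'] by metis
  let ?R1 = "lc_rect (u0 - 1) (u1 + 1) (v0 - 1) (v1 + 1)"
  have R1: "?R1 : \<K>" "closure R' <= ?R1" "u0 - 1 < u1 + 1" "v0 - 1 < v1 + 1" using r by (auto simp: closure_rect_subset_iff)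
  have nA: "\<forall>\<^sub>F l in KF. norm (\<phi> l A) <= norm A" using KF_pos by eventually_elim (rule \<phi>D(9)[OF _ AQ])
  have "?z (%l. \<phi> l A (\<phi> l B vac))"
  proof (rule apx_apply[OF _ nA])
   show "ap B ?R1" using B R1(1,2) unfolding PA_iff[OF R'] by blast
   fix B' assume B': "B' : SA ?R1"
   obtain D where D: "apx pos_scales (shifts B' D) (%l. B' l vac)" "!!c. c : shifts B' D ==> \<exists>C. \<forall>l>0. norm (c l) <= C"
    "!!c l X. c : shifts B' D ==> l > 0 ==> X : N ((%x. l *R x) ` lc_rect a b a b) ==> X oL c l = c l oL X"
    using far_shifts[OF B' R1(3,4) A(1,1)] by metis
   show "?z (%l. \<phi> l A (B' l vac))"
   proof (rule apx_apply[OF apx_mono[OF D(1) order_refl KF(3)] nA])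
    fix c assume c: "c : shifts B' D"
    obtain C where C: "!!l. l > 0 ==> norm (c l) <= C" using D(2)[OF c] by blast
    have "?z (%l. c l (\<phi> l A vac))"
     by (rule apx_apply[OF small[OF conjunct1[OF A(6)[OF tf_zero]]] eventually_mono[OF KF_pos C]]) (auto intro: apx_in)
    thus "?z (%l. \<phi> l A (c l vac))"
     by (rule apx_cong) (use KF_pos in eventually_elim, use D(3)[OF c] Al in "metis oL_app")
   qed
  qed
  thus ?thesis unfolding nul_iff by (rule apx_cong) (use KF_pos in eventually_elim, simp add: \<phi>D(5) AQ BQ)
 qed
 have nS: "nul ?P (%_. 0) (A oL B)" if B: "B : ?S" for B
 proof (rule nul_limit[OF P(1) tf_zero])
  show "A oL B : QL" using AQ B SQ QLD(4) by blast
  fix e :: real assume "e > 0"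
  hence "e/(norm A + 1) > 0" by (simp add: add_nonneg_pos)
  then obtain B' R' where B': "B' : PA R'" "R' : \<K>" "norm (B - B') <= e/(norm A + 1)"
   using B unfolding quasi_local_def closure_approachable by (metis UN_E dist_commute dist_norm less_imp_le)
  have "norm ((A oL B) - (A oL B')) <= (norm A + 1)*(e/(norm A + 1))"
   unfolding blinfun_compose_diff_right[symmetric]
   by (rule order_trans[OF norm_blinfun_compose mult_mono]) (use B'(3) in auto)
  moreover have "norm A + 1 ~= 0" using norm_ge_zero[of A] by linarith
  ultimately have "norm ((A oL B) - (A oL B')) <= e" by simp
  thus "\<exists>A'\<in>QL. nul ?P (%_. 0) A' & norm ((A oL B) - A') <= e"
   using nB[OF B'(1,2)] AQ PQ[OF B'(2)] B'(1) QLD(4) by blast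
 qed
 have "A : ?S" unfolding quasi_local_def using AP R by (intro subsetD[OF closure_subset]) blast
 hence "A : ?J" "A ~= 0" using nS A(5) by auto
 moreover have i: "id_blinfun : ?S" by (rule op_algebraD(2)[OF PA_quasi_local(1)])
 have "id_blinfun \<notin> ?J"
 proof
  assume "id_blinfun : ?J"
  hence "nul ?P (%_. 0) (id_blinfun oL id_blinfun)" by simp
  thus False using nul_id[OF _ P tf_zero] unfolding blinfun_compose_id by blast
 qed
 ultimately show False using simple J i unfolding simple_algebra_def by blast
qed

end

section \<open>An observable which is not scale-covariant\<close>

text \<open>Gaussian integrals whose quadratic form has a real coefficient along the diagonal.\<close>

definition gauss_fun :: "complex => complex" where
 "gauss_fun z = of_real (1/sqrt (2*pi))*(LI v. exp (- z * of_real (v^2)/2))"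

lemma gauss_fun_integrable:
 assumes "Re z > 0" shows "integrable lborel (%v. exp (- z * of_real (v^2)/2))"
proof (rule BI_bound[OF gauss_integral(1)[OF assms, of 0]])
 show "(%v. exp (- z * of_real (v^2)/2)) : borel_measurable lborel"
  by simp
qed (auto simp: norm_exp_eq_Re)

lemma gauss_fun_real: "r > 0 ==> gauss_fun (of_real r) = of_real (1/sqrt r)"
 using gauss_integral(2)[of r 0] by (simp add: gauss_fun_def real_sqrt_divide)

lemma gauss_fun_bound:
 assumes "r > 0" "Re z >= r" "!!v. cmod (w v) <= C" "w : borel_measurable borel"
 shows "cmod (of_real (1/sqrt (2*pi))*(LI v. w v * exp (- z * of_real (v^2)/2))) <= C*(1/sqrt r)"
proof -
 have C: "C >= 0" using order_trans[OF norm_ge_zero assms(3)] by blast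
 let ?g = "%v. exp (- (r * v^2)/2)"
 have g: "integrable lborel ?g" "(LI v. ?g v) = sqrt (2*pi/r)"
 proof -
  have e: "exp (cor (- (r * s^2)/2) + 0 * of_real s) = cor (?g s)" for s by (simp only: mult_zero_left add_0_right exp_of_real)
  show "integrable lborel ?g" using gauss_integral(1)[OF assms(1), of 0] unfolding e by (simp only: complex_of_real_integrable_eq)
  have "cor (LI v. ?g v) = of_real (sqrt (2*pi/r))"
   using gauss_integral(2)[OF assms(1), of 0] unfolding e by simp
  thus "(LI v. ?g v) = sqrt (2*pi/r)" by simp
 qed
 have "cmod (LI v. w v * exp (- z * of_real (v^2)/2)) <= (LI v. C*?g v)"
 proof (rule order_trans[OF integral_norm_bound integral_mono])
  show le: "norm (w v * exp (- z * of_real (v^2)/2)) <= C*?g v" for v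
   unfolding norm_mult using assms(2) C by (intro mult_mono assms(3)) (auto intro: mult_right_mono)
  show "integrable lborel (%v. norm (w v * exp (- z * of_real (v^2)/2)))"
  proof (rule integrable_norm, rule BI_bound[OF integrable_mult_right[OF g(1), of C]])
   show "(%v. w v * exp (- z * of_real (v^2)/2)) : borel_measurable lborel"
    by (simp only: measurable_lborel2) (intro borel_measurable_times assms(4); simp)
  qed (use le C in "auto intro!: AE_I2")
 qed (use g in simp)
 also have "... = C * sqrt (2*pi/r)" using g by simp
 finally show ?thesis unfolding norm_mult norm_of_real by (simp add: real_sqrt_divide field_simps)
qed

text \<open>The kernel which for \<open>\<epsilon> \<rightarrow> 0\<close> represents \<open>exp (- \<i> \<xi>\<^sup>2 / 2)\<close>, up to a phase, by the functions \<open>exp (\<i> s \<xi>)\<close>.\<close>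

definition fresnel :: "real => real => complex" where
 "fresnel \<epsilon> s = of_real (1/sqrt (2*pi))*exp (- (of_real \<epsilon> - \<i>) * of_real (s^2)/2)"

lemma fresnel_norm: "cmod (fresnel \<epsilon> s) = 1/sqrt (2*pi)*exp (- (\<epsilon> * s^2)/2)"
 unfolding fresnel_def norm_mult norm_of_real by simp

lemma fresnel_integrable: "\<epsilon> > 0 ==> integrable lborel (fresnel \<epsilon>)"
 unfolding fresnel_def[abs_def] by (intro integrable_mult_right gauss_fun_integrable) simp

lemma wint_cinner:
 assumes X: "wint lborel k T X" and Y: "wint lborel k' T' Y"
 shows "cinner (X x) (Y y) = (LI s. cnj (k s)*(LI t. k' t*cinner (T s x) (T' t y)))"
proof -
 have "cinner (X x) (Y y) = cnj (cinner (Y y) (X x))" by (rule cinner_commute)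
 also have "... = (LI s. cnj (k s*cinner (Y y) (T s x)))" unfolding wintD(2)[OF X] by (rule BI_cnj[symmetric])
 also have "... = (LI s. cnj (k s)*cinner (T s x) (Y y))" by (simp add: cinner_commute[symmetric])
 finally show ?thesis unfolding wintD(2)[OF Y] .
qed

text \<open>The substitution \<open>t = s + u\<close> in a double integral against two Fresnel kernels.\<close>

lemma fresnel_double:
 assumes d: "\<delta> > 0" "\<epsilon> > 0" and h: "h : borel_measurable borel" "!!x. cmod (h x) <= C"
 shows "(LI s. cnj (fresnel \<delta> s)*(LI t. fresnel \<epsilon> t*h (s, t))) =
   (LI u. LI s. cnj (fresnel \<delta> s)*fresnel \<epsilon> (s + u)*h (s, s + u))"
proof -
 define \<kappa> where "\<kappa> = min \<delta> \<epsilon>/3"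
 have \<kappa>: "\<kappa> > 0" "3*\<kappa> <= \<delta>" "3*\<kappa> <= \<epsilon>" using d by (auto simp: \<kappa>_def)
 let ?g = "%s. cor (exp (- (\<kappa> * s^2)/2))" and ?e = "%s. exp (\<kappa> * s^2/2)" and ?c = "1/sqrt (2*pi)"
 let ?f = "%s u. cnj (fresnel \<delta> s)*fresnel \<epsilon> (s + u)*h (s, s + u)"
 let ?H = "%x. ?f (fst x) (snd x) * of_real (?e (fst x)*?e (snd x))"
 have gi: "integrable lborel ?g" using gauss_fun_integrable[of "of_real \<kappa>"] \<kappa> by (simp add: exp_of_real[symmetric])
 have ge: "?g s * of_real (?e s) = 1" for s unfolding of_real_mult[symmetric] exp_add[symmetric] by simp
 have "?g s*(?g u*?H (s, u)) = ?f s u*(?g s * of_real (?e s))*(?g u * of_real (?e u))"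
  "?g u*(?g s*?H (s, u)) = ?f s u*(?g s * of_real (?e s))*(?g u * of_real (?e u))" for s u
  by (simp_all only: fst_conv snd_conv of_real_mult mult_ac)
 note gg = this[unfolded ge mult_1_right]
 have Hm: "?H : borel_measurable borel"
 proof (intro borel_measurable_times)
  show "(%x. h (fst x, fst x + snd x)) : borel_measurable borel"
   by (rule measurable_compose[OF _ h(1)]) (intro borel_cont continuous_intros)
 qed (unfold fresnel_def, (intro borel_cont continuous_intros; simp)+)
 have Hb: "cmod (?H (s, u)) <= 1 * C" for s u
 proof -
  have "u^2 <= 2 * s^2 + 2*(s + u)^2"
   using zero_le_power2[of "2 * s + u"] by (simp add: power2_eq_square algebra_simps)
  hence "\<kappa>*u^2 <= \<kappa>*(2 * s^2 + 2*(s + u)^2)" using \<kappa> by (intro mult_left_mono) auto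
  moreover have "3*\<kappa> * s^2 <= \<delta> * s^2" "3*\<kappa>*(s + u)^2 <= \<epsilon>*(s + u)^2" "0 <= \<kappa>*(s + u)^2" using \<kappa> by (simp_all add: mult_right_mono)
  ultimately have "- (\<delta> * s^2)/2 + - (\<epsilon>*(s + u)^2)/2 + (\<kappa> * s^2/2 + \<kappa>*u^2/2) <= 0" by (simp add: algebra_simps)
  hence E: "exp (- (\<delta> * s^2)/2)*exp (- (\<epsilon>*(s + u)^2)/2)*(?e s*?e u) <= 1" unfolding exp_add[symmetric] by simp
  have "?c <= 1" using pi_gt3 by simp
  hence "?c*?c*(exp (- (\<delta> * s^2)/2)*exp (- (\<epsilon>*(s + u)^2)/2)*(?e s*?e u)) <= 1" by (intro mult_le_one E) auto
  from mult_mono[OF this h(2)[of "(s, s + u)"]] show ?thesis by (simp add: norm_mult fresnel_norm mult_ac)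
 qed
 have "(LI s. cnj (fresnel \<delta> s)*(LI t. fresnel \<epsilon> t*h (s, t))) = (LI s. ?g s*(LI u. ?g u*?H (s, u)))"
 proof (rule BI_cong[OF refl])
  fix s
  have "(LI t. fresnel \<epsilon> t*h (s, t)) = (LI u. fresnel \<epsilon> (s + u)*h (s, s + u))"
   using lborel_integral_real_affine[of 1 "%t. fresnel \<epsilon> t*h (s, t)" s] by simp
  thus "cnj (fresnel \<delta> s)*(LI t. fresnel \<epsilon> t*h (s, t)) = ?g s*(LI u. ?g u*?H (s, u))"
   by (simp only: integral_mult_right_zero[symmetric] gg) (simp only: mult.assoc)
 qed
 also have "... = (LI u. ?g u*(LI s. ?g s*?H (s, u)))" by (rule fubini_lborel[OF gi gi Hm Hb])
 also have "... = (LI u. LI s. ?f s u)" by (simp only: integral_mult_right_zero[symmetric] gg)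
 finally show ?thesis .
qed

text \<open>The inner product of two Fresnel integrals of a family whose correlations are Gaussian up to a function of the difference.\<close>

lemma fresnel_pair:
 fixes a c \<delta> \<epsilon> :: real and r :: "real => complex"
 defines "q \<equiv> 2*(a - c) + \<delta> + \<epsilon>" and "z \<equiv> (of_real (a + \<delta>) + \<i>)*(of_real (a + \<epsilon>) - \<i>) - of_real (c^2) :: complex"
 assumes X: "wint lborel (fresnel \<delta>) T X" and Y: "wint lborel (fresnel \<epsilon>) T' Y" and d: "\<delta> > 0" "\<epsilon> > 0" and q: "q > 0"
  and r: "r : borel_measurable borel" and C: "!!s t. cmod (cinner (T s x) (T' t y)) <= C"
  and T: "!!s t. cinner (T s x) (T' t y) = of_real (exp (- (a * s^2)/2 - a*t^2/2 + c * s*t))*r (t - s)"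
 shows "cinner (X x) (Y y) = of_real (1/sqrt (2*pi))*(LI v. r (sqrt q * v)*exp (- z * of_real (v^2)/2))"
proof -
 let ?k = "of_real (1/sqrt (2*pi)) :: complex" and ?e = "%s t. cor (exp (- (a * s^2)/2 - a*t^2/2 + c * s*t))"
 let ?j = "%s u. cnj (fresnel \<delta> s)*fresnel \<epsilon> (s + u)*?e s (s + u)"
 have inner: "(LI s. ?j s u) = ?k*(of_real (1/sqrt q)*exp (- z * of_real ((u/sqrt q)^2)/2))" for u
 proof -
  let ?B = "of_real (a + \<epsilon>) - \<i> :: complex" and ?b = "- (of_real (a + \<epsilon> - c) - \<i>) * of_real u"
  have e: "?j s u =
    of_real (1/(2*pi))*exp (- ?B * of_real (u^2)/2)*exp (of_real (- (q * s^2)/2) + ?b * of_real s)" for s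
  proof -
   have "cnj (fresnel \<delta> s) = ?k*exp (- (of_real \<delta> + \<i>) * of_real (s^2)/2)" by (simp add: fresnel_def exp_cnj algebra_simps)
   hence "?j s u = (?k*?k) *
    exp (- (of_real \<delta> + \<i>) * of_real (s^2)/2 + - (of_real \<epsilon> - \<i>) * of_real ((s + u)^2)/2 + of_real (- (a * s^2)/2 - a*(s + u)^2/2 + c * s*(s + u)))"
    unfolding exp_add exp_of_real by (simp only: fresnel_def mult_ac)
   also have "- (of_real \<delta> + \<i>) * of_real (s^2)/2 + - (of_real \<epsilon> - \<i>) * of_real ((s + u)^2)/2 + of_real (- (a * s^2)/2 - a*(s + u)^2/2 + c * s*(s + u))
     = - ?B * of_real (u^2)/2 + (of_real (- (q * s^2)/2) + ?b * of_real s)"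
    by (simp add: q_def power2_eq_square field_simps)
   also have "?k*?k = of_real (1/(2*pi))" by (simp flip: of_real_mult)
   finally show ?thesis by (simp only: exp_add mult.assoc)
  qed
  have "(LI s. ?j s u) =
    of_real (1/(2*pi) * sqrt (2*pi/q))*exp (- ?B * of_real (u^2)/2 + ?b^2/of_real (2*q))"
   unfolding e integral_mult_right_zero gauss_integral(2)[OF q] by (simp only: exp_add of_real_mult mult_ac)
  also have "- ?B * of_real (u^2)/2 + ?b^2/of_real (2*q) = - z * of_real ((u/sqrt q)^2)/2"
  proof -
   have e: "?b^2 - ?B * of_real (u^2) * of_real q = - z * of_real (u^2)"
    by (simp add: q_def z_def power2_eq_square algebra_simps)
   have "- ?B * of_real (u^2)/2 + ?b^2/of_real (2*q) = (?b^2 - ?B * of_real (u^2) * of_real q)/of_real (2*q)"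
    using q by (simp add: field_simps)
   thus ?thesis unfolding e using q by (simp add: power_divide)
  qed
  also have "1/(2*pi) * sqrt (2*pi/q) = 1/sqrt (2*pi)*(1/sqrt q)"
   using q by (simp add: real_sqrt_divide field_simps)
  finally show ?thesis by simp
 qed
 let ?h = "%p. ?e (fst p) (snd p)*r (snd p - fst p)"
 have "cinner (X x) (Y y) = (LI s. cnj (fresnel \<delta> s)*(LI t. fresnel \<epsilon> t*?h (s, t)))"
  unfolding wint_cinner[OF X Y] T by simp
 also have "... = (LI u. LI s. cnj (fresnel \<delta> s)*fresnel \<epsilon> (s + u)*?h (s, s + u))"
 proof (rule fresnel_double[OF d])
  show "?h : borel_measurable borel"
   by (intro borel_measurable_times measurable_compose[OF _ r] borel_cont continuous_intros; simp)
 qed (use C T in simp)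
 also have "... = (LI u. ?k*(of_real (1/sqrt q)*exp (- z * of_real ((u/sqrt q)^2)/2))*r u)"
  by (simp only: fst_conv snd_conv add_diff_cancel_left' mult.assoc[symmetric] integral_mult_left_zero inner)
 also have "... = sqrt q *R (LI v. ?k*(of_real (1/sqrt q)*exp (- z * of_real (v^2)/2))*r (sqrt q * v))"
  using lborel_integral_real_affine[of "sqrt q" "%u. ?k*(of_real (1/sqrt q)*exp (- z * of_real ((u/sqrt q)^2)/2))*r u" 0] q
  by simp
 also have "... = (LI v. ?k*(r (sqrt q * v)*exp (- z * of_real (v^2)/2)))"
  unfolding integral_scaleR_right[symmetric] using q by (intro BI_cong) (auto simp: scaleR_conv_of_real)
 finally show ?thesis by simp
qed

lemma sympl_real:
 assumes "!!x. Im (f x) = 0" "!!x. Im (g x) = 0" shows "sympl f g = 0"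
proof -
 have "cnj (f x)*g x = of_real (Re (f x) * Re (g x))" for x using assms by (simp add: complex_eq_iff)
 thus ?thesis by (simp add: sympl_def del: of_real_mult)
qed

context vacuum_weyl
begin

text \<open>The operator \<open>exp (- \<i> \<Phi>\<^sup>2 / 2)\<close>, up to a phase, where \<open>V (s f) = exp (\<i> s \<Phi>)\<close>, as a limit of regularized Fresnel integrals.\<close>

lemma fresnel_product:
 assumes f: "f : \<D>" "!!x. Im (f x) = 0" and d: "\<delta> > 0" "\<epsilon> > 0"
  and X: "wint lborel (fresnel \<delta>) (%s. V (%t. of_real s*f t)) X" and Y: "wint lborel (fresnel \<epsilon>) (%s. V (%t. of_real s*f t)) Y"
 shows "cinner (X x) (Y y) = of_real (1/sqrt (2*pi))*(LI v. cinner x (V (%t. of_real (sqrt (\<delta> + \<epsilon>) * v)*f t) y) *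
  exp (- ((of_real \<delta> + \<i>)*(of_real \<epsilon> - \<i>)) * of_real (v^2)/2))"
proof -
 let ?F = "%s t. of_real s*f t"
 have F: "?F s : \<D>" for s by (rule tf_cmult[OF f(1)])
 have T: "cinner (V (?F s) x) (V (?F t) y) = cinner x (V (?F (t - s)) y)" for s t
 proof -
  have "V (%x. - ?F s x) oL V (?F t) = V (%x. ?F (t - s) x)"
   unfolding V_mult[OF tf_uminus[OF F] F] by (subst sympl_real) (auto simp: f(2) algebra_simps)
  thus ?thesis by (metis V_bounded adj_V[OF F] oL_app cinner_adj_right)
 qed
 have "cmod (cinner (V (?F s) x) (V (?F t) y)) <= norm x*norm y" for s t
  using cinner_norm_le[of "V (?F s) x" "V (?F t) y"] unfolding norm_V_apply[OF F] .
 from fresnel_pair[OF X Y d _ borel_cont[OF continuous_minner_mult[OF f(1), of x y]] this, of 0 0] d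
 show ?thesis by (simp add: T)
qed

lemma fresnel_unitary:
 assumes f: "f : \<D>" "!!x. Im (f x) = 0"
 obtains B :: "'h op" and Bn :: "nat => 'h op" where "!!n. Bn n : \<B>" "!!n. wint lborel (fresnel (1/real (Suc n))) (%s. V (%t. of_real s*f t)) (Bn n)"
  "!!n. norm (Bn n) <= 1" "!!x y. (%n. cinner x (Bn n y)) ----> cinner x (B y)" "B : \<B>" "adj B oL B = id_blinfun"
proof -
 let ?F = "%s t. of_real s*f t" and ?e = "%n. 1/real (Suc n)"
 have F: "?F s : \<D>" for s by (rule tf_cmult[OF f(1)])
 note wc = continuous_minner_mult[OF f(1)]
 have pos: "?e n > 0" for n by simp
 have "\<exists>A\<in>\<B>. wint lborel (fresnel (?e n)) (%s. V (?F s)) A" for n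
  by (rule wint_exists[OF fresnel_integrable[OF pos]]) (use norm_V[OF F] borel_cont[OF wc] in auto)
 then obtain A where A: "!!n. A n : \<B>" "!!n. wint lborel (fresnel (?e n)) (%s. V (?F s)) (A n)" by metis
 let ?r = "%x y u. cinner x (V (?F u) y)" and ?w = "%\<delta> \<epsilon> v. exp (- ((of_real \<delta> + \<i>)*(of_real \<epsilon> - \<i>)) * of_real (v^2)/2)"
 have r1: "cmod (?r x y u) <= norm x*norm y" for x y u using cinner_norm_le[of x "V (?F u) y"] by (simp add: norm_V_apply[OF F])
 note mr = borel_cont[OF continuous_on_compose2[OF wc]]
 have nA: "norm (A n) <= 1" for n
 proof (rule norm_blinfun_bound)
  fix y
  have "cmod (cinner (A n y) (A n y)) <= norm y*norm y*(1/sqrt 1)"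
   unfolding fresnel_product[OF f pos pos A(2) A(2)]
   by (rule gauss_fun_bound) (use r1[of y _ y] in "auto simp del: of_real_mult intro!: mr continuous_intros")
  thus "norm (A n y) <= 1*norm y" by (simp add: cinner_self power2_eq_square[symmetric] norm_power)
 qed simp
 \<comment> \<open>The scalar products converge to those of \<open>x\<close> and \<open>y\<close>; therefore the operators converge strongly to an isometry.\<close>
 have lim: "(%k. cinner (A (i k) x) (A (j k) y)) ----> cinner x y"
  if ij: "filterlim i at_top sequentially" "filterlim j at_top sequentially" for i j :: "nat => nat" and x y
 proof -
  have e0: "(%k. ?e (i k)) ----> 0" if "filterlim i at_top sequentially" for i :: "nat => nat"
   using filterlim_compose[OF lim_1_over_n[THEN LIMSEQ_Suc] that] by simp
  let ?s = "%k v. ?r x y (sqrt (?e (i k) + ?e (j k)) * v)*?w (?e (i k)) (?e (j k)) v" and ?l = "%v. ?r x y (sqrt (0 + 0) * v)*?w 0 0 v"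
  have "(%k. LI v. ?s k v) ----> (LI v. ?l v)"
  proof (rule integral_dominated_convergence[where w = "%v. norm x*norm y*cmod (?w 0 0 v)"])
   show "integrable lborel (%v. norm x*norm y*cmod (?w 0 0 v))" by (intro integrable_mult_right integrable_norm gauss_fun_integrable) simp
   show "AE v in lborel. (%k. ?s k v) ----> ?l v"
    by (intro AE_I2 tendsto_intros continuous_on_tendsto_compose[OF wc] e0 ij) auto
   have "cmod (?s k v) <= norm x*norm y*cmod (?w 0 0 v)" for k v
   proof -
    have "v^2 <= (1 + ?e (i k)*?e (j k)) * v^2" by (simp add: distrib_right)
    hence "cmod (?w (?e (i k)) (?e (j k)) v) <= cmod (?w 0 0 v)" by (simp add: algebra_simps)
    thus ?thesis unfolding norm_mult by (intro mult_mono r1) auto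
   qed
   thus "AE v in lborel. norm (?s k v) <= norm x*norm y*cmod (?w 0 0 v)" for k by simp
  qed (simp only: measurable_lborel2, intro borel_measurable_times mr continuous_intros subset_UNIV borel_cont; simp)+
  from tendsto_mult[OF tendsto_const[of "of_real (1/sqrt (2*pi))"] this]
  have "(%k. cinner (A (i k) x) (A (j k) y)) ----> cinner x y*gauss_fun 1"
   unfolding gauss_fun_def fresnel_product[OF f pos pos A(2) A(2)] by (simp add: V_zero)
  thus ?thesis using gauss_fun_real[of 1] by simp
 qed
 have "Cauchy (%n. A n y)" for y
 proof (rule ccontr)
  assume "\<not> ?thesis"
  then obtain e where e: "e > 0" "!!M. \<exists>m\<ge>M. \<exists>n\<ge>M. \<not> norm (A m y - A n y) < e" unfolding Cauchy_iff by blast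
  then obtain i j where ij: "!!k. i k >= k" "!!k. j k >= k" "!!k. \<not> norm (A (i k) y - A (j k) y) < e" by metis
  have t: "filterlim i at_top sequentially" "filterlim j at_top sequentially"
   using ij(1,2) by (auto intro: filterlim_at_top_mono[OF filterlim_ident])
  have "(%k. Re (cinner (A (i k) y) (A (i k) y)) + Re (cinner (A (j k) y) (A (j k) y)) - 2 * Re (cinner (A (i k) y) (A (j k) y)))
   ----> Re (cinner y y) + Re (cinner y y) - 2 * Re (cinner y y)" by (intro tendsto_intros lim t)
  hence l: "(%k. (norm (A (i k) y - A (j k) y))^2) ----> 0" by (simp add: norm_diff_sq_cinner cinner_self)
  have b: "e^2 <= (norm (A (i k) y - A (j k) y))^2" for k using ij(3)[of k] e(1) by (intro power_mono) auto
  have "e^2 <= 0" by (rule LIMSEQ_le_const[OF l]) (intro exI allI impI b)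
  thus False using e(1) by simp
 qed
 then obtain L where L: "!!y. (%n. A n y) ----> L y" unfolding Cauchy_convergent_iff convergent_def by metis
 have bl: "bounded_linear L"
 proof (rule bounded_linear_intro[where K = 1])
  show "L (x + y) = L x + L y" for x y using L[of "x + y"] tendsto_add[OF L[of x] L[of y]] unfolding blinfun.add_right by (rule LIMSEQ_unique)
  show "L (r *R x) = r *R L x" for r x using L[of "r *R x"] tendsto_scaleR[OF tendsto_const L[of x]] unfolding blinfun.scaleR_right by (rule LIMSEQ_unique)
  show "norm (L x) <= norm x*1" for x
   using LIMSEQ_le_const2[OF tendsto_norm[OF L]] norm_contraction_le[OF nA] by simp
 qed
 define B where "B = Blinfun L"
 have BL: "B y = L y" for y by (simp add: B_def bounded_linear_Blinfun_apply[OF bl])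
 have "B (c *C x) = c *C B x" for c x
  using bounded_linear.tendsto[OF bounded_linear_scaleC[of c] L[of x]] LIMSEQ_unique[OF L] by (simp add: BL \<B>_scaleC[OF A(1), symmetric])
 hence Bb: "B : \<B>" by (simp add: \<B>_def)
 have "cinner (B x) (B y) = cinner x y" for x y
  unfolding BL by (rule LIMSEQ_unique[OF cinner_tendsto[OF L L] lim]) (auto intro: filterlim_ident)
 hence "adj B oL B = id_blinfun" by (intro blinfun_eqI cinner_extR) (simp add: cinner_adj_right Bb)
 moreover have "(%n. cinner x (A n y)) ----> cinner x (B y)" for x y unfolding BL by (rule tendsto_cinner_right[OF L])
 ultimately show ?thesis using A nA Bb by (intro that[of A B])
qed

end

context weyl_net
begin

lemma local_weak_limit:
 fixes A :: "'h op" and An :: "nat => 'h op"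
 assumes R: "R : \<K>" and An: "!!n. An n : N R" "!!x y. (%n. cinner x (An n y)) ----> cinner x (A y)" and A: "A : \<B>"
 shows "A : N R"
proof -
 obtain g a b where g: "g : PG" "a < b" "R = tcone g a b" using double_cone_frame[OF R] by metis
 note lf = local_algebra_frame[OF g(1,2), folded g(3)]
 show ?thesis unfolding lf
 proof (rule in_bicommutantI[OF frame_gens(1,3)[OF g(1)] A])
  fix B x y assume B: "B : commutant (frame_gens g a b)"
  have "cinner x (An n (B y)) = cinner (adj B x) (An n y)" for n
  proof -
   have "An n oL B = B oL An n" and "B : \<B>" using An(1)[of n] B unfolding lf by (auto simp: commutant_def)
   thus ?thesis by (metis oL_app cinner_adj_left)
  qed
  thus "cinner x (A (B y)) = cinner (adj B x) (A y)" using LIMSEQ_unique[OF An(2)[of x "B y"]] An(2)[of "adj B x" y] by simp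
 qed
qed

lemma space_translation:
 assumes f: "f : \<D>"
 shows "act (mat 1, vector [0, b]) f = (%t. f (t - b))"
proof (rule poincare_action_eq[OF m])
 have sh: "fourier (%t. k (t - b)) p = exp (- (\<i> * of_real (b*p)))*fourier k p" for k p
 proof -
  have "exp (- (\<i> * of_real (p*(b + x)))) = exp (- (\<i> * of_real (b*p)))*exp (- (\<i> * of_real (p*x)))" for x
   by (simp add: exp_add[symmetric] algebra_simps)
  hence "(LI x. exp (- (\<i> * of_real (p*x)))*k (x - b)) = (LI x. exp (- (\<i> * of_real (b*p)))*(exp (- (\<i> * of_real (p*x)))*k x))"
   using lborel_integral_real_affine[of 1 "%x. exp (- (\<i> * of_real (p*x)))*k (x - b)" b]
   by (simp only: mult.assoc) simp
  thus ?thesis by (simp only: fourier_def integral_mult_right_zero mult.left_commute)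
 qed
 show "related m (mat 1, vector [0, b]) f (%t. f (t - b))"
  unfolding translation_related_iff
 proof (intro conjI allI)
  show "(%t. f (t - b)) : \<D>" using tf_affine[OF f, of 1 "- b"] by simp
  show "ftr m (%t. f (t - b)) p = exp (\<i> * of_real ((vector [0, b] :: real^2) $ 1*disp m p - (vector [0, b] :: real^2) $ 2*p))*ftr m f p" for p
   unfolding ftr_def Re_fourier_def Im_fourier_def sh[of "%t. of_real (Re (f t))"] sh[of "%t. of_real (Im (f t))"]
   by (simp add: algebra_simps)
 qed
qed

lemma mnsq_real_mono:
 assumes k: "k : \<D>" "!!x. Im (k x) = 0" and l: "0 < l" "l <= 1"
 shows "mnsq m k <= mnsq (l*m) k"
proof -
 have I: "Im_fourier k p = 0" for p by (simp add: Im_fourier_def fourier_def k(2))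
 have lm: "l*m > 0" using l m by simp
 have "(l*m)^2 <= m^2" using l m by (intro power_mono) auto
 hence d: "disp (l*m) p <= disp m p" for p by (simp add: disp_def)
 have "(LI p. (cmod (ftr m k p))^2/disp m p) <= (LI p. (cmod (ftr (l*m) k p))^2/disp (l*m) p)"
  by (intro integral_mono mnsq_integrable[OF k(1)]) (auto simp: ftr_def I intro!: divide_left_mono d mult_pos_pos disp_pos m lm)
 thus ?thesis unfolding mnsq_inner(2)[OF m] mnsq_inner(2)[OF lm] by simp
qed

lemma dilation_cmult: "dilation l (%t. of_real s*f t) = (%t. of_real s*dilation l f t)"
 by (auto simp: dilation_def complex_eq_iff)

text \<open>The dilates of \<open>B = exp (- \<i> \<Phi>\<^sup>2 / 2)\<close> and their translates by \<open>l b\<close> have small correlations: these are Gaussian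
 integrals with a determinant of at least \<open>1 + D a\<close>, where \<open>a\<close> is the squared norm of the bump at mass \<open>l m\<close>, which diverges.\<close>

lemma fresnel_correlation:
 fixes B :: "'h op" and Bn :: "nat => 'h op"
 assumes b: "b > 0" and W: "!!n. Bn n : \<B>" "!!n. wint lborel (fresnel (1/real (Suc n))) (%s. V (%t. of_real s*bump t)) (Bn n)"
  "!!n. norm (Bn n) <= 1" "!!x y. (%n. cinner x (Bn n y)) ----> cinner x (B y)" "B : \<B>"
 shows "B : QL" "\<forall>\<^sub>F l in at_right 0. cmod (cinner (sh (vector [0, l*b]) (\<phi> l B) vac) (\<phi> l B vac)) <= 1/2"
proof -
 let ?F = "%s t. of_real s*bump t" and ?C = "tcone (mat 1, 0) (- 1) 2"
 let ?c = "%l. cmod (cinner (sh (vector [0, l*b]) (\<phi> l B) vac) (\<phi> l B vac))"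
 have C: "?C : \<K>" by (rule cone_double_cone) auto
 have Fi: "?F s : tf_in (- 1) 2" for s
  using bump_tf_in tf_cmult[OF tf_bump] unfolding tf_in_iff by fastforce
 have F: "?F s : \<D>" for s using Fi by (simp add: tf_in_def)
 have VF: "V (?F s) : N ?C" for s using V_local[OF _ Fi] by (simp add: tcone_one)
 have in_local: "X : N (tcone (mat 1, 0) c d)" if "c < d" "X : \<B>" "wint lborel k T X" "!!s. T s : N (tcone (mat 1, 0) c d)" for k X c d and T :: "real => 'h op"
  using wint_in_bicommutant[OF frame_gens(1,3)[OF PG_trans] that(2,3)] that(4) unfolding local_algebra_frame[OF PG_trans that(1)] by blast
 have Bn: "Bn n : N ?C" for n by (rule in_local[OF _ W(1,2) VF]) simp
 have BC: "B : N ?C" by (rule local_weak_limit[OF C Bn W(4,5)])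
 thus BQ: "B : QL" using local_subset_QL[OF C] by blast
 have BnQ: "Bn n : QL" for n using Bn local_subset_QL[OF C] by blast
 let ?f = "%t. bump (t - b)"
 have f: "?f : \<D>" using tf_affine[OF tf_bump, of 1 "- b"] by simp
 define d1 d2 where "d1 = mnsq m (%t. ?f t - bump t)" and "d2 = mnsq m (%t. ?f t + bump t)"
 have pos: "d1 > 0" "d2 > 0"
 proof -
  let ?t = "min b 1/2"
  have t: "Re (bump ?t) > 0" "bump (?t - b) = 0" using b by (auto intro!: bump_pos bump_zero)
  have "(%t. ?f t - bump t) ~= (%_. 0)" "(%t. ?f t + bump t) ~= (%_. 0)" using t by (auto dest!: fun_cong[of _ _ ?t])
  hence "d1 ~= 0" "d2 ~= 0" unfolding d1_def d2_def
   using mnsq_eq_0[OF tf_diff[OF f tf_bump] m] mnsq_eq_0[OF tf_add[OF f tf_bump] m] by blast+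
  thus "d1 > 0" "d2 > 0" using mnsq_nonneg[OF m] unfolding d1_def d2_def by (simp_all add: order_less_le)
 qed
 define D where "D = min d1 d2/2"
 have D: "D > 0" using pos by (simp add: D_def)
 have bound: "?c l <= 1/sqrt (1 + D*mnsq (l*m) bump)"
  if l: "0 < l" "l <= 1" for l
 proof -
  define g g' where "g = dilation l bump" and "g' = dilation l ?f"
  let ?x = "vector [0, l*b] :: real^2" and ?lC = "tcone (mat 1, 0) (l * - 1) (l*2)"
  have gt: "g : \<D>" "g' : \<D>" unfolding g_def g'_def by (intro tf_dilation tf_bump f l)+
  have gr: "Im (g t) = 0" "Im (g' t) = 0" for t by (simp_all add: g_def g'_def dilation_def bump_real)
  have act_g: "act (mat 1, ?x) g = g'"
   unfolding space_translation[OF gt(1)] using l by (auto simp: g_def g'_def dilation_def diff_divide_distrib)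
  have lc: "l * - 1 < l*2" using l by simp
  have lC: "?lC : \<K>" by (rule cone_double_cone[OF PG_trans lc])
  have p: "\<phi> l (V (?F s)) = V (%t. of_real s*g t)" for s using \<phi>_props(3)[OF l(1) F] by (simp add: dilation_cmult g_def)
  have pN: "\<phi> l X : N ?lC" if "X : N ?C" for X by (rule \<phi>_local[OF l(1) _ that]) simp
  have gs: "(%t. of_real s*g t) : \<D>" "(%t. of_real s*g' t) : \<D>" for s by (intro tf_cmult gt)+
  have w: "wint lborel (fresnel (1/real (Suc n))) (%s. V (%t. of_real s*g t)) (\<phi> l (Bn n))" for n
   using wint_normal_on[OF W(2) fresnel_integrable norm_V[OF F] VF \<phi>_props(2)[OF l(1) C] Bn] by (simp add: p)
  have VgN: "V (%t. of_real s*g t) : N ?lC" for s using pN[OF VF] by (simp add: p)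
  have w': "wint lborel (fresnel (1/real (Suc n))) (%s. V (%t. of_real s*g' t)) (sh ?x (\<phi> l (Bn n)))" for n
   using wint_normal_on[OF w fresnel_integrable norm_V[OF gs(1)] VgN \<alpha>_props(2)[OF PG_trans[of ?x] lC] pN[OF Bn]]
   by (simp add: \<alpha>_props(3)[OF PG_trans gs(1)] act_cmult[OF PG_trans gt(1)] act_g)
  define a c where "a = mnsq m g" and "c = Re (minner m g' g)"
  have a': "mnsq m g' = a"
   unfolding a_def using mnsq_translation[OF m act_related[OF PG_trans gt(1), of ?x]] by (simp add: act_g)
  have ci: "minner m g' g = of_real c"
   using sympl_minner[OF gt(2,1) m] sympl_real[OF gr(2,1)] by (simp add: c_def complex_eq_iff)
  have e: "mnsq m (%t. g' t - g t) = 2*(a - c)" "mnsq m (%t. g' t + g t) = 2*(a + c)"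
   using mnsq_diff[OF gt(2,1) m] mnsq_add[OF gt(2,1)] a' by (simp_all add: a_def c_def)
  have "d1 <= 2*(a - c)" "d2 <= 2*(a + c)"
   unfolding e[symmetric] d1_def d2_def g_def g'_def dilation_diff[symmetric] dilation_add[symmetric] mnsq_dilation[OF l(1) m]
   by (intro mnsq_real_mono tf_diff tf_add f tf_bump l; simp add: bump_real)+
  hence ac: "D <= a - c" "D <= a + c" by (auto simp: D_def)
  have "D*a <= (a - c)*(a + c)"
  proof (cases "c >= 0")
   case True thus ?thesis using ac D by (intro mult_mono) auto
  next
   case False hence "D*a <= (a + c)*(a - c)" using ac D by (intro mult_mono) auto
   thus ?thesis by (simp add: mult.commute)
  qed
  hence prod: "D*a <= a^2 - c\<^sup>2" by (simp add: power2_eq_square algebra_simps)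
  have r0: "1 + D*a > 0" using D mnsq_nonneg[OF m, of g] by (simp add: a_def add_pos_nonneg)
  have coh: "cinner (V (%x. of_real s*g' x) vac) (V (%x. of_real t*g x) vac) = of_real (exp (- (a * s^2)/2 - a*t^2/2 + c * s*t))*1" for s t
  proof -
   have "minner m (%x. of_real s*g' x) (%x. of_real t*g x) = of_real (s*t*c)"
    using minner_mult_right[OF gt(1), of m "%x. of_real s*g' x" t] minner_mult_right[OF gt(2), of m g s]
     minner_commute[of m "%x. of_real s*g' x" g] minner_commute[of m g g'] by (simp add: ci)
   thus ?thesis
    unfolding V_coherent[OF gs(2,1)] mnsq_mult[OF gt(1)] mnsq_mult[OF gt(2)] by (simp add: a' a_def[symmetric] exp_of_real[symmetric] algebra_simps)
  qed
  have corr: "cmod (cinner (sh ?x (\<phi> l (Bn j)) vac) (\<phi> l (Bn n) vac)) <= 1/sqrt (1 + D*a)" for j n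
  proof -
   define \<delta> \<epsilon> where "\<delta> = 1/real (Suc j)" and "\<epsilon> = 1/real (Suc n)"
   have de: "\<delta> > 0" "\<epsilon> > 0" by (simp_all add: \<delta>_def \<epsilon>_def)
   let ?z = "(of_real (a + \<delta>) + \<i>)*(of_real (a + \<epsilon>) - \<i>) - cor (c^2)"
   have b1: "cmod (cinner (V (%x. of_real s*g' x) vac) (V (%x. of_real t*g x) vac)) <= 1" for s t
    using cinner_norm_le[of "V (%x. of_real s*g' x) vac" "V (%x. of_real t*g x) vac"] by (simp add: norm_V_apply[OF gs(1)] norm_V_apply[OF gs(2)] norm_Omega)
   have eq: "cinner (sh ?x (\<phi> l (Bn j)) vac) (\<phi> l (Bn n) vac) = of_real (1/sqrt (2*pi))*(LI v. 1*exp (- ?z * of_real (v^2)/2))"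
    by (rule fresnel_pair[OF w'[of j, folded \<delta>_def] w[of n, folded \<epsilon>_def] de _ _ b1 coh]) (use ac(1) D de in auto)
   have "a*a <= (a + \<delta>)*(a + \<epsilon>)" using de mnsq_nonneg[OF m, of g] by (intro mult_mono) (auto simp: a_def)
   hence "1 + D*a <= Re ?z" using prod by (simp add: power2_eq_square)
   hence "cmod (cinner (sh ?x (\<phi> l (Bn j)) vac) (\<phi> l (Bn n) vac)) <= 1*(1/sqrt (1 + D*a))"
    unfolding eq by (intro gauss_fun_bound[OF r0]) auto
   thus ?thesis by simp
  qed
  have lim1: "(%n. cinner y (\<phi> l (Bn n) z)) ----> cinner y (\<phi> l B z)" for y z
   by (rule normal_form_weak_limit[OF normal_form_normal_on[OF \<phi>_props(2)[OF l(1) C]] BC Bn W(3,4)])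
  have lim2: "(%n. cinner y (sh ?x (\<phi> l (Bn n)) z)) ----> cinner y (sh ?x (\<phi> l B) z)" for y z
   by (rule normal_form_weak_limit[OF normal_form_comp[OF \<phi>_props(2)[OF l(1) C] normal_form_normal_on[OF \<alpha>_props(2)[OF PG_trans lC]] pN] BC Bn W(3,4)])
  have "cmod (cinner (\<phi> l (Bn n) vac) (sh ?x (\<phi> l B) vac)) <= 1/sqrt (1 + D*a)" for n
   by (rule LIMSEQ_le_const2[OF tendsto_norm[OF lim2]]) (use corr in "metis cinner_commute complex_mod_cnj")
  hence "cmod (cinner (sh ?x (\<phi> l B) vac) (\<phi> l B vac)) <= 1/sqrt (1 + D*a)"
   by (intro LIMSEQ_le_const2[OF tendsto_norm[OF lim1]]) (metis cinner_commute complex_mod_cnj)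
  thus ?thesis unfolding a_def g_def mnsq_dilation[OF l(1) m] .
 qed
 have "\<forall>\<^sub>F l in at_right 0. 3/D <= mnsq (l*m) bump"
  using mnsq_diverges[OF tf_bump Re_fourier_bump m] unfolding filterlim_at_top by blast
 moreover have "\<forall>\<^sub>F l in at_right (0::real). l : {0<..<1}" by (rule eventually_at_right_real) simp
 ultimately show "\<forall>\<^sub>F l in at_right 0. ?c l <= 1/2"
 proof eventually_elim
  case (elim l)
  have "3 <= D*mnsq (l*m) bump" using elim(1) D by (simp add: pos_divide_le_eq mult.commute)
  hence "sqrt 4 <= sqrt (1 + D*mnsq (l*m) bump)" by (intro real_sqrt_le_mono) simp
  hence "1/sqrt (1 + D*mnsq (l*m) bump) <= 1/2" by (intro frac_le) auto
  thus ?case using bound[of l] elim(2) by auto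
 qed
qed

end

context scaling_net
begin

text \<open>Scaling functions are uniformly continuous under translations by \<open>l b\<close>; dilates of elements within \<open>1 / 8\<close> of \<open>B\<close> are not,
 since the dilates of \<open>B\<close> create unit vectors which are far from their translates.\<close>

lemma PA_proper: "quasi_local PA ~= QL"
proof
 assume eq: "quasi_local PA = QL"
 obtain B :: "'h op" and Bn :: "nat => 'h op" where W: "!!n. Bn n : \<B>" "!!n. wint lborel (fresnel (1/real (Suc n))) (%s. V (%t. of_real s*bump t)) (Bn n)"
  "!!n. norm (Bn n) <= 1" "!!x y. (%n. cinner x (Bn n y)) ----> cinner x (B y)" "B : \<B>" and iso: "adj B oL B = id_blinfun"
  using fresnel_unitary[OF tf_bump bump_real] by metis
 have BQ: "B : QL" by (rule fresnel_correlation(1)[OF zero_less_one W])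
 hence "B : closure (\<Union>R\<in>\<K>. PA R)" using eq by (simp add: quasi_local_def)
 then obtain B' R where B': "R : \<K>" "B' : PA R" "norm (B - B') <= 1/8"
  unfolding closure_approachable by (metis UN_E dist_commute dist_norm less_imp_le zero_less_divide_1_iff zero_less_numeral)
 obtain u0 u1 v0 v1 where r: "R = lc_rect u0 u1 v0 v1" "u0 < u1" "v0 < v1" using double_coneE[OF B'(1)] by metis
 let ?R1 = "lc_rect (u0 - 1) (u1 + 1) (v0 - 1) (v1 + 1)"
 have R1: "?R1 : \<K>" "closure R <= ?R1" using r by (auto simp: closure_rect_subset_iff)
 have B'Q: "B' : QL" using B'(2) local_subset_QL[OF B'(1)] by (auto simp: phi_algebra_def)
 have e8: "(1::real)/8 > 0" by simp
 obtain X where X: "X : SA ?R1" "\<forall>\<^sub>F k in K. norm (\<phi> (scl k) B' vac - X (scl k) vac) <= 1/8"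
  using B'(2) R1 e8 unfolding PA_iff[OF B'(1)] apx_def eventually_filtermap by blast
 obtain d where d: "d > 0" "!!x l. norm x < d ==> l > 0 ==> norm (sh (l *R x) (X l) - X l) <= 1/8"
  using SA_equicontinuous[OF X(1) R1(1)] e8 unfolding equicontinuous_def by meson
 have "\<forall>\<^sub>F k in K. False"
  using eventually_compose_filterlim[OF fresnel_correlation(2)[OF half_gt_zero[OF d(1)] W] K(2)] X(2) K_pos
 proof eventually_elim
  case (elim k)
  let ?l = "scl k" and ?b = "\<phi> (scl k) B" and ?b' = "\<phi> (scl k) B'" and ?s = "sh (vector [0, scl k*(d/2)])"
  note l = elim(3)
  have q: "?b : QL" "?b' : QL" "X ?l : QL" by (rule \<phi>D(1)[OF l BQ] \<phi>D(1)[OF l B'Q] SA_QL[OF X(1) R1(1) l])+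
  have "?l *R (vector [0, d/2] :: real^2) = vector [0, ?l*(d/2)]" by (simp add: vec_eq_iff forall_2)
  moreover have "norm (vector [0, d/2] :: real^2) < d" using d(1) by (simp add: norm_vec_def L2_set_def sum_2)
  ultimately have dx: "norm (?s (X ?l) - X ?l) <= 1/8" using d(2)[of "vector [0, d/2]" ?l] l by simp
  have 1: "norm ((?b - X ?l) vac) <= 1/4"
  proof -
   have "(?b - X ?l) vac = (\<phi> ?l (B - B')) vac + (?b' vac - X ?l vac)" by (simp add: \<phi>D(8)[OF l BQ B'Q] blinfun.diff_left)
   moreover have "norm (\<phi> ?l (B - B') vac) <= 1/8"
    using norm_blinfun[of "\<phi> ?l (B - B')" vac] \<phi>D(9)[OF l QL_diff[OF BQ B'Q]] B'(3) by (simp add: norm_Omega)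
   ultimately show ?thesis using elim(2) norm_triangle_ineq[of "\<phi> ?l (B - B') vac" "?b' vac - X ?l vac"] by simp
  qed
  have 2: "norm (?s (?b - X ?l) vac) <= 1/4" using 1 norm_sh[OF QL_diff[OF q(1,3)]] by simp
  have "norm ((?s (X ?l) - X ?l) vac) <= 1/8" using norm_blinfun[of "?s (X ?l) - X ?l" vac] dx by (simp add: norm_Omega)
  moreover have "?s ?b vac - ?b vac = ?s (?b - X ?l) vac + (?s (X ?l) - X ?l) vac - (?b - X ?l) vac"
   by (simp add: \<alpha>D(8)[OF PG_trans q(1,3)] blinfun.diff_left)
  ultimately have small: "norm (?s ?b vac - ?b vac) <= 5/8"
   using 1 2 norm_triangle_ineq4[of "?s (?b - X ?l) vac + (?s (X ?l) - X ?l) vac" "(?b - X ?l) vac"]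
    norm_triangle_ineq[of "?s (?b - X ?l) vac" "(?s (X ?l) - X ?l) vac"] by simp
  have bb: "?b : \<B>" by (rule QLD(1)[OF q(1)])
  have "adj ?b oL ?b = id_blinfun" using \<phi>D(5)[OF l QLD(5)[OF BQ] BQ] \<phi>D(2)[OF l BQ] iso \<phi>D(7)[OF l] by simp
  hence "cinner (?b vac) (?b vac) = cinner vac vac" by (metis bb oL_app cinner_adj_right id_blinfun.rep_eq)
  hence n1: "(norm (?b vac))^2 = 1" unfolding cinner_self of_real_eq_iff norm_Omega by simp
  hence n2: "(norm (?s ?b vac))^2 = 1" by (simp add: norm_sh[OF q(1)])
  have "Re (cinner (?s ?b vac) (?b vac)) <= 1/2" using elim(1) complex_Re_le_cmod order_trans by blast
  hence "1 <= (norm (?s ?b vac - ?b vac))^2" unfolding norm_diff_sq_cinner n1 n2 by simp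
  moreover have "(norm (?s ?b vac - ?b vac))^2 <= (5/8)^2" by (rule power_mono[OF small]) simp
  ultimately show False by (simp add: power2_eq_square)
 qed
 thus False using K(1) by simp
qed

end

theorem corollary4p3:
  fixes m :: real
    and W :: "(real \<Rightarrow> complex) \<Rightarrow> 'w::cstar_algebra"
    and \<omega> :: "'w \<Rightarrow> complex"
    and rep :: "'w \<Rightarrow> ('h::complex_hilbert) op"
    and \<Omega> :: 'h
    and \<alpha> :: "poincare_elem \<Rightarrow> 'h op \<Rightarrow> 'h op"
    and \<phi> :: "real \<Rightarrow> 'h op \<Rightarrow> 'h op"
    and G :: "poincare_elem set"
    and K :: "'k filter"
    and scl :: "'k \<Rightarrow> real"
    and \<omega>\<^sub>0 :: "(real \<Rightarrow> 'h op) \<Rightarrow> complex"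
  assumes "m > 0"
    and "weyl_algebra W"
    and "vacuum_state m W \<omega>"
    and "gns_triple \<omega> rep \<Omega>"
    and "\<forall>g \<in> carrier poincare. weyl_automorphism m (rep \<circ> W) (poincare_action m g) (\<alpha> g)"
    and "\<forall>l>0. weyl_automorphism m (rep \<circ> W) (dilation l) (\<phi> l)"
    and "subgroup G poincare"
    and "spacetime_shifts \<subseteq> G"
    and "scaling_limit_state (local_algebra m (rep \<circ> W)) \<alpha> G \<Omega> K scl \<omega>\<^sub>0"
  shows "\<not> simple_algebra (quasi_local (weyl_reg_algebra m (rep \<circ> W) \<alpha>))
       \<and> \<not> simple_algebra
             (quasi_local (phi_algebra (local_algebra m (rep \<circ> W)) \<alpha> \<phi> G \<Omega> K scl))
       \<and> op_cstar_subalgebra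
             (quasi_local (phi_algebra (local_algebra m (rep \<circ> W)) \<alpha> \<phi> G \<Omega> K scl))
       \<and> quasi_local (phi_algebra (local_algebra m (rep \<circ> W)) \<alpha> \<phi> G \<Omega> K scl)
           \<subset> quasi_local (local_algebra m (rep \<circ> W))"
proof -
 interpret scaling_net m W \<omega> rep \<Omega> "rep \<circ> W" \<alpha> \<phi> G K scl
  using assms by (simp add: scaling_net_def weyl_net_def vacuum_weyl_def weyl_net_axioms_def scaling_net_axioms_def scaling_limit_state_def)
 have "PA R <= QL" if "R : \<K>" for R using local_subset_QL[OF that] by (auto simp: phi_algebra_def)
 hence "quasi_local PA <= QL" unfolding quasi_local_def[of PA] by (intro closure_minimal) (use QL_algebra(2) in auto)
 moreover have "op_cstar_subalgebra (quasi_local PA)"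
  unfolding cstar_subalgebra_def using op_algebraD[OF PA_quasi_local(1)] PA_quasi_local(2) by auto (use op_algebraD(6)[OF PA_quasi_local(1) op_algebraD(2)[OF PA_quasi_local(1)], of 0] scaleC_of_real[of 0 id_blinfun] in simp)
 ultimately show ?thesis using weyl_reg_not_simple PA_not_simple PA_proper by blast
qed

end
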